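(* Let $\gamma>1$, $N\in\{1,2,3\}$, $T>0$, and let the initial data satisfy $$\varrho^0\in C^1(\Omega),\ \varrho^0>0,\quad \mathbf m^0\in C^1(\Omega;\mathbb R^N),\quad E^0\in C^1(\Omega),\quad p^0=(\gamma-1)\Big(E^0-\tfrac12\tfrac{|\mathbf m^0|^2}{\varrho^0}\Big)>0 .$$ Let $\mathbf U_h=[\varrho_h,\mathbf m_h,E_h]$ be numerical solutions on $[0,T]$ of the complete Euler system constructed either by the local Lax--Friedrichs scheme or by the global Lax--Friedrichs scheme with these initial data. Suppose that there exist constants $\underline\varrho>0$, $\overline E>0$ such that $$\underline\varrho\le \varrho_h,\qquad E_h\le\overline E\qquad\text{uniformly for } h\to0 .$$ Then $\{\mathbf U_h\}_{h>0}$, up to a subsequence, generates a Young measure $$\mathcal V_{t,x}\in L^\infty_{\mathrm{weak}( * )}\big((0,T)\times\Omega;\ \mathcal P([0,\infty)\times\mathbb R^N\times[0,\infty))\big)$$ which is a dissipative measure-valued (DMV) solution of the complete Euler system, with initial condition $\mathcal V_{0,x}=\delta_{[\varrho^0(x),\mathbf m^0(x),E^0(x)]}$.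
   Context: **Domain and mesh.** $\Omega=([0,1]|_{\{0,1\}})^N$ is the flat torus (periodic boundary conditions). $\mathcal T_h$ is the uniform periodic partition of $\Omega$ into cubes $K$ of side $h$ ($1/h$ an integer). $\mathbf e_s$, $s=1,\dots,N$, are the unit basis vectors and $K\pm h\mathbf e_s$ the neighbouring cells of $K$ (indices taken periodically); $\mathcal N(K)$ is the set of all neighbours of $K$. $X(\mathcal T_h)$ is the space of functions constant on each cell, $g_K$ is the value of $g_h\in X(\mathcal T_h)$ on $K$, and $(\Pi_h\phi)_K=h^{-N}\int_K\phi\,dx$. The discrete divergence is $(\widetilde{\mathrm{div}}_h\,\mathbf g_h)_K=\sum_{s=1}^N\frac{g^s_{K+h\mathbf e_s}-g^s_{K-h\mathbf e_s}}{2h}$, where for matrix-valued arguments $g^s$ is the $s$-th column. **Complete Euler system** (conservative variables density $\varrho$, momentum $\mathbf m$, total energy $E$): $$\partial_t\varrho+\mathrm{div}\,\mathbf m=0,\quad \partial_t\mathbf m+\mathrm{div}\Big(\frac{\mathbf m\otimes\mathbf m}{\varrho}\Big)+\nabla p=0,\quad \partial_tE+\mathrm{div}\Big[(E+p)\frac{\mathbf m}{\varrho}\Big]=0,\quad p=(\gamma-1)\Big(E-\frac12\frac{|\mathbf m|^2}{\varrho}\Big).$$ **Schemes.** For $t>0$ and all $K\in\mathcal T_h$, $$\frac{d}{dt}\varrho_K+(\widetilde{\mathrm{div}}_h\mathbf m_h)_K-\frac1h\sum_{L\in\mathcal N(K)}\lambda_{K|L}(\varrho_L-\varrho_K)=0,$$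 $$\frac{d}{dt}\mathbf m_K+\Big(\widetilde{\mathrm{div}}_h\Big(\frac{\mathbf m_h\otimes\mathbf m_h}{\varrho_h}+p_h\mathbb I\Big)\Big)_K-\frac1h\sum_{L\in\mathcal N(K)}\lambda_{K|L}(\mathbf m_L-\mathbf m_K)=0,$$ $$\frac{d}{dt}E_K+\Big(\widetilde{\mathrm{div}}_h\Big(\frac{\mathbf m_h}{\varrho_h}(E_h+p_h)\Big)\Big)_K-\frac1h\sum_{L\in\mathcal N(K)}\lambda_{K|L}(E_L-E_K)=0,$$ with $p_h=(\gamma-1)(E_h-\frac12|\mathbf m_h|^2/\varrho_h)$ and initial values $(\varrho_K,\mathbf m_K,E_K)(0)=((\Pi_h\varrho^0)_K,(\Pi_h\mathbf m^0)_K,(\Pi_hE^0)_K)$. Put $\lambda(\mathbf U_K)=|\mathbf u_K|+c_K$, $\mathbf u_K=\mathbf m_K/\varrho_K$, $c_K=\sqrt{\gamma p_K/\varrho_K}$ (largest modulus of the characteristic speeds). *Local* scheme: $\lambda_{K|L}=\max(\lambda(\mathbf U_K),\lambda(\mathbf U_L))$. *Global* scheme: $\lambda_{K|L}=\lambda=\max_{K\in\mathcal T_h}\lambda(\mathbf U_K)$ for all faces. Everything depends on $t$. A numerical solution on $[0,T]$ is understood to exist on $[0,T]$ with $\varrho_h(t)>0$. **Young measure.** $\{\mathbf U_h\}$ generates $\mathcal V_{t,x}$ if $g(\mathbf U_h)\to\langle\mathcal V_{t,x};g\rangle$ weakly in $L^1((0,T)\times\Omega)$ for every $g\in C_c(\mathcal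 F)$; here $\langle\mathcal V_{t,x};g\rangle=\int_{\mathcal F}g\,d\mathcal V_{t,x}$, $\mathcal P$ denotes Borel probability measures. **DMV solution of the complete Euler system.** Let $\mathcal F=\{[\varrho,\mathbf m,E]:\varrho\ge0,\mathbf m\in\mathbb R^N,E\ge0\}$. A family $\{\mathcal V_{t,x}\}_{t\in(0,T),x\in\Omega}$ of probability measures on $\mathcal F$ is a DMV solution with initial condition $\mathcal V_{0,x}\in\mathcal P(\mathcal F)$ if (all expressions being tacitly integrable on $(0,T)\times\Omega$): 1. $(t,x)\mapsto\mathcal V_{t,x}$ is weakly-( * ) measurable from $(0,T)\times\Omega$ into $\mathcal P(\mathcal F)$; 2. $\int_0^T\!\int_\Omega[\langle\mathcal V_{t,x};\varrho\rangle\partial_t\varphi+\langle\mathcal V_{t,x};\mathbf m\rangle\cdot\nabla\varphi]\,dx\,dt=-\int_\Omega\langle\mathcal V_{0,x};\varrho\rangle\varphi(0,\cdot)\,dx$ for all $\varphi\in C^1_c([0,T)\times\Omega)$; 3. there is a signed matrix-valued measure $\mu_C$ on $[0,T]\times\Omega$ such that for all $\boldsymbol\varphi\in C^1_c([0,T)\times\Omega;\mathbb R^N)$ $$\int_0^T\!\!\int_\Omega\Big[\langle\mathcal V_{t,x};\mathbf m\rangle\cdot\partial_t\boldsymbol\varphi+\Big\langle\mathcal V_{t,x};\frac{\mathbf m\otimes\mathbf m}{\varrho}\Big\rangle:\nabla\boldsymbol\varphi+(\gamma-1)\Big\langle\mathcal V_{t,x};E-\frac12\frac{|\mathbf m|^2}{\varrho}\Big\rangle\mathrm{div}\boldsymbol\varphi\Big]dx\,dt=-\int_\Omega\langle\mathcal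 V_{0,x};\mathbf m\rangle\cdot\boldsymbol\varphi(0,\cdot)\,dx+\int_0^T\!\!\int_\Omega\nabla\boldsymbol\varphi:d\mu_C;$$ 4. $\int_\Omega\langle\mathcal V_{\tau,x};E\rangle dx\le\int_\Omega\langle\mathcal V_{0,x};E\rangle dx$ for a.a. $\tau\in(0,T)$; 5. for every increasing concave $\chi:\mathbb R\to\mathbb R$ with $\chi\le\overline\chi$ for some constant $\overline\chi$, with $\mathcal S_\chi(\varrho,\mathbf m,E)=\chi\Big(\frac1{\gamma-1}\log\Big((\gamma-1)\frac{E-\frac12|\mathbf m|^2/\varrho}{\varrho^\gamma}\Big)\Big)$, and every $\varphi\in C^1_c([0,T)\times\Omega)$, $\varphi\ge0$, $$\int_0^T\!\!\int_\Omega[\langle\mathcal V_{t,x};\varrho\mathcal S_\chi\rangle\partial_t\varphi+\langle\mathcal V_{t,x};\mathcal S_\chi\mathbf m\rangle\cdot\nabla\varphi]\,dx\,dt\le-\int_\Omega\langle\mathcal V_{0,x};\varrho\mathcal S_\chi\rangle\varphi(0,\cdot)\,dx;$$ 6. $\int_0^\tau\!\int_\Omega d|\mu_C|\le c(N,\gamma)\int_0^\tau\!\int_\Omega[\langle\mathcal V_{0,x};E\rangle-\langle\mathcal V_{t,x};E\rangle]\,dx\,dt$ for all $0\le\tau<T$. *)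

theory Defs
  imports "HOL-Probability.Probability"
begin

section \<open>The flat torus\<close>

text \<open>
  The space dimension is \<open>N = CARD('n)\<close>. Functions on the torus are 1-periodic functions on
  \<open>real ^ 'n\<close>. The half-open unit cube contains exactly one representative of every point of the
  torus, and its Borel sets correspond to those of the torus, so integrals and measures over the
  torus are taken over it.
\<close>

definition torus :: "(real ^ 'n::finite) set" where
  "torus = {x. \<forall>i. 0 \<le> x $ i \<and> x $ i < 1}"

definition periodic :: "(real ^ 'n::finite \<Rightarrow> 'b) \<Rightarrow> bool" where
  "periodic f \<longleftrightarrow> (\<forall>x i. f (x + axis i 1) = f x)"

definition C1_torus :: "(real ^ 'n::finite \<Rightarrow> 'b::real_normed_vector) \<Rightarrow> bool" where
  "C1_torus f \<longleftrightarrow> periodic f \<and>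
     (\<exists>D. continuous_on UNIV D \<and> (\<forall>x. (f has_derivative blinfun_apply (D x)) (at x)))"

definition space_time :: "real \<Rightarrow> (real \<times> (real ^ 'n::finite)) set" where
  "space_time T = {0<..<T} \<times> torus"

text \<open>
  Test functions in \<open>C\<^sup>1\<^sub>c([0,T) \<times> \<Omega>)\<close>: \<open>C\<^sup>1\<close> up to \<open>t = 0\<close> (one-sided in time there), vanishing near
  \<open>t = T\<close>, and extended by zero to later times so that they are defined on \<open>[0,T] \<times> \<Omega>\<close>.
\<close>

definition test_function ::
    "real \<Rightarrow> (real \<times> (real ^ 'n::finite) \<Rightarrow> 'b::real_normed_vector) \<Rightarrow> bool" where
  "test_function T \<phi> \<longleftrightarrow>
     (\<forall>t. periodic (\<lambda>x. \<phi> (t, x))) \<and>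
     (\<exists>D. continuous_on ({0..<T} \<times> UNIV) D \<and>
        (\<forall>z\<in>{0..<T} \<times> UNIV.
           (\<phi> has_derivative blinfun_apply (D z)) (at z within {0..<T} \<times> UNIV))) \<and>
     (\<exists>\<tau><T. \<forall>t\<ge>\<tau>. \<forall>x. \<phi> (t, x) = 0)"

definition time_deriv :: "(real \<times> (real ^ 'n::finite) \<Rightarrow> 'b::real_normed_vector) \<Rightarrow>
    real \<times> (real ^ 'n) \<Rightarrow> 'b" where
  "time_deriv \<phi> z = vector_derivative (\<lambda>s. \<phi> (s, snd z)) (at (fst z))"

definition space_grad :: "(real \<times> (real ^ 'n::finite) \<Rightarrow> real) \<Rightarrow> real \<times> (real ^ 'n) \<Rightarrow> real ^ 'n"
  where "space_grad \<phi> z = (\<chi> i. frechet_derivative (\<lambda>x. \<phi> (fst z, x)) (at (snd z)) (axis i 1))"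

text \<open>The \<open>(i,j)\<close> entry is \<open>\<partial>\<^sub>j \<phi>\<^sub>i\<close>; its trace is the divergence.\<close>

definition space_jacobian ::
    "(real \<times> (real ^ 'n::finite) \<Rightarrow> real ^ 'n) \<Rightarrow> real \<times> (real ^ 'n) \<Rightarrow> real ^ 'n ^ 'n" where
  "space_jacobian \<phi> z = jacobian (\<lambda>x. \<phi> (fst z, x)) (at (snd z))"


section \<open>States of the complete Euler system\<close>

type_synonym 'n state = "real \<times> (real ^ 'n) \<times> real"

abbreviation dens :: "'n::finite state \<Rightarrow> real" where "dens U \<equiv> fst U"
abbreviation mom :: "'n::finite state \<Rightarrow> real ^ 'n" where "mom U \<equiv> fst (snd U)"
abbreviation energy :: "'n::finite state \<Rightarrow> real" where "energy U \<equiv> snd (snd U)"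

definition pressure :: "real \<Rightarrow> 'n::finite state \<Rightarrow> real" where
  "pressure \<gamma> U = (\<gamma> - 1) * (energy U - 1/2 * ((norm (mom U))\<^sup>2 / dens U))"

definition convection :: "'n::finite state \<Rightarrow> real ^ 'n ^ 'n" where
  "convection U = (\<chi> i j. mom U $ i * mom U $ j / dens U)"

text \<open>\<open>|u| + c\<close>. The argument of the root is only meaningful for \<open>p \<ge> 0\<close>. This is not built into the
  definition of a numerical solution.\<close>

definition wave_speed :: "real \<Rightarrow> 'n::finite state \<Rightarrow> real" where
  "wave_speed \<gamma> U = norm (mom U /\<^sub>R dens U) + sqrt (\<gamma> * pressure \<gamma> U / dens U)"


section \<open>The Lax--Friedrichs schemes\<close>

text \<open>
  The mesh has size \<open>h = 1/n\<close>. Cells are indexed by \<open>int ^ 'n\<close>, indices being identified modulo \<open>n\<close>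
  in each coordinate, so a function in \<open>X(T\<^sub>h)\<close> is an \<open>n\<close>-periodic function of the index.
\<close>

definition periodic_grid :: "nat \<Rightarrow> (int ^ 'n::finite \<Rightarrow> 'b) \<Rightarrow> bool" where
  "periodic_grid n g \<longleftrightarrow> (\<forall>K s. g (K + axis s (int n)) = g K)"

definition cell :: "nat \<Rightarrow> int ^ 'n::finite \<Rightarrow> (real ^ 'n) set" where
  "cell n K = {x. \<forall>i. of_int (K $ i) / real n \<le> x $ i \<and> x $ i < (of_int (K $ i) + 1) / real n}"

definition cell_index :: "nat \<Rightarrow> real ^ 'n::finite \<Rightarrow> int ^ 'n" where
  "cell_index n x = (\<chi> i. \<lfloor>real n * x $ i\<rfloor>)"

definition torus_cells :: "nat \<Rightarrow> (int ^ 'n::finite) set" where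
  "torus_cells n = {K. \<forall>i. 0 \<le> K $ i \<and> K $ i < int n}"

definition neighbours :: "int ^ 'n::finite \<Rightarrow> (int ^ 'n) set" where
  "neighbours K = (\<Union>s. {K + axis s 1, K - axis s 1})"

definition projection ::
    "nat \<Rightarrow> (real ^ 'n::finite \<Rightarrow> 'b::{banach, second_countable_topology}) \<Rightarrow> int ^ 'n \<Rightarrow> 'b" where
  "projection n \<phi> K = (real n ^ CARD('n)) *\<^sub>R (LINT x:cell n K|lborel. \<phi> x)"

definition div_h :: "nat \<Rightarrow> (int ^ 'n::finite \<Rightarrow> real ^ 'n) \<Rightarrow> int ^ 'n \<Rightarrow> real" where
  "div_h n g K = (\<Sum>s\<in>UNIV. (g (K + axis s 1) $ s - g (K - axis s 1) $ s) / (2 * (1 / real n)))"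

definition Div_h :: "nat \<Rightarrow> (int ^ 'n::finite \<Rightarrow> real ^ 'n ^ 'n) \<Rightarrow> int ^ 'n \<Rightarrow> real ^ 'n" where
  "Div_h n g K = (\<Sum>s\<in>UNIV.
     (column s (g (K + axis s 1)) - column s (g (K - axis s 1))) /\<^sub>R (2 * (1 / real n)))"

datatype lf_scheme = Local | Global

definition viscosity :: "lf_scheme \<Rightarrow> real \<Rightarrow> nat \<Rightarrow>
    (int ^ 'n::finite \<Rightarrow> 'n state) \<Rightarrow> int ^ 'n \<Rightarrow> int ^ 'n \<Rightarrow> real" where
  "viscosity sch \<gamma> n W K L = (case sch of
       Local \<Rightarrow> max (wave_speed \<gamma> (W K)) (wave_speed \<gamma> (W L))
     | Global \<Rightarrow> Max ((\<lambda>J. wave_speed \<gamma> (W J)) ` torus_cells n))"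

definition num_diffusion :: "lf_scheme \<Rightarrow> real \<Rightarrow> nat \<Rightarrow> (int ^ 'n::finite \<Rightarrow> 'n state) \<Rightarrow>
    (int ^ 'n \<Rightarrow> 'b::real_vector) \<Rightarrow> int ^ 'n \<Rightarrow> 'b" where
  "num_diffusion sch \<gamma> n W g K =
     (1 / (1 / real n)) *\<^sub>R (\<Sum>L\<in>neighbours K. viscosity sch \<gamma> n W K L *\<^sub>R (g L - g K))"

definition lf_solution :: "lf_scheme \<Rightarrow> real \<Rightarrow> real \<Rightarrow> nat \<Rightarrow>
    (real ^ 'n::finite \<Rightarrow> real) \<Rightarrow> (real ^ 'n \<Rightarrow> real ^ 'n) \<Rightarrow> (real ^ 'n \<Rightarrow> real) \<Rightarrow>
    (real \<Rightarrow> int ^ 'n \<Rightarrow> 'n state) \<Rightarrow> bool" where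
  "lf_solution sch \<gamma> T n \<rho>0 m0 E0 U \<longleftrightarrow>
     n > 0 \<and>
     (\<forall>t\<in>{0..T}. periodic_grid n (U t)) \<and>
     (\<forall>t\<in>{0..T}. \<forall>K. dens (U t K) > 0) \<and>
     (\<forall>K. continuous_on {0..T} (\<lambda>t. U t K)) \<and>
     (\<forall>K. U 0 K = (projection n \<rho>0 K, projection n m0 K, projection n E0 K)) \<and>
     (\<forall>t\<in>{0<..<T}. \<forall>K. \<exists>d\<rho> dm dE.
        ((\<lambda>s. dens (U s K)) has_vector_derivative d\<rho>) (at t) \<and>
        ((\<lambda>s. mom (U s K)) has_vector_derivative dm) (at t) \<and>
        ((\<lambda>s. energy (U s K)) has_vector_derivative dE) (at t) \<and>
        d\<rho> + div_h n (\<lambda>J. mom (U t J)) K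
          - num_diffusion sch \<gamma> n (U t) (\<lambda>J. dens (U t J)) K = 0 \<and>
        dm + Div_h n (\<lambda>J. convection (U t J) + pressure \<gamma> (U t J) *\<^sub>R mat 1) K
          - num_diffusion sch \<gamma> n (U t) (\<lambda>J. mom (U t J)) K = 0 \<and>
        dE + div_h n (\<lambda>J. (energy (U t J) + pressure \<gamma> (U t J)) *\<^sub>R (mom (U t J) /\<^sub>R dens (U t J))) K
          - num_diffusion sch \<gamma> n (U t) (\<lambda>J. energy (U t J)) K = 0)"

definition grid_to_fun :: "nat \<Rightarrow> (real \<Rightarrow> int ^ 'n::finite \<Rightarrow> 'b) \<Rightarrow> real \<times> (real ^ 'n) \<Rightarrow> 'b" where
  "grid_to_fun n U z = U (fst z) (cell_index n (snd z))"


section \<open>Young measures\<close>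

definition phase_space :: "('n::finite state) set" where
  "phase_space = {U. dens U \<ge> 0 \<and> energy U \<ge> 0}"

definition phase_borel :: "('n::finite state) measure" where
  "phase_borel = restrict_space borel phase_space"

definition phase_probs :: "('n::finite state) measure set" where
  "phase_probs = {\<nu>. prob_space \<nu> \<and> sets \<nu> = sets phase_borel}"

text \<open>\<open>C\<^sub>c(F)\<close>: supports are compact subsets of the closed set \<open>F\<close>; values at its boundary need not vanish.\<close>

definition Cc_phase :: "('n::finite state \<Rightarrow> real) set" where
  "Cc_phase = {g. continuous_on phase_space g \<and>
     (\<exists>C\<subseteq>phase_space. compact C \<and> (\<forall>U\<in>phase_space - C. g U = 0))}"

definition parametrized_measure ::
    "real \<Rightarrow> (real \<times> (real ^ 'n::finite) \<Rightarrow> 'n state measure) \<Rightarrow> bool" where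
  "parametrized_measure T V \<longleftrightarrow>
     (\<forall>z\<in>space_time T. V z \<in> phase_probs) \<and>
     (\<forall>g\<in>Cc_phase. (\<lambda>z. \<integral>U. g U \<partial>V z) \<in> borel_measurable (restrict_space lborel (space_time T)))"

definition weak_L1_limit :: "'z::euclidean_space set \<Rightarrow> (nat \<Rightarrow> 'z \<Rightarrow> real) \<Rightarrow> ('z \<Rightarrow> real) \<Rightarrow> bool" where
  "weak_L1_limit Q f F \<longleftrightarrow>
     (\<forall>k. set_integrable lborel Q (f k)) \<and> set_integrable lborel Q F \<and>
     (\<forall>\<psi>\<in>borel_measurable lborel. \<forall>C. (AE z in lborel. z \<in> Q \<longrightarrow> \<bar>\<psi> z\<bar> \<le> C) \<longrightarrow>
        (\<lambda>k. LINT z:Q|lborel. f k z * \<psi> z) \<longlonglongrightarrow> (LINT z:Q|lborel. F z * \<psi> z))"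

definition generates_young_measure :: "real \<Rightarrow> (nat \<Rightarrow> real \<times> (real ^ 'n::finite) \<Rightarrow> 'n state) \<Rightarrow>
    (real \<times> (real ^ 'n) \<Rightarrow> 'n state measure) \<Rightarrow> bool" where
  "generates_young_measure T U V \<longleftrightarrow> parametrized_measure T V \<and>
     (\<forall>g\<in>Cc_phase. weak_L1_limit (space_time T) (\<lambda>k z. g (U k z)) (\<lambda>z. \<integral>U. g U \<partial>V z))"


section \<open>Matrix-valued signed measures\<close>

definition vector_measure_on ::
    "'z::topological_space set \<Rightarrow> ('z set \<Rightarrow> 'b::real_normed_vector) \<Rightarrow> bool" where
  "vector_measure_on S \<mu> \<longleftrightarrow>
     (\<forall>A::nat \<Rightarrow> 'z set. range A \<subseteq> sets (restrict_space borel S) \<and> disjoint_family A \<longrightarrow>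
        (\<lambda>i. \<mu> (A i)) sums \<mu> (\<Union>i. A i))"

text \<open>Total variation \<open>|\<mu>|(B)\<close>; for matrices the norm is the Frobenius norm.\<close>

definition total_variation ::
    "('z::topological_space set \<Rightarrow> 'b::real_normed_vector) \<Rightarrow> 'z set \<Rightarrow> ereal" where
  "total_variation \<mu> B =
     (SUP P\<in>{P. finite P \<and> partition_on B P \<and> P \<subseteq> sets borel}. \<Sum>A\<in>P. ereal (norm (\<mu> A)))"

text \<open>Integration against a real signed measure is by its Jordan decomposition, where
  \<open>\<nu>\<^sup>+(A) = sup {\<nu>(B) | B \<subseteq> A}\<close> and \<open>\<nu>\<^sup>- = (- \<nu>)\<^sup>+\<close>.\<close>

definition positive_variation :: "'z::topological_space set \<Rightarrow> ('z set \<Rightarrow> real) \<Rightarrow> 'z measure" where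
  "positive_variation S \<nu> = measure_of S (sets (restrict_space borel S))
     (\<lambda>A. SUP B\<in>{B \<in> sets (restrict_space borel S). B \<subseteq> A}. ennreal (\<nu> B))"

definition signed_integral ::
    "'z::topological_space set \<Rightarrow> ('z set \<Rightarrow> real) \<Rightarrow> ('z \<Rightarrow> real) \<Rightarrow> real" where
  "signed_integral S \<nu> f =
     (\<integral>z. f z \<partial>positive_variation S \<nu>) - (\<integral>z. f z \<partial>positive_variation S (\<lambda>A. - \<nu> A))"

text \<open>\<open>\<integral> \<Phi> : d\<mu>\<close>\<close>

definition matrix_integral :: "'z::topological_space set \<Rightarrow> ('z set \<Rightarrow> real ^ 'n ^ 'n) \<Rightarrow>
    ('z \<Rightarrow> real ^ 'n ^ 'n::finite) \<Rightarrow> real" where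
  "matrix_integral S \<mu> \<Phi> =
     (\<Sum>i\<in>UNIV. \<Sum>j\<in>UNIV. signed_integral S (\<lambda>A. \<mu> A $ i $ j) (\<lambda>z. \<Phi> z $ i $ j))"


section \<open>Dissipative measure-valued solutions\<close>

text \<open>
  The states at which \<open>m \<otimes> m / \<rho>\<close>, \<open>|m|\<^sup>2 / \<rho>\<close>, \<open>\<rho> S\<^sub>\<chi>\<close> and \<open>S\<^sub>\<chi> m\<close> are finite for every \<open>\<chi>\<close>:
  off vacuum the argument of the logarithm has to be positive; at vacuum \<open>|m|\<^sup>2 / \<rho>\<close> is \<open>0\<close>
  if \<open>m = 0\<close> and infinite otherwise. Since division by zero yields zero in HOL, this has to be stated
  separately; on this set the HOL expressions have the intended values.
\<close>

definition proper_states :: "real \<Rightarrow> ('n::finite state) set" where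
  "proper_states \<gamma> = {U. dens U \<ge> 0 \<and> energy U \<ge> 0 \<and>
     (dens U = 0 \<longrightarrow> mom U = 0) \<and> (dens U > 0 \<longrightarrow> pressure \<gamma> U > 0)}"

definition S_chi :: "real \<Rightarrow> (real \<Rightarrow> real) \<Rightarrow> 'n::finite state \<Rightarrow> real" where
  "S_chi \<gamma> chi U = chi (1 / (\<gamma> - 1) * ln (pressure \<gamma> U / dens U powr \<gamma>))"

definition entropy_cutoff :: "(real \<Rightarrow> real) \<Rightarrow> bool" where
  "entropy_cutoff chi \<longleftrightarrow> mono chi \<and> concave_on UNIV chi \<and> (\<exists>b. \<forall>s. chi s \<le> b)"

definition pairing_integrable :: "'z::euclidean_space set \<Rightarrow> ('z \<Rightarrow> 'n::finite state measure) \<Rightarrow>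
    ('n state \<Rightarrow> 'b::{banach, second_countable_topology}) \<Rightarrow> bool" where
  "pairing_integrable Q V f \<longleftrightarrow>
     (AE z in lborel. z \<in> Q \<longrightarrow> integrable (V z) f) \<and>
     set_integrable lborel Q (\<lambda>z. \<integral>U. f U \<partial>V z)"

definition expressions_integrable ::
    "real \<Rightarrow> 'z::euclidean_space set \<Rightarrow> ('z \<Rightarrow> 'n::finite state measure) \<Rightarrow> bool" where
  "expressions_integrable \<gamma> Q V \<longleftrightarrow>
     (AE z in lborel. z \<in> Q \<longrightarrow> (AE U in V z. U \<in> proper_states \<gamma>)) \<and>
     pairing_integrable Q V dens \<and>
     pairing_integrable Q V mom \<and>
     pairing_integrable Q V energy \<and>
     pairing_integrable Q V convection \<and>
     pairing_integrable Q V (pressure \<gamma>) \<and>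
     (\<forall>chi. entropy_cutoff chi \<longrightarrow>
        pairing_integrable Q V (\<lambda>U. dens U * S_chi \<gamma> chi U) \<and>
        pairing_integrable Q V (\<lambda>U. S_chi \<gamma> chi U *\<^sub>R mom U))"

definition continuity_eq :: "real \<Rightarrow> (real ^ 'n::finite \<Rightarrow> 'n state measure) \<Rightarrow>
    (real \<times> (real ^ 'n) \<Rightarrow> 'n state measure) \<Rightarrow> bool" where
  "continuity_eq T V0 V \<longleftrightarrow> (\<forall>\<phi>. test_function T \<phi> \<longrightarrow>
     (LINT z:space_time T|lborel.
        (\<integral>U. dens U \<partial>V z) * time_deriv \<phi> z + (\<integral>U. mom U \<partial>V z) \<bullet> space_grad \<phi> z)
     = - (LINT x:torus|lborel. (\<integral>U. dens U \<partial>V0 x) * \<phi> (0, x)))"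

definition momentum_eq :: "real \<Rightarrow> real \<Rightarrow> (real ^ 'n::finite \<Rightarrow> 'n state measure) \<Rightarrow>
    (real \<times> (real ^ 'n) \<Rightarrow> 'n state measure) \<Rightarrow>
    ((real \<times> (real ^ 'n)) set \<Rightarrow> real ^ 'n ^ 'n) \<Rightarrow> bool" where
  "momentum_eq \<gamma> T V0 V \<mu> \<longleftrightarrow> (\<forall>\<phi>. test_function T \<phi> \<longrightarrow>
     (LINT z:space_time T|lborel.
        (\<integral>U. mom U \<partial>V z) \<bullet> time_deriv \<phi> z
        + (\<integral>U. convection U \<partial>V z) \<bullet> space_jacobian \<phi> z
        + (\<integral>U. pressure \<gamma> U \<partial>V z) * trace (space_jacobian \<phi> z))
     = - (LINT x:torus|lborel. (\<integral>U. mom U \<partial>V0 x) \<bullet> \<phi> (0, x))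
       + matrix_integral ({0..T} \<times> torus) \<mu> (space_jacobian \<phi>))"

definition energy_ineq :: "real \<Rightarrow> (real ^ 'n::finite \<Rightarrow> 'n state measure) \<Rightarrow>
    (real \<times> (real ^ 'n) \<Rightarrow> 'n state measure) \<Rightarrow> bool" where
  "energy_ineq T V0 V \<longleftrightarrow> (AE \<tau> in lborel. \<tau> \<in> {0<..<T} \<longrightarrow>
     (LINT x:torus|lborel. \<integral>U. energy U \<partial>V (\<tau>, x)) \<le> (LINT x:torus|lborel. \<integral>U. energy U \<partial>V0 x))"

definition entropy_ineq :: "real \<Rightarrow> real \<Rightarrow> (real ^ 'n::finite \<Rightarrow> 'n state measure) \<Rightarrow>
    (real \<times> (real ^ 'n) \<Rightarrow> 'n state measure) \<Rightarrow> bool" where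
  "entropy_ineq \<gamma> T V0 V \<longleftrightarrow>
     (\<forall>chi \<phi>. entropy_cutoff chi \<and> test_function T \<phi> \<and> (\<forall>z\<in>{0..<T} \<times> UNIV. \<phi> z \<ge> 0) \<longrightarrow>
        (LINT z:space_time T|lborel.
           (\<integral>U. dens U * S_chi \<gamma> chi U \<partial>V z) * time_deriv \<phi> z
           + (\<integral>U. S_chi \<gamma> chi U *\<^sub>R mom U \<partial>V z) \<bullet> space_grad \<phi> z)
        \<le> - (LINT x:torus|lborel. (\<integral>U. dens U * S_chi \<gamma> chi U \<partial>V0 x) * \<phi> (0, x)))"

definition defect_bound :: "real \<Rightarrow> real \<Rightarrow> (real ^ 'n::finite \<Rightarrow> 'n state measure) \<Rightarrow>
    (real \<times> (real ^ 'n) \<Rightarrow> 'n state measure) \<Rightarrow>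
    ((real \<times> (real ^ 'n)) set \<Rightarrow> real ^ 'n ^ 'n) \<Rightarrow> bool" where
  "defect_bound c T V0 V \<mu> \<longleftrightarrow> (\<forall>\<tau>. 0 \<le> \<tau> \<and> \<tau> < T \<longrightarrow>
     total_variation \<mu> ({0..\<tau>} \<times> torus)
     \<le> ereal (c * (LINT z:space_time \<tau>|lborel.
                      (\<integral>U. energy U \<partial>V0 (snd z)) - (\<integral>U. energy U \<partial>V z))))"

text \<open>The constant \<open>c\<close> in the bound on the concentration defect is a parameter, so that its
  dependence on \<open>N\<close> and \<open>\<gamma>\<close> alone can be expressed by the order of quantifiers.\<close>

definition dmv_solution :: "real \<Rightarrow> real \<Rightarrow> real \<Rightarrow> (real ^ 'n::finite \<Rightarrow> 'n state measure) \<Rightarrow>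
    (real \<times> (real ^ 'n) \<Rightarrow> 'n state measure) \<Rightarrow> bool" where
  "dmv_solution c \<gamma> T V0 V \<longleftrightarrow>
     parametrized_measure T V \<and> (\<forall>x\<in>torus. V0 x \<in> phase_probs) \<and>
     expressions_integrable \<gamma> (space_time T) V \<and> expressions_integrable \<gamma> torus V0 \<and>
     continuity_eq T V0 V \<and>
     energy_ineq T V0 V \<and>
     entropy_ineq \<gamma> T V0 V \<and>
     (\<exists>\<mu>. vector_measure_on ({0..T} \<times> torus) \<mu> \<and>
          momentum_eq \<gamma> T V0 V \<mu> \<and> defect_bound c T V0 V \<mu>)"

end

theory Submission
  imports Defs
begin

text \<open>
  The proof rests on an inequality for a single face between two cells. Let \<open>S\<close> be the specific
  entropy and \<open>\<chi>\<close> an increasing concave function. The scheme is a sum over faces, and the time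
  derivative of \<open>\<rho> \<chi>(S)\<close> in a cell \<open>K\<close> is the gradient of this function at the state of \<open>K\<close>, applied to
  that sum. Face by face it dominates the Lax--Friedrichs discretisation of the entropy density
  \<open>\<rho> \<chi>(S)\<close> with flux \<open>\<chi>(S) m\<close>, and the surplus is at least a fixed fraction of the relative entropy
  of the two neighbouring states (\<open>face_entropy_inequality\<close>). A diffusion coefficient that bounds
  the wave speeds of both states is large enough for this, so the local and the global scheme
  are treated alike.

  Three choices of \<open>\<chi>\<close> are used. A function vanishing exactly on \<open>{s\<^sub>0..}\<close> yields the minimum entropy
  principle. With the lower bound on the density it keeps the pressure away from zero, with
  the upper bound on the energy it bounds the density and the momentum; all states then stay in one
  compact set \<open>C\<close> of states with positive density and pressure (\<open>uniform_state_bounds\<close>). The choice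
  \<open>\<chi>(s) = s\<close> bounds the total dissipation: the mean relative entropy of neighbouring states, integrated
  in time, is \<open>O(h)\<close> (\<open>total_dissipation_bound\<close>). On \<open>C\<close> the relative entropy vanishes on the diagonal only,
  hence the jumps of every continuous function of the state tend to zero in mean
  (\<open>variation_vanishes\<close>); after summation by parts the numerical diffusion is a sum of such jumps against
  differences of a test function and disappears in the limit. A general \<open>\<chi>\<close> gives the entropy inequality.

  States in a compact set generate a Young measure (\<open>young_measure_exists\<close>). All nonlinearities of the
  system are continuous on \<open>C\<close>, so the discrete weak formulations pass to the limit
  (\<open>weak_form_limit\<close>) without concentration: the momentum equation holds with defect measure zero.
  The total energy is conserved by the scheme and hence by the limit, so both sides of the bound on the
  defect vanish and \<open>c = 1\<close> is a possible constant.
\<close>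

section \<open>The entropy inequality for a single face\<close>

text \<open>
  The entropy content of a ratio of temperatures or densities: nonnegative, and zero only for the ratio 1.
\<close>

definition relent :: "real \<Rightarrow> real" where
  "relent x = x - 1 - ln x"

lemma relent_nonneg: "x > 0 \<Longrightarrow> relent x \<ge> 0"
  using ln_le_minus_one[of x] by (simp add: relent_def)

lemma relent_eq_0: "x > 0 \<Longrightarrow> relent x = 0 \<Longrightarrow> x = 1"
  using ln_eq_minus_one[of x] by (simp add: relent_def)

lemma relent_ge_below_1:
  assumes "0 < x" "x \<le> 1"
  shows "(1 - x)\<^sup>2 / 2 \<le> relent x"
proof -
  let ?g = "\<lambda>z::real. z - 1 - ln z - (1 - z)\<^sup>2 / 2"
  have "?g 1 \<le> ?g x"
  proof (rule DERIV_nonpos_imp_nonincreasing[OF assms(2)])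
    fix z :: real assume z: "x \<le> z" "z \<le> 1"
    then have z0: "z > 0" using assms by linarith
    have "(?g has_real_derivative (1 - 1 / z + (1 - z))) (at z)"
      using z0 by (auto intro!: derivative_eq_intros simp: field_simps)
    moreover have "1 - 1 / z + (1 - z) = - ((1 - z)\<^sup>2 / z)"
      using z0 by (simp add: field_simps power2_eq_square)
    ultimately show "\<exists>y. (?g has_real_derivative y) (at z) \<and> y \<le> 0"
      using z0 by (intro exI[of _ "- ((1 - z)\<^sup>2 / z)"]) simp
  qed
  then show ?thesis by (simp add: relent_def)
qed

lemma relent_ge_above_1:
  assumes "1 \<le> x"
  shows "(x - 1)\<^sup>2 / (2 * x) \<le> relent x"
proof -
  let ?g = "\<lambda>z::real. z - 1 - ln z - (z - 2 + 1 / z) / 2"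
  have "?g 1 \<le> ?g x"
  proof (rule DERIV_nonneg_imp_nondecreasing[OF assms])
    fix z :: real assume z: "1 \<le> z" "z \<le> x"
    then have z0: "z > 0" by linarith
    have "(?g has_real_derivative (1 - 1 / z - (1 - 1 / z\<^sup>2) / 2)) (at z)"
      using z0 by (auto intro!: derivative_eq_intros simp: field_simps power2_eq_square)
    moreover have "1 - 1 / z - (1 - 1 / z\<^sup>2) / 2 = (1 - 1 / z)\<^sup>2 / 2"
      using z0 by (simp add: field_simps power2_eq_square)
    ultimately show "\<exists>y. (?g has_real_derivative y) (at z) \<and> 0 \<le> y"
      by (intro exI[of _ "(1 - 1 / z)\<^sup>2 / 2"]) simp
  qed
  moreover have "(x - 1)\<^sup>2 / (2 * x) = (x - 2 + 1 / x) / 2"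
    using assms by (simp add: field_simps power2_eq_square)
  ultimately show ?thesis by (simp add: relent_def)
qed

lemma relent_ge_ln:
  assumes "1 \<le> x"
  shows "(ln x)\<^sup>2 / 2 \<le> relent x"
proof -
  let ?g = "\<lambda>z::real. z - 1 - ln z - (ln z)\<^sup>2 / 2"
  have "?g 1 \<le> ?g x"
  proof (rule DERIV_nonneg_imp_nondecreasing[OF assms])
    fix z :: real assume z: "1 \<le> z" "z \<le> x"
    then have z0: "z > 0" by linarith
    have "(?g has_real_derivative ((z - 1 - ln z) / z)) (at z)"
      using z0 by (auto intro!: derivative_eq_intros simp: field_simps power2_eq_square)
    moreover have "(z - 1 - ln z) / z \<ge> 0" using z0 ln_le_minus_one[of z] by simp
    ultimately show "\<exists>y. (?g has_real_derivative y) (at z) \<and> 0 \<le> y" by blast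
  qed
  then show ?thesis by (simp add: relent_def)
qed

lemma weighted_amgm:
  fixes r B G :: real
  assumes "G > 0"
  shows "(2/3) * (r * B) \<le> G * r\<^sup>2 / 4 + B\<^sup>2 / (2 * G)"
proof -
  have "0 \<le> 3 * (G * r - 4/3 * B)\<^sup>2 + (2/3) * B\<^sup>2" by simp
  also have "\<dots> = 3 * G\<^sup>2 * r\<^sup>2 + 6 * B\<^sup>2 - 8 * G * r * B"
    by (simp add: power2_eq_square algebra_simps)
  finally have "0 \<le> (3 * G\<^sup>2 * r\<^sup>2 + 6 * B\<^sup>2 - 8 * G * r * B) / (12 * G)"
    using assms by simp
  also have "\<dots> = G * r\<^sup>2 / 4 + B\<^sup>2 / (2 * G) - (2/3) * (r * B)"
    using assms by (simp add: field_simps power2_eq_square)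
  finally show ?thesis by linarith
qed

text \<open>
  The only term of indefinite sign in the entropy production at a face, in units where the sound speed
  of the first state is 1: \<open>r\<close> is the jump of the normal velocity, \<open>x\<close> and \<open>y\<close> are the ratios of the
  temperatures and of the densities, \<open>\<beta>\<close> is twice the viscosity minus the outer normal velocity of the second
  state. The factor \<open>5/6\<close> is smaller than 1, so that a sixth of the production survives.
  
  Half of \<open>\<gamma> r\<^sup>2 / 2\<close> is divided between the temperature (\<open>X\<close>) and the density (\<open>Y\<close>), which
  absorb \<open>r (x - 1)\<close> and \<open>r (1 - y)\<close> separately. If \<open>r \<ge> 0\<close> and \<open>x < 1\<close>, then \<open>\<beta>\<close> may be too small for
  this, and \<open>x - y \<le> x (1 - y)\<close> is used instead. For \<open>r < 0\<close> and large \<open>y\<close> the relative entropy grows only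
  linearly in \<open>y\<close>, with a coefficient that does not depend on \<open>r\<close>, so there \<open>\<beta>\<close> has to grow with \<open>|r|\<close>: the
  constants satisfy \<open>5/6 \<cdot> 1.2 = 1\<close> and \<open>5/6 \<cdot> 1.8 = 3/2\<close>.
\<close>

lemma scalar_face_estimate:
  fixes \<gamma> r x y \<beta> :: real
  assumes \<gamma>: "\<gamma> > 1" and x: "x > 0" and y: "y > 0"
    and H1: "\<beta> \<ge> 2 * sqrt x" and H2: "\<beta> \<ge> 1 + sqrt x"
    and H3: "r < 0 \<Longrightarrow> \<beta> \<ge> 1.2 * \<bar>r\<bar> + 1.8"
  shows "r * (x - y) \<le> 5/6 * \<beta> * (\<gamma> * r\<^sup>2 / 2 + relent x / (\<gamma> - 1) + relent y)"
proof -
  define G where "G = \<gamma> - 1"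
  have G: "G > 0" using \<gamma> by (simp add: G_def)
  have fx: "relent x \<ge> 0" and fy: "relent y \<ge> 0" using relent_nonneg x y by auto
  have sx: "sqrt x > 0" using x by simp
  have \<beta>: "\<beta> > 0" using H1 sx by linarith
  have split: "\<gamma> * r\<^sup>2 / 2 \<ge> G * r\<^sup>2 / 4 + r\<^sup>2 / 4 "
  proof -
    have "\<gamma> * r\<^sup>2 / 2 - (G * r\<^sup>2 / 4 + r\<^sup>2 / 4) = \<gamma> * r\<^sup>2 / 4" by (simp add: G_def field_simps)
    moreover have "\<gamma> * r\<^sup>2 / 4 \<ge> 0" using \<gamma> by simp
    ultimately show ?thesis by linarith
  qed
  define X where "X = G * r\<^sup>2 / 4 + relent x / G"
  define Y where "Y = r\<^sup>2 / 4 + relent y"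
  have X0: "X \<ge> 0" using G fx by (simp add: X_def)
  have Y0: "Y \<ge> 0" using fy by (simp add: Y_def)
  have XY: "X + Y \<le> \<gamma> * r\<^sup>2 / 2 + relent x / (\<gamma> - 1) + relent y"
    using split by (simp add: X_def Y_def G_def)
  have Xbelow: "(1 - x) * \<bar>r\<bar> \<le> 3/2 * X" if "x \<le> 1"
  proof -
    have "(1 - x)\<^sup>2 / (2 * G) \<le> relent x / G"
      using divide_right_mono[OF relent_ge_below_1[OF x that], of G] G by (simp add: field_simps)
    with weighted_amgm[OF G, of "\<bar>r\<bar>" "1 - x"] show ?thesis
      by (simp add: X_def algebra_simps)
  qed
  have Xabove: "(x - 1) * \<bar>r\<bar> \<le> sqrt x * (3/2 * X)" if "1 \<le> x"
  proof -
    define B where "B = (x - 1) / sqrt x"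
    have "B\<^sup>2 / (2 * G) = (x - 1)\<^sup>2 / (2 * x) / G"
      using x by (simp add: B_def power_divide)
    also have "\<dots> \<le> relent x / G"
      using divide_right_mono[OF relent_ge_above_1[OF that], of G] G by simp
    finally have "\<bar>r\<bar> * B \<le> 3/2 * X"
      using weighted_amgm[OF G, of "\<bar>r\<bar>" B] by (simp add: X_def algebra_simps)
    then have "sqrt x * (\<bar>r\<bar> * B) \<le> sqrt x * (3/2 * X)" using sx by simp
    moreover have "sqrt x * (\<bar>r\<bar> * B) = (x - 1) * \<bar>r\<bar>" using sx by (simp add: B_def field_simps)
    ultimately show ?thesis by simp
  qed
  have Ybelow: "(1 - y) * \<bar>r\<bar> \<le> 3/2 * Y" if "y \<le> 1"
    using weighted_amgm[of 1 "\<bar>r\<bar>" "1 - y"] relent_ge_below_1[OF y that]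
    by (simp add: Y_def algebra_simps)
  have Ylog: "ln y * \<bar>r\<bar> \<le> 3/2 * Y" if "1 \<le> y"
    using weighted_amgm[of 1 "\<bar>r\<bar>" "ln y"] relent_ge_ln[OF that]
    by (simp add: Y_def algebra_simps)
  define Z where "Z = \<gamma> * r\<^sup>2 / 2 + relent x / (\<gamma> - 1) + relent y"
  have XYZ: "5/6 * \<beta> * (X + Y) \<le> 5/6 * \<beta> * Z"
    using XY \<beta> by (intro mult_left_mono) (auto simp: Z_def)
  have Z0: "Z \<ge> 0" using XY X0 Y0 by (simp add: Z_def)
  have "r * (x - y) \<le> 5/6 * \<beta> * Z"
  proof (cases "r \<ge> 0")
    case r: True
    show ?thesis
    proof (cases "x \<ge> 1")
      case True
      have s1: "sqrt x \<ge> 1" using True by simp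
      have "(x - 1) * r \<le> 5/6 * \<beta> * X"
      proof -
        have "sqrt x * (3/2 * X) \<le> (5/6 * \<beta>) * X"
          using mult_right_mono[of "3/2 * sqrt x" "5/6 * \<beta>" X] H1 X0 sx by (simp add: mult.assoc)
        then show ?thesis using Xabove[OF True] r by linarith
      qed
      moreover have "(1 - y) * r \<le> 5/6 * \<beta> * Y"
      proof (cases "y \<le> 1")
        case True
        have "3/2 * Y \<le> (5/6 * \<beta>) * Y"
          by (rule mult_right_mono) (use H1 s1 Y0 in linarith)+
        then show ?thesis using Ybelow[OF True] r by linarith
      next
        case False
        then have "(1 - y) * r \<le> 0" using r by (simp add: mult_nonpos_nonneg)
        moreover have "0 \<le> 5/6 * \<beta> * Y" using \<beta> Y0 by simp
        ultimately show ?thesis by linarith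
      qed
      moreover have "r * (x - y) = (x - 1) * r + (1 - y) * r" by (simp add: algebra_simps)
      moreover have "5/6 * \<beta> * (X + Y) = 5/6 * \<beta> * X + 5/6 * \<beta> * Y" by (simp add: algebra_simps)
      ultimately show ?thesis using XYZ by linarith
    next
      case False
      then have x1: "x < 1" by simp
      show ?thesis
      proof (cases "y < x")
        case False
        then have "r * (x - y) \<le> 0" using r by (simp add: mult_nonneg_nonpos)
        moreover have "0 \<le> 5/6 * \<beta> * Z" using \<beta> Z0 by simp
        ultimately show ?thesis by linarith
      next
        case yx: True
        have "x \<le> sqrt x"
          using x1 x mult_left_le[of "sqrt x" "sqrt x"] by simp
        then have xb: "x \<le> 5/6 * \<beta>" using H2 sx x1 by linarith
        have "(x - y) \<le> x * (1 - y)" using x1 y by (simp add: algebra_simps)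
        then have "r * (x - y) \<le> r * (x * (1 - y))" using r by (rule mult_left_mono)
        also have "\<dots> = x * (r * (1 - y))" by simp
        also have "\<dots> \<le> 5/6 * \<beta> * (r * (1 - y))"
          using xb r yx x1 by (intro mult_right_mono) auto
        also have "\<dots> \<le> 5/6 * \<beta> * Z"
        proof -
          have "r * (1 - y) \<le> r\<^sup>2 / 2 + (1 - y)\<^sup>2 / 2"
            using sum_squares_bound[of r "1 - y"] by simp
          also have "\<dots> \<le> Z"
          proof -
            have "1 * r\<^sup>2 \<le> \<gamma> * r\<^sup>2" using \<gamma> by (intro mult_right_mono) auto
            moreover have "relent x / (\<gamma> - 1) \<ge> 0" using fx \<gamma> by simp
            ultimately show ?thesis using relent_ge_below_1[OF y] yx x1 by (simp add: Z_def)
          qed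
          finally show ?thesis using \<beta> by simp
        qed
        finally show ?thesis .
      qed
    qed
  next
    case False
    define z where "z = \<bar>r\<bar>"
    have z: "z > 0" "r = - z" using False by (auto simp: z_def)
    have b: "5/6 * \<beta> \<ge> z + 3/2" using H3 False by (simp add: z_def)
    have zX: "(1 - x) * z \<le> 5/6 * \<beta> * X"
    proof (cases "x \<le> 1")
      case True
      have "3/2 * X \<le> (5/6 * \<beta>) * X" using b z X0 by (intro mult_right_mono) auto
      then show ?thesis using Xbelow[OF True] by (simp add: z_def)
    next
      case False
      then have "(1 - x) * z \<le> 0" using z by (simp add: mult_nonpos_nonneg)
      moreover have "0 \<le> 5/6 * \<beta> * X" using \<beta> X0 by simp
      ultimately show ?thesis by linarith
    qed
    have zY: "(y - 1) * z \<le> 5/6 * \<beta> * Y"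
    proof (cases "y \<ge> 1")
      case True
      have "(y - 1) * z = z * relent y + ln y * z" by (simp add: relent_def algebra_simps)
      also have "\<dots> \<le> z * Y + 3/2 * Y"
      proof -
        have "z * relent y \<le> z * Y" using z by (intro mult_left_mono) (auto simp: Y_def)
        then show ?thesis using Ylog[OF True] by (simp add: z_def)
      qed
      also have "\<dots> = (z + 3/2) * Y" by (simp add: algebra_simps)
      also have "\<dots> \<le> 5/6 * \<beta> * Y" using b Y0 by (rule mult_right_mono)
      finally show ?thesis .
    next
      case False
      then have "(y - 1) * z \<le> 0" using z by (simp add: mult_nonpos_nonneg)
      moreover have "0 \<le> 5/6 * \<beta> * Y" using \<beta> Y0 by simp
      ultimately show ?thesis by linarith
    qed
    have "r * (x - y) = (1 - x) * z + (y - 1) * z" using z by (simp add: algebra_simps)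
    also have "\<dots> \<le> 5/6 * \<beta> * (X + Y)" using zX zY by (simp add: algebra_simps)
    finally show ?thesis using XYZ by linarith
  qed
  then show ?thesis by (simp add: Z_def)
qed

definition temperature :: "real \<Rightarrow> 'n::finite state \<Rightarrow> real" where
  "temperature \<gamma> U = pressure \<gamma> U / dens U"

definition entropy :: "real \<Rightarrow> 'n::finite state \<Rightarrow> real" where
  "entropy \<gamma> U = 1 / (\<gamma> - 1) * ln (pressure \<gamma> U / dens U powr \<gamma>)"

definition velocity :: "'n::finite state \<Rightarrow> real ^ 'n" where
  "velocity U = mom U /\<^sub>R dens U"

definition flux :: "real \<Rightarrow> 'n \<Rightarrow> 'n::finite state \<Rightarrow> 'n state" where
  "flux \<gamma> s U = (mom U $ s, (mom U $ s / dens U) *\<^sub>R mom U + pressure \<gamma> U *\<^sub>R axis s 1,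
     (energy U + pressure \<gamma> U) * (mom U $ s / dens U))"

text \<open>
  The derivative of \<open>\<rho> \<chi>(S)\<close> at \<open>U\<close> in the direction \<open>Z\<close>, where \<open>c\<close> and \<open>\<kappa>\<close> stand for \<open>\<chi>(S(U))\<close>
  and \<open>\<chi>'(S(U))\<close>.
\<close>

definition entropy_gradient ::
    "real \<Rightarrow> real \<Rightarrow> real \<Rightarrow> 'n::finite state \<Rightarrow> 'n state \<Rightarrow> real" where
  "entropy_gradient \<gamma> c \<kappa> U Z = c * dens Z + \<kappa> / temperature \<gamma> U *
     (((norm (velocity U))\<^sup>2 / 2 - temperature \<gamma> U / (\<gamma> - 1) - temperature \<gamma> U) * dens Z
       - velocity U \<bullet> mom Z + energy Z)"

text \<open>
  The Bregman distance of the convex function \<open>- \<rho> S\<close> from \<open>U\<close> to \<open>V\<close>, divided by the density of \<open>V\<close>. In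
  terms of velocity, temperature and density it is a sum of three nonnegative terms.
\<close>

definition relative_entropy :: "real \<Rightarrow> 'n::finite state \<Rightarrow> 'n state \<Rightarrow> real" where
  "relative_entropy \<gamma> U V = (norm (velocity V - velocity U))\<^sup>2 / (2 * temperature \<gamma> U)
     + relent (temperature \<gamma> V / temperature \<gamma> U) / (\<gamma> - 1) + relent (dens U / dens V)"

lemma linear_entropy_gradient: "linear (entropy_gradient \<gamma> c \<kappa> U)"
  by (rule linearI)
    (simp_all add: entropy_gradient_def inner_add_right algebra_simps add_divide_distrib)

lemma state_decomposition:
  fixes U :: "'n::finite state"
  assumes "\<gamma> > 1" "dens U > 0"
  shows "mom U = dens U *\<^sub>R velocity U"
    and "pressure \<gamma> U = dens U * temperature \<gamma> U"
    and "energy U = dens U * (temperature \<gamma> U / (\<gamma> - 1) + (norm (velocity U))\<^sup>2 / 2)"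
proof -
  show 1: "mom U = dens U *\<^sub>R velocity U" using assms by (simp add: velocity_def)
  show "pressure \<gamma> U = dens U * temperature \<gamma> U" using assms by (simp add: temperature_def)
  have "(norm (mom U))\<^sup>2 / dens U = dens U * (norm (velocity U))\<^sup>2"
    using assms by (subst 1) (simp add: power_mult_distrib power2_eq_square)
  then have *: "pressure \<gamma> U / (\<gamma> - 1) = energy U - dens U * (norm (velocity U))\<^sup>2 / 2"
    using assms by (simp add: pressure_def)
  have "pressure \<gamma> U / (\<gamma> - 1) = dens U * (temperature \<gamma> U / (\<gamma> - 1))"
    using assms by (simp add: temperature_def)
  with * show "energy U = dens U * (temperature \<gamma> U / (\<gamma> - 1) + (norm (velocity U))\<^sup>2 / 2)"
    by (simp add: algebra_simps)
qed

lemma entropy_gradient_state: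
  fixes U V :: "'n::finite state"
  assumes "\<gamma> > 1" "dens U > 0" "dens V > 0" "pressure \<gamma> U > 0"
  shows "entropy_gradient \<gamma> c \<kappa> U V = dens V * (c + \<kappa> *
     ((norm (velocity V - velocity U))\<^sup>2 / (2 * temperature \<gamma> U)
       + (temperature \<gamma> V / temperature \<gamma> U - 1) / (\<gamma> - 1) - 1))"
proof -
  have T: "temperature \<gamma> U > 0" using assms by (simp add: temperature_def)
  have n: "(norm (velocity V - velocity U))\<^sup>2
      = (norm (velocity V))\<^sup>2 + (norm (velocity U))\<^sup>2 - 2 * (velocity U \<bullet> velocity V)"
    by (simp add: power2_norm_eq_inner inner_diff inner_commute algebra_simps)
  have m: "velocity U \<bullet> mom V = dens V * (velocity U \<bullet> velocity V)"
    by (simp add: state_decomposition(1)[OF assms(1,3)])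
  define B where "B = (norm (velocity U))\<^sup>2 / 2 - temperature \<gamma> U / (\<gamma> - 1) - temperature \<gamma> U
    - velocity U \<bullet> velocity V + temperature \<gamma> V / (\<gamma> - 1) + (norm (velocity V))\<^sup>2 / 2"
  have B: "((norm (velocity U))\<^sup>2 / 2 - temperature \<gamma> U / (\<gamma> - 1) - temperature \<gamma> U) * dens V
      - dens V * (velocity U \<bullet> velocity V)
      + dens V * (temperature \<gamma> V / (\<gamma> - 1) + (norm (velocity V))\<^sup>2 / 2) = dens V * B"
    unfolding B_def by (simp add: algebra_simps)
  have "entropy_gradient \<gamma> c \<kappa> U V = dens V * (c + \<kappa> * (B / temperature \<gamma> U))"
    unfolding entropy_gradient_def m state_decomposition(3)[OF assms(1,3)] B
    by (simp add: algebra_simps)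
  moreover have "B / temperature \<gamma> U = (norm (velocity V - velocity U))\<^sup>2 / (2 * temperature \<gamma> U)
       + (temperature \<gamma> V / temperature \<gamma> U - 1) / (\<gamma> - 1) - 1"
    unfolding n B_def using T assms(1)
    by (simp add: add_divide_distrib diff_divide_distrib mult.commute)
  ultimately show ?thesis by simp
qed

lemma entropy_gradient_flux:
  fixes U V :: "'n::finite state"
  assumes "\<gamma> > 1" "dens U > 0" "dens V > 0" "pressure \<gamma> U > 0"
  shows "entropy_gradient \<gamma> c \<kappa> U (flux \<gamma> s V) = velocity V $ s * entropy_gradient \<gamma> c \<kappa> U V
     + pressure \<gamma> V * (velocity V $ s - velocity U $ s) * \<kappa> / temperature \<gamma> U"
proof -
  have f: "flux \<gamma> s V = (velocity V $ s) *\<^sub>R V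
      + (0, pressure \<gamma> V *\<^sub>R axis s 1, pressure \<gamma> V * velocity V $ s)"
    using assms by (cases V) (simp add: flux_def velocity_def algebra_simps divide_inverse)
  interpret linear "entropy_gradient \<gamma> c \<kappa> U" by (rule linear_entropy_gradient)
  have "entropy_gradient \<gamma> c \<kappa> U (0, pressure \<gamma> V *\<^sub>R axis s 1, pressure \<gamma> V * velocity V $ s)
      = pressure \<gamma> V * (velocity V $ s - velocity U $ s) * \<kappa> / temperature \<gamma> U"
    by (simp add: entropy_gradient_def inner_axis algebra_simps diff_divide_distrib)
  then show ?thesis by (simp add: f add scale)
qed

lemma sqrt_temperature:
  assumes "dens U > 0"
  shows "wave_speed \<gamma> U = norm (velocity U) + sqrt (\<gamma> * temperature \<gamma> U)"
  using assms by (simp add: wave_speed_def velocity_def temperature_def)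

lemma entropy_diff:
  fixes U V :: "'n::finite state"
  assumes "\<gamma> > 1" "dens U > 0" "dens V > 0" "pressure \<gamma> U > 0" "pressure \<gamma> V > 0"
  shows "entropy \<gamma> V - entropy \<gamma> U
    = ln (temperature \<gamma> V / temperature \<gamma> U) / (\<gamma> - 1) + ln (dens U / dens V)"
proof -
  have "entropy \<gamma> W = ln (temperature \<gamma> W) / (\<gamma> - 1) - ln (dens W)"
    if "dens W > 0" "pressure \<gamma> W > 0" for W :: "'n state"
  proof -
    have "ln (pressure \<gamma> W / dens W powr \<gamma>) = ln (temperature \<gamma> W) - (\<gamma> - 1) * ln (dens W)"
      using that by (simp add: temperature_def ln_div ln_powr algebra_simps)
    then show ?thesis using assms(1) by (simp add: entropy_def field_simps)
  qed
  then show ?thesis using assms by (simp add: temperature_def ln_div ln_mult diff_divide_distrib add_divide_distrib)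
qed

text \<open>
  The gradient of the entropy, applied to the contribution of one face to the scheme, exceeds the
  contribution of this face to the discretised entropy equation. Here \<open>a\<close> is twice the viscosity and \<open>\<sigma>\<close> is the
  sign of the outer normal. Concavity of \<open>\<chi>\<close> enters only through the tangent inequality \<open>conc\<close>; the difference
  of both sides is its slack plus a multiple of \<open>b R - \<omega> (x - y)\<close>, which \<open>scalar_face_estimate\<close> bounds below.
\<close>

theorem face_entropy_inequality:
  fixes U V :: "'n::finite state"
  assumes \<gamma>: "\<gamma> > 1" and U: "dens U > 0" "pressure \<gamma> U > 0" and V: "dens V > 0" "pressure \<gamma> V > 0"
    and aU: "a \<ge> 2 * wave_speed \<gamma> U" and aV: "a \<ge> 2 * wave_speed \<gamma> V"
    and \<sigma>: "\<sigma> = 1 \<or> \<sigma> = -1"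
    and \<kappa>: "\<kappa> \<ge> 0" and conc: "cV \<le> cU + \<kappa> * (entropy \<gamma> V - entropy \<gamma> U)"
  shows "a * (dens V * cV - dens U * cU) - \<sigma> * (mom V $ s * cV - mom U $ s * cU)
       + \<kappa> * dens V * sqrt (\<gamma> * temperature \<gamma> U) * relative_entropy \<gamma> U V / 6
     \<le> entropy_gradient \<gamma> cU \<kappa> U (a *\<^sub>R (V - U) - \<sigma> *\<^sub>R (flux \<gamma> s V - flux \<gamma> s U))"
proof -
  interpret linear "entropy_gradient \<gamma> cU \<kappa> U" by (rule linear_entropy_gradient)
  define \<tau> where "\<tau> = temperature \<gamma> U"
  define x where "x = temperature \<gamma> V / \<tau>"
  define y where "y = dens U / dens V"
  define us where "us = velocity U $ s"
  define vs where "vs = velocity V $ s"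
  define q where "q = (norm (velocity V - velocity U))\<^sup>2"
  define b where "b = a - \<sigma> * vs"
  define \<omega> where "\<omega> = \<sigma> * (vs - us)"
  define c0 where "c0 = sqrt (\<gamma> * \<tau>)"
  have \<tau>: "\<tau> > 0" using U by (simp add: \<tau>_def temperature_def)
  have x: "x > 0" using V \<tau> by (simp add: x_def temperature_def)
  have y: "y > 0" using U V by (simp add: y_def)
  have c0: "c0 > 0" "c0\<^sup>2 = \<gamma> * \<tau>" using \<tau> \<gamma> by (auto simp: c0_def)
  have cV: "sqrt (\<gamma> * temperature \<gamma> V) = c0 * sqrt x"
    using \<tau> by (simp add: c0_def x_def real_sqrt_mult[symmetric])
  have aU': "a \<ge> 2 * (norm (velocity U) + c0)" using aU U by (simp add: sqrt_temperature c0_def \<tau>_def)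
  have aV': "a \<ge> 2 * (norm (velocity V) + c0 * sqrt x)" using aV V by (simp add: sqrt_temperature cV)
  have nu: "\<bar>us\<bar> \<le> norm (velocity U)" "\<bar>vs\<bar> \<le> norm (velocity V)"
    unfolding us_def vs_def by (rule component_le_norm_cart)+
  have \<sigma>u: "\<bar>\<sigma> * us\<bar> \<le> norm (velocity U)" "\<bar>\<sigma> * vs\<bar> \<le> norm (velocity V)"
    using \<sigma> nu by auto
  have \<omega>': "\<omega> = \<sigma> * vs - \<sigma> * us" by (simp add: \<omega>_def algebra_simps)
  have sx: "0 < c0 * sqrt x" using c0 x by simp
  have H1: "b \<ge> 2 * (c0 * sqrt x)" using aV' \<sigma>u(2) by (simp add: b_def)
  have H2: "b \<ge> c0 + c0 * sqrt x" using aV' aU' \<sigma>u by (simp add: b_def)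
  have H3: "b \<ge> 1.2 * \<bar>\<omega>\<bar> + 1.8 * c0" if "\<omega> < 0"
  proof -
    have bw: "b = a - \<sigma> * us - \<omega>" by (simp add: b_def \<omega>')
    then have 1: "b \<ge> \<bar>\<omega>\<bar> + norm (velocity U) + 2 * c0"
      using aU' abs_le_D1[OF \<sigma>u(1)] that by argo
    have 2: "b \<ge> \<bar>\<omega>\<bar> + 2 * norm (velocity V) - norm (velocity U)"
      using bw aV' abs_le_D1[OF \<sigma>u(1)] abs_le_D1[OF \<sigma>u(2)] sx \<omega>' that
      by argo
    \<comment> \<open>Nine tenths of the first bound, one tenth of the second, and one fifth of this one.\<close>
    have "\<bar>\<omega>\<bar> \<le> norm (velocity U) + norm (velocity V)" using \<sigma>u by (simp add: \<omega>')
    then show ?thesis using 1 2 norm_ge_zero[of "velocity U"] by argo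
  qed
  have scal: "\<omega> * (x - y) \<le> 5/6 * b * (\<omega>\<^sup>2 / (2 * \<tau>) + relent x / (\<gamma> - 1) + relent y)"
  proof -
    have "\<omega> / c0 * (x - y) \<le> 5/6 * (b / c0) * (\<gamma> * (\<omega> / c0)\<^sup>2 / 2 + relent x / (\<gamma> - 1) + relent y)"
    proof (rule scalar_face_estimate[OF \<gamma> x y])
      show "2 * sqrt x \<le> b / c0" "1 + sqrt x \<le> b / c0"
        using H1 H2 c0 by (simp_all add: field_simps)
      show "12 / 10 * \<bar>\<omega> / c0\<bar> + 18 / 10 \<le> b / c0" if "\<omega> / c0 < 0"
      proof -
        have "\<omega> < 0" using that c0 by (simp add: divide_less_0_iff)
        then have "(1.2 * \<bar>\<omega>\<bar> + 1.8 * c0) / c0 \<le> b / c0"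
          using H3 c0 by (intro divide_right_mono) auto
        moreover have "(1.2 * \<bar>\<omega>\<bar> + 1.8 * c0) / c0 = 1.2 * \<bar>\<omega> / c0\<bar> + 1.8"
          using c0 by (simp add: add_divide_distrib)
        ultimately show ?thesis by simp
      qed
    qed
    moreover have "\<gamma> * (\<omega> / c0)\<^sup>2 / 2 = \<omega>\<^sup>2 / (2 * \<tau>)"
      using c0 \<gamma> \<tau> by (simp add: power_divide)
    ultimately have "c0 * (\<omega> / c0 * (x - y))
        \<le> c0 * (5/6 * (b / c0) * (\<omega>\<^sup>2 / (2 * \<tau>) + relent x / (\<gamma> - 1) + relent y))"
      using c0 by (intro mult_left_mono) auto
    then show ?thesis using c0 by simp
  qed
  have \<omega>q: "\<omega>\<^sup>2 \<le> q"
  proof -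
    have "\<omega>\<^sup>2 = ((velocity V - velocity U) $ s)\<^sup>2" using \<sigma> by (auto simp: \<omega>_def us_def vs_def power2_commute)
    also have "\<dots> \<le> q" unfolding q_def
      by (metis component_le_norm_cart abs_le_square_iff abs_norm_cancel)
    finally show ?thesis .
  qed
  define R where "R = q / (2 * \<tau>) + relent x / (\<gamma> - 1) + relent y"
  have R: "relative_entropy \<gamma> U V = R"
    by (simp add: R_def relative_entropy_def q_def \<tau>_def x_def y_def)
  have b0: "b > 0" using H2 sx c0 by linarith
  have R0: "R \<ge> 0"
    using \<tau> \<gamma> relent_nonneg[OF x] relent_nonneg[OF y] by (simp add: R_def q_def)
  have face: "\<omega> * (x - y) \<le> 5/6 * b * R"
  proof -
    have "\<omega>\<^sup>2 / (2 * \<tau>) \<le> q / (2 * \<tau>)" using \<omega>q \<tau> by (simp add: divide_right_mono)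
    then have "5/6 * b * (\<omega>\<^sup>2 / (2 * \<tau>) + relent x / (\<gamma> - 1) + relent y) \<le> 5/6 * b * R"
      using b0 by (intro mult_left_mono) (auto simp: R_def)
    then show ?thesis using scal by linarith
  qed
  have mU: "mom U $ s = dens U * us" "mom V $ s = dens V * vs"
    using state_decomposition(1)[OF \<gamma> U(1)] state_decomposition(1)[OF \<gamma> V(1)]
    by (metis us_def vs_def vector_scaleR_component real_scaleR_def)+
  define g where "g = q / (2 * \<tau>) + (x - 1) / (\<gamma> - 1) - 1"
  have gV: "entropy_gradient \<gamma> cU \<kappa> U V = dens V * (cU + \<kappa> * g)"
    using entropy_gradient_state[OF \<gamma> U(1) V(1) U(2)] by (simp add: g_def q_def x_def \<tau>_def)
  have gU: "entropy_gradient \<gamma> cU \<kappa> U U = dens U * (cU - \<kappa>)"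
    using entropy_gradient_state[OF \<gamma> U(1) U(1) U(2)] \<tau> by (simp add: \<tau>_def)
  have fV: "entropy_gradient \<gamma> cU \<kappa> U (flux \<gamma> s V)
      = vs * (dens V * (cU + \<kappa> * g)) + dens V * x * (vs - us) * \<kappa>"
    using entropy_gradient_flux[OF \<gamma> U(1) V(1) U(2), of cU \<kappa> s] \<tau>
    by (simp add: gV vs_def us_def x_def \<tau>_def state_decomposition(2)[OF \<gamma> V(1)])
  have fU: "entropy_gradient \<gamma> cU \<kappa> U (flux \<gamma> s U) = us * (dens U * (cU - \<kappa>))"
    using entropy_gradient_flux[OF \<gamma> U(1) U(1) U(2), of cU \<kappa> s] by (simp add: gU us_def)
  have dU: "dens U = dens V * y" using V by (simp add: y_def)
  have ent: "entropy \<gamma> V - entropy \<gamma> U = ln x / (\<gamma> - 1) + ln y"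
    using entropy_diff[OF \<gamma> U(1) V(1) U(2) V(2)] by (simp add: x_def y_def \<tau>_def)
  have Rg: "R = g - (ln x / (\<gamma> - 1) + ln y) + y"
    by (simp add: R_def g_def relent_def diff_divide_distrib)
  have id: "entropy_gradient \<gamma> cU \<kappa> U (a *\<^sub>R (V - U) - \<sigma> *\<^sub>R (flux \<gamma> s V - flux \<gamma> s U))
      - (a * (dens V * cV - dens U * cU) - \<sigma> * (mom V $ s * cV - mom U $ s * cU))
      = b * dens V * (cU + \<kappa> * (ln x / (\<gamma> - 1) + ln y) - cV) + \<kappa> * dens V * (b * R - \<omega> * (x - y))"
    unfolding diff scale gV gU fV fU mU Rg unfolding b_def \<omega>_def dU real_scaleR_def by algebra
  have c: "0 \<le> b * dens V * (cU + \<kappa> * (ln x / (\<gamma> - 1) + ln y) - cV)"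
    using b0 V conc unfolding ent by (intro mult_nonneg_nonneg) auto
  have "c0 * R / 6 \<le> b * R / 6"
    using H2 sx R0 by (intro divide_right_mono mult_right_mono) auto
  then have "\<kappa> * dens V * (c0 * R / 6) \<le> \<kappa> * dens V * (b * R - \<omega> * (x - y))"
    using face \<kappa> V by (intro mult_left_mono) auto
  then show ?thesis using id c by (simp add: R c0_def \<tau>_def)
qed

section \<open>The semi-discrete scheme on the periodic grid\<close>

lemma periodic_grid_multiple:
  fixes g :: "int ^ 'n::finite \<Rightarrow> 'b"
  assumes "periodic_grid n g"
  shows "g (K + axis s (int n * k)) = g K"
proof -
  have nat: "g (K + axis s (int n * int j)) = g K" for j :: nat and K
  proof (induction j)
    case 0
    have "K + axis s (int n * int 0) = K" by (simp add: vec_eq_iff axis_def)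
    then show ?case by metis
  next
    case (Suc j)
    have "K + axis s (int n * int (Suc j)) = (K + axis s (int n * int j)) + axis s (int n)"
      by (simp add: vec_eq_iff axis_def algebra_simps)
    then show ?case using Suc assms unfolding periodic_grid_def by metis
  qed
  show ?thesis
  proof (cases "k \<ge> 0")
    case True
    then show ?thesis using nat[of K "nat k"] by simp
  next
    case False
    then have "K = (K + axis s (int n * k)) + axis s (int n * int (nat (- k)))"
      by (simp add: vec_eq_iff axis_def)
    then show ?thesis using nat[of "K + axis s (int n * k)" "nat (- k)"] by metis
  qed
qed

definition torus_rep :: "nat \<Rightarrow> int ^ 'n::finite \<Rightarrow> int ^ 'n" where
  "torus_rep n K = (\<chi> i. K $ i mod int n)"

lemma periodic_grid_rep:
  fixes g :: "int ^ 'n::finite \<Rightarrow> 'b"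
  assumes "periodic_grid n g"
  shows "g (torus_rep n K) = g K"
proof -
  have "g (\<chi> i. if i \<in> S then K $ i mod int n else K $ i) = g K" if "finite S" for S
    using that
  proof (induction S rule: finite_induct)
    case empty
    then show ?case by simp
  next
    case (insert s S)
    have "(\<chi> i. if i \<in> S then K $ i mod int n else K $ i)
        = (\<chi> i. if i \<in> insert s S then K $ i mod int n else K $ i) + axis s (int n * (K $ s div int n))"
      using insert(2) by (auto simp: vec_eq_iff axis_def)
    then show ?case
      using insert(3) periodic_grid_multiple[OF assms, of _ s "K $ s div int n"] by simp
  qed
  from this[of UNIV] show ?thesis by (simp add: torus_rep_def)
qed

lemma torus_rep_in: "n > 0 \<Longrightarrow> torus_rep n K \<in> torus_cells n"
  by (simp add: torus_rep_def torus_cells_def)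

lemma torus_cells_eq_image:
  "torus_cells n = vec_lambda ` (UNIV \<rightarrow>\<^sub>E {0..<int n} :: ('n::finite \<Rightarrow> int) set)"
proof -
  have "K \<in> vec_lambda ` (UNIV \<rightarrow>\<^sub>E {0..<int n})" if "\<forall>i. 0 \<le> K $ i \<and> K $ i < int n" for K :: "int ^ 'n"
    using that by (intro image_eqI[of _ _ "vec_nth K"]) (auto simp: PiE_def)
  then show ?thesis by (auto simp: torus_cells_def PiE_def)
qed

lemma finite_torus_cells [simp]: "finite (torus_cells n)"
  unfolding torus_cells_eq_image by (intro finite_imageI finite_PiE) auto

lemma card_torus_cells: "card (torus_cells n :: (int ^ 'n::finite) set) = n ^ CARD('n)"
proof -
  have "inj_on vec_lambda (UNIV \<rightarrow>\<^sub>E {0..<int n} :: ('n \<Rightarrow> int) set)"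
    by (auto intro!: inj_onI simp: vec_lambda_inject)
  then show ?thesis
    unfolding torus_cells_eq_image by (simp add: card_image card_PiE)
qed

lemma sum_torus_shift:
  fixes g :: "int ^ 'n::finite \<Rightarrow> 'b::comm_monoid_add"
  assumes per: "periodic_grid n g" and n: "n > 0"
  shows "(\<Sum>K\<in>torus_cells n. g (K + Z)) = (\<Sum>K\<in>torus_cells n. g K)"
proof -
  have "(\<Sum>K\<in>torus_cells n. g (K + Z)) = (\<Sum>K\<in>torus_cells n. g (torus_rep n (K + Z)))"
    by (simp add: periodic_grid_rep[OF per])
  also have "\<dots> = (\<Sum>K\<in>torus_cells n. g K)"
  proof (rule sum.reindex_bij_betw)
    have inv: "torus_rep n (torus_rep n (K + Y) - Y) = K" if "K \<in> torus_cells n" for K Y :: "int ^ 'n"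
      using that by (auto simp: torus_rep_def torus_cells_def vec_eq_iff mod_diff_left_eq)
    show "bij_betw (\<lambda>K. torus_rep n (K + Z)) (torus_cells n) (torus_cells n)"
    proof (rule bij_betwI[where g = "\<lambda>K. torus_rep n (K - Z)"])
      show "torus_rep n (torus_rep n (K + Z) - Z) = K" if "K \<in> torus_cells n" for K
        using inv[OF that] .
      show "torus_rep n (torus_rep n (K - Z) + Z) = K" if "K \<in> torus_cells n" for K
        using inv[OF that, of "- Z"] by simp
    qed (use torus_rep_in[OF n] in auto)
  qed
  finally show ?thesis .
qed

lemma sum_neighbours:
  fixes f :: "int ^ 'n::finite \<Rightarrow> 'b::comm_monoid_add"
  shows "(\<Sum>L\<in>neighbours K. f L) = (\<Sum>s\<in>UNIV. f (K + axis s 1) + f (K - axis s 1))"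
proof -
  have ne: "K + axis s 1 \<noteq> K - axis t 1" for s t :: 'n
  proof
    assume "K + axis s 1 = K - axis t 1"
    then have "(K + axis s 1) $ s = (K - axis t 1) $ s" by simp
    then show False by (auto simp: axis_def split: if_splits)
  qed
  have "(\<Sum>L\<in>neighbours K. f L) = (\<Sum>s\<in>UNIV. \<Sum>L\<in>{K + axis s 1, K - axis s 1}. f L)"
    unfolding neighbours_def
  proof (rule sum.UNION_disjoint)
    show "\<forall>i\<in>UNIV. \<forall>j\<in>UNIV. i \<noteq> j \<longrightarrow> {K + axis i 1, K - axis i 1} \<inter> {K + axis j 1, K - axis j 1} = {}"
      using ne ne[symmetric] by (auto simp: axis_eq_axis)
  qed auto
  also have "\<dots> = (\<Sum>s\<in>UNIV. f (K + axis s 1) + f (K - axis s 1))"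
    using ne by simp
  finally show ?thesis .
qed

lemma viscosity_sym: "viscosity sch \<gamma> n W K L = viscosity sch \<gamma> n W L K"
  by (simp add: viscosity_def max.commute split: lf_scheme.split)

lemma viscosity_ge:
  assumes "periodic_grid n W" "n > 0"
  shows "wave_speed \<gamma> (W K) \<le> viscosity sch \<gamma> n W K L"
proof (cases sch)
  case Global
  have "wave_speed \<gamma> (W K) = wave_speed \<gamma> (W (torus_rep n K))"
    by (simp add: periodic_grid_rep[OF assms(1)])
  also have "\<dots> \<le> Max ((\<lambda>J. wave_speed \<gamma> (W J)) ` torus_cells n)"
    using torus_rep_in[OF assms(2)] by (intro Max_ge) auto
  finally show ?thesis by (simp add: viscosity_def Global)
qed (simp add: viscosity_def)

lemma viscosity_le:
  assumes "\<And>K. wave_speed \<gamma> (W K) \<le> \<Lambda>" "n > 0"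
  shows "viscosity sch \<gamma> n W K L \<le> \<Lambda>"
proof (cases sch)
  case Global
  have "torus_cells n \<noteq> ({} :: (int ^ 'a) set)" using torus_rep_in[OF assms(2)] by auto
  then show ?thesis using assms by (simp add: viscosity_def Global)
qed (use assms in \<open>simp add: viscosity_def\<close>)

lemma viscosity_shift:
  assumes "periodic_grid n W"
  shows "viscosity sch \<gamma> n W (K + axis s (int n)) (L + axis s (int n)) = viscosity sch \<gamma> n W K L"
  using assms by (simp add: viscosity_def periodic_grid_def split: lf_scheme.split)

text \<open>
  The right-hand side of the scheme for a density \<open>G\<close> with fluxes \<open>F s\<close>, grouped by faces: every face contributes
  \<open>2 \<lambda> (G\<^sub>L - G\<^sub>K) - \<sigma> (F\<^sub>L - F\<^sub>K)\<close>. Subtracting \<open>F\<^sub>K\<close> changes nothing, since the two faces orthogonal to the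
  \<open>s\<close>-th direction have opposite normals.
\<close>

definition scheme :: "lf_scheme \<Rightarrow> real \<Rightarrow> nat \<Rightarrow> ('n::finite state \<Rightarrow> 'b::real_vector) \<Rightarrow>
    ('n \<Rightarrow> 'n state \<Rightarrow> 'b) \<Rightarrow> (int ^ 'n \<Rightarrow> 'n state) \<Rightarrow> int ^ 'n \<Rightarrow> 'b" where
  "scheme sch \<gamma> n G F W K = (real n / 2) *\<^sub>R (\<Sum>s\<in>UNIV.
      ((2 * viscosity sch \<gamma> n W K (K + axis s 1)) *\<^sub>R (G (W (K + axis s 1)) - G (W K))
        - (F s (W (K + axis s 1)) - F s (W K)))
    + ((2 * viscosity sch \<gamma> n W K (K - axis s 1)) *\<^sub>R (G (W (K - axis s 1)) - G (W K))
        + (F s (W (K - axis s 1)) - F s (W K))))"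

lemma scheme_linear:
  assumes "linear l"
  shows "l (scheme sch \<gamma> n G F W K) = scheme sch \<gamma> n (\<lambda>V. l (G V)) (\<lambda>s V. l (F s V)) W K"
proof -
  interpret linear l by fact
  show ?thesis by (simp add: scheme_def scale sum add diff)
qed

lemma num_diffusion_eq:
  "num_diffusion sch \<gamma> n W g K = real n *\<^sub>R (\<Sum>s\<in>UNIV.
     viscosity sch \<gamma> n W K (K + axis s 1) *\<^sub>R (g (K + axis s 1) - g K)
     + viscosity sch \<gamma> n W K (K - axis s 1) *\<^sub>R (g (K - axis s 1) - g K))"
  by (simp add: num_diffusion_def sum_neighbours)

lemma scheme_eq:
  "scheme sch \<gamma> n G F W K = num_diffusion sch \<gamma> n W (\<lambda>J. G (W J)) K
     - (\<Sum>s\<in>UNIV. (real n / 2) *\<^sub>R (F s (W (K + axis s 1)) - F s (W (K - axis s 1))))"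
  unfolding num_diffusion_eq scheme_def scaleR_sum_right sum_subtractf[symmetric]
  by (rule sum.cong) (simp_all add: algebra_simps)

lemma lf_solution_ode:
  fixes U :: "real \<Rightarrow> int ^ 'n::finite \<Rightarrow> 'n state"
  assumes sol: "lf_solution sch \<gamma> T n \<rho>0 m0 E0 U" and t: "0 < t" "t < T"
  shows "((\<lambda>s. U s K) has_vector_derivative scheme sch \<gamma> n (\<lambda>V. V) (flux \<gamma>) (U t) K) (at t)"
proof -
  let ?W = "U t"
  obtain d\<rho> dm dE where d:
      "((\<lambda>s. dens (U s K)) has_vector_derivative d\<rho>) (at t)"
      "((\<lambda>s. mom (U s K)) has_vector_derivative dm) (at t)"
      "((\<lambda>s. energy (U s K)) has_vector_derivative dE) (at t)"
    and e: "d\<rho> + div_h n (\<lambda>J. mom (?W J)) K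
          - num_diffusion sch \<gamma> n ?W (\<lambda>J. dens (?W J)) K = 0"
        "dm + Div_h n (\<lambda>J. convection (?W J) + pressure \<gamma> (?W J) *\<^sub>R mat 1) K
          - num_diffusion sch \<gamma> n ?W (\<lambda>J. mom (?W J)) K = 0"
        "dE + div_h n (\<lambda>J. (energy (?W J) + pressure \<gamma> (?W J)) *\<^sub>R (mom (?W J) /\<^sub>R dens (?W J))) K
          - num_diffusion sch \<gamma> n ?W (\<lambda>J. energy (?W J)) K = 0"
  proof -
    have "t \<in> {0<..<T}" using t by simp
    with sol show thesis unfolding lf_solution_def
      by (elim conjE) (drule (1) bspec, drule spec[of _ K], elim exE conjE, rule that)
  qed
  have lin: "linear (fst :: 'n state \<Rightarrow> _)" "linear (\<lambda>V :: 'n state. mom V)" "linear (\<lambda>V :: 'n state. energy V)"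
    by (auto intro!: linearI)
  have "(\<Sum>s\<in>UNIV. (real n / 2) *\<^sub>R (dens (flux \<gamma> s (?W (K + axis s 1))) - dens (flux \<gamma> s (?W (K - axis s 1)))))
      = div_h n (\<lambda>J. mom (?W J)) K"
    unfolding div_h_def by (rule sum.cong) (simp_all add: flux_def)
  then have 1: "dens (scheme sch \<gamma> n (\<lambda>V. V) (flux \<gamma>) ?W K) = d\<rho>"
    using e(1) unfolding scheme_linear[OF lin(1)] unfolding scheme_eq by simp
  have col: "column s (convection V + pressure \<gamma> V *\<^sub>R mat 1)
      = (mom V $ s / dens V) *\<^sub>R mom V + pressure \<gamma> V *\<^sub>R axis s 1" for s and V :: "'n state"
    by (simp add: vec_eq_iff column_def convection_def mat_def axis_def)
  have "(\<Sum>s\<in>UNIV. (real n / 2) *\<^sub>R (mom (flux \<gamma> s (?W (K + axis s 1))) - mom (flux \<gamma> s (?W (K - axis s 1)))))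
      = Div_h n (\<lambda>J. convection (?W J) + pressure \<gamma> (?W J) *\<^sub>R mat 1) K"
    unfolding Div_h_def col by (rule sum.cong) (simp_all add: flux_def)
  then have 2: "mom (scheme sch \<gamma> n (\<lambda>V. V) (flux \<gamma>) ?W K) = dm"
    using e(2) unfolding scheme_linear[OF lin(2)] unfolding scheme_eq by (simp add: algebra_simps)
  have fl: "energy (flux \<gamma> s V) = ((energy V + pressure \<gamma> V) *\<^sub>R (mom V /\<^sub>R dens V)) $ s"
    for s and V :: "'n state"
    by (simp add: flux_def divide_inverse)
  have "(\<Sum>s\<in>UNIV. (real n / 2) *\<^sub>R (energy (flux \<gamma> s (?W (K + axis s 1))) - energy (flux \<gamma> s (?W (K - axis s 1)))))
      = div_h n (\<lambda>J. (energy (?W J) + pressure \<gamma> (?W J)) *\<^sub>R (mom (?W J) /\<^sub>R dens (?W J))) K"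
    unfolding div_h_def fl by (rule sum.cong) simp_all
  then have 3: "energy (scheme sch \<gamma> n (\<lambda>V. V) (flux \<gamma>) ?W K) = dE"
    using e(3) unfolding scheme_linear[OF lin(3)] unfolding scheme_eq by simp
  have "((\<lambda>s. (dens (U s K), mom (U s K), energy (U s K))) has_vector_derivative (d\<rho>, dm, dE)) (at t)"
    by (intro has_vector_derivative_Pair d)
  moreover have "(d\<rho>, dm, dE) = scheme sch \<gamma> n (\<lambda>V. V) (flux \<gamma>) ?W K"
    using 1 2 3 by (metis prod.collapse)
  ultimately show ?thesis by simp
qed

lemma entropy_has_derivative:
  fixes u :: "real \<Rightarrow> 'n::finite state"
  assumes \<gamma>: "\<gamma> > 1" and u: "(u has_vector_derivative u') (at t)"
    and pos: "dens (u t) > 0" "pressure \<gamma> (u t) > 0"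
    and chi: "(chi has_real_derivative \<kappa>) (at (entropy \<gamma> (u t)))"
  shows "((\<lambda>t. dens (u t) * chi (entropy \<gamma> (u t))) has_real_derivative
     entropy_gradient \<gamma> (chi (entropy \<gamma> (u t))) \<kappa> (u t) u') (at t)"
proof -
  define \<rho> where "\<rho> t = dens (u t)" for t
  define m where "m t = mom (u t)" for t
  define E where "E t = energy (u t)" for t
  have u_eq: "u t = (\<rho> t, m t, E t)" for t by (simp add: \<rho>_def m_def E_def)
  obtain \<rho>' m' E' where u': "u' = (\<rho>', m', E')" by (cases u')
  have d\<rho>: "(\<rho> has_real_derivative \<rho>') (at t)"
    using bounded_linear.has_vector_derivative[OF bounded_linear_fst u]
    by (simp add: \<rho>_def[abs_def] u' has_real_derivative_iff_has_vector_derivative)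
  have dm: "(m has_vector_derivative m') (at t)"
    using bounded_linear.has_vector_derivative[OF bounded_linear_fst
        bounded_linear.has_vector_derivative[OF bounded_linear_snd u]]
    by (simp add: m_def[abs_def] u')
  have dE: "(E has_real_derivative E') (at t)"
    using bounded_linear.has_vector_derivative[OF bounded_linear_snd
        bounded_linear.has_vector_derivative[OF bounded_linear_snd u]]
    by (simp add: E_def[abs_def] u' has_real_derivative_iff_has_vector_derivative)
  have dmm: "((\<lambda>t. m t \<bullet> m t) has_real_derivative 2 * (m t \<bullet> m')) (at t)"
    using bounded_bilinear.has_vector_derivative[OF bounded_bilinear_inner dm dm]
    by (simp add: has_real_derivative_iff_has_vector_derivative inner_commute)
  define p where "p t = (\<gamma> - 1) * (E t - 1/2 * ((m t \<bullet> m t) / \<rho> t))" for t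
  have p: "pressure \<gamma> (u t) = p t" for t
    unfolding pressure_def p_def \<rho>_def m_def E_def power2_norm_eq_inner by (rule refl)
  have \<rho>0: "\<rho> t > 0" and p0: "p t > 0" using pos by (simp_all add: \<rho>_def p)
  define \<pi> where "\<pi> = E' - (m t \<bullet> m') / \<rho> t + (m t \<bullet> m t) * \<rho>' / (2 * (\<rho> t)\<^sup>2)"
  have dp: "(p has_real_derivative (\<gamma> - 1) * \<pi>) (at t)"
  proof -
    have "((\<lambda>t. (\<gamma> - 1) * (E t - 1/2 * ((m t \<bullet> m t) / \<rho> t))) has_real_derivative
        (\<gamma> - 1) * (E' - 1/2 * ((2 * (m t \<bullet> m') * \<rho> t - (m t \<bullet> m t) * \<rho>') / (\<rho> t * \<rho> t)))) (at t)"
      by (intro DERIV_cmult DERIV_diff dE DERIV_divide dmm d\<rho>) (use \<rho>0 in simp)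
    moreover have "E' - 1/2 * ((2 * (m t \<bullet> m') * \<rho> t - (m t \<bullet> m t) * \<rho>') / (\<rho> t * \<rho> t)) = \<pi>"
      using \<rho>0 by (simp add: \<pi>_def diff_divide_distrib power2_eq_square)
    ultimately show ?thesis by (simp add: p_def[abs_def])
  qed
  have dpow: "((\<lambda>t. \<rho> t powr \<gamma>) has_real_derivative (\<rho> t powr \<gamma>) * (\<rho>' * \<gamma> / \<rho> t)) (at t)"
    using DERIV_powr[OF d\<rho> \<rho>0 DERIV_const[of \<gamma>]] by simp
  define \<sigma> where "\<sigma> t = 1 / (\<gamma> - 1) * ln (p t / \<rho> t powr \<gamma>)" for t
  have \<sigma>: "entropy \<gamma> (u t) = \<sigma> t" for t by (simp add: entropy_def \<sigma>_def p \<rho>_def)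
  have d\<sigma>: "(\<sigma> has_real_derivative \<pi> / p t - \<gamma> / (\<gamma> - 1) * \<rho>' / \<rho> t) (at t)"
  proof -
    define R where "R = \<rho> t powr \<gamma>"
    have R: "R > 0" using \<rho>0 by (simp add: R_def)
    have "((\<lambda>t. 1 / (\<gamma> - 1) * ln (p t / \<rho> t powr \<gamma>)) has_real_derivative
        1 / (\<gamma> - 1) * (inverse (p t / R) * (((\<gamma> - 1) * \<pi> * R - p t * (R * (\<rho>' * \<gamma> / \<rho> t))) / (R * R)))) (at t)"
      unfolding R_def
      by (intro DERIV_cmult DERIV_chain2[where f = ln] DERIV_ln DERIV_divide dp dpow)
        (use \<rho>0 p0 in auto)
    moreover have "1 / (\<gamma> - 1) * (inverse (p t / R) * (((\<gamma> - 1) * \<pi> * R - p t * (R * (\<rho>' * \<gamma> / \<rho> t))) / (R * R)))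
        = \<pi> / p t - \<gamma> / (\<gamma> - 1) * \<rho>' / \<rho> t"
      using R p0 \<rho>0 \<gamma> by (simp add: diff_divide_distrib right_diff_distrib)
    ultimately show ?thesis by (simp add: \<sigma>_def[abs_def])
  qed
  have dchi: "((\<lambda>t. chi (\<sigma> t)) has_real_derivative \<kappa> * (\<pi> / p t - \<gamma> / (\<gamma> - 1) * \<rho>' / \<rho> t)) (at t)"
    using DERIV_chain2[OF chi[unfolded \<sigma>] d\<sigma>] .
  have "((\<lambda>t. \<rho> t * chi (\<sigma> t)) has_real_derivative
      \<rho>' * chi (\<sigma> t) + \<kappa> * (\<pi> / p t - \<gamma> / (\<gamma> - 1) * \<rho>' / \<rho> t) * \<rho> t) (at t)"
    by (rule DERIV_mult'[OF d\<rho> dchi, THEN DERIV_cong]) (simp add: algebra_simps)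
  moreover have "\<rho>' * chi (\<sigma> t) + \<kappa> * (\<pi> / p t - \<gamma> / (\<gamma> - 1) * \<rho>' / \<rho> t) * \<rho> t
      = entropy_gradient \<gamma> (chi (\<sigma> t)) \<kappa> (u t) u'"
  proof -
    define \<theta> where "\<theta> = temperature \<gamma> (u t)"
    have \<theta>: "p t = \<rho> t * \<theta>" "\<theta> > 0"
      using \<rho>0 p0 by (simp_all add: \<theta>_def temperature_def p \<rho>_def[symmetric])
    have g: "\<gamma> / (\<gamma> - 1) = 1 + 1 / (\<gamma> - 1)" using \<gamma> by (simp add: field_simps)
    have \<pi>: "\<pi> = E' - velocity (u t) \<bullet> m' + (norm (velocity (u t)))\<^sup>2 / 2 * \<rho>'"
      using \<rho>0 unfolding velocity_def \<rho>_def[symmetric] m_def[symmetric] power2_norm_eq_inner \<pi>_def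
      by (simp add: field_simps power2_eq_square)
    have "(\<pi> / p t - \<gamma> / (\<gamma> - 1) * \<rho>' / \<rho> t) * \<rho> t = \<pi> / \<theta> - (1 + 1 / (\<gamma> - 1)) * \<rho>'"
      unfolding g \<theta>(1) using \<theta>(2) \<rho>0 by (simp add: diff_divide_distrib left_diff_distrib)
    also have "\<dots> = ((\<theta> * (- \<rho>' / (\<gamma> - 1) - \<rho>')) + \<pi>) / \<theta>"
      using \<theta>(2) by (simp add: add_divide_distrib left_diff_distrib distrib_right)
    also have "\<theta> * (- \<rho>' / (\<gamma> - 1) - \<rho>') + \<pi> = ((norm (velocity (u t)))\<^sup>2 / 2 - \<theta> / (\<gamma> - 1) - \<theta>) * \<rho>'
        - velocity (u t) \<bullet> m' + E'"
      unfolding \<pi> by (simp add: algebra_simps)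
    finally have "\<kappa> * ((\<pi> / p t - \<gamma> / (\<gamma> - 1) * \<rho>' / \<rho> t) * \<rho> t) = \<kappa> / \<theta> * (((norm (velocity (u t)))\<^sup>2 / 2
        - \<theta> / (\<gamma> - 1) - \<theta>) * \<rho>' - velocity (u t) \<bullet> m' + E')"
      by simp
    then show ?thesis
      unfolding entropy_gradient_def u' \<theta>_def[symmetric]
      by (simp only: mult.assoc[of \<kappa> _ "\<rho> t"] fst_conv snd_conv mult.commute[of \<rho>'])
  qed
  ultimately show ?thesis by (simp add: \<sigma> \<rho>_def)
qed

text \<open>
  Summation of \<open>face_entropy_inequality\<close> over the faces of a cell: the viscosity dominates the wave speeds
  on both sides of a face.
\<close>

lemma entropy_production:
  fixes W :: "int ^ 'n::finite \<Rightarrow> 'n state"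
  assumes \<gamma>: "\<gamma> > 1" and per: "periodic_grid n W" and n: "n > 0"
    and pos: "\<And>K. dens (W K) > 0" "\<And>K. pressure \<gamma> (W K) > 0"
    and \<kappa>: "\<kappa> \<ge> 0" and conc: "\<And>s. chi s \<le> chi (entropy \<gamma> (W K)) + \<kappa> * (s - entropy \<gamma> (W K))"
  shows "scheme sch \<gamma> n (\<lambda>V. dens V * chi (entropy \<gamma> V)) (\<lambda>s V. mom V $ s * chi (entropy \<gamma> V)) W K
       + real n / 12 * \<kappa> * sqrt (\<gamma> * temperature \<gamma> (W K)) * (\<Sum>s\<in>UNIV.
           dens (W (K + axis s 1)) * relative_entropy \<gamma> (W K) (W (K + axis s 1))
         + dens (W (K - axis s 1)) * relative_entropy \<gamma> (W K) (W (K - axis s 1)))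
     \<le> entropy_gradient \<gamma> (chi (entropy \<gamma> (W K))) \<kappa> (W K) (scheme sch \<gamma> n (\<lambda>V. V) (flux \<gamma>) W K)"
proof -
  define g where "g = entropy_gradient \<gamma> (chi (entropy \<gamma> (W K))) \<kappa> (W K)"
  have lin: "linear g" unfolding g_def by (rule linear_entropy_gradient)
  interpret linear g by (rule lin)
  define D where "D L = \<kappa> * dens (W L) * sqrt (\<gamma> * temperature \<gamma> (W K)) * relative_entropy \<gamma> (W K) (W L) / 6" for L
  define \<eta> where "\<eta> V = dens V * chi (entropy \<gamma> V)" for V :: "'n state"
  define q where "q s V = mom V $ s * chi (entropy \<gamma> V)" for s and V :: "'n state"
  define a where "a L = 2 * viscosity sch \<gamma> n W K L" for L
  have face: "a L * (\<eta> (W L) - \<eta> (W K)) - \<sigma> * (q s (W L) - q s (W K)) + D L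
      \<le> g (a L *\<^sub>R (W L - W K) - \<sigma> *\<^sub>R (flux \<gamma> s (W L) - flux \<gamma> s (W K)))"
    if "\<sigma> = 1 \<or> \<sigma> = -1" for L s and \<sigma> :: real
    unfolding g_def \<eta>_def q_def D_def
    by (rule face_entropy_inequality[OF \<gamma> pos pos _ _ that \<kappa> conc])
      (use viscosity_ge[OF per n, of \<gamma> K sch L] viscosity_ge[OF per n, of \<gamma> L sch K]
        in \<open>simp_all add: a_def viscosity_sym[of _ _ _ _ L]\<close>)
  have "scheme sch \<gamma> n \<eta> q W K + real n / 2 * (\<Sum>s\<in>UNIV. D (K + axis s 1) + D (K - axis s 1))
      = real n / 2 * (\<Sum>s\<in>UNIV.
          (a (K + axis s 1) * (\<eta> (W (K + axis s 1)) - \<eta> (W K)) - 1 * (q s (W (K + axis s 1)) - q s (W K)) + D (K + axis s 1))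
        + (a (K - axis s 1) * (\<eta> (W (K - axis s 1)) - \<eta> (W K)) - (-1) * (q s (W (K - axis s 1)) - q s (W K)) + D (K - axis s 1)))"
    unfolding scheme_def a_def[symmetric] real_scaleR_def distrib_left[symmetric] sum.distrib[symmetric]
    by (rule arg_cong[where f = "\<lambda>x. real n / 2 * x"], rule sum.cong) simp_all
  also have "\<dots> \<le> real n / 2 * (\<Sum>s\<in>UNIV.
       g (a (K + axis s 1) *\<^sub>R (W (K + axis s 1) - W K) - 1 *\<^sub>R (flux \<gamma> s (W (K + axis s 1)) - flux \<gamma> s (W K)))
     + g (a (K - axis s 1) *\<^sub>R (W (K - axis s 1) - W K) - (-1) *\<^sub>R (flux \<gamma> s (W (K - axis s 1)) - flux \<gamma> s (W K))))"
    by (intro mult_left_mono sum_mono add_mono face) auto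
  also have "\<dots> = g (scheme sch \<gamma> n (\<lambda>V. V) (flux \<gamma>) W K)"
    unfolding scheme_def a_def[symmetric] by (simp add: scale sum add diff algebra_simps)
  also have "real n / 2 * (\<Sum>s\<in>UNIV. D (K + axis s 1) + D (K - axis s 1))
    = real n / 12 * \<kappa> * sqrt (\<gamma> * temperature \<gamma> (W K)) * (\<Sum>s\<in>UNIV.
           dens (W (K + axis s 1)) * relative_entropy \<gamma> (W K) (W (K + axis s 1))
         + dens (W (K - axis s 1)) * relative_entropy \<gamma> (W K) (W (K - axis s 1)))"
    unfolding sum_distrib_left by (rule sum.cong) (simp_all add: D_def algebra_simps)
  finally show ?thesis by (simp add: g_def \<eta>_def q_def)
qed

section \<open>Positivity of the pressure and the minimum entropy principle\<close>

text \<open>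
  By periodicity and since the viscosity is symmetric in the two cells of a face, all differences can be shifted
  to the test function.
\<close>

lemma summation_by_parts:
  fixes W :: "int ^ 'n::finite \<Rightarrow> 'n state" and \<phi> :: "int ^ 'n \<Rightarrow> real"
  assumes W: "periodic_grid n W" and \<phi>: "periodic_grid n \<phi>" and n: "n > 0"
  shows "(\<Sum>K\<in>torus_cells n. scheme sch \<gamma> n G F W K * \<phi> K) = (\<Sum>K\<in>torus_cells n. \<Sum>s\<in>UNIV.
      F s (W K) * ((\<phi> (K + axis s 1) - \<phi> (K - axis s 1)) * (real n / 2))
      - real n * (viscosity sch \<gamma> n W K (K + axis s 1)
          * (G (W (K + axis s 1)) - G (W K)) * (\<phi> (K + axis s 1) - \<phi> K)))"
proof -
  define a where "a s K = viscosity sch \<gamma> n W K (K + axis s 1) * (G (W (K + axis s 1)) - G (W K))" for s K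
  have a_minus: "viscosity sch \<gamma> n W K (K - axis s 1) * (G (W (K - axis s 1)) - G (W K)) = - a s (K - axis s 1)" for s K
    by (simp add: a_def viscosity_sym[of _ _ _ _ "K - axis s 1" K] algebra_simps)
  have per: "W (K + axis i (int n) + Z) = W (K + Z)" "\<phi> (K + axis i (int n) + Z) = \<phi> (K + Z)" for K i Z
    using W \<phi> unfolding periodic_grid_def by (metis add.assoc add.commute)+
  have pa: "a s (K + axis i (int n) + Z) = a s (K + Z)" for s K i Z
  proof -
    have e: "K + axis i (int n) + Z = (K + Z) + axis i (int n)"
      "(K + Z) + axis i (int n) + axis s 1 = (K + Z + axis s 1) + axis i (int n)"
      by (simp_all add: algebra_simps)
    have W': "W (K + axis i (int n)) = W K" for K using W by (simp add: periodic_grid_def)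
    show ?thesis unfolding a_def e by (simp only: viscosity_shift[OF W] W')
  qed
  have per0: "W (K + axis i (int n)) = W K" "\<phi> (K + axis i (int n)) = \<phi> K"
    and pa0: "a s (K + axis i (int n)) = a s K" for K i s
    using per[of K i 0] pa[of s K i 0] by simp_all
  have perm: "W (K + axis i (int n) - Z) = W (K - Z)" "\<phi> (K + axis i (int n) - Z) = \<phi> (K - Z)" 
     "a s (K + axis i (int n) - Z) = a s (K - Z)" for K i Z s
    using per[of K i "- Z"] pa[of s K i "- Z"] by simp_all
  have face_sum: "(\<Sum>K\<in>torus_cells n. real n / 2 * ((2 * a s K - (F s (W (K + axis s 1)) - F s (W K)))
       + (- 2 * a s (K - axis s 1) + (F s (W (K - axis s 1)) - F s (W K)))) * \<phi> K)
     = (\<Sum>K\<in>torus_cells n. F s (W K) * ((\<phi> (K + axis s 1) - \<phi> (K - axis s 1)) * (real n / 2))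
      - real n * (a s K * (\<phi> (K + axis s 1) - \<phi> K)))" for s
  proof -
    have 1: "(\<Sum>K\<in>torus_cells n. a s (K - axis s 1) * \<phi> K) = (\<Sum>K\<in>torus_cells n. a s K * \<phi> (K + axis s 1))"
      using sum_torus_shift[of n "\<lambda>K. a s (K - axis s 1) * \<phi> K" "axis s 1"] n
      by (simp add: periodic_grid_def per0 perm)
    have 2: "(\<Sum>K\<in>torus_cells n. F s (W (K - axis s 1)) * \<phi> K) = (\<Sum>K\<in>torus_cells n. F s (W K) * \<phi> (K + axis s 1))"
      using sum_torus_shift[of n "\<lambda>K. F s (W (K - axis s 1)) * \<phi> K" "axis s 1"] n
      by (simp add: periodic_grid_def per0 perm)
    have 3: "(\<Sum>K\<in>torus_cells n. F s (W (K + axis s 1)) * \<phi> K) = (\<Sum>K\<in>torus_cells n. F s (W K) * \<phi> (K - axis s 1))"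
      using sum_torus_shift[of n "\<lambda>K. F s (W K) * \<phi> (K - axis s 1)" "axis s 1"] n
      by (simp add: periodic_grid_def per0 perm)
    have "(\<Sum>K\<in>torus_cells n. real n / 2 * ((2 * a s K - (F s (W (K + axis s 1)) - F s (W K)))
       + (- 2 * a s (K - axis s 1) + (F s (W (K - axis s 1)) - F s (W K)))) * \<phi> K)
      = real n * (\<Sum>K\<in>torus_cells n. a s K * \<phi> K) - real n * (\<Sum>K\<in>torus_cells n. a s (K - axis s 1) * \<phi> K)
       + real n / 2 * (\<Sum>K\<in>torus_cells n. F s (W (K - axis s 1)) * \<phi> K)
       - real n / 2 * (\<Sum>K\<in>torus_cells n. F s (W (K + axis s 1)) * \<phi> K)"
      unfolding sum_distrib_left sum_subtractf[symmetric] sum.distrib[symmetric]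
      by (rule sum.cong) (simp_all add: algebra_simps)
    also have "\<dots> = (\<Sum>K\<in>torus_cells n. F s (W K) * ((\<phi> (K + axis s 1) - \<phi> (K - axis s 1)) * (real n / 2))
      - real n * (a s K * (\<phi> (K + axis s 1) - \<phi> K)))"
      unfolding 1 2 3
      unfolding sum_distrib_left sum_subtractf[symmetric] sum.distrib[symmetric]
      by (rule sum.cong) (simp_all add: algebra_simps)
    finally show ?thesis .
  qed
  have "(\<Sum>K\<in>torus_cells n. scheme sch \<gamma> n G F W K * \<phi> K)
    = (\<Sum>K\<in>torus_cells n. \<Sum>s\<in>UNIV. real n / 2 * ((2 * a s K - (F s (W (K + axis s 1)) - F s (W K)))
       + (- 2 * a s (K - axis s 1) + (F s (W (K - axis s 1)) - F s (W K)))) * \<phi> K)"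
  proof (rule sum.cong[OF refl])
    fix K :: "int ^ 'n"
    have "scheme sch \<gamma> n G F W K = (\<Sum>s\<in>UNIV. real n / 2 * ((2 * a s K - (F s (W (K + axis s 1)) - F s (W K)))
       + (- 2 * a s (K - axis s 1) + (F s (W (K - axis s 1)) - F s (W K)))))"
      unfolding scheme_def real_scaleR_def sum_distrib_left mult.assoc[of 2] a_minus
      unfolding a_def by (simp add: mult.assoc)
    then show "scheme sch \<gamma> n G F W K * \<phi> K = (\<Sum>s\<in>UNIV. real n / 2 * ((2 * a s K - (F s (W (K + axis s 1)) - F s (W K)))
       + (- 2 * a s (K - axis s 1) + (F s (W (K - axis s 1)) - F s (W K)))) * \<phi> K)"
      by (simp only: sum_distrib_right)
  qed
  also have "\<dots> = (\<Sum>s\<in>UNIV. \<Sum>K\<in>torus_cells n. F s (W K) * ((\<phi> (K + axis s 1) - \<phi> (K - axis s 1)) * (real n / 2))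
      - real n * (a s K * (\<phi> (K + axis s 1) - \<phi> K)))"
    by (subst sum.swap) (simp only: face_sum)
  also have "\<dots> = (\<Sum>K\<in>torus_cells n. \<Sum>s\<in>UNIV. F s (W K) * ((\<phi> (K + axis s 1) - \<phi> (K - axis s 1)) * (real n / 2))
      - real n * (a s K * (\<phi> (K + axis s 1) - \<phi> K)))"
    by (rule sum.swap)
  finally show ?thesis by (simp add: a_def)
qed

lemma sum_scheme_zero:
  fixes W :: "int ^ 'n::finite \<Rightarrow> 'n state" and G :: "'n state \<Rightarrow> real"
  assumes "periodic_grid n W" "n > 0"
  shows "(\<Sum>K\<in>torus_cells n. scheme sch \<gamma> n G F W K) = 0"
  using summation_by_parts[OF assms(1) _ assms(2), of "\<lambda>_. 1" sch \<gamma> G F]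
  by (simp add: periodic_grid_def)

lemma continuous_on_pressure:
  "continuous_on {U :: 'n::finite state. dens U > 0} (pressure \<gamma>)"
  unfolding pressure_def[abs_def] by (intro continuous_intros) auto

lemma continuous_on_temperature:
  "continuous_on {U :: 'n::finite state. dens U > 0} (temperature \<gamma>)"
  unfolding temperature_def[abs_def] by (intro continuous_intros continuous_on_pressure) auto

lemma continuous_on_entropy:
  "continuous_on {U :: 'n::finite state. dens U > 0 \<and> pressure \<gamma> U > 0} (entropy \<gamma>)"
  unfolding entropy_def[abs_def]
  by (intro continuous_intros continuous_on_subset[OF continuous_on_pressure]) auto

lemma relative_entropy_nonneg:
  fixes U V :: "'n::finite state"
  assumes "\<gamma> > 1" "dens U > 0" "pressure \<gamma> U > 0" "dens V > 0" "pressure \<gamma> V > 0"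
  shows "relative_entropy \<gamma> U V \<ge> 0"
  unfolding relative_entropy_def using assms
  by (intro add_nonneg_nonneg divide_nonneg_nonneg relent_nonneg) (auto simp: temperature_def)

lemma pressure_ge_of_entropy_ge:
  assumes "\<gamma> > 1" "dens U \<ge> \<rho>" "\<rho> > 0" "pressure \<gamma> U > 0" "entropy \<gamma> U \<ge> s0"
  shows "pressure \<gamma> U \<ge> exp ((\<gamma> - 1) * s0) * dens U powr \<gamma>"
    and "pressure \<gamma> U \<ge> exp ((\<gamma> - 1) * s0) * \<rho> powr \<gamma>"
proof -
  have d: "dens U > 0" using assms by linarith
  have "(\<gamma> - 1) * s0 \<le> (\<gamma> - 1) * entropy \<gamma> U" using assms by (intro mult_left_mono) auto
  also have "\<dots> = ln (pressure \<gamma> U / dens U powr \<gamma>)" using assms by (simp add: entropy_def)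
  finally have "exp ((\<gamma> - 1) * s0) \<le> pressure \<gamma> U / dens U powr \<gamma>"
    using assms d by (simp add: ln_ge_iff)
  then show *: "pressure \<gamma> U \<ge> exp ((\<gamma> - 1) * s0) * dens U powr \<gamma>"
    using d by (simp add: field_simps)
  have "\<rho> powr \<gamma> \<le> dens U powr \<gamma>" using assms by (intro powr_mono2) auto
  then have "exp ((\<gamma> - 1) * s0) * \<rho> powr \<gamma> \<le> exp ((\<gamma> - 1) * s0) * dens U powr \<gamma>" by simp
  with * show "pressure \<gamma> U \<ge> exp ((\<gamma> - 1) * s0) * \<rho> powr \<gamma>" by linarith
qed

text \<open>
  A solution of the semi-discrete system on \<open>{0..<T}\<close>, detached from its initial data.
\<close>

locale lf_run =
  fixes \<gamma> T :: real and sch :: lf_scheme and n :: nat and U :: "real \<Rightarrow> int ^ 'n::finite \<Rightarrow> 'n state"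
  assumes gamma: "\<gamma> > 1" and T_pos: "T > 0" and n_pos: "n > 0"
    and periodic: "\<And>t. 0 \<le> t \<Longrightarrow> t < T \<Longrightarrow> periodic_grid n (U t)"
    and dens_pos: "\<And>t K. 0 \<le> t \<Longrightarrow> t < T \<Longrightarrow> dens (U t K) > 0"
    and cont: "\<And>K. continuous_on {0..<T} (\<lambda>t. U t K)"
    and ode: "\<And>t K. 0 < t \<Longrightarrow> t < T \<Longrightarrow>
       ((\<lambda>s. U s K) has_vector_derivative scheme sch \<gamma> n (\<lambda>V. V) (flux \<gamma>) (U t) K) (at t)"
begin

definition entropy_dissipation :: "real \<Rightarrow> int ^ 'n \<Rightarrow> real" where
  "entropy_dissipation t K = real n / 12 * sqrt (\<gamma> * temperature \<gamma> (U t K)) * (\<Sum>s\<in>UNIV.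
      dens (U t (K + axis s 1)) * relative_entropy \<gamma> (U t K) (U t (K + axis s 1))
    + dens (U t (K - axis s 1)) * relative_entropy \<gamma> (U t K) (U t (K - axis s 1)))"

lemma entropy_dissipation_nonneg:
  assumes "0 \<le> t" "t < T" "\<And>K. pressure \<gamma> (U t K) > 0"
  shows "0 \<le> entropy_dissipation t K"
  unfolding entropy_dissipation_def using assms dens_pos[OF assms(1,2)] gamma
  by (intro mult_nonneg_nonneg sum_nonneg add_nonneg_nonneg relative_entropy_nonneg)
    (auto simp: less_imp_le temperature_def)

text \<open>
  The chain rule expresses the derivative by the entropy gradient, which \<open>entropy_production\<close> estimates; only the
  resulting lower bound is kept.
\<close>

lemma entropy_balance:
  assumes t: "0 < t" "t < T" and p: "\<And>K. pressure \<gamma> (U t K) > 0"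
    and chi: "(chi has_real_derivative \<kappa>) (at (entropy \<gamma> (U t K)))" and \<kappa>: "\<kappa> \<ge> 0"
    and conc: "\<And>s. chi s \<le> chi (entropy \<gamma> (U t K)) + \<kappa> * (s - entropy \<gamma> (U t K))"
  shows "\<exists>g. ((\<lambda>t. dens (U t K) * chi (entropy \<gamma> (U t K))) has_real_derivative g) (at t) \<and>
     scheme sch \<gamma> n (\<lambda>V. dens V * chi (entropy \<gamma> V)) (\<lambda>s V. mom V $ s * chi (entropy \<gamma> V)) (U t) K
       + \<kappa> * entropy_dissipation t K \<le> g"
proof (intro exI conjI)
  have d: "\<And>K. dens (U t K) > 0" using dens_pos t by simp
  show "((\<lambda>t. dens (U t K) * chi (entropy \<gamma> (U t K))) has_real_derivative
     entropy_gradient \<gamma> (chi (entropy \<gamma> (U t K))) \<kappa> (U t K) (scheme sch \<gamma> n (\<lambda>V. V) (flux \<gamma>) (U t) K)) (at t)"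
    by (rule entropy_has_derivative[OF gamma ode[OF t] d p chi])
  show "scheme sch \<gamma> n (\<lambda>V. dens V * chi (entropy \<gamma> V)) (\<lambda>s V. mom V $ s * chi (entropy \<gamma> V)) (U t) K
       + \<kappa> * entropy_dissipation t K
     \<le> entropy_gradient \<gamma> (chi (entropy \<gamma> (U t K))) \<kappa> (U t K) (scheme sch \<gamma> n (\<lambda>V. V) (flux \<gamma>) (U t) K)"
    using entropy_production[OF gamma periodic n_pos d p \<kappa> conc, of sch] t
    by (simp add: entropy_dissipation_def mult_ac)
qed

text \<open>
  The function \<open>\<chi>(s) = - ((s\<^sub>0 - s)\<^sup>+)\<^sup>2\<close> is increasing, concave and differentiable, and it vanishes exactly for
  \<open>s \<ge> s\<^sub>0\<close>. The sum of \<open>\<rho> \<chi>(S)\<close> over all cells is nonpositive, does not decrease, and is zero initially; so it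
  stays zero. The principle is stated up to a time \<open>t1\<close> before which the pressure is positive, so that
  \<open>pressure_positive\<close> can be deduced from it.
\<close>

lemma minimum_entropy_principle:
  assumes t1: "t1 \<le> T" and p: "\<And>t K. 0 \<le> t \<Longrightarrow> t < t1 \<Longrightarrow> pressure \<gamma> (U t K) > 0"
    and s0: "\<And>K. s0 \<le> entropy \<gamma> (U 0 K)" and t: "0 \<le> t" "t < t1"
  shows "s0 \<le> entropy \<gamma> (U t K)"
proof -
  define chi where "chi s = - (max (s0 - s) 0)\<^sup>2" for s :: real
  have chi_deriv: "(chi has_real_derivative 2 * max (s0 - s) 0) (at s)" for s
  proof -
    consider "s < s0" | "s = s0" | "s > s0" by linarith
    then show ?thesis
    proof cases
      case 1
      have "((\<lambda>s. - (s0 - s)\<^sup>2) has_real_derivative 2 * max (s0 - s) 0) (at s)"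
        using 1 by (auto intro!: derivative_eq_intros)
      then show ?thesis
        by (rule has_field_derivative_transform_within_open[of _ _ _ "{..<s0}"])
          (use 1 in \<open>auto simp: chi_def\<close>)
    next
      case 3
      have "((\<lambda>s. 0) has_real_derivative 2 * max (s0 - s) 0) (at s)" using 3 by simp
      then show ?thesis
        by (rule has_field_derivative_transform_within_open[of _ _ _ "{s0<..}"])
          (use 3 in \<open>auto simp: chi_def\<close>)
    next
      case 2
      have "(\<lambda>h. (chi (s0 + h) - chi s0) / h) \<midarrow>0\<rightarrow> 0"
      proof (rule Lim_null_comparison)
        show "((\<lambda>h. \<bar>h\<bar>) \<longlongrightarrow> 0) (at (0::real))" by (intro tendsto_eq_intros) auto
        have "norm ((chi (s0 + h) - chi s0) / h) \<le> \<bar>h\<bar>" for h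
          by (cases "h < 0") (auto simp: chi_def power2_eq_square)
        then show "\<forall>\<^sub>F h in at 0. norm ((chi (s0 + h) - chi s0) / h) \<le> \<bar>h\<bar>" by simp
      qed
      then show ?thesis using 2 by (simp add: DERIV_def)
    qed
  qed
  have conc: "chi s' \<le> chi s + 2 * max (s0 - s) 0 * (s' - s)" for s s'
  proof -
    define a b where "a = max (s0 - s) 0" and "b = max (s0 - s') 0"
    have "(s0 - s') * a \<le> b * a" by (intro mult_right_mono) (auto simp: a_def b_def)
    moreover have "(s0 - s) * a = a * a" by (auto simp: a_def max_def)
    moreover have "2 * b * a \<le> b\<^sup>2 + a\<^sup>2" by (rule sum_squares_bound)
    ultimately have "2 * ((s0 - s') * a) \<le> b\<^sup>2 + 2 * ((s0 - s) * a) - a\<^sup>2"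
      unfolding power2_eq_square by linarith
    then show ?thesis by (simp add: chi_def a_def[symmetric] b_def[symmetric] algebra_simps)
  qed
  define P where "P t = (\<Sum>K\<in>torus_cells n. dens (U t K) * chi (entropy \<gamma> (U t K)))" for t
  have cchi: "continuous_on UNIV chi"
    using chi_deriv DERIV_isCont by (intro continuous_at_imp_continuous_on) blast
  have "P 0 \<le> P t"
  proof (rule DERIV_nonneg_imp_increasing_open[OF t(1)])
    fix r assume r: "0 < r" "r < t"
    then have r': "0 < r" "r < T" and pr: "\<And>K. pressure \<gamma> (U r K) > 0" using t t1 p[of r] by auto
    have "\<forall>K. \<exists>g. ((\<lambda>t. dens (U t K) * chi (entropy \<gamma> (U t K))) has_real_derivative g) (at r) \<and>
     scheme sch \<gamma> n (\<lambda>V. dens V * chi (entropy \<gamma> V)) (\<lambda>s V. mom V $ s * chi (entropy \<gamma> V)) (U r) K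
       + 2 * max (s0 - entropy \<gamma> (U r K)) 0 * entropy_dissipation r K \<le> g"
      by (intro allI entropy_balance[OF r' pr chi_deriv _ conc]) auto
    from choice[OF this] obtain g where g: "\<And>K. ((\<lambda>t. dens (U t K) * chi (entropy \<gamma> (U t K))) has_real_derivative g K) (at r)"
      and ge: "\<And>K. scheme sch \<gamma> n (\<lambda>V. dens V * chi (entropy \<gamma> V)) (\<lambda>s V. mom V $ s * chi (entropy \<gamma> V)) (U r) K
       + 2 * max (s0 - entropy \<gamma> (U r K)) 0 * entropy_dissipation r K \<le> g K" by blast
    have "(P has_real_derivative (\<Sum>K\<in>torus_cells n. g K)) (at r)"
      unfolding P_def[abs_def] by (intro DERIV_sum g)
    moreover have "0 \<le> (\<Sum>K\<in>torus_cells n. g K)"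
    proof -
      have "0 = (\<Sum>K\<in>torus_cells n. scheme sch \<gamma> n (\<lambda>V. dens V * chi (entropy \<gamma> V)) (\<lambda>s V. mom V $ s * chi (entropy \<gamma> V)) (U r) K)"
        using sum_scheme_zero[OF periodic n_pos, of r] r' by simp
      also have "\<dots> \<le> (\<Sum>K\<in>torus_cells n. g K)"
      proof (rule sum_mono)
        fix K
        have "0 \<le> 2 * max (s0 - entropy \<gamma> (U r K)) 0 * entropy_dissipation r K"
          using entropy_dissipation_nonneg[OF _ r'(2) pr] r' by (intro mult_nonneg_nonneg) auto
        then show "scheme sch \<gamma> n (\<lambda>V. dens V * chi (entropy \<gamma> V)) (\<lambda>s V. mom V $ s * chi (entropy \<gamma> V)) (U r) K \<le> g K"
          using ge[of K] by linarith
      qed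
      finally show ?thesis .
    qed
    ultimately show "\<exists>y. (P has_real_derivative y) (at r) \<and> 0 \<le> y" by blast
  next
    have "continuous_on {0..t} (\<lambda>r. entropy \<gamma> (U r K))" for K
      by (rule continuous_on_compose2[OF continuous_on_entropy continuous_on_subset[OF cont]])
        (use t t1 p dens_pos in auto)
    then have "continuous_on {0..t} (\<lambda>r. chi (entropy \<gamma> (U r K)))" for K
      by (rule continuous_on_compose2[OF cchi]) auto
    moreover have "continuous_on {0..t} (\<lambda>r. dens (U r K))" for K
      using t t1 by (intro continuous_intros continuous_on_subset[OF cont]) auto
    ultimately show "continuous_on {0..t} P"
      unfolding P_def by (intro continuous_on_sum continuous_on_mult) auto
  qed
  moreover have "P 0 = 0"
    unfolding P_def using s0 by (intro sum.neutral) (auto simp: chi_def max_def)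
  moreover have le0: "dens (U t K) * chi (entropy \<gamma> (U t K)) \<le> 0" for K
    using dens_pos[of t K] t t1 by (auto simp: chi_def mult_le_0_iff)
  moreover have "P t \<le> 0" unfolding P_def by (intro sum_nonpos le0)
  ultimately have "P t = 0" by linarith
  then have z: "dens (U t K) * chi (entropy \<gamma> (U t K)) = 0" if "K \<in> torus_cells n" for K
    using sum_nonneg_eq_0_iff[of "torus_cells n" "\<lambda>K. - (dens (U t K) * chi (entropy \<gamma> (U t K)))"] le0 that
    unfolding P_def sum_negf by simp
  have "chi (entropy \<gamma> (U t (torus_rep n K))) = 0"
    using z[OF torus_rep_in[OF n_pos, of K]] dens_pos[of t "torus_rep n K"] t t1 by auto
  then have "chi (entropy \<gamma> (U t K)) = 0"
    using periodic_grid_rep[OF periodic, of t K] t t1 by simp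
  then show ?thesis by (simp add: chi_def max_def split: if_splits)
qed

text \<open>
  As long as the pressure is positive, the minimum entropy principle keeps it above \<open>p1\<close>. At the first
  time when some cell has pressure at most \<open>p1 / 2\<close> this bound contradicts continuity.
\<close>

lemma pressure_positive:
  assumes \<rho>: "\<rho> > 0" "\<And>t K. 0 \<le> t \<Longrightarrow> t < T \<Longrightarrow> \<rho> \<le> dens (U t K)"
    and p0: "\<And>K. pressure \<gamma> (U 0 K) > 0" and s0: "\<And>K. s0 \<le> entropy \<gamma> (U 0 K)"
    and t: "0 \<le> t" "t < T"
  shows "pressure \<gamma> (U t K) > 0"
proof (rule ccontr)
  assume neg: "\<not> pressure \<gamma> (U t K) > 0"
  define p1 where "p1 = exp ((\<gamma> - 1) * s0) * \<rho> powr \<gamma>"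
  have p1: "p1 > 0" using \<rho> by (simp add: p1_def)
  have contp: "continuous_on {0..t} (\<lambda>r. pressure \<gamma> (U r K))" for K
    by (rule continuous_on_compose2[OF continuous_on_pressure continuous_on_subset[OF cont]])
      (use t dens_pos in auto)
  define A where "A = (\<Union>K\<in>torus_cells n. {r \<in> {0..t}. pressure \<gamma> (U r K) \<le> p1 / 2})"
  have "closed {r \<in> {0..t}. pressure \<gamma> (U r K) \<le> p1 / 2}" for K
    by (rule continuous_on_closed_Collect_le[OF contp continuous_on_const closed_real_atLeastAtMost])
  then have "closed A" unfolding A_def by (intro closed_UN) auto
  moreover have bdd: "bdd_below A" unfolding A_def by (intro bdd_belowI[of _ 0]) auto
  moreover have "t \<in> A"
  proof -
    have "pressure \<gamma> (U t (torus_rep n K)) \<le> p1 / 2"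
      using neg p1 periodic_grid_rep[OF periodic, of t K] t by simp
    then show ?thesis unfolding A_def using torus_rep_in[OF n_pos] t by auto
  qed
  ultimately have inA: "Inf A \<in> A" using closed_contains_Inf[of A] by blast
  define t1 where "t1 = Inf A"
  obtain K1 where K1: "pressure \<gamma> (U t1 K1) \<le> p1 / 2" and t1: "0 \<le> t1" "t1 \<le> t"
    using inA by (auto simp: A_def t1_def)
  have before: "pressure \<gamma> (U r K) > 0" if r: "0 \<le> r" "r < t1" for r K
  proof (rule ccontr)
    assume "\<not> pressure \<gamma> (U r K) > 0"
    then have "pressure \<gamma> (U r (torus_rep n K)) \<le> p1 / 2"
      using p1 periodic_grid_rep[OF periodic, of r K] r t t1 by simp
    then have "r \<in> A" unfolding A_def using torus_rep_in[OF n_pos] r t1 by auto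
    then show False using cInf_lower[OF _ bdd, of r] r by (simp add: t1_def)
  qed
  have "pressure \<gamma> (U 0 K1) \<ge> p1"
    unfolding p1_def by (rule pressure_ge_of_entropy_ge(2)[OF gamma \<rho>(2) \<rho>(1) p0 s0]) (use T_pos in auto)
  then have "t1 \<noteq> 0" using K1 p1 by auto
  then have t1p: "0 < t1" using t1 by simp
  have "pressure \<gamma> (U t1 K1) \<ge> p1"
  proof (rule continuous_ge_on_closure[of "{0..<t1}" "\<lambda>r. pressure \<gamma> (U r K1)"])
    show "continuous_on (closure {0..<t1}) (\<lambda>r. pressure \<gamma> (U r K1))"
      using t1p t1 by (auto intro: continuous_on_subset[OF contp])
    show "t1 \<in> closure {0..<t1}" using t1p by simp
    show "p1 \<le> pressure \<gamma> (U r K1)" if "r \<in> {0..<t1}" for r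
      unfolding p1_def
      by (rule pressure_ge_of_entropy_ge(2)[OF gamma \<rho>(2) \<rho>(1) before minimum_entropy_principle[OF _ before s0]])
        (use that t t1 in auto)
  qed
  then show False using K1 p1 by simp
qed

end

section \<open>Sums over cells as integrals over the torus\<close>

definition node :: "nat \<Rightarrow> int ^ 'n::finite \<Rightarrow> real ^ 'n" where
  "node n K = (\<chi> i. of_int (K $ i) / real n)"

lemma cell_index_eq_iff: "n > 0 \<Longrightarrow> cell_index n x = K \<longleftrightarrow> x \<in> cell n K"
  by (auto simp: cell_index_def cell_def vec_eq_iff floor_eq_iff field_simps)

lemma cell_index_in_torus_cells:
  assumes "n > 0" "x \<in> torus"
  shows "cell_index n x \<in> torus_cells n"
proof -
  have "0 \<le> real n * x $ i \<and> real n * x $ i < real n" for i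
    using assms by (auto simp: torus_def)
  then show ?thesis
    by (simp add: torus_cells_def cell_index_def floor_less_iff)
qed

lemma cell_subset_torus:
  assumes "n > 0" "K \<in> torus_cells n"
  shows "cell n K \<subseteq> torus"
proof
  fix x assume x: "x \<in> cell n K"
  show "x \<in> torus"
    unfolding torus_def mem_Collect_eq
  proof
    fix i
    have "0 \<le> K $ i \<and> K $ i < int n" using assms by (simp add: torus_cells_def)
    then have K: "0 \<le> K $ i" "K $ i + 1 \<le> int n" by linarith+
    have "0 \<le> real_of_int (K $ i) / real n" using K by simp
    moreover have "(real_of_int (K $ i) + 1) / real n \<le> 1"
    proof -
      have "real_of_int (K $ i + 1) \<le> real_of_int (int n)" using K(2) by (simp only: of_int_le_iff)
      then show ?thesis using assms by (simp add: field_simps)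
    qed
    moreover have "of_int (K $ i) / real n \<le> x $ i \<and> x $ i < (of_int (K $ i) + 1) / real n"
      using x by (simp add: cell_def)
    ultimately show "0 \<le> x $ i \<and> x $ i < 1" by linarith
  qed
qed

lemma torus_borel [measurable]: "(torus :: (real ^ 'n::finite) set) \<in> sets borel"
  unfolding torus_def by measurable

lemma cell_borel [measurable]: "cell n K \<in> sets borel"
  unfolding cell_def by measurable

lemma space_time_borel [measurable]: "(space_time T :: (real \<times> (real ^ 'n::finite)) set) \<in> sets borel"
  unfolding space_time_def by (intro borel_Times) auto

lemma indicator_torus:
  assumes "n > 0"
  shows "(\<Sum>K\<in>torus_cells n. c K * indicat_real (cell n K) x) = indicator torus x * c (cell_index n x)"
proof (cases "x \<in> torus")
  case True
  have "(\<Sum>K\<in>torus_cells n. c K * indicat_real (cell n K) x)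
      = (\<Sum>K\<in>torus_cells n. if K = cell_index n x then c K else 0)"
    by (rule sum.cong) (auto simp: indicator_def cell_index_eq_iff[OF assms, symmetric])
  then show ?thesis using True cell_index_in_torus_cells[OF assms True] by simp
next
  case False
  then have "x \<notin> cell n K" if "K \<in> torus_cells n" for K using cell_subset_torus[OF assms that] by blast
  then have "(\<Sum>K\<in>torus_cells n. c K * indicat_real (cell n K) x) = 0"
    by (intro sum.neutral) auto
  then show ?thesis using False by simp
qed

lemma emeasure_cell:
  assumes "n > 0"
  shows "emeasure lborel (cell n K :: (real ^ 'n::finite) set) = ennreal (1 / real n ^ CARD('n))"
proof -
  define a b :: "real ^ 'n" where "a = node n K" and "b = (\<chi> i. (of_int (K $ i) + 1) / real n)"
  have le: "\<forall>c\<in>Basis. a \<bullet> c \<le> b \<bullet> c"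
    using assms by (auto simp: Basis_vec_def inner_axis a_def b_def node_def divide_right_mono)
  have sub: "box a b \<subseteq> cell n K" "cell n K \<subseteq> cbox a b"
    by (auto simp: cell_def a_def b_def node_def mem_box_cart less_imp_le)
  have eq: "emeasure lborel (box a b) = emeasure lborel (cbox a b)"
    by (simp add: emeasure_lborel_box_eq emeasure_lborel_cbox_eq)
  have "emeasure lborel (cell n K) = emeasure lborel (cbox a b)"
    using emeasure_mono[OF sub(1), of lborel] emeasure_mono[OF sub(2), of lborel] eq by (intro antisym) auto
  also have "\<dots> = ennreal (measure lborel (cbox a b))"
    using emeasure_lborel_cbox_finite[of a b] by (intro emeasure_eq_ennreal_measure) auto
  also have "measure lborel (cbox a b) = (\<Prod>i\<in>UNIV. b $ i - a $ i)"
    using le by (intro content_cbox_cart) (auto simp: box_ne_empty)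
  also have "\<dots> = 1 / real n ^ CARD('n)"
    by (simp add: a_def b_def node_def diff_divide_distrib[symmetric] power_one_over)
  finally show ?thesis .
qed

lemma integral_torus_grid:
  fixes c :: "int ^ 'n::finite \<Rightarrow> real"
  assumes "n > 0"
  shows "set_integrable lborel torus (\<lambda>x. c (cell_index n x))"
    and "(LINT x:torus|lborel. c (cell_index n x)) = (\<Sum>K\<in>torus_cells n. c K) / real n ^ CARD('n)"
proof -
  have i: "integrable lborel (\<lambda>x. c K * indicat_real (cell n K) x)" for K
    by (simp add: emeasure_cell[OF assms])
  show "set_integrable lborel torus (\<lambda>x. c (cell_index n x))"
    unfolding set_integrable_def real_scaleR_def indicator_torus[OF assms, symmetric]
    by (intro Bochner_Integration.integrable_sum i)
  have "(LINT x:torus|lborel. c (cell_index n x)) = (\<integral>x. (\<Sum>K\<in>torus_cells n. c K * indicat_real (cell n K) x) \<partial>lborel)"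
    unfolding set_lebesgue_integral_def by (simp add: indicator_torus[OF assms])
  also have "\<dots> = (\<Sum>K\<in>torus_cells n. \<integral>x. c K * indicat_real (cell n K) x \<partial>lborel)"
    by (rule Bochner_Integration.integral_sum) (rule i)
  also have "\<dots> = (\<Sum>K\<in>torus_cells n. c K / real n ^ CARD('n))"
    by (rule sum.cong) (simp_all add: measure_def emeasure_cell[OF assms])
  finally show "(LINT x:torus|lborel. c (cell_index n x)) = (\<Sum>K\<in>torus_cells n. c K) / real n ^ CARD('n)"
    by (simp add: sum_divide_distrib)
qed

lemma emeasure_torus: "emeasure lborel (torus :: (real ^ 'n::finite) set) = 1"
proof -
  have "(torus :: (real ^ 'n) set) = cell 1 0" by (simp add: torus_def cell_def)
  then show ?thesis using emeasure_cell[of 1 "0 :: int ^ 'n"] by simp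
qed

lemma set_integrable_torus_const: "set_integrable lborel (torus :: (real ^ 'n::finite) set) (\<lambda>x. c :: real)"
  and set_integral_torus_const: "(LINT x:(torus :: (real ^ 'n::finite) set)|lborel. c) = (c :: real)"
  by (simp_all add: set_integrable_def set_lebesgue_integral_def emeasure_torus measure_def)

lemma set_integrable_torus_bounded:
  fixes f :: "real ^ 'n::finite \<Rightarrow> real"
  assumes "(\<lambda>x. indicator torus x * f x) \<in> borel_measurable borel" "\<And>x. x \<in> torus \<Longrightarrow> \<bar>f x\<bar> \<le> B"
  shows "set_integrable lborel torus f"
proof -
  have "integrable lborel (\<lambda>x. indicator torus x *\<^sub>R (indicator torus x * f x))"
    by (rule integrableI_bounded_set_indicator[where B = B])
      (use assms in \<open>auto simp: emeasure_torus indicator_def\<close>)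
  moreover have "(\<lambda>x. indicator torus x *\<^sub>R (indicator torus x * f x)) = (\<lambda>x. indicator torus x *\<^sub>R f x)"
    by (auto simp: indicator_def)
  ultimately show ?thesis by (simp add: set_integrable_def)
qed

text \<open>
  A Riemann sum; the cell values need only be uniformly close to the integrand.
\<close>

lemma cell_sum_approximates_integral:
  fixes f :: "real ^ 'n::finite \<Rightarrow> real"
  assumes n: "n > 0" and f: "set_integrable lborel torus f"
    and close: "\<And>K x. K \<in> torus_cells n \<Longrightarrow> x \<in> cell n K \<Longrightarrow> \<bar>c K - f x\<bar> \<le> \<epsilon>"
  shows "\<bar>(\<Sum>K\<in>torus_cells n. c K) / real n ^ CARD('n) - (LINT x:torus|lborel. f x)\<bar> \<le> \<epsilon>"
proof -
  note g = integral_torus_grid[OF n, of c]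
  have i: "set_integrable lborel torus (\<lambda>x. c (cell_index n x) - f x)"
    by (rule set_integral_diff(1)[OF g(1) f])
  have "\<bar>(\<Sum>K\<in>torus_cells n. c K) / real n ^ CARD('n) - (LINT x:torus|lborel. f x)\<bar>
      = norm (LINT x:torus|lborel. c (cell_index n x) - f x)"
    using set_integral_diff(2)[OF g(1) f] g(2) by simp
  also have "\<dots> \<le> (LINT x:torus|lborel. norm (c (cell_index n x) - f x))"
    by (rule set_integral_norm_bound[OF i])
  also have "\<dots> \<le> (LINT x:(torus :: (real ^ 'n) set)|lborel. \<epsilon>)"
  proof (rule set_integral_mono[OF set_integrable_norm[OF i] set_integrable_torus_const])
    fix x :: "real ^ 'n" assume "x \<in> torus"
    then show "norm (c (cell_index n x) - f x) \<le> \<epsilon>"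
      using close[OF cell_index_in_torus_cells[OF n], of x x] cell_index_eq_iff[OF n, of x "cell_index n x"] by simp
  qed
  finally show ?thesis by (simp only: set_integral_torus_const)
qed

lemma cell_index_measurable [measurable]:
  "cell_index n \<in> measurable borel (count_space (UNIV :: (int ^ 'n::finite) set))"
proof (subst measurable_count_space_eq2_countable, intro conjI ballI)
  show "cell_index n -` {K} \<inter> space borel \<in> sets borel" for K :: "int ^ 'n"
  proof -
    have "cell_index n -` {K} \<inter> space borel = {x. \<forall>i. \<lfloor>real n * x $ i\<rfloor> = K $ i}"
      by (auto simp: cell_index_def vec_eq_iff)
    also have "\<dots> \<in> sets borel" by measurable
    finally show ?thesis .
  qed
qed auto

lemma integral_space_time:
  fixes f :: "real \<times> (real ^ 'n::finite) \<Rightarrow> real"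
  assumes f: "f \<in> borel_measurable borel" and B: "\<And>z. z \<in> space_time T \<Longrightarrow> \<bar>f z\<bar> \<le> B"
  shows "set_integrable lborel (space_time T) f"
    and "(LINT z:space_time T|lborel. f z) = (LINT t:{0<..<T}|lborel. LINT x:torus|lborel. f (t, x))"
    and "set_integrable lborel {0<..<T} (\<lambda>t. LINT x:torus|lborel. f (t, x))"
proof -
  have em: "emeasure lborel (space_time T :: (real \<times> (real ^ 'n)) set) < \<infinity>"
  proof -
    have "emeasure lborel (space_time T :: (real \<times> (real ^ 'n)) set)
        = emeasure (lborel \<Otimes>\<^sub>M lborel) ({0<..<T} \<times> (torus :: (real ^ 'n) set))"
      by (simp add: lborel_prod space_time_def)
    also have "\<dots> = emeasure lborel {0<..<T} * emeasure lborel (torus :: (real ^ 'n) set)"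
      by (rule lborel.emeasure_pair_measure_Times) auto
    also have "\<dots> < \<infinity>" by (cases "0 \<le> T") (simp_all add: emeasure_torus)
    finally show ?thesis .
  qed
  show i: "set_integrable lborel (space_time T) f"
    unfolding set_integrable_def
    by (rule integrableI_bounded_set_indicator[where B = B]) (use f B em in auto)
  have eq: "indicator (space_time T) (t, x) *\<^sub>R f (t, x)
      = indicator {0<..<T} t *\<^sub>R (indicator torus x *\<^sub>R f (t, x))" for t and x :: "real ^ 'n"
    by (auto simp: space_time_def indicator_def)
  have i2: "integrable (lborel \<Otimes>\<^sub>M lborel) (\<lambda>(t, x). indicator (space_time T) (t, x) *\<^sub>R f (t, x))"
    using i by (simp add: set_integrable_def lborel_prod case_prod_unfold)
  have "(LINT z:space_time T|lborel. f z) = (\<integral>t. \<integral>x. indicator (space_time T) (t, x) *\<^sub>R f (t, x) \<partial>lborel \<partial>lborel)"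
    using lborel_pair.integral_fst'[OF i2] by (simp add: set_lebesgue_integral_def lborel_prod case_prod_unfold)
  then show "(LINT z:space_time T|lborel. f z) = (LINT t:{0<..<T}|lborel. LINT x:torus|lborel. f (t, x))"
    unfolding eq by (simp add: set_lebesgue_integral_def)
  show "set_integrable lborel {0<..<T} (\<lambda>t. LINT x:torus|lborel. f (t, x))"
    using lborel_pair.integrable_fst'[OF i2] unfolding case_prod_conv eq
    by (simp add: set_lebesgue_integral_def set_integrable_def)
qed

lemma emeasure_space_time_finite: "emeasure lborel (space_time T :: (real \<times> (real ^ 'n::finite)) set) < \<infinity>"
proof -
  have "set_integrable lborel (space_time T :: (real \<times> (real ^ 'n)) set) (\<lambda>_. 1 :: real)"
    by (rule integral_space_time(1)[where B = 1]) auto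
  then show ?thesis by (simp add: set_integrable_def integrable_indicator_iff)
qed

lemma continuous_comp_measurable:
  fixes f :: "'a::euclidean_space \<Rightarrow> real"
  assumes "closed C" "continuous_on C f" "u \<in> borel_measurable M" "\<And>z. u z \<in> C"
  shows "(\<lambda>z. f (u z)) \<in> borel_measurable M"
proof -
  have "(\<lambda>x. if x \<in> C then f x else 0) \<in> borel_measurable borel"
    using assms by (intro borel_measurable_continuous_on_if) auto
  from measurable_compose[OF assms(3) this] show ?thesis using assms(4) by simp
qed

text \<open>
  The derivative of \<open>P\<close> is bounded below by the continuous function \<open>H\<close> but is not known to be integrable,
  so \<open>P\<close> is compared with a primitive of \<open>H\<close>.
\<close>

lemma integral_le_increment:
  fixes P H :: "real \<Rightarrow> real"
  assumes ab: "a \<le> b" and P: "continuous_on {a..b} P" and H: "continuous_on {a..b} H"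
    and d: "\<And>t. a < t \<Longrightarrow> t < b \<Longrightarrow> \<exists>p. (P has_real_derivative p) (at t) \<and> H t \<le> p"
  shows "(LINT t:{a..b}|lborel. H t) \<le> P b - P a"
proof -
  define Q where "Q t = P t - integral {a..t} H" for t
  have "Q a \<le> Q b"
  proof (rule DERIV_nonneg_imp_increasing_open[OF ab])
    fix t assume t: "a < t" "t < b"
    obtain p where p: "(P has_real_derivative p) (at t)" "H t \<le> p" using d[OF t] by blast
    have "((\<lambda>x. integral {a..x} H) has_real_derivative H t) (at t within {a..b})"
      using t by (intro integral_has_real_derivative[OF H]) auto
    then have "((\<lambda>x. integral {a..x} H) has_real_derivative H t) (at t)"
      using t by (simp add: at_within_Icc_at)
    then have "(Q has_real_derivative p - H t) (at t)" unfolding Q_def by (intro DERIV_diff p)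
    then show "\<exists>y. (Q has_real_derivative y) (at t) \<and> 0 \<le> y" using p by (intro exI[of _ "p - H t"]) simp
  next
    show "continuous_on {a..b} Q" unfolding Q_def
      by (intro continuous_on_diff P indefinite_integral_continuous_1 integrable_continuous_real H)
  qed
  moreover have "(LINT t:{a..b}|lborel. H t) = integral {a..b} H"
    by (rule set_borel_integral_eq_integral(2)[OF borel_integrable_atLeastAtMost'[OF H]])
  ultimately show ?thesis by (simp add: Q_def)
qed

section \<open>Test functions\<close>

text \<open>
  A compact set that contains the torus and everything within distance 1 of it in each coordinate, in particular all
  neighbours of the nodes. Continuous functions are uniformly continuous on it.
\<close>

definition node_box :: "(real ^ 'n::finite) set" where
  "node_box = cbox (\<chi> i. - 1) (\<chi> i. 2)"

lemma node_box_iff: "x \<in> node_box \<longleftrightarrow> (\<forall>i. - 1 \<le> x $ i \<and> x $ i \<le> 2)"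
  by (simp add: node_box_def mem_box_cart)

lemma torus_subset_node_box: "torus \<subseteq> node_box"
proof
  fix x :: "real ^ 'n" assume "x \<in> torus"
  then have "0 \<le> x $ i \<and> x $ i < 1" for i by (simp add: torus_def)
  then show "x \<in> node_box" unfolding node_box_iff by (meson dual_order.trans less_eq_real_def
      neg_le_0_iff_le one_le_numeral zero_le_one)
qed

lemma node_shift:
  "node n (K + axis s 1) = node n K + (1 / real n) *\<^sub>R axis s 1"
  "node n (K - axis s 1) = node n K - (1 / real n) *\<^sub>R axis s 1"
  by (auto simp: node_def vec_eq_iff axis_def add_divide_distrib diff_divide_distrib)

lemma node_in_torus:
  assumes "n > 0" "K \<in> torus_cells n"
  shows "node n K \<in> cell n K" "node n K \<in> torus"
proof -
  show "node n K \<in> cell n K" using assms by (simp add: node_def cell_def divide_strict_right_mono)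
  then show "node n K \<in> torus" using cell_subset_torus[OF assms] by blast
qed

lemma dist_in_cell:
  fixes x :: "real ^ 'n::finite"
  assumes "n > 0" "x \<in> cell n K"
  shows "norm (x - node n K) \<le> CARD('n) / real n"
proof -
  have "norm (x - node n K) \<le> (\<Sum>i\<in>UNIV. \<bar>(x - node n K) $ i\<bar>)" by (rule norm_le_l1_cart)
  also have "\<dots> \<le> (\<Sum>i\<in>(UNIV :: 'n set). 1 / real n)"
  proof (rule sum_mono)
    fix i
    have "of_int (K $ i) / real n \<le> x $ i" "x $ i < of_int (K $ i) / real n + 1 / real n"
      using assms by (auto simp: cell_def add_divide_distrib)
    then show "\<bar>(x - node n K) $ i\<bar> \<le> 1 / real n" by (simp add: node_def)
  qed
  also have "\<dots> = CARD('n) / real n" by simp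
  finally show ?thesis .
qed

text \<open>
  What the convergence proof uses of a test function: time and space derivatives that are bounded and
  equicontinuous in space, and support in \<open>[0,\<tau>]\<close>.
\<close>

definition test_data :: "real \<Rightarrow> (real \<times> (real ^ 'n::finite) \<Rightarrow> real) \<Rightarrow> real \<Rightarrow> real \<Rightarrow>
    (real \<times> (real ^ 'n) \<Rightarrow> real) \<Rightarrow> ('n \<Rightarrow> real \<times> (real ^ 'n) \<Rightarrow> real) \<Rightarrow> bool" where
  "test_data T \<phi> \<tau> B dt dx \<longleftrightarrow> 0 < \<tau> \<and> \<tau> < T \<and> 0 \<le> B \<and>
     (\<forall>t. periodic (\<lambda>x. \<phi> (t, x))) \<and>
     (\<forall>t x. t \<ge> \<tau> \<longrightarrow> \<phi> (t, x) = 0) \<and>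
     (\<forall>t x s. \<tau> \<le> t \<longrightarrow> t < T \<longrightarrow> dt (t, x) = 0 \<and> dx s (t, x) = 0) \<and>
     (\<forall>t x. 0 < t \<longrightarrow> t < T \<longrightarrow> ((\<lambda>s. \<phi> (s, x)) has_real_derivative dt (t, x)) (at t)) \<and>
     (\<forall>t x. 0 < t \<longrightarrow> t < T \<longrightarrow> time_deriv \<phi> (t, x) = dt (t, x)) \<and>
     (\<forall>t x s. 0 < t \<longrightarrow> t < T \<longrightarrow> space_grad \<phi> (t, x) $ s = dx s (t, x)) \<and>
     continuous_on ({0..<T} \<times> UNIV) \<phi> \<and> continuous_on ({0..<T} \<times> UNIV) dt \<and>
     (\<forall>s. continuous_on ({0..<T} \<times> UNIV) (dx s)) \<and>
     (\<forall>t x s. 0 \<le> t \<longrightarrow> t < T \<longrightarrow> x \<in> node_box \<longrightarrow> \<bar>\<phi> (t, x)\<bar> \<le> B \<and> \<bar>dt (t, x)\<bar> \<le> B \<and> \<bar>dx s (t, x)\<bar> \<le> B) \<and>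
     (\<forall>t x s h. 0 \<le> t \<longrightarrow> t < T \<longrightarrow> x \<in> torus \<longrightarrow> 0 \<le> h \<longrightarrow> h \<le> 1 \<longrightarrow> \<bar>\<phi> (t, x + h *\<^sub>R axis s 1) - \<phi> (t, x)\<bar> \<le> B * h) \<and>
     (\<forall>\<epsilon>>0. \<exists>\<delta>>0. \<forall>t x y s h. 0 \<le> t \<longrightarrow> t < T \<longrightarrow> x \<in> torus \<longrightarrow> y \<in> torus \<longrightarrow> norm (y - x) < \<delta> \<longrightarrow>
        0 < h \<longrightarrow> h < \<delta> \<longrightarrow> \<bar>dt (t, x) - dt (t, y)\<bar> \<le> \<epsilon> \<and>
        \<bar>(\<phi> (t, x + h *\<^sub>R axis s 1) - \<phi> (t, x - h *\<^sub>R axis s 1)) / (2 * h) - dx s (t, y)\<bar> \<le> \<epsilon>)"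

lemma test_dataD:
  assumes "test_data T \<phi> \<tau> B dt dx"
  shows "0 < \<tau>" "\<tau> < T" "0 \<le> B"
    and "periodic (\<lambda>x. \<phi> (t, x))"
    and "t \<ge> \<tau> \<Longrightarrow> \<phi> (t, x) = 0"
    and "\<tau> \<le> t \<Longrightarrow> t < T \<Longrightarrow> dt (t, x) = 0"
    and "\<tau> \<le> t \<Longrightarrow> t < T \<Longrightarrow> dx s (t, x) = 0"
    and "0 < t \<Longrightarrow> t < T \<Longrightarrow> ((\<lambda>s. \<phi> (s, x)) has_real_derivative dt (t, x)) (at t)"
    and "0 < t \<Longrightarrow> t < T \<Longrightarrow> time_deriv \<phi> (t, x) = dt (t, x)"
    and "0 < t \<Longrightarrow> t < T \<Longrightarrow> space_grad \<phi> (t, x) $ s = dx s (t, x)"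
    and "continuous_on ({0..<T} \<times> UNIV) \<phi>"
    and "continuous_on ({0..<T} \<times> UNIV) dt"
    and "continuous_on ({0..<T} \<times> UNIV) (dx s)"
    and "0 \<le> t \<Longrightarrow> t < T \<Longrightarrow> x \<in> node_box \<Longrightarrow> \<bar>\<phi> (t, x)\<bar> \<le> B"
    and "0 \<le> t \<Longrightarrow> t < T \<Longrightarrow> x \<in> node_box \<Longrightarrow> \<bar>dt (t, x)\<bar> \<le> B"
    and "0 \<le> t \<Longrightarrow> t < T \<Longrightarrow> x \<in> node_box \<Longrightarrow> \<bar>dx s (t, x)\<bar> \<le> B"
    and "0 \<le> t \<Longrightarrow> t < T \<Longrightarrow> x \<in> torus \<Longrightarrow> 0 \<le> h \<Longrightarrow> h \<le> 1 \<Longrightarrow>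
      \<bar>\<phi> (t, x + h *\<^sub>R axis s 1) - \<phi> (t, x)\<bar> \<le> B * h"
    and "\<epsilon> > 0 \<Longrightarrow> \<exists>\<delta>>0. \<forall>t x y s h. 0 \<le> t \<longrightarrow> t < T \<longrightarrow> x \<in> torus \<longrightarrow> y \<in> torus \<longrightarrow> norm (y - x) < \<delta> \<longrightarrow>
        0 < h \<longrightarrow> h < \<delta> \<longrightarrow> \<bar>dt (t, x) - dt (t, y)\<bar> \<le> \<epsilon> \<and>
        \<bar>(\<phi> (t, x + h *\<^sub>R axis s 1) - \<phi> (t, x - h *\<^sub>R axis s 1)) / (2 * h) - dx s (t, y)\<bar> \<le> \<epsilon>"
  using assms unfolding test_data_def by (elim conjE; (simp only: simp_thms)?; (fast | blast))+

text \<open>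
  The derivative of a test function is continuous up to \<open>t = 0\<close> and vanishes near \<open>t = T\<close>, hence it is bounded and
  uniformly continuous on the compact set that matters. The mean value inequality compares the central difference
  quotients with the derivative.
\<close>

lemma test_function_test_data:
  fixes \<phi> :: "real \<times> (real ^ 'n::finite) \<Rightarrow> real"
  assumes T: "T > 0" and \<phi>: "test_function T \<phi>"
  obtains \<tau> B dt dx where "test_data T \<phi> \<tau> B dt dx"
proof -
  obtain D \<tau>0 where D: "continuous_on ({0..<T} \<times> UNIV) D"
      "\<And>z. z \<in> {0..<T} \<times> UNIV \<Longrightarrow> (\<phi> has_derivative blinfun_apply (D z)) (at z within {0..<T} \<times> UNIV)"
    and \<tau>0: "\<tau>0 < T" "\<And>t x. t \<ge> \<tau>0 \<Longrightarrow> \<phi> (t, x) = 0" and per: "\<forall>t. periodic (\<lambda>x. \<phi> (t, x))"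
    using \<phi> unfolding test_function_def by blast
  define \<tau> where "\<tau> = (max \<tau>0 0 + T) / 2"
  have \<tau>: "0 < \<tau>" "\<tau> < T" "\<tau>0 < \<tau>" using T \<tau>0 by (auto simp: \<tau>_def)
  define dt where "dt z = D z (1, 0)" for z
  define dx where "dx s z = D z (0, axis s 1)" for s z
  have dpx: "((\<lambda>x. \<phi> (t, x)) has_derivative (\<lambda>v. D (t, x) (0, v))) (at x)" if "0 \<le> t" "t < T" for t x
  proof -
    have "((\<lambda>x. (t, x)) has_derivative (\<lambda>v. (0, v))) (at x)"
      by (intro derivative_eq_intros) auto
    moreover have "(\<phi> has_derivative D (t, x)) (at (t, x) within range (Pair t))"
      by (rule has_derivative_subset[OF D(2)]) (use that in auto)
    ultimately show ?thesis by (rule has_derivative_in_compose)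
  qed
  have dpt: "((\<lambda>s. \<phi> (s, x)) has_real_derivative dt (t, x)) (at t)" if "0 < t" "t < T" for t x
  proof -
    have "(\<phi> has_derivative D (t, x)) (at (t, x) within {0<..<T} \<times> UNIV)"
      by (rule has_derivative_subset[OF D(2)]) (use that in auto)
    then have d: "(\<phi> has_derivative D (t, x)) (at (t, x))"
      using that by (subst (asm) at_within_open) (auto intro: open_Times)
    have "((\<lambda>s. (s, x)) has_derivative (\<lambda>r. (r, 0))) (at t)"
      by (intro derivative_eq_intros) auto
    from has_derivative_compose[OF this d] have "((\<lambda>s. \<phi> (s, x)) has_derivative (\<lambda>r. D (t, x) (r, 0))) (at t)"
      by (simp add: comp_def)
    moreover have "D (t, x) (r, 0) = dt (t, x) * r" for r
    proof -
      have "D (t, x) (r, 0) = D (t, x) (r *\<^sub>R (1, 0))" by simp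
      also have "\<dots> = r *\<^sub>R D (t, x) (1, 0)" by (simp only: blinfun.scaleR_right)
      finally show ?thesis by (simp add: dt_def)
    qed
    ultimately show ?thesis by (simp add: has_field_derivative_def)
  qed
  have zero: "D (t, x) = 0" if t: "\<tau> \<le> t" "t < T" for t x
  proof -
    define S :: "(real \<times> (real ^ 'n)) set" where "S = {max \<tau>0 0<..<T} \<times> UNIV"
    have S: "open S" "(t, x) \<in> S" using t \<tau> by (auto simp: S_def intro: open_Times)
    have "(\<phi> has_derivative D (t, x)) (at (t, x) within S)"
      by (rule has_derivative_subset[OF D(2)]) (use t \<tau> in \<open>auto simp: S_def\<close>)
    then have 1: "(\<phi> has_derivative D (t, x)) (at (t, x))"
      unfolding at_within_open[OF S(2,1)] .
    have 2: "(\<phi> has_derivative (\<lambda>_. 0)) (at (t, x))"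
      by (rule has_derivative_transform_within_open[where f = "\<lambda>_. 0", OF has_derivative_const S]) (auto simp: S_def \<tau>0(2))
    have "blinfun_apply (D (t, x)) = (\<lambda>_. 0)" by (rule has_derivative_unique[OF 1 2])
    then show ?thesis by (intro blinfun_eqI) (simp only: zero_blinfun.rep_eq)
  qed
  have cD: "continuous_on ({0..<T} \<times> UNIV) dt" "continuous_on ({0..<T} \<times> UNIV) (dx s)" for s
    unfolding dt_def dx_def by (intro continuous_intros D(1))+
  have c\<phi>: "continuous_on ({0..<T} \<times> UNIV) \<phi>"
    by (rule has_derivative_continuous_on) (rule D(2))
  define Q :: "(real \<times> (real ^ 'n)) set" where "Q = {0..\<tau>} \<times> node_box"
  have Q: "compact Q" "Q \<subseteq> {0..<T} \<times> UNIV"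
    unfolding Q_def node_box_def using \<tau> by (auto intro: compact_Times)
  have convB: "convex (node_box :: (real ^ 'n) set)" by (simp add: node_box_def convex_box)
  obtain B1 where B1: "\<And>z. z \<in> Q \<Longrightarrow> norm (D z) \<le> B1"
    using compact_imp_bounded[OF compact_continuous_image[OF continuous_on_subset[OF D(1) Q(2)] Q(1)]]
    by (auto simp: bounded_iff)
  obtain B2 where B2: "\<And>z. z \<in> Q \<Longrightarrow> norm (\<phi> z) \<le> B2"
    using compact_imp_bounded[OF compact_continuous_image[OF continuous_on_subset[OF c\<phi> Q(2)] Q(1)]]
    by (auto simp: bounded_iff)
  define B where "B = max 0 (max B1 B2)"
  have DB: "norm (D (t, x)) \<le> B" if "0 \<le> t" "t < T" "x \<in> node_box" for t x
    using that B1[of "(t, x)"] zero[of t x] by (cases "t \<le> \<tau>") (auto simp: B_def Q_def)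
  have \<phi>B: "\<bar>\<phi> (t, x)\<bar> \<le> B" if "0 \<le> t" "x \<in> node_box" for t x
    using that B2[of "(t, x)"] \<tau>0(2)[of t x] \<tau> by (cases "t \<le> \<tau>") (auto simp: B_def Q_def)
  have n1: "norm (1 :: real, 0 :: real ^ 'n) = 1" "norm (0 :: real, v :: real ^ 'n) = norm v" for v
    by (simp_all add: norm_Pair)
  have apply_le: "\<bar>blinfun_apply A (0, v)\<bar> \<le> norm A * norm v" "\<bar>blinfun_apply A (1, 0)\<bar> \<le> norm A"
    for A :: "(real \<times> (real ^ 'n)) \<Rightarrow>\<^sub>L real" and v
    using norm_blinfun[of A "(0, v)"] norm_blinfun[of A "(1, 0)"] by (simp_all add: n1)
  have equi: "\<exists>d>0. \<forall>t x y. 0 \<le> t \<longrightarrow> t < T \<longrightarrow> x \<in> node_box \<longrightarrow> y \<in> node_box \<longrightarrow> norm (y - x) < d \<longrightarrow>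
      norm (D (t, x) - D (t, y)) \<le> \<epsilon>" if e: "\<epsilon> > 0" for \<epsilon>
  proof -
    have "uniformly_continuous_on Q D"
      by (rule compact_uniformly_continuous[OF continuous_on_subset[OF D(1) Q(2)] Q(1)])
    then obtain d where d: "d > 0" "\<And>z z'. z \<in> Q \<Longrightarrow> z' \<in> Q \<Longrightarrow> dist z' z < d \<Longrightarrow> dist (D z') (D z) < \<epsilon>"
      unfolding uniformly_continuous_on_def using e by metis
    have "norm (D (t, x) - D (t, y)) \<le> \<epsilon>"
      if "0 \<le> t" "t < T" "x \<in> node_box" "y \<in> node_box" "norm (y - x) < d" for t x y
    proof (cases "t \<le> \<tau>")
      case True
      have "dist (t, x) (t, y) < d" using that(5) by (simp add: dist_Pair_Pair dist_norm norm_minus_commute)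
      then have "dist (D (t, x)) (D (t, y)) < \<epsilon>" using that True by (intro d(2)) (auto simp: Q_def)
      then show ?thesis by (simp add: dist_norm)
    next
      case False then show ?thesis using zero[of t] that e by simp
    qed
    then show ?thesis using d(1) by blast
  qed
  have shift_in: "x + h *\<^sub>R axis s 1 \<in> node_box" if "x \<in> torus" "\<bar>h\<bar> \<le> 1" for x :: "real ^ 'n" and h s
    unfolding node_box_iff
  proof
    fix i
    have "0 \<le> x $ i" "x $ i < 1" using that(1) by (auto simp: torus_def)
    then show "- 1 \<le> (x + h *\<^sub>R axis s 1) $ i \<and> (x + h *\<^sub>R axis s 1) $ i \<le> 2"
      using that(2) by (auto simp: axis_def)
  qed
  have incr: "\<bar>\<phi> (t, x + h *\<^sub>R axis s 1) - \<phi> (t, x)\<bar> \<le> B * h"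
    if t: "0 \<le> t" "t < T" and x: "x \<in> torus" and h: "0 \<le> h" "h \<le> 1" for t x h s
  proof -
    have "norm (\<phi> (t, x + h *\<^sub>R axis s 1) - \<phi> (t, x)) \<le> B * norm ((x + h *\<^sub>R axis s 1) - x)"
    proof (rule differentiable_bound[OF convB])
      show "((\<lambda>x. \<phi> (t, x)) has_derivative (\<lambda>v. D (t, w) (0, v))) (at w within node_box)" for w
        by (rule has_derivative_at_withinI[OF dpx[OF t]])
      show "onorm (\<lambda>v. D (t, w) (0, v)) \<le> B" if "w \<in> node_box" for w
      proof (rule onorm_le)
        show "norm (blinfun_apply (D (t, w)) (0, v)) \<le> B * norm v" for v
          using apply_le(1)[of "D (t, w)" v] mult_right_mono[OF DB[OF t that] norm_ge_zero[of v]] by simp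
      qed
    qed (use shift_in[OF x] h x torus_subset_node_box in auto)
    then show ?thesis using h by simp
  qed
  have quot: "\<exists>\<delta>>0. \<forall>t x y s h. 0 \<le> t \<longrightarrow> t < T \<longrightarrow> x \<in> torus \<longrightarrow> y \<in> torus \<longrightarrow> norm (y - x) < \<delta> \<longrightarrow>
        0 < h \<longrightarrow> h < \<delta> \<longrightarrow> \<bar>dt (t, x) - dt (t, y)\<bar> \<le> \<epsilon> \<and>
        \<bar>(\<phi> (t, x + h *\<^sub>R axis s 1) - \<phi> (t, x - h *\<^sub>R axis s 1)) / (2 * h) - dx s (t, y)\<bar> \<le> \<epsilon>"
    if e: "\<epsilon> > 0" for \<epsilon>
  proof -
    obtain d where d: "d > 0" "\<And>t x y. 0 \<le> t \<Longrightarrow> t < T \<Longrightarrow> x \<in> node_box \<Longrightarrow> y \<in> node_box \<Longrightarrow> norm (y - x) < d \<Longrightarrow>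
      norm (D (t, x) - D (t, y)) \<le> \<epsilon>" using equi[OF e] by blast
    define \<delta> where "\<delta> = min (d / 2) 1"
    have \<delta>: "\<delta> > 0" "2 * \<delta> \<le> d" "\<delta> \<le> 1" using d by (auto simp: \<delta>_def)
    have "\<bar>dt (t, x) - dt (t, y)\<bar> \<le> \<epsilon> \<and>
        \<bar>(\<phi> (t, x + h *\<^sub>R axis s 1) - \<phi> (t, x - h *\<^sub>R axis s 1)) / (2 * h) - dx s (t, y)\<bar> \<le> \<epsilon>"
      if t: "0 \<le> t" "t < T" and x: "x \<in> torus" and y: "y \<in> torus" and xy: "norm (y - x) < \<delta>"
        and h: "0 < h" "h < \<delta>" for t x y s h
    proof
      have xb: "x \<in> node_box" "y \<in> node_box" using x y torus_subset_node_box by auto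
      have "\<bar>dt (t, x) - dt (t, y)\<bar> = \<bar>(D (t, x) - D (t, y)) (1, 0)\<bar>"
        by (simp add: dt_def blinfun.diff_left)
      also have "\<dots> \<le> norm (D (t, x) - D (t, y))" by (rule apply_le)
      also have "\<dots> \<le> \<epsilon>" using xy \<delta> by (intro d(2) t xb) linarith
      finally show "\<bar>dt (t, x) - dt (t, y)\<bar> \<le> \<epsilon>" .
    next
      have xb: "x \<in> node_box" "y \<in> node_box" using x y torus_subset_node_box by auto
      define a b where "a = x - h *\<^sub>R axis s 1" and "b = x + h *\<^sub>R axis s (1 :: real)"
      have ab: "a \<in> node_box" "b \<in> node_box"
        using shift_in[OF x, of h s] shift_in[OF x, of "- h" s] h \<delta> by (auto simp: a_def b_def)
      have bma: "b - a = (2 * h) *\<^sub>R axis s 1" by (simp add: a_def b_def scaleR_2[symmetric])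
      define L where "L v = D (t, y) (0, v)" for v
      have "norm ((\<phi> (t, b) - L b) - (\<phi> (t, a) - L a)) \<le> \<epsilon> * norm (b - a)"
      proof (rule differentiable_bound[OF convex_closed_segment, where f = "\<lambda>w. \<phi> (t, w) - L w"])
        fix w assume w: "w \<in> closed_segment a b"
        have "(L has_derivative L) (at w within closed_segment a b)"
          unfolding L_def by (intro derivative_eq_intros) auto
        then show "((\<lambda>w. \<phi> (t, w) - L w) has_derivative (\<lambda>v. D (t, w) (0, v) - L v)) (at w within closed_segment a b)"
          by (intro has_derivative_diff has_derivative_at_withinI[OF dpx[OF t]])
        have wb: "w \<in> node_box" using w ab convB by (meson closed_segment_subset subsetD)
        have "norm (y - w) < d"
        proof -
          have "closed_segment a b \<subseteq> cball x h"
            by (rule closed_segment_subset) (use h in \<open>auto simp: a_def b_def dist_norm\<close>)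
          then have "norm (w - x) \<le> h" using w by (auto simp: dist_norm norm_minus_commute)
          moreover have "norm (y - w) \<le> norm (y - x) + norm (w - x)"
            using norm_triangle_ineq4[of "y - x" "w - x"] by simp
          ultimately show ?thesis using xy h \<delta> by linarith
        qed
        then have "norm (D (t, w) - D (t, y)) \<le> \<epsilon>" by (intro d(2) t wb xb)
        then have le: "norm (D (t, w) - D (t, y)) * norm v \<le> \<epsilon> * norm v" for v :: "real ^ 'n"
          by (intro mult_right_mono) auto
        show "onorm (\<lambda>v. D (t, w) (0, v) - L v) \<le> \<epsilon>"
        proof (rule onorm_le)
          fix v :: "real ^ 'n"
          have "norm (D (t, w) (0, v) - L v) = \<bar>(D (t, w) - D (t, y)) (0, v)\<bar>"
            by (simp add: L_def blinfun.diff_left)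
          also have "\<dots> \<le> norm (D (t, w) - D (t, y)) * norm v" by (rule apply_le)
          also have "\<dots> \<le> \<epsilon> * norm v" by (rule le)
          finally show "norm (D (t, w) (0, v) - L v) \<le> \<epsilon> * norm v" .
        qed
      qed auto
      moreover have "L b - L a = 2 * h * dx s (t, y)"
      proof -
        have "L b - L a = D (t, y) (0, b - a)" by (simp add: L_def blinfun.diff_right[symmetric])
        also have "(0, b - a) = (2 * h) *\<^sub>R (0 :: real, axis s 1 :: real ^ 'n)" by (simp add: bma)
        also have "D (t, y) \<dots> = 2 * h * dx s (t, y)" by (simp only: blinfun.scaleR_right dx_def real_scaleR_def)
        finally show ?thesis .
      qed
      ultimately have "\<bar>(\<phi> (t, b) - \<phi> (t, a)) - 2 * h * dx s (t, y)\<bar> \<le> \<epsilon> * (2 * h)"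
        using h by (simp add: bma algebra_simps)
      then have "\<bar>(\<phi> (t, b) - \<phi> (t, a)) - 2 * h * dx s (t, y)\<bar> / (2 * h) \<le> \<epsilon>"
        using h by (simp add: divide_le_eq)
      moreover have "\<bar>(\<phi> (t, b) - \<phi> (t, a)) - 2 * h * dx s (t, y)\<bar> / (2 * h) = \<bar>(\<phi> (t, b) - \<phi> (t, a)) / (2 * h) - dx s (t, y)\<bar>"
      proof -
        have "\<bar>(\<phi> (t, b) - \<phi> (t, a)) - 2 * h * dx s (t, y)\<bar> / (2 * h) = \<bar>((\<phi> (t, b) - \<phi> (t, a)) - 2 * h * dx s (t, y)) / (2 * h)\<bar>"
          using h by simp
        then show ?thesis using h by (simp add: diff_divide_distrib)
      qed
      ultimately show "\<bar>(\<phi> (t, x + h *\<^sub>R axis s 1) - \<phi> (t, x - h *\<^sub>R axis s 1)) / (2 * h) - dx s (t, y)\<bar> \<le> \<epsilon>"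
        by (simp add: a_def b_def)
    qed
    then show ?thesis using \<delta>(1) by blast
  qed
  have "test_data T \<phi> \<tau> B dt dx"
    unfolding test_data_def
  proof (intro conjI)
    show "\<forall>t x. 0 < t \<longrightarrow> t < T \<longrightarrow> time_deriv \<phi> (t, x) = dt (t, x)"
      using dpt by (auto simp: time_deriv_def has_real_derivative_iff_has_vector_derivative intro!: vector_derivative_at)
    show "\<forall>t x s. 0 < t \<longrightarrow> t < T \<longrightarrow> space_grad \<phi> (t, x) $ s = dx s (t, x)"
      using frechet_derivative_at[OF dpx, symmetric] by (auto simp: space_grad_def dx_def)
    show "\<forall>t x s. 0 \<le> t \<longrightarrow> t < T \<longrightarrow> x \<in> node_box \<longrightarrow> \<bar>\<phi> (t, x)\<bar> \<le> B \<and> \<bar>dt (t, x)\<bar> \<le> B \<and> \<bar>dx s (t, x)\<bar> \<le> B"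
    proof (intro allI impI conjI)
      fix t x s assume a: "0 \<le> t" "t < T" "x \<in> (node_box :: (real ^ 'n) set)"
      show "\<bar>\<phi> (t, x)\<bar> \<le> B" using a by (intro \<phi>B)
      show "\<bar>dt (t, x)\<bar> \<le> B" using apply_le(2)[of "D (t, x)"] DB[OF a] by (simp add: dt_def)
      show "\<bar>dx s (t, x)\<bar> \<le> B" using apply_le(1)[of "D (t, x)" "axis s 1"] DB[OF a] by (simp add: dx_def)
    qed
    show "\<forall>t x s. \<tau> \<le> t \<longrightarrow> t < T \<longrightarrow> dt (t, x) = 0 \<and> dx s (t, x) = 0" by (simp add: zero dt_def dx_def)
    show "\<forall>t x. \<tau> \<le> t \<longrightarrow> \<phi> (t, x) = 0" using \<tau>0(2) \<tau> by auto
    show "0 \<le> B" by (simp add: B_def)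
  qed (use \<tau> per c\<phi> cD dpt incr quot in blast)+
  then show ?thesis by (rule that)
qed

section \<open>Consistency\<close>

definition variation :: "nat \<Rightarrow> (real \<Rightarrow> int ^ 'n::finite \<Rightarrow> 'n state) \<Rightarrow> ('n state \<Rightarrow> real) \<Rightarrow> real \<Rightarrow> real" where
  "variation n U G t = (\<Sum>K\<in>torus_cells n. \<Sum>s\<in>UNIV. \<bar>G (U t (K + axis s 1)) - G (U t K)\<bar>) / real n ^ CARD('n)"

context lf_run
begin

lemma grid_measurable:
  "(\<lambda>z. if z \<in> space_time T then grid_to_fun n U z else U 0 0) \<in> borel_measurable borel"
proof -
  have K: "(\<lambda>z :: real \<times> (real ^ 'n). if z \<in> space_time T then U (fst z) K else U 0 0) \<in> borel_measurable borel" for K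
  proof -
    have a: "(\<lambda>t. if t \<in> {0..<T} then U t K else U 0 0) \<in> borel_measurable borel"
      by (rule borel_measurable_continuous_on_if) (auto intro: cont)
    have m: "(\<lambda>z::real \<times> (real ^ 'n). if fst z \<in> {0..<T} then U (fst z) K else U 0 0) \<in> borel_measurable borel"
      using measurable_compose[OF borel_measurable_continuous_onI[OF continuous_on_fst[OF continuous_on_id]] a] by simp
    have "(\<lambda>z :: real \<times> (real ^ 'n). if z \<in> space_time T then (if fst z \<in> {0..<T} then U (fst z) K else U 0 0) else U 0 0) \<in> borel_measurable borel"
      by (rule measurable_If[OF m]) (use space_time_borel[of T] in \<open>simp_all add: Collect_mem_eq\<close>)
    moreover have "(\<lambda>z :: real \<times> (real ^ 'n). if z \<in> space_time T then (if fst z \<in> {0..<T} then U (fst z) K else U 0 0) else U 0 0)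
        = (\<lambda>z :: real \<times> (real ^ 'n). if z \<in> space_time T then U (fst z) K else U 0 0)"
      by (auto simp: space_time_def)
    ultimately show ?thesis by simp
  qed
  have "(\<lambda>z::real \<times> (real ^ 'n). cell_index n (snd z)) \<in> measurable borel (count_space UNIV)"
    by (rule measurable_compose[OF borel_measurable_continuous_onI cell_index_measurable]) (intro continuous_intros)
  from measurable_compose_countable[where f = "\<lambda>K z. if z \<in> space_time T then U (fst z) K else U 0 0", OF K this] show ?thesis
    unfolding grid_to_fun_def .
qed

text \<open>
  The discrete balance is tested with the values of \<open>\<phi>\<close> at the nodes, summed by parts and integrated in time. The
  consistency error comes from replacing nodal values of \<open>dt\<close> and difference quotients by the derivatives in the
  cell. The numerical diffusion is at most \<open>\<Lambda> B\<close> times the variation, for a difference of \<open>\<phi>\<close> over one cell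
  is \<open>O(h)\<close> and cancels the factor \<open>1/h\<close>. The hypothesis \<open>balance\<close> covers equations, with both signs of \<open>G\<close>,
  as well as entropy inequalities with \<open>\<phi> \<ge> 0\<close>.
\<close>

lemma weak_form:
  fixes G :: "'n state \<Rightarrow> real" and F :: "'n \<Rightarrow> 'n state \<Rightarrow> real"
  assumes C: "closed C" and inC: "\<And>t K. 0 \<le> t \<Longrightarrow> t < T \<Longrightarrow> U t K \<in> C"
    and G: "continuous_on C G" and F: "\<And>s. continuous_on C (F s)"
    and M: "\<And>V. V \<in> C \<Longrightarrow> \<bar>G V\<bar> \<le> M" "\<And>s V. V \<in> C \<Longrightarrow> \<bar>F s V\<bar> \<le> M"
    and \<Lambda>: "\<And>V. V \<in> C \<Longrightarrow> wave_speed \<gamma> V \<le> \<Lambda>" "\<And>V. V \<in> C \<Longrightarrow> 0 \<le> wave_speed \<gamma> V"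
    and td: "test_data T \<phi> \<tau> B dt dx"
    and \<epsilon>: "\<epsilon> \<ge> 0" "\<And>t K x. 0 \<le> t \<Longrightarrow> t < T \<Longrightarrow> K \<in> torus_cells n \<Longrightarrow> x \<in> cell n K \<Longrightarrow> \<bar>dt (t, node n K) - dt (t, x)\<bar> \<le> \<epsilon>"
      "\<And>t K x s. 0 \<le> t \<Longrightarrow> t < T \<Longrightarrow> K \<in> torus_cells n \<Longrightarrow> x \<in> cell n K \<Longrightarrow>
         \<bar>(\<phi> (t, node n (K + axis s 1)) - \<phi> (t, node n (K - axis s 1))) * (real n / 2) - dx s (t, x)\<bar> \<le> \<epsilon>"
    and balance: "\<And>t K. 0 < t \<Longrightarrow> t < T \<Longrightarrow> \<exists>g. ((\<lambda>t. G (U t K)) has_real_derivative g) (at t) \<and>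
        0 \<le> (g - scheme sch \<gamma> n G F (U t) K) * \<phi> (t, node n K)"
  shows "(LINT z:space_time T|lborel. G (grid_to_fun n U z) * dt z + (\<Sum>s\<in>UNIV. F s (grid_to_fun n U z) * dx s z))
      \<le> - ((\<Sum>K\<in>torus_cells n. G (U 0 K) * \<phi> (0, node n K)) / real n ^ CARD('n))
        + T * (M * \<epsilon> * (1 + CARD('n))) + \<Lambda> * B * (LINT t:{0..\<tau>}|lborel. variation n U G t)"
proof -
  note tds = test_dataD[OF td]
  have \<tau>: "0 < \<tau>" "\<tau> < T" and B0: "0 \<le> B" by (rule tds)+
  note per = tds(4) and \<phi>0 = tds(5) and d0 = tds(6,7) and ddt = tds(8)
    and c\<phi> = tds(11) and cdt = tds(12) and cdx = tds(13)
  have bnd: "\<bar>dt (t, x)\<bar> \<le> B" "\<bar>dx s (t, x)\<bar> \<le> B" if "0 \<le> t" "t < T" "x \<in> torus" for t x s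
    using tds(15,16) that torus_subset_node_box by blast+
  note incr = tds(17)
  define hN where "hN = real n ^ CARD('n)"
  have hN: "hN > 0" using n_pos by (simp add: hN_def)
  have U0: "U 0 0 \<in> C" using inC T_pos by simp
  have M0: "M \<ge> 0" using M(1)[OF U0] by linarith
  define P where "P t = (\<Sum>K\<in>torus_cells n. G (U t K) * \<phi> (t, node n K)) / hN" for t
  define h where "h t K = G (U t K) * dt (t, node n K)
     + (\<Sum>s\<in>UNIV. F s (U t K) * ((\<phi> (t, node n (K + axis s 1)) - \<phi> (t, node n (K - axis s 1))) * (real n / 2)))" for t K
  define H where "H t = (\<Sum>K\<in>torus_cells n. h t K) / hN" for t
  have deriv: "\<exists>p. (P has_real_derivative p) (at t) \<and> H t - \<Lambda> * B * variation n U G t \<le> p" if t: "0 < t" "t < \<tau>" for t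
  proof -
    have t': "0 < t" "t < T" "0 \<le> t" using t \<tau> by auto
    have "\<forall>K. \<exists>g. ((\<lambda>t. G (U t K)) has_real_derivative g) (at t) \<and>
        0 \<le> (g - scheme sch \<gamma> n G F (U t) K) * \<phi> (t, node n K)" using balance[OF t'(1,2)] by blast
    from choice[OF this] obtain g where g: "\<And>K. ((\<lambda>t. G (U t K)) has_real_derivative g K) (at t)"
      "\<And>K. 0 \<le> (g K - scheme sch \<gamma> n G F (U t) K) * \<phi> (t, node n K)" by blast
    define p where "p = (\<Sum>K\<in>torus_cells n. g K * \<phi> (t, node n K) + dt (t, node n K) * G (U t K)) / hN"
    have "(P has_real_derivative p) (at t)"
      unfolding P_def[abs_def] p_def by (intro DERIV_cdivide DERIV_sum DERIV_mult g(1) ddt t')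
    have p\<phi>: "periodic_grid n (\<lambda>K. \<phi> (t, node n K))"
    proof -
      have "node n (K + axis s (int n)) = node n K + axis s 1" for K :: "int ^ 'n" and s
        using n_pos by (auto simp: node_def vec_eq_iff axis_def add_divide_distrib)
      then show ?thesis using per[of t] by (simp add: periodic_grid_def periodic_def)
    qed
    define E where "E K s = real n * (viscosity sch \<gamma> n (U t) K (K + axis s 1)
          * (G (U t (K + axis s 1)) - G (U t K)) * (\<phi> (t, node n (K + axis s 1)) - \<phi> (t, node n K)))" for K s
    have E: "E K s \<le> \<Lambda> * B * \<bar>G (U t (K + axis s 1)) - G (U t K)\<bar>" if "K \<in> torus_cells n" for K s
    proof -
      have v: "0 \<le> viscosity sch \<gamma> n (U t) K (K + axis s 1)" "viscosity sch \<gamma> n (U t) K (K + axis s 1) \<le> \<Lambda>"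
        using order_trans[OF \<Lambda>(2)[OF inC] viscosity_ge[OF periodic n_pos]] viscosity_le[OF \<Lambda>(1)[OF inC] n_pos] t' by auto
      have "\<bar>\<phi> (t, node n (K + axis s 1)) - \<phi> (t, node n K)\<bar> \<le> B * (1 / real n)"
        unfolding node_shift using n_pos node_in_torus(2)[OF n_pos that] t' by (intro incr) auto
      then have "real n * \<bar>\<phi> (t, node n (K + axis s 1)) - \<phi> (t, node n K)\<bar> \<le> B"
        using n_pos by (simp add: field_simps)
      then have "(viscosity sch \<gamma> n (U t) K (K + axis s 1) * \<bar>G (U t (K + axis s 1)) - G (U t K)\<bar>)
          * (real n * \<bar>\<phi> (t, node n (K + axis s 1)) - \<phi> (t, node n K)\<bar>)
          \<le> (\<Lambda> * \<bar>G (U t (K + axis s 1)) - G (U t K)\<bar>) * B"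
        using v by (intro mult_mono mult_right_mono) auto
      moreover have "E K s \<le> \<bar>E K s\<bar>" by simp
      moreover have "\<bar>E K s\<bar> = (viscosity sch \<gamma> n (U t) K (K + axis s 1) * \<bar>G (U t (K + axis s 1)) - G (U t K)\<bar>)
          * (real n * \<bar>\<phi> (t, node n (K + axis s 1)) - \<phi> (t, node n K)\<bar>)"
        using v by (simp add: E_def abs_mult mult_ac)
      ultimately show ?thesis by (simp add: mult_ac)
    qed
    have "(\<Sum>K\<in>torus_cells n. h t K) - \<Lambda> * B * (\<Sum>K\<in>torus_cells n. \<Sum>s\<in>UNIV. \<bar>G (U t (K + axis s 1)) - G (U t K)\<bar>)
      \<le> (\<Sum>K\<in>torus_cells n. h t K) - (\<Sum>K\<in>torus_cells n. \<Sum>s\<in>UNIV. E K s)"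
      unfolding sum_distrib_left by (intro diff_left_mono sum_mono E)
    also have "\<dots> = (\<Sum>K\<in>torus_cells n. G (U t K) * dt (t, node n K)) + (\<Sum>K\<in>torus_cells n. scheme sch \<gamma> n G F (U t) K * \<phi> (t, node n K))"
      using summation_by_parts[OF periodic p\<phi> n_pos, of t sch \<gamma> G F] t'
      by (simp add: h_def E_def sum.distrib sum_subtractf)
    also have "\<dots> \<le> (\<Sum>K\<in>torus_cells n. g K * \<phi> (t, node n K) + dt (t, node n K) * G (U t K))"
    proof -
      have "(\<Sum>K\<in>torus_cells n. scheme sch \<gamma> n G F (U t) K * \<phi> (t, node n K)) \<le> (\<Sum>K\<in>torus_cells n. g K * \<phi> (t, node n K))"
        using g(2) by (intro sum_mono) (simp add: left_diff_distrib)
      then show ?thesis by (simp add: sum.distrib mult.commute)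
    qed
    finally have "H t - \<Lambda> * B * variation n U G t \<le> p"
      using divide_right_mono[of _ _ hN] hN by (fastforce simp: H_def variation_def hN_def[symmetric] p_def diff_divide_distrib)
    with \<open>(P has_real_derivative p) (at t)\<close> show ?thesis by blast
  qed
  have sub: "{0..\<tau>} \<subseteq> {0..<T}" using \<tau> by auto
  have cG: "continuous_on {0..\<tau>} (\<lambda>t. G (U t K))" for K
    by (rule continuous_on_compose2[OF G continuous_on_subset[OF cont sub]]) (use inC \<tau> in auto)
  have cF: "continuous_on {0..\<tau>} (\<lambda>t. F s (U t K))" for K s
    by (rule continuous_on_compose2[OF F continuous_on_subset[OF cont sub]]) (use inC \<tau> in auto)
  have ctf: "continuous_on {0..\<tau>} (\<lambda>t. f (t, x))" if "continuous_on ({0..<T} \<times> UNIV) f" for f :: "_ \<Rightarrow> real" and x :: "real ^ 'n"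
    by (rule continuous_on_compose2[OF that]) (use \<tau> in \<open>auto intro!: continuous_intros\<close>)
  have cP: "continuous_on {0..\<tau>} P"
    unfolding P_def using hN by (intro continuous_intros cG ctf c\<phi>) auto
  have cH: "continuous_on {0..\<tau>} H"
    unfolding H_def h_def using hN by (intro continuous_intros cG cF ctf c\<phi> cdt) auto
  have cV: "continuous_on {0..\<tau>} (variation n U G)"
    unfolding variation_def[abs_def] using hN by (intro continuous_intros cG) (auto simp: hN_def)
  have "(LINT t:{0..\<tau>}|lborel. H t - \<Lambda> * B * variation n U G t) \<le> P \<tau> - P 0"
    by (rule integral_le_increment[OF _ cP _ deriv]) (use \<tau> cH cV in \<open>auto intro!: continuous_intros\<close>)
  moreover have "P \<tau> = 0" unfolding P_def by (simp add: \<phi>0)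
  moreover have iH: "set_integrable lborel {0..\<tau>} H" and iV: "set_integrable lborel {0..\<tau>} (variation n U G)"
    using borel_integrable_atLeastAtMost'[OF cH] borel_integrable_atLeastAtMost'[OF cV] .
  ultimately have increment: "(LINT t:{0..\<tau>}|lborel. H t) \<le> - P 0 + \<Lambda> * B * (LINT t:{0..\<tau>}|lborel. variation n U G t)"
    by (simp add: set_integral_diff)
  define u where "u z = (if z \<in> space_time T then grid_to_fun n U z else U 0 0)" for z
  have uC: "u z \<in> C" for z
    using inC U0 by (auto simp: u_def grid_to_fun_def space_time_def)
  have um: "u \<in> borel_measurable borel" unfolding u_def[abs_def] by (rule grid_measurable)
  have st: "{0..<T} \<times> (UNIV :: (real ^ 'n) set) \<in> sets borel" by (intro borel_Times) auto
  define cut where "cut f z = (if z \<in> {0..<T} \<times> UNIV then f z else 0)" for f :: "real \<times> (real ^ 'n) \<Rightarrow> real" and z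
  have cutm: "cut f \<in> borel_measurable borel" if "continuous_on ({0..<T} \<times> UNIV) f" for f
    unfolding cut_def by (rule borel_measurable_continuous_on_if[OF st that]) auto
  define e where "e z = G (u z) * cut dt z + (\<Sum>s\<in>UNIV. F s (u z) * cut (dx s) z)" for z
  have em: "e \<in> borel_measurable borel"
    unfolding e_def
    by (intro borel_measurable_add borel_measurable_sum borel_measurable_times cutm cdt cdx
        continuous_comp_measurable[OF C _ um uC] G F)
  have e_eq: "e (t, x) = G (U t (cell_index n x)) * dt (t, x) + (\<Sum>s\<in>UNIV. F s (U t (cell_index n x)) * dx s (t, x))"
    if "0 < t" "t < T" "x \<in> torus" for t x
    using that by (simp add: e_def u_def cut_def space_time_def grid_to_fun_def)
  have eB: "\<bar>e z\<bar> \<le> M * B + CARD('n) * (M * B)" if z: "z \<in> space_time T" for z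
  proof -
    obtain t x where tx: "z = (t, x)" "0 < t" "t < T" "x \<in> torus" using z by (auto simp: space_time_def)
    have UC: "U t (cell_index n x) \<in> C" using inC tx by simp
    have "\<bar>e z\<bar> \<le> \<bar>G (U t (cell_index n x)) * dt (t, x)\<bar> + (\<Sum>s\<in>(UNIV :: 'n set). \<bar>F s (U t (cell_index n x)) * dx s (t, x)\<bar>)"
      unfolding tx(1) e_eq[OF tx(2-4)] by (rule order_trans[OF abs_triangle_ineq add_left_mono[OF sum_abs]])
    also have "\<dots> \<le> M * B + (\<Sum>s\<in>(UNIV :: 'n set). M * B)"
      unfolding abs_mult using M UC bnd tx M0 B0 by (intro add_mono sum_mono mult_mono) auto
    finally show ?thesis by simp
  qed
  define err where "err = M * \<epsilon> * (1 + CARD('n))"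
  note fub = integral_space_time[OF em eB]
  have near: "(LINT x:torus|lborel. e (t, x)) \<le> H t + err" if t: "0 < t" "t < T" for t
  proof -
    have "\<bar>(\<Sum>K\<in>torus_cells n. h t K) / real n ^ CARD('n) - (LINT x:torus|lborel. e (t, x))\<bar> \<le> err"
    proof (rule cell_sum_approximates_integral[OF n_pos])
      show "set_integrable lborel torus (\<lambda>x. e (t, x))"
      proof (rule set_integrable_torus_bounded)
        have "(\<lambda>x. e (t, x)) \<in> borel_measurable borel"
          by (rule measurable_compose[OF borel_measurable_continuous_onI em]) (intro continuous_intros)
        then show "(\<lambda>x. indicator torus x * e (t, x)) \<in> borel_measurable borel" by measurable
        show "\<bar>e (t, x)\<bar> \<le> M * B + CARD('n) * (M * B)" if "x \<in> torus" for x
          using that t by (intro eB) (simp add: space_time_def)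
      qed
      fix K :: "int ^ 'n" and x assume K: "K \<in> torus_cells n" and x: "x \<in> cell n K"
      have xt: "x \<in> torus" using cell_subset_torus[OF n_pos K] x by blast
      have ci: "cell_index n x = K" using x cell_index_eq_iff[OF n_pos] by blast
      have UC: "U t K \<in> C" using inC t by simp
      have diff: "h t K - e (t, x) = G (U t K) * (dt (t, node n K) - dt (t, x))
        + (\<Sum>s\<in>UNIV. F s (U t K) * ((\<phi> (t, node n (K + axis s 1)) - \<phi> (t, node n (K - axis s 1))) * (real n / 2) - dx s (t, x)))"
        unfolding e_eq[OF t xt] h_def ci by (simp add: right_diff_distrib sum_subtractf)
      have "\<bar>h t K - e (t, x)\<bar> \<le> \<bar>G (U t K) * (dt (t, node n K) - dt (t, x))\<bar>
        + (\<Sum>s\<in>(UNIV :: 'n set). \<bar>F s (U t K) * ((\<phi> (t, node n (K + axis s 1)) - \<phi> (t, node n (K - axis s 1))) * (real n / 2) - dx s (t, x))\<bar>)"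
        unfolding diff by (rule order_trans[OF abs_triangle_ineq add_left_mono[OF sum_abs]])
      also have "\<dots> \<le> M * \<epsilon> + (\<Sum>s\<in>(UNIV :: 'n set). M * \<epsilon>)"
        unfolding abs_mult using M[OF UC] \<epsilon>(2)[OF _ t(2) K x] \<epsilon>(3)[OF _ t(2) K x] t M0 \<epsilon>(1)
        by (intro add_mono sum_mono mult_mono) auto
      also have "\<dots> = err" by (simp add: err_def algebra_simps)
      finally show "\<bar>h t K - e (t, x)\<bar> \<le> err" .
    qed
    then show ?thesis by (simp add: H_def hN_def abs_le_iff)
  qed
  have H0: "H t = 0" if "\<tau> \<le> t" "t < T" for t
    using that by (simp add: H_def h_def d0 \<phi>0)
  have ind: "AE t in lborel. indicator {0<..<T} t *\<^sub>R H t = indicator {0..\<tau>} t *\<^sub>R H t"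
    using AE_lborel_singleton[of "0 :: real"]
  proof eventually_elim
    case (elim t)
    then show ?case using H0[of t] \<tau> by (cases "t \<le> \<tau>") (auto simp: indicator_def)
  qed
  have mH: "(\<lambda>t. indicator {0..\<tau>} t *\<^sub>R H t) \<in> borel_measurable lborel"
    using iH by (simp add: set_integrable_def)
  have mH': "(\<lambda>t. indicator {0<..<T} t *\<^sub>R H t) \<in> borel_measurable lborel"
  proof -
    have "(\<lambda>t. indicator {0<..<T} t *\<^sub>R H t) = (\<lambda>t. indicator {0<..<T} t *\<^sub>R (indicator {0..\<tau>} t *\<^sub>R H t))"
    proof
      fix t
      show "indicator {0<..<T} t *\<^sub>R H t = indicator {0<..<T} t *\<^sub>R (indicator {0..\<tau>} t *\<^sub>R H t)"
        using H0[of t] \<tau> by (cases "t \<le> \<tau>") (auto simp: indicator_def)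
    qed
    then show ?thesis using mH by simp
  qed
  have iH': "set_integrable lborel {0<..<T} H"
    unfolding set_integrable_def
    by (rule integrable_cong_AE_imp[OF iH[unfolded set_integrable_def] mH' AE_symmetric[OF ind]])
  have eqH: "(LINT t:{0<..<T}|lborel. H t) = (LINT t:{0..\<tau>}|lborel. H t)"
    unfolding set_lebesgue_integral_def by (rule integral_cong_AE[OF mH' mH ind])
  have ie: "set_integrable lborel {0<..<T} (\<lambda>_. err)"
    unfolding set_integrable_def
    by (rule integrableI_bounded_set_indicator[where B = "\<bar>err\<bar>"]) (use T_pos in auto)
  have le: "(LINT t:{0<..<T}|lborel. err) = T * err"
    using T_pos by (simp add: set_lebesgue_integral_def)
  have "(LINT z:space_time T|lborel. e z) = (LINT t:{0<..<T}|lborel. LINT x:torus|lborel. e (t, x))" by (rule fub(2))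
  also have "\<dots> \<le> (LINT t:{0<..<T}|lborel. H t + err)"
    by (rule set_integral_mono[OF fub(3) set_integral_add(1)[OF iH' ie]]) (use near in auto)
  also have "\<dots> = (LINT t:{0..\<tau>}|lborel. H t) + T * err"
    by (simp only: set_integral_add(2)[OF iH' ie] eqH le)
  finally have "(LINT z:space_time T|lborel. e z) \<le> - P 0 + \<Lambda> * B * (LINT t:{0..\<tau>}|lborel. variation n U G t) + T * err"
    using increment by linarith
  moreover have "(LINT z:space_time T|lborel. e z) = (LINT z:space_time T|lborel. G (grid_to_fun n U z) * dt z + (\<Sum>s\<in>UNIV. F s (grid_to_fun n U z) * dx s z))"
  proof (rule set_lebesgue_integral_cong)
    show "\<forall>z. z \<in> space_time T \<longrightarrow> e z = G (grid_to_fun n U z) * dt z + (\<Sum>s\<in>UNIV. F s (grid_to_fun n U z) * dx s z)"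
      by (auto simp: e_def u_def cut_def space_time_def)
  qed simp
  ultimately show ?thesis by (simp add: P_def hN_def err_def)
qed

end

section \<open>Vanishing of the numerical diffusion\<close>

lemma relative_entropy_eq_0:
  fixes U V :: "'n::finite state"
  assumes \<gamma>: "\<gamma> > 1" and U: "dens U > 0" "pressure \<gamma> U > 0" and V: "dens V > 0" "pressure \<gamma> V > 0"
    and z: "relative_entropy \<gamma> U V = 0"
  shows "U = V"
proof -
  have TU: "temperature \<gamma> U > 0" and TV: "temperature \<gamma> V > 0" using U V by (auto simp: temperature_def)
  define a where "a = (norm (velocity V - velocity U))\<^sup>2 / (2 * temperature \<gamma> U)"
  define b where "b = relent (temperature \<gamma> V / temperature \<gamma> U) / (\<gamma> - 1)"
  define c where "c = relent (dens U / dens V)"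
  have nn: "a \<ge> 0" "b \<ge> 0" "c \<ge> 0"
    using TU TV U V \<gamma> by (auto simp: a_def b_def c_def intro!: divide_nonneg_nonneg relent_nonneg)
  have "a + b + c = 0" using z by (simp add: relative_entropy_def a_def b_def c_def)
  then have "a = 0" "b = 0" "c = 0" using nn by linarith+
  then have v: "velocity V = velocity U" using TU by (simp add: a_def)
  have "relent (temperature \<gamma> V / temperature \<gamma> U) = 0" using \<open>b = 0\<close> \<gamma> by (simp add: b_def)
  then have "temperature \<gamma> V / temperature \<gamma> U = 1" using TU TV by (intro relent_eq_0) auto
  then have t: "temperature \<gamma> V = temperature \<gamma> U" using TU by simp
  have "dens U / dens V = 1" using \<open>c = 0\<close> U V by (intro relent_eq_0) (auto simp: c_def)
  then have d: "dens U = dens V" using V by simp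
  show ?thesis
    using state_decomposition(1,3)[OF \<gamma> U(1)] state_decomposition(1,3)[OF \<gamma> V(1)] v t d
    by (metis prod.collapse)
qed

definition admissible :: "real \<Rightarrow> ('n::finite state) set" where
  "admissible \<gamma> = {U. dens U > 0 \<and> pressure \<gamma> U > 0}"

lemma continuous_on_velocity: "continuous_on (admissible \<gamma>) velocity"
  unfolding velocity_def[abs_def] admissible_def by (intro continuous_intros) auto

lemma continuous_on_relent: "continuous_on {0<..} relent"
  unfolding relent_def[abs_def] by (intro continuous_intros) auto

lemma continuous_on_relative_entropy:
  assumes "\<gamma> > 1"
  shows "continuous_on (admissible \<gamma> \<times> admissible \<gamma>) (\<lambda>z. relative_entropy \<gamma> (fst z) (snd z))"
proof -
  have T: "continuous_on (admissible \<gamma>) (temperature \<gamma>)" for \<gamma>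
    by (rule continuous_on_subset[OF continuous_on_temperature]) (auto simp: admissible_def)
  have c: "continuous_on (admissible \<gamma> \<times> admissible \<gamma>) (\<lambda>z. f (fst z))"
    "continuous_on (admissible \<gamma> \<times> admissible \<gamma>) (\<lambda>z. f (snd z))"
    if "continuous_on (admissible \<gamma>) f" for f :: "'a state \<Rightarrow> 'b::topological_space"
    by (rule continuous_on_compose2[OF that]; auto intro!: continuous_intros)+
  have d: "continuous_on (admissible \<gamma>) (\<lambda>U :: 'a state. dens U)" by (intro continuous_intros)
  have tp: "temperature \<gamma> U > 0" "dens U > 0" if "U \<in> admissible \<gamma>" for U :: "'a state"
    using that by (auto simp: admissible_def temperature_def)
  have dpos: "0 < a" if "(a, m, e) \<in> admissible \<gamma>" for a e and m :: "real ^ 'a"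
    using tp(2)[OF that] by simp
  have r: "continuous_on (admissible \<gamma> \<times> admissible \<gamma>) (\<lambda>z. relent (f z))"
    if "continuous_on (admissible \<gamma> \<times> admissible \<gamma>) f" "\<And>z. z \<in> admissible \<gamma> \<times> admissible \<gamma> \<Longrightarrow> f z > 0"
    for f :: "'a state \<times> 'a state \<Rightarrow> real"
    by (rule continuous_on_compose2[OF continuous_on_relent that(1)]) (use that(2) in auto)
  have nz: "temperature \<gamma> (fst z) \<noteq> 0" "dens (snd z) \<noteq> 0" if "z \<in> admissible \<gamma> \<times> admissible \<gamma>" for z :: "'a state \<times> 'a state"
    using that tp by (metis less_irrefl mem_Times_iff)+
  show ?thesis
    unfolding relative_entropy_def
    using assms
    by (intro continuous_on_add continuous_on_divide r continuous_on_power continuous_on_norm continuous_on_diff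
        continuous_on_mult continuous_on_const c continuous_on_velocity T d)
      (auto simp: tp nz less_imp_neq[OF tp(1), symmetric] intro!: divide_pos_pos dest: dpos)
qed

text \<open>
  Pairs of states in \<open>C\<close> at which \<open>G\<close> differs by at least \<open>\<epsilon>\<close> form a compact set that misses the diagonal; the
  relative entropy has a positive minimum there.
\<close>

lemma increment_le_relative_entropy:
  fixes G :: "'n::finite state \<Rightarrow> real"
  assumes \<gamma>: "\<gamma> > 1" and C: "compact C" "C \<subseteq> admissible \<gamma>" and G: "continuous_on C G" and \<epsilon>: "\<epsilon> > 0"
  shows "\<exists>A\<ge>0. \<forall>U\<in>C. \<forall>V\<in>C. \<bar>G V - G U\<bar> \<le> \<epsilon> + A * relative_entropy \<gamma> U V"
proof -
  define d where "d z = \<bar>G (snd z) - G (fst z)\<bar>" for z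
  have cd: "continuous_on (C \<times> C) d"
    unfolding d_def by (intro continuous_intros continuous_on_compose2[OF G]) auto
  define S where "S = {z \<in> C \<times> C. \<epsilon> \<le> d z}"
  have CC: "compact (C \<times> C)" using C by (intro compact_Times)
  have "closed S" unfolding S_def
    by (rule continuous_on_closed_Collect_le[OF continuous_on_const cd compact_imp_closed[OF CC]])
  moreover have "S = C \<times> C \<inter> S" by (auto simp: S_def)
  ultimately have "compact S" using compact_Int_closed[OF CC, of S] by simp
  have nn: "0 \<le> relative_entropy \<gamma> U V" if "U \<in> C" "V \<in> C" for U V
    using subsetD[OF C(2) that(1)] subsetD[OF C(2) that(2)] unfolding admissible_def mem_Collect_eq
    by (intro relative_entropy_nonneg[OF \<gamma>]) blast+
  show ?thesis
  proof (cases "S = {}")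
    case True
    have "\<bar>G V - G U\<bar> \<le> \<epsilon>" if "U \<in> C" "V \<in> C" for U V
    proof -
      have "(U, V) \<notin> S" using True by simp
      then show ?thesis using that by (simp add: S_def d_def)
    qed
    then show ?thesis by (intro exI[of _ 0]) auto
  next
    case False
    have "continuous_on S (\<lambda>z. relative_entropy \<gamma> (fst z) (snd z))"
      by (rule continuous_on_subset[OF continuous_on_relative_entropy[OF \<gamma>]]) (use C in \<open>auto simp: S_def\<close>)
    from continuous_attains_inf[OF \<open>compact S\<close> False this] obtain z0 where z0: "z0 \<in> S"
      "\<And>z. z \<in> S \<Longrightarrow> relative_entropy \<gamma> (fst z0) (snd z0) \<le> relative_entropy \<gamma> (fst z) (snd z)" by blast
    define m where "m = relative_entropy \<gamma> (fst z0) (snd z0)"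
    have "m \<noteq> 0"
    proof
      assume "m = 0"
      then have "fst z0 = snd z0"
        using z0(1) C by (intro relative_entropy_eq_0[OF \<gamma>]) (auto simp: m_def S_def admissible_def)
      then show False using z0(1) \<epsilon> by (simp add: S_def d_def)
    qed
    then have m: "m > 0" using nn[of "fst z0" "snd z0"] z0(1) by (force simp: m_def S_def)
    obtain K where K: "\<And>z. z \<in> C \<times> C \<Longrightarrow> \<bar>d z\<bar> \<le> K"
      using compact_imp_bounded[OF compact_continuous_image[OF cd CC]] by (auto simp: bounded_iff)
    have K0: "K \<ge> 0" using K[of z0] z0(1) by (simp add: S_def) 
    have "\<bar>G V - G U\<bar> \<le> \<epsilon> + K / m * relative_entropy \<gamma> U V" if UV: "U \<in> C" "V \<in> C" for U V
    proof (cases "(U, V) \<in> S")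
      case True
      have "\<bar>G V - G U\<bar> \<le> K" using K[of "(U, V)"] UV by (simp add: d_def)
      also have "K = K / m * m" using m by simp
      also have "\<dots> \<le> K / m * relative_entropy \<gamma> U V"
        using z0(2)[OF True] K0 m by (intro mult_left_mono) (auto simp: m_def)
      finally show ?thesis using \<epsilon> by linarith
    next
      case False
      then have "\<bar>G V - G U\<bar> \<le> \<epsilon>" using UV by (simp add: S_def d_def)
      moreover have "0 \<le> K / m * relative_entropy \<gamma> U V" using K0 m nn[OF UV] by simp
      ultimately show ?thesis by linarith
    qed
    then show ?thesis using K0 m by (intro exI[of _ "K / m"]) auto
  qed
qed

text \<open>
  With \<open>\<chi>(s) = s\<close> the total entropy increases at least at the rate of the dissipation, which is of order \<open>1/h\<close>
  times the mean relative entropy of neighbours; but the total entropy is bounded on \<open>C\<close>.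
\<close>

lemma total_dissipation_bound:
  fixes C :: "('n::finite state) set"
  assumes \<gamma>: "\<gamma> > 1" and C: "compact C" "C \<subseteq> admissible \<gamma>" "C \<noteq> {}"
  shows "\<exists>A\<ge>0. \<forall>T sch n U \<tau>. lf_run \<gamma> T sch n U \<longrightarrow> (\<forall>t K. 0 \<le> t \<longrightarrow> t < T \<longrightarrow> U t K \<in> C) \<longrightarrow> 0 \<le> \<tau> \<longrightarrow> \<tau> < T \<longrightarrow>
    (LINT t:{0..\<tau>}|lborel. (\<Sum>K\<in>torus_cells n. \<Sum>s\<in>UNIV. relative_entropy \<gamma> (U t K) (U t (K + axis s 1))) / real n ^ CARD('n))
      \<le> A / real n"
proof -
  have adm: "dens V > 0" "pressure \<gamma> V > 0" "temperature \<gamma> V > 0" if "V \<in> C" for V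
    using that C by (auto simp: admissible_def temperature_def)
  have "continuous_on C (\<lambda>V. dens V)" by (intro continuous_intros)
  from continuous_attains_inf[OF C(1,3) this] obtain V1 where V1: "V1 \<in> C" "\<And>V. V \<in> C \<Longrightarrow> dens V1 \<le> dens V" by blast
  have "continuous_on C (temperature \<gamma>)"
    by (rule continuous_on_subset[OF continuous_on_temperature]) (use adm in auto)
  from continuous_attains_inf[OF C(1,3) this] obtain V2 where V2: "V2 \<in> C" "\<And>V. V \<in> C \<Longrightarrow> temperature \<gamma> V2 \<le> temperature \<gamma> V" by blast
  define c where "c = sqrt (\<gamma> * temperature \<gamma> V2) * dens V1"
  have c: "c > 0" using adm V1 V2 \<gamma> by (simp add: c_def)
  have cent: "continuous_on C (entropy \<gamma>)"
    by (rule continuous_on_subset[OF continuous_on_entropy]) (use adm in auto)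
  have "continuous_on C (\<lambda>V. dens V * entropy \<gamma> V)" by (intro continuous_intros cent)
  from compact_imp_bounded[OF compact_continuous_image[OF this C(1)]] obtain S
    where S: "\<And>V. V \<in> C \<Longrightarrow> \<bar>dens V * entropy \<gamma> V\<bar> \<le> S" by (auto simp: bounded_iff)
  have S0: "S \<ge> 0" using S[OF V1(1)] by linarith
  have "(LINT t:{0..\<tau>}|lborel. (\<Sum>K\<in>torus_cells n. \<Sum>s\<in>UNIV. relative_entropy \<gamma> (U t K) (U t (K + axis s 1))) / real n ^ CARD('n))
      \<le> 24 * S / c / real n"
    if run: "lf_run \<gamma> T sch n U" and inC: "\<And>t K. 0 \<le> t \<Longrightarrow> t < T \<Longrightarrow> U t K \<in> C" and \<tau>: "0 \<le> \<tau>" "\<tau> < T"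
    for T sch n \<tau> and U :: "real \<Rightarrow> int ^ 'n \<Rightarrow> 'n state"
  proof -
    interpret lf_run \<gamma> T sch n U by (rule run)
    define hN where "hN = real n ^ CARD('n)"
    have hN: "hN > 0" using n_pos by (simp add: hN_def)
    define P where "P t = (\<Sum>K\<in>torus_cells n. dens (U t K) * entropy \<gamma> (U t K)) / hN" for t
    define R where "R t = (\<Sum>K\<in>torus_cells n. \<Sum>s\<in>UNIV. relative_entropy \<gamma> (U t K) (U t (K + axis s 1))) / hN" for t
    have sub: "{0..\<tau>} \<subseteq> {0..<T}" using \<tau> by auto
    have cU: "continuous_on {0..\<tau>} (\<lambda>t. U t K)" for K using continuous_on_subset[OF cont sub] .
    have PS: "\<bar>P t\<bar> \<le> S" if "0 \<le> t" "t < T" for t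
    proof -
      have "\<bar>P t\<bar> = \<bar>\<Sum>K\<in>torus_cells n. dens (U t K) * entropy \<gamma> (U t K)\<bar> / hN" using hN by (simp add: P_def)
      also have "\<dots> \<le> (\<Sum>K\<in>(torus_cells n :: (int ^ 'n) set). S) / hN"
        using hN S inC that by (intro divide_right_mono order_trans[OF sum_abs] sum_mono) auto
      also have "\<dots> = S" using n_pos by (simp add: card_torus_cells hN_def)
      finally show ?thesis .
    qed
    have rel_nn: "0 \<le> relative_entropy \<gamma> (U t K) (U t L)" if "0 \<le> t" "t < T" for t K L
      by (intro relative_entropy_nonneg[OF \<gamma>] adm inC that)
    have "(LINT t:{0..\<tau>}|lborel. real n / 12 * c * R t) \<le> P \<tau> - P 0"
    proof (rule integral_le_increment[OF \<tau>(1)])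
      show "continuous_on {0..\<tau>} P"
        unfolding P_def using hN inC \<tau>
        by (intro continuous_intros continuous_on_compose2[OF cent] cU) auto
      have "continuous_on {0..\<tau>} (\<lambda>t. relative_entropy \<gamma> (U t K) (U t L))" for K L
        using continuous_on_compose2[OF continuous_on_relative_entropy[OF \<gamma>] continuous_on_Pair[OF cU[of K] cU[of L]]]
          inC C(2) \<tau> by fastforce
      then show "continuous_on {0..\<tau>} (\<lambda>t. real n / 12 * c * R t)"
        unfolding R_def using hN by (intro continuous_intros) auto
      fix t assume t: "0 < t" "t < \<tau>"
      then have t': "0 < t" "t < T" "0 \<le> t" using \<tau> by auto
      have "\<forall>K. \<exists>g. ((\<lambda>t. dens (U t K) * id (entropy \<gamma> (U t K))) has_real_derivative g) (at t) \<and>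
        scheme sch \<gamma> n (\<lambda>V. dens V * id (entropy \<gamma> V)) (\<lambda>s V. mom V $ s * id (entropy \<gamma> V)) (U t) K
         + 1 * entropy_dissipation t K \<le> g"
        using adm inC t' by (intro allI entropy_balance[OF t'(1,2)]) (auto simp: id_def)
      from choice[OF this] obtain g where g: "\<And>K. ((\<lambda>t. dens (U t K) * entropy \<gamma> (U t K)) has_real_derivative g K) (at t)"
        "\<And>K. scheme sch \<gamma> n (\<lambda>V. dens V * id (entropy \<gamma> V)) (\<lambda>s V. mom V $ s * id (entropy \<gamma> V)) (U t) K
         + entropy_dissipation t K \<le> g K" by auto
      have "(P has_real_derivative (\<Sum>K\<in>torus_cells n. g K) / hN) (at t)"
        unfolding P_def[abs_def] by (intro DERIV_cdivide DERIV_sum g(1))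
      moreover have "real n / 12 * c * R t \<le> (\<Sum>K\<in>torus_cells n. g K) / hN"
      proof -
        have diss: "real n / 12 * c * (\<Sum>s\<in>UNIV. relative_entropy \<gamma> (U t K) (U t (K + axis s 1))) \<le> entropy_dissipation t K" for K
        proof -
          have k: "sqrt (\<gamma> * temperature \<gamma> V2) \<le> sqrt (\<gamma> * temperature \<gamma> (U t K))"
            using V2(2)[OF inC[OF t'(3,2)]] \<gamma> by simp
          have "dens V1 * (\<Sum>s\<in>UNIV. relative_entropy \<gamma> (U t K) (U t (K + axis s 1)))
            \<le> (\<Sum>s\<in>UNIV. dens (U t (K + axis s 1)) * relative_entropy \<gamma> (U t K) (U t (K + axis s 1))
              + dens (U t (K - axis s 1)) * relative_entropy \<gamma> (U t K) (U t (K - axis s 1)))"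
            unfolding sum_distrib_left
          proof (rule sum_mono)
            fix s
            have "dens V1 * relative_entropy \<gamma> (U t K) (U t (K + axis s 1))
               \<le> dens (U t (K + axis s 1)) * relative_entropy \<gamma> (U t K) (U t (K + axis s 1))"
              using V1(2) inC rel_nn t' by (intro mult_right_mono) auto
            moreover have "0 \<le> dens (U t (K - axis s 1)) * relative_entropy \<gamma> (U t K) (U t (K - axis s 1))"
              using adm(1) inC rel_nn t' by (intro mult_nonneg_nonneg) (auto simp: less_imp_le)
            ultimately show "dens V1 * relative_entropy \<gamma> (U t K) (U t (K + axis s 1))
              \<le> dens (U t (K + axis s 1)) * relative_entropy \<gamma> (U t K) (U t (K + axis s 1))
              + dens (U t (K - axis s 1)) * relative_entropy \<gamma> (U t K) (U t (K - axis s 1))" by linarith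
          qed
          then have "sqrt (\<gamma> * temperature \<gamma> V2) * (dens V1 * (\<Sum>s\<in>UNIV. relative_entropy \<gamma> (U t K) (U t (K + axis s 1))))
            \<le> sqrt (\<gamma> * temperature \<gamma> (U t K)) * (\<Sum>s\<in>UNIV. dens (U t (K + axis s 1)) * relative_entropy \<gamma> (U t K) (U t (K + axis s 1))
              + dens (U t (K - axis s 1)) * relative_entropy \<gamma> (U t K) (U t (K - axis s 1)))"
            using k adm[OF V1(1)] adm[OF inC[OF t'(3,2)]] \<gamma> rel_nn t'
            by (intro mult_mono) (auto intro!: mult_nonneg_nonneg sum_nonneg simp: less_imp_le)
          then have "real n / 12 * (sqrt (\<gamma> * temperature \<gamma> V2) * (dens V1 * (\<Sum>s\<in>UNIV. relative_entropy \<gamma> (U t K) (U t (K + axis s 1)))))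
            \<le> real n / 12 * (sqrt (\<gamma> * temperature \<gamma> (U t K)) * (\<Sum>s\<in>UNIV. dens (U t (K + axis s 1)) * relative_entropy \<gamma> (U t K) (U t (K + axis s 1))
              + dens (U t (K - axis s 1)) * relative_entropy \<gamma> (U t K) (U t (K - axis s 1))))"
            by (intro mult_left_mono) auto
          then show ?thesis by (simp only: entropy_dissipation_def c_def mult.assoc)
        qed
        have "real n / 12 * c * (\<Sum>K\<in>torus_cells n. \<Sum>s\<in>UNIV. relative_entropy \<gamma> (U t K) (U t (K + axis s 1)))
          \<le> (\<Sum>K\<in>torus_cells n. scheme sch \<gamma> n (\<lambda>V. dens V * id (entropy \<gamma> V)) (\<lambda>s V. mom V $ s * id (entropy \<gamma> V)) (U t) K
           + entropy_dissipation t K)"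
          unfolding sum.distrib sum_scheme_zero[OF periodic[OF t'(3,2)] n_pos]
          unfolding sum_distrib_left[of "real n / 12 * c" _ "torus_cells n"]
          using diss by (simp add: sum_mono)
        also have "\<dots> \<le> (\<Sum>K\<in>torus_cells n. g K)" by (intro sum_mono g(2))
        finally show ?thesis
          unfolding R_def times_divide_eq_right by (rule divide_right_mono[OF _ less_imp_le[OF hN]])
      qed
      ultimately show "\<exists>p. (P has_real_derivative p) (at t) \<and> real n / 12 * c * R t \<le> p" by blast
    qed
    also have "P \<tau> - P 0 \<le> 2 * S" using PS[of \<tau>] PS[of 0] \<tau> by (simp add: abs_le_iff)
    finally have "real n / 12 * c * (LINT t:{0..\<tau>}|lborel. R t) \<le> 2 * S" by simp
    then have "(LINT t:{0..\<tau>}|lborel. R t) \<le> 24 * S / c / real n"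
      using c n_pos by (simp add: field_simps)
    then show ?thesis by (simp add: R_def[abs_def] hN_def)
  qed
  then show ?thesis using S0 c by (intro exI[of _ "24 * S / c"]) auto
qed

text \<open>
  A qualitative substitute for an estimate of the gradient: the mean increment is at most \<open>\<epsilon>\<close> plus a constant
  times the mean relative entropy, and the latter is \<open>O(h)\<close>.
\<close>

lemma variation_vanishes:
  fixes G :: "'n::finite state \<Rightarrow> real"
  assumes \<gamma>: "\<gamma> > 1" and C: "compact C" "C \<subseteq> admissible \<gamma>" "C \<noteq> {}" and G: "continuous_on C G" and \<epsilon>: "\<epsilon> > 0" and T: "T > 0"
  shows "\<exists>n0. \<forall>sch n U \<tau>. n \<ge> n0 \<longrightarrow> lf_run \<gamma> T sch n U \<longrightarrow> (\<forall>t K. 0 \<le> t \<longrightarrow> t < T \<longrightarrow> U t K \<in> C) \<longrightarrow> 0 \<le> \<tau> \<longrightarrow> \<tau> < T \<longrightarrow>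
    (LINT t:{0..\<tau>}|lborel. variation n U G t) \<le> \<epsilon>"
proof -
  obtain A where A: "A \<ge> 0" "\<And>T sch n U \<tau>. lf_run \<gamma> T sch n U \<Longrightarrow> (\<And>t K. 0 \<le> t \<Longrightarrow> t < T \<Longrightarrow> U t K \<in> C) \<Longrightarrow> 0 \<le> \<tau> \<Longrightarrow> \<tau> < T \<Longrightarrow>
    (LINT t:{0..\<tau>}|lborel. (\<Sum>K\<in>torus_cells n. \<Sum>s\<in>UNIV. relative_entropy \<gamma> (U t K) (U t (K + axis s 1))) / real n ^ CARD('n))
      \<le> A / real n"
    using total_dissipation_bound[OF \<gamma> C] by blast
  define \<epsilon>' where "\<epsilon>' = \<epsilon> / (2 * CARD('n) * T)"
  have \<epsilon>': "\<epsilon>' > 0" using \<epsilon> T by (simp add: \<epsilon>'_def)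
  obtain A' where A': "A' \<ge> 0" "\<And>V W. V \<in> C \<Longrightarrow> W \<in> C \<Longrightarrow> \<bar>G W - G V\<bar> \<le> \<epsilon>' + A' * relative_entropy \<gamma> V W"
    using increment_le_relative_entropy[OF \<gamma> C(1,2) G \<epsilon>'] by blast
  obtain n0 where n0: "A' * A * 2 / \<epsilon> < real n0" using reals_Archimedean2 by blast
  have "(LINT t:{0..\<tau>}|lborel. variation n U G t) \<le> \<epsilon>"
    if n: "n \<ge> n0" and run: "lf_run \<gamma> T sch n U" and inC: "\<And>t K. 0 \<le> t \<Longrightarrow> t < T \<Longrightarrow> U t K \<in> C" and \<tau>: "0 \<le> \<tau>" "\<tau> < T"
    for sch n \<tau> and U :: "real \<Rightarrow> int ^ 'n \<Rightarrow> 'n state"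
  proof -
    interpret lf_run \<gamma> T sch n U by (rule run)
    define hN where "hN = real n ^ CARD('n)"
    have hN: "hN > 0" using n_pos by (simp add: hN_def)
    define R where "R t = (\<Sum>K\<in>torus_cells n. \<Sum>s\<in>UNIV. relative_entropy \<gamma> (U t K) (U t (K + axis s 1))) / hN" for t
    have sub: "{0..\<tau>} \<subseteq> {0..<T}" using \<tau> by auto
    have cU: "continuous_on {0..\<tau>} (\<lambda>t. U t K)" for K using continuous_on_subset[OF cont sub] .
    have cG: "continuous_on {0..\<tau>} (\<lambda>t. G (U t K))" for K
      by (rule continuous_on_compose2[OF G cU]) (use inC \<tau> in auto)
    have "continuous_on {0..\<tau>} (\<lambda>t. relative_entropy \<gamma> (U t K) (U t L))" for K L
      using continuous_on_compose2[OF continuous_on_relative_entropy[OF \<gamma>] continuous_on_Pair[OF cU[of K] cU[of L]]]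
        inC C(2) \<tau> by fastforce
    then have cR: "continuous_on {0..\<tau>} R" unfolding R_def using hN by (intro continuous_intros) auto
    have cV: "continuous_on {0..\<tau>} (variation n U G)"
      unfolding variation_def[abs_def] using hN by (intro continuous_intros cG) (auto simp: hN_def)
    have iV: "set_integrable lborel {0..\<tau>} (variation n U G)" by (rule borel_integrable_atLeastAtMost'[OF cV])
    have iR: "set_integrable lborel {0..\<tau>} (\<lambda>t. CARD('n) * \<epsilon>' + A' * R t)"
      by (rule borel_integrable_atLeastAtMost') (intro continuous_intros cR)
    have le: "variation n U G t \<le> CARD('n) * \<epsilon>' + A' * R t" if t: "t \<in> {0..\<tau>}" for t
    proof -
      have "variation n U G t \<le> (\<Sum>K\<in>torus_cells n. \<Sum>s\<in>UNIV. \<epsilon>' + A' * relative_entropy \<gamma> (U t K) (U t (K + axis s 1))) / hN"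
        unfolding variation_def hN_def[symmetric] using hN t \<tau> inC
        by (intro divide_right_mono sum_mono A') auto
      also have "\<dots> = CARD('n) * \<epsilon>' + A' * R t"
        using n_pos hN by (simp add: sum.distrib R_def sum_distrib_left[symmetric] card_torus_cells add_divide_distrib hN_def)
      finally show ?thesis .
    qed
    have "(LINT t:{0..\<tau>}|lborel. variation n U G t) \<le> (LINT t:{0..\<tau>}|lborel. CARD('n) * \<epsilon>' + A' * R t)"
      by (rule set_integral_mono[OF iV iR le])
    also have "\<dots> = \<tau> * (CARD('n) * \<epsilon>') + A' * (LINT t:{0..\<tau>}|lborel. R t)"
    proof -
      have 1: "set_integrable lborel {0..\<tau>} (\<lambda>_. CARD('n) * \<epsilon>')"
          by (rule borel_integrable_atLeastAtMost'[OF continuous_on_const])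
      have 2: "set_integrable lborel {0..\<tau>} (\<lambda>t. A' * R t)"
        by (rule borel_integrable_atLeastAtMost') (intro continuous_intros cR)
      show ?thesis unfolding set_integral_add(2)[OF 1 2] using \<tau> by (simp add: set_lebesgue_integral_def)
    qed
    also have "\<dots> \<le> T * (CARD('n) * \<epsilon>') + A' * (A / real n)"
    proof (intro add_mono mult_right_mono mult_left_mono)
      show "(LINT t:{0..\<tau>}|lborel. R t) \<le> A / real n"
        using A(2)[OF run inC \<tau>] by (simp add: R_def[abs_def] hN_def)
    qed (use \<tau> \<epsilon>' A' in auto)
    also have "T * (CARD('n) * \<epsilon>') = \<epsilon> / 2" using T by (simp add: \<epsilon>'_def field_simps)
    also have "A' * (A / real n) \<le> \<epsilon> / 2"
    proof -
      have "A' * A * 2 / \<epsilon> \<le> real n" using n0 n by linarith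
      then show ?thesis using n_pos \<epsilon> by (simp add: field_simps)
    qed
    finally show ?thesis by simp
  qed
  then show ?thesis by blast
qed

section \<open>A priori bounds\<close>

definition state_bounds :: "real \<Rightarrow> real \<Rightarrow> real \<Rightarrow> real \<Rightarrow> real \<Rightarrow> real \<Rightarrow> ('n::finite state) set" where
  "state_bounds \<gamma> \<rho>l \<rho>u p M E = {U. \<rho>l \<le> dens U \<and> dens U \<le> \<rho>u \<and> norm (mom U) \<le> M \<and>
     0 \<le> energy U \<and> energy U \<le> E \<and> p \<le> pressure \<gamma> U}"

lemma compact_state_bounds:
  assumes "\<rho>l > 0"
  shows "compact (state_bounds \<gamma> \<rho>l \<rho>u p M E :: ('n::finite state) set)"
proof -
  define Q :: "('n state) set" where "Q = {\<rho>l..\<rho>u} \<times> cball 0 M \<times> {0..E}"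
  have Q: "compact Q" unfolding Q_def by (intro compact_Times compact_cball compact_Icc)
  have "continuous_on Q (pressure \<gamma>)"
    by (rule continuous_on_subset[OF continuous_on_pressure]) (use assms in \<open>auto simp: Q_def\<close>)
  then have "closed {U \<in> Q. p \<le> pressure \<gamma> U}"
    by (intro continuous_on_closed_Collect_le continuous_on_const compact_imp_closed[OF Q])
  from compact_Int_closed[OF Q this] have "compact (Q \<inter> {U \<in> Q. p \<le> pressure \<gamma> U})" .
  moreover have "Q \<inter> {U \<in> Q. p \<le> pressure \<gamma> U} = state_bounds \<gamma> \<rho>l \<rho>u p M E"
    by (auto simp: Q_def state_bounds_def)
  ultimately show ?thesis by simp
qed

lemma energy_ge_pressure:
  assumes "\<gamma> > 1" "dens U > 0"
  shows "pressure \<gamma> U \<le> (\<gamma> - 1) * energy U"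
    and "pressure \<gamma> U > 0 \<Longrightarrow> 0 \<le> energy U"
    and "pressure \<gamma> U > 0 \<Longrightarrow> (norm (mom U))\<^sup>2 \<le> 2 * dens U * energy U"
proof -
  have k: "0 \<le> 1/2 * ((norm (mom U))\<^sup>2 / dens U)" using assms by simp
  then show "pressure \<gamma> U \<le> (\<gamma> - 1) * energy U"
    unfolding pressure_def using assms by (intro mult_left_mono) auto
  assume "pressure \<gamma> U > 0"
  then have "energy U - 1/2 * ((norm (mom U))\<^sup>2 / dens U) > 0"
    using assms by (simp add: pressure_def zero_less_mult_iff)
  then have k': "1/2 * ((norm (mom U))\<^sup>2 / dens U) \<le> energy U" by simp
  then show "0 \<le> energy U" using k by linarith
  show "(norm (mom U))\<^sup>2 \<le> 2 * dens U * energy U"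
    using k' assms by (simp add: field_simps)
qed

lemma set_integrable_cell_continuous:
  fixes f :: "real ^ 'n::finite \<Rightarrow> 'b::{banach, second_countable_topology}"
  assumes "continuous_on UNIV f"
  shows "set_integrable lborel (cell n K) f"
proof (rule set_integrable_subset)
  let ?Q = "cbox (node n K) (\<chi> i. (of_int (K $ i) + 1) / real n)"
  show "set_integrable lborel ?Q f"
    unfolding set_integrable_def
    by (rule borel_integrable_compact[OF compact_cbox continuous_on_subset[OF assms]]) auto
  show "cell n K \<subseteq> ?Q" by (auto simp: cell_def node_def mem_box_cart less_imp_le)
qed auto

lemma projection_const:
  assumes "n > 0"
  shows "projection n (\<lambda>x. c :: real) K = c"
  using assms by (simp add: projection_def set_lebesgue_integral_def measure_def emeasure_cell)

lemma projection_mono: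
  assumes "continuous_on UNIV f" "continuous_on UNIV g" "\<And>x. x \<in> cell n K \<Longrightarrow> f x \<le> g x"
  shows "projection n f K \<le> (projection n g K :: real)"
  unfolding projection_def real_scaleR_def
  by (intro mult_left_mono set_integral_mono set_integrable_cell_continuous assms) auto

text \<open>
  Averages over a cell commute with bounded linear maps; this reduces states to real functions.
\<close>

lemma projection_linear:
  assumes f: "continuous_on UNIV f" and l: "bounded_linear l"
  shows "l (projection n f K) = projection n (\<lambda>x. l (f x)) K"
proof -
  interpret bounded_linear l by (rule l)
  have "integrable lborel (\<lambda>x. indicator (cell n K) x *\<^sub>R f x)"
    using set_integrable_cell_continuous[OF f] by (simp add: set_integrable_def)
  from integral_bounded_linear[OF l this] show ?thesis
    by (simp add: projection_def scaleR set_lebesgue_integral_def)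
qed

lemma projection_add:
  assumes "continuous_on UNIV f" "continuous_on UNIV g"
  shows "projection n (\<lambda>x. f x + g x) K = projection n f K + projection n g K"
    and "projection n (\<lambda>x. f x - g x) K = projection n f K - projection n g K"
  using set_integrable_cell_continuous[OF assms(1)] set_integrable_cell_continuous[OF assms(2)]
  by (simp_all add: projection_def set_integral_add set_integral_diff scaleR_add_right scaleR_diff_right)

lemma projection_vector_const:
  fixes c :: "'b::euclidean_space"
  assumes "n > 0"
  shows "projection n (\<lambda>x. c) K = c"
proof (rule euclidean_eqI)
  fix b :: 'b
  show "projection n (\<lambda>x. c) K \<bullet> b = c \<bullet> b"
    using projection_linear[OF continuous_on_const bounded_linear_inner_left[of b], of n c K]
    by (simp add: projection_const[OF assms])
qed

lemma projection_close:
  fixes f :: "real ^ 'n::finite \<Rightarrow> 'b::euclidean_space"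
  assumes n: "n > 0" and f: "continuous_on UNIV f" and close: "\<And>y. y \<in> cell n K \<Longrightarrow> norm (f y - v) \<le> \<epsilon>"
  shows "norm (projection n f K - v) \<le> \<epsilon>"
proof -
  have "projection n f K - v = projection n (\<lambda>y. f y - v) K"
    using projection_add(2)[OF f continuous_on_const, of n v K] projection_vector_const[OF n, of v K] by simp
  also have "norm \<dots> \<le> projection n (\<lambda>y. norm (f y - v)) K"
    unfolding projection_def using set_integral_norm_bound[OF set_integrable_cell_continuous, of "\<lambda>y. f y - v" n K] f
    by (simp add: continuous_intros mult_left_mono)
  also have "\<dots> \<le> projection n (\<lambda>y. \<epsilon>) K"
    by (intro projection_mono continuous_intros f close)
  finally show ?thesis by (simp add: projection_const[OF n])
qed

text \<open>
  Jensen's inequality for the kinetic energy \<open>|m|\<^sup>2 / \<rho>\<close>: its tangent planes lie below it, so the pressure of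
  an average is at least the smallest pressure.
\<close>

lemma pressure_projection_ge:
  fixes \<rho>0 E0 :: "real ^ 'n::finite \<Rightarrow> real" and m0 :: "real ^ 'n \<Rightarrow> real ^ 'n"
  assumes \<gamma>: "\<gamma> > 1" and n: "n > 0"
    and c: "continuous_on UNIV \<rho>0" "continuous_on UNIV m0" "continuous_on UNIV E0"
    and pos: "\<And>x. x \<in> cell n K \<Longrightarrow> \<rho>0 x > 0"
    and p: "\<And>x. x \<in> cell n K \<Longrightarrow> p \<le> pressure \<gamma> (\<rho>0 x, m0 x, E0 x)"
    and dpos: "projection n \<rho>0 K > 0"
  shows "p \<le> pressure \<gamma> (projection n \<rho>0 K, projection n m0 K, projection n E0 K)"
proof -
  define \<rho> m E where "\<rho> = projection n \<rho>0 K" and "m = projection n m0 K" and "E = projection n E0 K"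
  define v where "v = m /\<^sub>R \<rho>"
  have \<rho>: "\<rho> > 0" using dpos by (simp add: \<rho>_def)
  have point: "m0 x \<bullet> v - (v \<bullet> v) / 2 * \<rho>0 x + p / (\<gamma> - 1) \<le> E0 x" if x: "x \<in> cell n K" for x
  proof -
    have r: "\<rho>0 x > 0" using pos[OF x] .
    have "p / (\<gamma> - 1) \<le> pressure \<gamma> (\<rho>0 x, m0 x, E0 x) / (\<gamma> - 1)" using p[OF x] \<gamma> by (intro divide_right_mono) auto
    also have "\<dots> = E0 x - 1/2 * ((m0 x \<bullet> m0 x) / \<rho>0 x)" using \<gamma> by (simp add: pressure_def power2_norm_eq_inner)
    finally have 1: "p / (\<gamma> - 1) \<le> E0 x - 1/2 * ((m0 x \<bullet> m0 x) / \<rho>0 x)" .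
    have "0 \<le> ((m0 x - \<rho>0 x *\<^sub>R v) \<bullet> (m0 x - \<rho>0 x *\<^sub>R v)) / \<rho>0 x" using r by simp
    also have "\<dots> = (m0 x \<bullet> m0 x) / \<rho>0 x - 2 * (m0 x \<bullet> v) + \<rho>0 x * (v \<bullet> v)"
      using r by (simp add: inner_diff inner_commute field_simps power2_eq_square)
    finally have 2: "0 \<le> (m0 x \<bullet> m0 x) / \<rho>0 x - 2 * (m0 x \<bullet> v) + \<rho>0 x * (v \<bullet> v)" .
    have "(v \<bullet> v) / 2 * \<rho>0 x = (\<rho>0 x * (v \<bullet> v)) / 2" by simp
    then show ?thesis using 1 2 by linarith
  qed
  have l1: "projection n (\<lambda>x. m0 x \<bullet> v) K = m \<bullet> v"
    unfolding m_def by (rule projection_linear[OF c(2) bounded_linear_inner_left, symmetric])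
  have l2: "projection n (\<lambda>x. (v \<bullet> v) / 2 * \<rho>0 x) K = (v \<bullet> v) / 2 * \<rho>"
    unfolding \<rho>_def by (rule projection_linear[OF c(1) bounded_linear_mult_right, symmetric])
  have "projection n (\<lambda>x. m0 x \<bullet> v - (v \<bullet> v) / 2 * \<rho>0 x + p / (\<gamma> - 1)) K \<le> projection n E0 K"
    by (intro projection_mono point continuous_intros c)
  moreover have "projection n (\<lambda>x. m0 x \<bullet> v - (v \<bullet> v) / 2 * \<rho>0 x + p / (\<gamma> - 1)) K
      = m \<bullet> v - (v \<bullet> v) / 2 * \<rho> + p / (\<gamma> - 1)"
    by (subst projection_add, (intro continuous_intros c)+)
      (subst projection_add, (intro continuous_intros c)+, simp only: l1 l2 projection_const[OF n])
  ultimately have "m \<bullet> v - (v \<bullet> v) / 2 * \<rho> + p / (\<gamma> - 1) \<le> E" by (simp add: E_def)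
  moreover have "m \<bullet> v - (v \<bullet> v) / 2 * \<rho> = 1/2 * ((norm m)\<^sup>2 / \<rho>)"
    using \<rho> by (simp add: v_def power2_norm_eq_inner field_simps)
  ultimately have "p / (\<gamma> - 1) \<le> E - 1/2 * ((norm m)\<^sup>2 / \<rho>)" by linarith
  then have "p \<le> (\<gamma> - 1) * (E - 1/2 * ((norm m)\<^sup>2 / \<rho>))" using \<gamma> by (simp add: field_simps)
  then show ?thesis by (simp add: pressure_def \<rho>_def m_def E_def)
qed

lemma C1_torus_continuous: "C1_torus f \<Longrightarrow> continuous_on UNIV f"
  unfolding C1_torus_def by (meson has_derivative_continuous continuous_at_imp_continuous_on)

lemma lf_solution_lf_run:
  fixes U :: "real \<Rightarrow> int ^ 'n::finite \<Rightarrow> 'n state"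
  assumes "\<gamma> > 1" "T > 0" "lf_solution sch \<gamma> T n \<rho>0 m0 E0 U"
  shows "lf_run \<gamma> T sch n U"
proof
  note sol = assms(3)[unfolded lf_solution_def]
  show "\<gamma> > 1" "T > 0" by fact+
  show "n > 0" using sol by (elim conjE)
  show "periodic_grid n (U t)" if "0 \<le> t" "t < T" for t using sol that by simp
  show "dens (U t K) > 0" if "0 \<le> t" "t < T" for t K using sol that by simp
  show "continuous_on {0..<T} (\<lambda>t. U t K)" for K
  proof -
    have "continuous_on {0..T} (\<lambda>t. U t K)" using sol by simp
    then show ?thesis by (rule continuous_on_subset) auto
  qed
  show "((\<lambda>s. U s K) has_vector_derivative scheme sch \<gamma> n (\<lambda>V. V) (flux \<gamma>) (U t) K) (at t)"
    if "0 < t" "t < T" for t K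
    by (rule lf_solution_ode[OF assms(3) that])
qed

text \<open>
  Averaging the data preserves a lower bound on the entropy, since the averaged pressure is bounded below and the
  averaged density above. The minimum entropy principle then gives \<open>p \<ge> k \<rho>\<^sup>\<gamma>\<close> for all times, and
  \<open>p \<le> (\<gamma> - 1) E\<close> bounds the density from above. The bounds do not depend on the mesh.
\<close>

lemma uniform_state_bounds:
  fixes \<rho>0 E0 :: "real ^ 'n::finite \<Rightarrow> real" and m0 :: "real ^ 'n \<Rightarrow> real ^ 'n"
  assumes \<gamma>: "\<gamma> > 1" and T: "T > 0"
    and c: "continuous_on UNIV \<rho>0" "continuous_on UNIV m0" "continuous_on UNIV E0"
    and pos: "\<And>x. \<rho>0 x > 0" and p: "\<And>x. pressure \<gamma> (\<rho>0 x, m0 x, E0 x) > 0"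
    and \<rho>l: "\<rho>l > 0"
  obtains \<rho>u pl M where "pl > 0" "\<And>sch n U t K. lf_solution sch \<gamma> T n \<rho>0 m0 E0 U \<Longrightarrow>
     (\<And>t K. 0 \<le> t \<Longrightarrow> t < T \<Longrightarrow> \<rho>l \<le> dens (U t K) \<and> energy (U t K) \<le> Eu) \<Longrightarrow>
     0 \<le> t \<Longrightarrow> t < T \<Longrightarrow> U t K \<in> state_bounds \<gamma> \<rho>l \<rho>u pl M Eu"
proof -
  have cB: "compact (node_box :: (real ^ 'n) set)" by (simp add: node_box_def)
  have neB: "(node_box :: (real ^ 'n) set) \<noteq> {}"
    unfolding node_box_def by (auto simp: box_ne_empty Basis_vec_def inner_axis)
  obtain x1 where x1: "\<And>x. x \<in> node_box \<Longrightarrow> \<rho>0 x \<le> \<rho>0 x1"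
    using continuous_attains_sup[OF cB neB continuous_on_subset[OF c(1)]] by auto
  have cp: "continuous_on node_box (\<lambda>x. pressure \<gamma> (\<rho>0 x, m0 x, E0 x))"
    unfolding pressure_def using pos
    by (auto intro!: continuous_intros continuous_on_subset[OF c(1)] continuous_on_subset[OF c(2)]
      continuous_on_subset[OF c(3)] simp: less_imp_neq[OF pos, symmetric])
  obtain x2 where x2: "\<And>x. x \<in> node_box \<Longrightarrow> pressure \<gamma> (\<rho>0 x2, m0 x2, E0 x2) \<le> pressure \<gamma> (\<rho>0 x, m0 x, E0 x)"
    using continuous_attains_inf[OF cB neB cp] by auto
  define pm where "pm = pressure \<gamma> (\<rho>0 x2, m0 x2, E0 x2)"
  define \<rho>m where "\<rho>m = \<rho>0 x1"
  have pm: "pm > 0" using p by (simp add: pm_def)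
  have \<rho>m: "\<rho>m > 0" using pos by (simp add: \<rho>m_def)
  define s0 where "s0 = 1 / (\<gamma> - 1) * ln (pm / \<rho>m powr \<gamma>)"
  define k where "k = exp ((\<gamma> - 1) * s0)"
  have k: "k > 0" by (simp add: k_def)
  define pl where "pl = k * \<rho>l powr \<gamma>"
  define \<rho>u where "\<rho>u = (((\<gamma> - 1) * Eu) / k) powr (1 / \<gamma>)"
  define M where "M = sqrt (2 * \<rho>u * Eu)"
  have "U t K \<in> state_bounds \<gamma> \<rho>l \<rho>u pl M Eu"
    if sol: "lf_solution sch \<gamma> T n \<rho>0 m0 E0 U"
      and bnd: "\<And>t K. 0 \<le> t \<Longrightarrow> t < T \<Longrightarrow> \<rho>l \<le> dens (U t K) \<and> energy (U t K) \<le> Eu"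
      and t: "0 \<le> t" "t < T"
    for sch n U t K
  proof -
    interpret lf_run \<gamma> T sch n U by (rule lf_solution_lf_run[OF \<gamma> T sol])
    have init: "U 0 K = (projection n \<rho>0 K, projection n m0 K, projection n E0 K)" for K
      using sol by (simp add: lf_solution_def)
    have cellB: "x \<in> node_box" if "K \<in> torus_cells n" "x \<in> cell n K" for x K
      using that cell_subset_torus[OF n_pos] torus_subset_node_box by blast
    have rep0: "U 0 (torus_rep n K) = U 0 K" for K
      by (rule periodic_grid_rep[OF periodic]) (use T in auto)
    have p0': "pm \<le> pressure \<gamma> (U 0 K)" and \<rho>0': "dens (U 0 K) \<le> \<rho>m" if K: "K \<in> torus_cells n" for K
    proof -
      have d: "projection n \<rho>0 K > 0" using dens_pos[of 0 K] T by (simp add: init)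
      show "pm \<le> pressure \<gamma> (U 0 K)" unfolding init
        using x2 cellB[OF K] by (intro pressure_projection_ge[OF \<gamma> n_pos c pos _ d]) (auto simp: pm_def)
      have "projection n \<rho>0 K \<le> projection n (\<lambda>_. \<rho>m) K"
        using x1 cellB[OF K] by (intro projection_mono c continuous_on_const) (auto simp: \<rho>m_def)
      then show "dens (U 0 K) \<le> \<rho>m" by (simp add: init projection_const[OF n_pos])
    qed
    have p0: "pm \<le> pressure \<gamma> (U 0 K)" and \<rho>0b: "dens (U 0 K) \<le> \<rho>m" for K
      using p0'[OF torus_rep_in[OF n_pos, of K]] \<rho>0'[OF torus_rep_in[OF n_pos, of K]] by (simp_all add: rep0)
    have d0: "dens (U 0 K) > 0" for K using dens_pos T by simp
    have s0: "s0 \<le> entropy \<gamma> (U 0 K)" for K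
    proof -
      have "dens (U 0 K) powr \<gamma> \<le> \<rho>m powr \<gamma>" using \<rho>0b[of K] d0[of K] \<gamma> by (intro powr_mono2) auto
      then have "pm / \<rho>m powr \<gamma> \<le> pressure \<gamma> (U 0 K) / dens (U 0 K) powr \<gamma>"
        using p0[of K] pm d0[of K] by (intro frac_le) auto
      moreover have "0 < pm / \<rho>m powr \<gamma>" using pm \<rho>m by simp
      ultimately have "ln (pm / \<rho>m powr \<gamma>) \<le> ln (pressure \<gamma> (U 0 K) / dens (U 0 K) powr \<gamma>)" by simp
      then show ?thesis unfolding s0_def entropy_def using \<gamma> by (intro mult_left_mono) auto
    qed
    have pp0: "pressure \<gamma> (U 0 K) > 0" for K using p0[of K] pm by linarith
    have pp: "pressure \<gamma> (U t K) > 0" if "0 \<le> t" "t < T" for t K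
      using bnd by (intro pressure_positive[OF \<rho>l _ pp0 s0 that]) auto
    have s: "s0 \<le> entropy \<gamma> (U t K)" by (rule minimum_entropy_principle[OF order_refl pp s0 t])
    have \<rho>b: "\<rho>l \<le> dens (U t K)" "energy (U t K) \<le> Eu" using bnd t by auto
    have d: "dens (U t K) > 0" using \<rho>b \<rho>l by linarith
    note low = pressure_ge_of_entropy_ge[OF \<gamma> \<rho>b(1) \<rho>l pp[OF t] s, folded k_def]
    note en = energy_ge_pressure[OF \<gamma> d]
    have "k * dens (U t K) powr \<gamma> \<le> (\<gamma> - 1) * Eu"
      using low(1) en(1) mult_left_mono[OF \<rho>b(2), of "\<gamma> - 1"] \<gamma> by linarith
    then have "dens (U t K) powr \<gamma> \<le> ((\<gamma> - 1) * Eu) / k" using k by (simp add: field_simps)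
    then have "(dens (U t K) powr \<gamma>) powr (1 / \<gamma>) \<le> \<rho>u"
      unfolding \<rho>u_def using \<gamma> by (intro powr_mono2) auto
    then have \<rho>u: "dens (U t K) \<le> \<rho>u" using d \<gamma> by (simp add: powr_powr)
    have e0: "0 \<le> energy (U t K)" using en(2) pp[OF t] by blast
    have "(norm (mom (U t K)))\<^sup>2 \<le> 2 * dens (U t K) * energy (U t K)" using en(3) pp[OF t] by blast
    also have "\<dots> \<le> 2 * \<rho>u * Eu" using \<rho>u \<rho>b e0 d by (intro mult_mono) auto
    finally have "norm (mom (U t K)) \<le> M" unfolding M_def by (rule real_le_rsqrt)
    then show ?thesis using \<rho>b \<rho>u e0 low(2) by (simp add: state_bounds_def pl_def)
  qed
  moreover have "pl > 0" using k \<rho>l by (simp add: pl_def)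
  ultimately show ?thesis using that by blast
qed

section \<open>Existence of Young measures\<close>

lemma tendsto_by_uniform_approximation:
  fixes a :: "nat \<Rightarrow> real"
  assumes "\<And>\<epsilon>. \<epsilon> > 0 \<Longrightarrow> \<exists>b \<beta>. b \<longlonglongrightarrow> \<beta> \<and> (\<forall>\<^sub>F k in sequentially. \<bar>a k - b k\<bar> \<le> \<epsilon>) \<and> \<bar>\<alpha> - \<beta>\<bar> \<le> \<epsilon>"
  shows "a \<longlonglongrightarrow> \<alpha>"
proof (rule tendstoI)
  fix e :: real assume "e > 0"
  then obtain b \<beta> where b: "b \<longlonglongrightarrow> \<beta>" "\<forall>\<^sub>F k in sequentially. \<bar>a k - b k\<bar> \<le> e / 4" "\<bar>\<alpha> - \<beta>\<bar> \<le> e / 4"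
    using assms[of "e / 4"] by auto
  have "\<forall>\<^sub>F k in sequentially. dist (b k) \<beta> < e / 4"
    using b(1) \<open>e > 0\<close> by (intro tendstoD) auto
  with b(2) show "\<forall>\<^sub>F k in sequentially. dist (a k) \<alpha> < e"
    by eventually_elim (use b(3) \<open>e > 0\<close> in \<open>simp only: dist_real_def; linarith\<close>)
qed

lemma diagonal_subsequence_convergent:
  fixes a :: "nat \<Rightarrow> nat \<Rightarrow> real"
  assumes bdd: "\<And>i k. \<bar>a i k\<bar> \<le> M i"
  shows "\<exists>r. strict_mono r \<and> (\<forall>i. convergent (\<lambda>k. a i (r k)))"
proof -
  let ?P = "\<lambda>i s. convergent (\<lambda>k. a i (s k))"
  interpret subseqs ?P
  proof
    fix i and s :: "nat \<Rightarrow> nat"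
    have "\<And>k. a i (s k) \<in> {- M i..M i}"
      using bdd by (simp add: abs_le_iff minus_le_iff)
    then obtain l s' where "strict_mono s'" "((\<lambda>k. a i (s k)) \<circ> s') \<longlonglongrightarrow> l"
      using compact_Icc compact_imp_seq_compact seq_compactE by metis
    then show "\<exists>r'. strict_mono r' \<and> ?P i (s \<circ> r')"
      by (auto simp: convergent_def comp_def)
  qed
  have "?P i diagseq" for i
  proof -
    have "?P i (diagseq \<circ> ((+) (Suc i)))"
    proof (rule diagseq_holds)
      fix r s :: "nat \<Rightarrow> nat" and n assume "strict_mono r" "?P n s"
      then show "?P n (s \<circ> r)"
        using convergent_subseq_convergent[of "\<lambda>k. a n (s k)" r] by (simp add: comp_def)
    qed
    then obtain L where "(\<lambda>k. a i (diagseq (k + Suc i))) \<longlonglongrightarrow> L"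
      by (auto simp: add.commute dest: convergentD)
    then have "(\<lambda>k. a i (diagseq k)) \<longlonglongrightarrow> L" by (rule LIMSEQ_offset)
    then show ?thesis by (auto simp: convergent_def)
  qed
  then show ?thesis using subseq_diagseq by blast
qed

lemma countable_Int_stable_generator:
  obtains G :: "'a::second_countable_topology set set"
  where "countable G" "Int_stable G" "borel = sigma UNIV G" "UNIV \<in> G"
proof -
  obtain B :: "'a set set" where B: "countable B" "topological_basis B"
    using ex_countable_basis by blast
  define G where "G = Inter ` {F. finite F \<and> F \<subseteq> B}"
  have "countable G"
    unfolding G_def by (intro countable_image countable_Collect_finite_subset B)
  moreover have "Int_stable G"
  proof (rule Int_stableI)
    fix a b assume "a \<in> G" "b \<in> G"
    then obtain F F' where "finite F" "F \<subseteq> B" "finite F'" "F' \<subseteq> B" "a = \<Inter>F" "b = \<Inter>F'"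
      unfolding G_def by blast
    then show "a \<inter> b \<in> G"
      unfolding G_def by (intro image_eqI[of _ _ "F \<union> F'"]) auto
  qed
  moreover have "UNIV \<in> G"
    unfolding G_def by (intro image_eqI[of _ _ "{}"]) auto
  moreover have "borel = sigma UNIV G"
  proof -
    have "B \<subseteq> G" unfolding G_def by (auto intro!: image_eqI[of _ Inter "{_}"])
    moreover have "open A" if "A \<in> G" for A
      using that topological_basis_open[OF B(2)] unfolding G_def by (auto intro!: open_Inter)
    ultimately have "sigma_sets UNIV G = sigma_sets UNIV B"
    proof (intro sigma_sets_eqI)
      fix A assume "A \<in> G"
      then have "A \<in> sets borel" using \<open>\<And>A. A \<in> G \<Longrightarrow> open A\<close> by simp
      then show "A \<in> sigma_sets UNIV B" by (simp add: borel_eq_countable_basis[OF B])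
    qed auto
    then show ?thesis unfolding borel_eq_countable_basis[OF B] by (intro sigma_eqI) auto
  qed
  ultimately show ?thesis using that by blast
qed

lemma AE_eq_if_set_integrals_eq:
  fixes f g :: "'a \<Rightarrow> real"
  assumes f: "integrable M f" and g: "integrable M g"
    and eq: "\<And>A. A \<in> sets M \<Longrightarrow> (\<integral>z. indicator A z * f z \<partial>M) = (\<integral>z. indicator A z * g z \<partial>M)"
  shows "AE z in M. f z = g z"
proof -
  have le: "AE z in M. f z \<le> g z"
    if f: "integrable M f" and g: "integrable M g"
      and eq: "\<And>A. A \<in> sets M \<Longrightarrow> (\<integral>z. indicator A z * f z \<partial>M) = (\<integral>z. indicator A z * g z \<partial>M)"
    for f g :: "'a \<Rightarrow> real"
  proof -
    define A where "A = {z \<in> space M. g z < f z}"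
    have [measurable]: "f \<in> borel_measurable M" "g \<in> borel_measurable M" using f g by auto
    have A: "A \<in> sets M" unfolding A_def by measurable
    have i: "integrable M (\<lambda>z. indicator A z * f z)" "integrable M (\<lambda>z. indicator A z * g z)"
      using integrable_mult_indicator[OF A f] integrable_mult_indicator[OF A g] by simp_all
    have "(\<integral>z. indicator A z * f z - indicator A z * g z \<partial>M) = 0"
      using i eq[OF A] by simp
    moreover have "AE z in M. 0 \<le> indicator A z * f z - indicator A z * g z"
      by (auto simp: A_def indicator_def)
    ultimately have "AE z in M. indicator A z * f z - indicator A z * g z = 0"
      using integral_nonneg_eq_0_iff_AE[OF Bochner_Integration.integrable_diff[OF i]] by simp
    with AE_space show ?thesis
      by eventually_elim (auto simp: A_def indicator_def split: if_splits)
  qed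
  have "AE z in M. f z \<le> g z" by (rule le[OF f g]) (rule eq)
  moreover have "AE z in M. g z \<le> f z" by (rule le[OF g f]) (rule eq[symmetric])
  ultimately show ?thesis by eventually_elim auto
qed

text \<open>
  Weak-star compactness in \<open>L\<^sup>\<infinity>\<close>, one sequence at a time. Convergence on a generator extends to all measurable
  sets by Dynkin's lemma; countable unions are handled by dominated convergence, as the integrals over \<open>A\<close> are at
  most the measure of \<open>A\<close>. The limit is an absolutely continuous measure, whose density is \<open>g\<close>.
\<close>

lemma (in finite_measure) weak_star_limit:
  fixes f :: "nat \<Rightarrow> 'a \<Rightarrow> real"
  assumes G: "Int_stable G" "G \<subseteq> Pow (space M)" "sets M = sigma_sets (space M) G" "space M \<in> G"
    and f: "\<And>k. f k \<in> borel_measurable M" "\<And>k z. 0 \<le> f k z" "\<And>k z. f k z \<le> 1"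
    and conv: "\<And>A. A \<in> G \<Longrightarrow> convergent (\<lambda>k. \<integral>z. indicator A z * f k z \<partial>M)"
  obtains g where "g \<in> borel_measurable M" "integrable M g" "\<And>z. 0 \<le> g z"
    "\<And>A. A \<in> sets M \<Longrightarrow> (\<lambda>k. \<integral>z. indicator A z * f k z \<partial>M) \<longlonglongrightarrow> (\<integral>z. indicator A z * g z \<partial>M)"
proof -
  note [measurable] = f(1)
  define I where "I A k = (\<integral>z. indicator A z * f k z \<partial>M)" for A k
  have bound: "integrable M (\<lambda>z. indicator A z * f k z)" if "A \<in> sets M" for A k
    by (rule integrable_const_bound[where B = 1])
      (use that f in \<open>auto simp: indicator_def abs_mult\<close>)
  have I0: "0 \<le> I A k" for A k
    unfolding I_def by (intro integral_nonneg_AE) (auto simp: f)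
  have I1: "I A k \<le> measure M A" if A: "A \<in> sets M" for A k
  proof -
    have "I A k \<le> (\<integral>z. indicator A z \<partial>M)"
      unfolding I_def
    proof (rule integral_mono[OF bound[OF A]])
      show "integrable M (indicator A :: 'a \<Rightarrow> real)"
        using A by (simp add: emeasure_finite less_top[symmetric])
    qed (use f in \<open>auto simp: indicator_def\<close>)
    then show ?thesis using A by simp
  qed
  have dom: "summable (\<lambda>i. measure M (A i))" if A: "range A \<subseteq> sets M" "disjoint_family A" for A
    using finite_measure_UNION[OF A] by (auto simp: sums_iff)
  have Isums: "(\<lambda>i. I (A i) k) sums I (\<Union>i. A i) k"
    if A: "range A \<subseteq> sets M" "disjoint_family A" for A k
  proof -
    have d: "\<And>i j. i \<noteq> j \<Longrightarrow> A i \<inter> A j = {}" using A(2) by (auto simp: disjoint_family_on_def)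
    have i: "set_integrable M (\<Union>i. A i) (f k)"
      unfolding set_integrable_def using bound[of "\<Union>i. A i" k] A by auto
    have "set_lebesgue_integral M (\<Union>i. A i) (f k) = (\<Sum>i. set_lebesgue_integral M (A i) (f k))"
      using A d i by (intro lebesgue_integral_countable_add) auto
    moreover have "summable (\<lambda>i. set_lebesgue_integral M (A i) (f k))"
    proof (rule summable_comparison_test[OF _ dom[OF A]])
      show "\<exists>N. \<forall>i\<ge>N. norm (set_lebesgue_integral M (A i) (f k)) \<le> measure M (A i)"
        using I0[of "A _" k] I1[of "A _" k] A by (auto simp: I_def set_lebesgue_integral_def)
    qed
    ultimately have "(\<lambda>i. set_lebesgue_integral M (A i) (f k)) sums set_lebesgue_integral M (\<Union>i. A i) (f k)"
      by (simp add: sums_iff)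
    then show ?thesis by (simp add: I_def set_lebesgue_integral_def)
  qed
  have lim_union: "(\<lambda>k. I (\<Union>i. A i) k) \<longlonglongrightarrow> (\<Sum>i. lim (I (A i)))" "summable (\<lambda>i. lim (I (A i)))"
    if A: "range A \<subseteq> sets M" "disjoint_family A" and c: "\<And>i. convergent (I (A i))" for A
  proof -
    have "I (\<Union>i. A i) = (\<lambda>k. \<Sum>i. I (A i) k)" using Isums[OF A] by (auto simp: sums_iff)
    moreover have "eventually (\<lambda>k. summable (\<lambda>i. norm (I (A i) k))) sequentially \<and>
        summable (\<lambda>i. norm (lim (I (A i)))) \<and>
        ((\<lambda>k. \<Sum>i. I (A i) k) \<longlongrightarrow> (\<Sum>i. lim (I (A i)))) sequentially"
    proof (rule tannerys_theorem[OF _ _ dom[OF A]])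
      show "(I (A i) \<longlongrightarrow> lim (I (A i))) sequentially" for i
        using c convergent_LIMSEQ_iff by blast
      show "\<forall>\<^sub>F (i, k) in at_top \<times>\<^sub>F sequentially. norm (I (A i) k) \<le> measure M (A i)"
        using I0 I1 A by (intro always_eventually) auto
    qed auto
    ultimately show "(\<lambda>k. I (\<Union>i. A i) k) \<longlonglongrightarrow> (\<Sum>i. lim (I (A i)))" "summable (\<lambda>i. lim (I (A i)))"
      by (auto intro: summable_rabs_cancel)
  qed
  have conv_all: "convergent (I A)" if "A \<in> sets M" for A
    using G(1,2) that[unfolded G(3)]
  proof (induct rule: sigma_sets_induct_disjoint)
    case (basic A)
    then show ?case using conv by (simp add: I_def[abs_def])
  next
    case empty
    have "I {} = (\<lambda>k. 0)" by (auto simp: I_def)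
    then show ?case by (simp add: convergent_const)
  next
    case (compl A)
    then have A: "A \<in> sets M" using G(3) by simp
    have "I (space M - A) = (\<lambda>k. I (space M) k - I A k)"
    proof
      fix k
      have "I (space M) k - I A k = (\<integral>z. indicator (space M) z * f k z - indicator A z * f k z \<partial>M)"
        unfolding I_def using bound[OF A] bound[of "space M"] by simp
      also have "\<dots> = I (space M - A) k"
        unfolding I_def using sets.sets_into_space[OF A]
        by (intro Bochner_Integration.integral_cong) (auto simp: indicator_def)
      finally show "I (space M - A) k = I (space M) k - I A k" by simp
    qed
    moreover have "convergent (I (space M))" using conv[OF G(4)] by (simp add: I_def[abs_def])
    ultimately show ?case using compl convergent_diff by metis
  next
    case (union A)
    then have "range A \<subseteq> sets M" using G(3) by simp
    then show ?case using lim_union(1)[of A] union by (auto simp: convergent_def)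
  qed
  define \<nu> where "\<nu> A = lim (I A)" for A
  have \<nu>lim: "I A \<longlonglongrightarrow> \<nu> A" if "A \<in> sets M" for A
    unfolding \<nu>_def using conv_all[OF that] convergent_LIMSEQ_iff by blast
  have \<nu>0: "0 \<le> \<nu> A" if "A \<in> sets M" for A
    by (rule LIMSEQ_le_const[OF \<nu>lim[OF that]]) (use I0 in auto)
  have \<nu>1: "\<nu> A \<le> measure M A" if "A \<in> sets M" for A
    by (rule LIMSEQ_le_const2[OF \<nu>lim[OF that]]) (use I1[OF that] in auto)
  have \<nu>sums: "(\<lambda>i. \<nu> (A i)) sums \<nu> (\<Union>i. A i)" if A: "range A \<subseteq> sets M" "disjoint_family A" for A
  proof -
    have c: "convergent (I (A i))" for i using A conv_all by auto
    have "\<nu> (\<Union>i. A i) = (\<Sum>i. \<nu> (A i))"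
      using LIMSEQ_unique[OF \<nu>lim lim_union(1)[OF A c]] A by (auto simp: \<nu>_def)
    then show ?thesis using lim_union(2)[OF A c] by (simp add: sums_iff \<nu>_def)
  qed
  define N where "N = measure_of (space M) (sets M) (\<lambda>A. ennreal (\<nu> A))"
  have sN: "sets N = sets M" and spN: "space N = space M" by (simp_all add: N_def)
  have eN: "emeasure N A = ennreal (\<nu> A)" if "A \<in> sets M" for A
  proof (rule emeasure_measure_of[OF N_def])
    show "sets M \<subseteq> Pow (space M)" by (rule sets.space_closed)
    show "A \<in> sets N" using that sN by simp
    show "positive (sets N) (\<lambda>A. ennreal (\<nu> A))"
      using \<nu>1[of "{}"] \<nu>0[of "{}"] by (simp add: positive_def)
    show "countably_additive (sets N) (\<lambda>A. ennreal (\<nu> A))"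
      unfolding sN
    proof (rule countably_additiveI)
      fix A :: "nat \<Rightarrow> 'a set" assume A: "range A \<subseteq> sets M" "disjoint_family A"
      then show "(\<Sum>i. ennreal (\<nu> (A i))) = ennreal (\<nu> (\<Union> (range A)))"
        using \<nu>sums[OF A] \<nu>0 by (intro suminf_ennreal_eq) auto
    qed
  qed
  have fN: "finite_measure N"
    by (rule finite_measureI) (simp add: spN eN)
  have ac: "absolutely_continuous M N"
    unfolding absolutely_continuous_def
  proof
    fix A assume A: "A \<in> null_sets M"
    then have "A \<in> sets M" "measure M A = 0" by (auto simp: measure_eq_0_null_sets)
    then have "\<nu> A = 0" using \<nu>0[of A] \<nu>1[of A] by simp
    then show "A \<in> null_sets N" using \<open>A \<in> sets M\<close> by (simp add: null_sets_def sN eN)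
  qed
  obtain h where h[measurable]: "h \<in> borel_measurable M" and hN: "density M h = N"
    using Radon_Nikodym_finite_measure[OF fN sN ac] by blast
  have hA: "(\<integral>\<^sup>+z. h z * indicator A z \<partial>M) = ennreal (\<nu> A)" if "A \<in> sets M" for A
    using that by (simp add: emeasure_density[symmetric] hN eN)
  have hfin: "AE z in M. h z \<noteq> \<infinity>"
  proof (rule nn_integral_noteq_infinite)
    have "(\<integral>\<^sup>+z. h z \<partial>M) = (\<integral>\<^sup>+z. h z * indicator (space M) z \<partial>M)"
      by (intro nn_integral_cong) simp
    then show "(\<integral>\<^sup>+z. h z \<partial>M) \<noteq> \<infinity>" using hA[of "space M"] by simp
  qed simp
  define g where "g z = enn2real (h z)" for z
  have g[measurable]: "g \<in> borel_measurable M" unfolding g_def by measurable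
  have g0: "0 \<le> g z" for z by (simp add: g_def)
  have gA: "(\<integral>\<^sup>+z. ennreal (indicator A z * g z) \<partial>M) = ennreal (\<nu> A)" if "A \<in> sets M" for A
    unfolding hA[OF that, symmetric]
    by (rule nn_integral_cong_AE)
      (use hfin in \<open>eventually_elim; auto simp: g_def indicator_def less_top\<close>)
  have gI: "(\<integral>z. indicator A z * g z \<partial>M) = \<nu> A" if A[measurable]: "A \<in> sets M" for A
    by (subst integral_eq_nn_integral) (use gA[OF A] g0 \<nu>0[OF A] in auto)
  have "integrable M g"
  proof (rule integrableI_bounded)
    have "(\<integral>\<^sup>+z. ennreal (norm (g z)) \<partial>M) = (\<integral>\<^sup>+z. ennreal (indicator (space M) z * g z) \<partial>M)"
      by (intro nn_integral_cong) (simp add: g0)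
    then show "(\<integral>\<^sup>+z. ennreal (norm (g z)) \<partial>M) < \<infinity>" using gA[of "space M"] by simp
  qed simp
  moreover have "(\<lambda>k. \<integral>z. indicator A z * f k z \<partial>M) \<longlonglongrightarrow> (\<integral>z. indicator A z * g z \<partial>M)"
    if "A \<in> sets M" for A
    using \<nu>lim[OF that] gI[OF that] by (simp add: I_def[abs_def])
  ultimately show ?thesis using that g g0 by blast
qed


text \<open>
  A bounded test function is uniformly close to a finite combination of indicators.
\<close>

lemma (in finite_measure) weak_star_bounded_test_function:
  fixes f :: "nat \<Rightarrow> 'a \<Rightarrow> real"
  assumes f: "\<And>k. f k \<in> borel_measurable M" "\<And>k z. 0 \<le> f k z" "\<And>k z. f k z \<le> 1"
    and g: "integrable M g"
    and lim: "\<And>A. A \<in> sets M \<Longrightarrow> (\<lambda>k. \<integral>z. indicator A z * f k z \<partial>M) \<longlonglongrightarrow> (\<integral>z. indicator A z * g z \<partial>M)"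
    and \<psi>[measurable]: "\<psi> \<in> borel_measurable M" and C: "\<And>z. \<bar>\<psi> z\<bar> \<le> C"
  shows "(\<lambda>k. \<integral>z. f k z * \<psi> z \<partial>M) \<longlonglongrightarrow> (\<integral>z. g z * \<psi> z \<partial>M)"
proof (rule tendsto_by_uniform_approximation)
  fix \<epsilon> :: real assume \<epsilon>: "\<epsilon> > 0"
  note [measurable] = f(1)
  have gm[measurable]: "g \<in> borel_measurable M" using g by simp
  define D where "D = measure M (space M) + (\<integral>z. \<bar>g z\<bar> \<partial>M) + 1"
  have D: "D > 0" "measure M (space M) \<le> D" "(\<integral>z. \<bar>g z\<bar> \<partial>M) \<le> D"
  proof -
    have "(\<integral>z. \<bar>g z\<bar> \<partial>M) \<ge> 0" "measure M (space M) \<ge> 0" by auto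
    then show "D > 0" "measure M (space M) \<le> D" "(\<integral>z. \<bar>g z\<bar> \<partial>M) \<le> D"
      unfolding D_def by linarith+
  qed
  define \<delta> where "\<delta> = \<epsilon> / D"
  have \<delta>: "\<delta> > 0" using \<epsilon> D by (simp add: \<delta>_def)
  define j where "j z = \<lfloor>\<psi> z / \<delta>\<rfloor>" for z
  define J where "J = {\<lfloor>- C / \<delta>\<rfloor>..\<lfloor>C / \<delta>\<rfloor>}"
  define A where "A i = {z \<in> space M. j z = i}" for i
  have A[measurable]: "A i \<in> sets M" for i unfolding A_def j_def by measurable
  have jJ: "j z \<in> J" for z
  proof -
    have "- C / \<delta> \<le> \<psi> z / \<delta>" "\<psi> z / \<delta> \<le> C / \<delta>"
      using C[of z] \<delta> by (simp_all add: field_simps abs_le_iff)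
    then show ?thesis by (auto simp: J_def j_def intro!: floor_mono)
  qed
  define \<phi> where "\<phi> z = (\<Sum>i\<in>J. \<delta> * of_int i * indicator (A i) z)" for z
  have \<phi>: "\<phi> z = \<delta> * of_int (j z)" if "z \<in> space M" for z
  proof -
    have "\<phi> z = (\<Sum>i\<in>J. if i = j z then \<delta> * of_int i else 0)"
      unfolding \<phi>_def using that by (intro sum.cong) (auto simp: A_def)
    then show ?thesis using jJ by (simp add: J_def)
  qed
  have close: "\<bar>\<psi> z - \<phi> z\<bar> \<le> \<delta>" if "z \<in> space M" for z
  proof -
    have "of_int (j z) \<le> \<psi> z / \<delta>" "\<psi> z / \<delta> < of_int (j z) + 1"
      unfolding j_def by linarith+
    then have "\<delta> * of_int (j z) \<le> \<psi> z" "\<psi> z \<le> \<delta> * of_int (j z) + \<delta>"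
      using \<delta> by (simp_all add: field_simps)
    then show ?thesis using \<phi>[OF that] by (simp add: abs_le_iff)
  qed
  have \<phi>m[measurable]: "\<phi> \<in> borel_measurable M" unfolding \<phi>_def by measurable
  have fint: "integrable M (f k)" for k
    by (rule integrable_const_bound[where B = 1]) (use f in auto)
  have prod: "integrable M (\<lambda>z. h z * \<theta> z)"
    if "integrable M h" and [measurable]: "\<theta> \<in> borel_measurable M" and "\<And>z. z \<in> space M \<Longrightarrow> \<bar>\<theta> z\<bar> \<le> B"
    for h \<theta> :: "'a \<Rightarrow> real" and B
  proof (rule Bochner_Integration.integrable_bound)
    show "integrable M (\<lambda>z. B * \<bar>h z\<bar>)" using that by simp
    show "AE z in M. norm (h z * \<theta> z) \<le> norm (B * \<bar>h z\<bar>)"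
    proof (rule AE_I2)
      fix z assume "z \<in> space M"
      then have "\<bar>\<theta> z\<bar> \<le> \<bar>B\<bar>" using that(3) by force
      then show "norm (h z * \<theta> z) \<le> norm (B * \<bar>h z\<bar>)"
        by (simp add: abs_mult mult.commute[of "\<bar>B\<bar>"] mult_left_mono)
    qed
    have [measurable]: "h \<in> borel_measurable M" using that(1) by simp
    show "(\<lambda>z. h z * \<theta> z) \<in> borel_measurable M" by measurable
  qed
  have \<phi>b: "\<bar>\<phi> z\<bar> \<le> C + \<delta>" if "z \<in> space M" for z using close[OF that] C[of z] by linarith
  have expand: "(\<integral>z. h z * \<phi> z \<partial>M) = (\<Sum>i\<in>J. \<delta> * of_int i * (\<integral>z. indicator (A i) z * h z \<partial>M))"
    if h: "integrable M h" for h
  proof -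
    have "(\<integral>z. h z * \<phi> z \<partial>M) = (\<integral>z. (\<Sum>i\<in>J. \<delta> * of_int i * (indicator (A i) z * h z)) \<partial>M)"
      by (intro Bochner_Integration.integral_cong) (auto simp: \<phi>_def sum_distrib_left mult_ac)
    also have "\<dots> = (\<Sum>i\<in>J. \<integral>z. \<delta> * of_int i * (indicator (A i) z * h z) \<partial>M)"
      using integrable_mult_indicator[OF A h] by (intro Bochner_Integration.integral_sum) auto
    finally show ?thesis by simp
  qed
  have err: "\<bar>(\<integral>z. h z * \<psi> z \<partial>M) - (\<integral>z. h z * \<phi> z \<partial>M)\<bar> \<le> \<delta> * (\<integral>z. \<bar>h z\<bar> \<partial>M)"
    if h: "integrable M h" for h
  proof -
    have "(\<integral>z. h z * \<psi> z \<partial>M) - (\<integral>z. h z * \<phi> z \<partial>M) = (\<integral>z. h z * (\<psi> z - \<phi> z) \<partial>M)"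
      using prod[OF h \<psi> C] prod[OF h \<phi>m \<phi>b] by (simp add: right_diff_distrib)
    also have "\<bar>\<dots>\<bar> \<le> (\<integral>z. \<bar>h z * (\<psi> z - \<phi> z)\<bar> \<partial>M)" by (rule integral_abs_bound)
    also have "\<dots> \<le> (\<integral>z. \<delta> * \<bar>h z\<bar> \<partial>M)"
    proof (rule integral_mono)
      show "integrable M (\<lambda>z. \<bar>h z * (\<psi> z - \<phi> z)\<bar>)"
        using prod[OF h _ close] by auto
      show "\<bar>h z * (\<psi> z - \<phi> z)\<bar> \<le> \<delta> * \<bar>h z\<bar>" if "z \<in> space M" for z
        using close[OF that] by (simp add: abs_mult mult.commute[of \<delta>] mult_left_mono)
    qed (use h in simp)
    finally show ?thesis by simp
  qed
  have "(\<lambda>k. \<integral>z. f k z * \<phi> z \<partial>M) \<longlonglongrightarrow> (\<integral>z. g z * \<phi> z \<partial>M)"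
    unfolding expand[OF fint] expand[OF g] by (intro tendsto_sum tendsto_mult_left lim A)
  moreover have "\<bar>(\<integral>z. f k z * \<psi> z \<partial>M) - (\<integral>z. f k z * \<phi> z \<partial>M)\<bar> \<le> \<epsilon>" for k
  proof -
    have "(\<integral>z. \<bar>f k z\<bar> \<partial>M) \<le> (\<integral>z. 1 \<partial>M)"
      using fint f by (intro integral_mono) auto
    then have "\<delta> * (\<integral>z. \<bar>f k z\<bar> \<partial>M) \<le> \<delta> * D" using D \<delta> by (intro mult_left_mono) auto
    also have "\<delta> * D = \<epsilon>" using D by (simp add: \<delta>_def)
    finally show ?thesis using err[OF fint[of k]] by linarith
  qed
  moreover have "\<bar>(\<integral>z. g z * \<psi> z \<partial>M) - (\<integral>z. g z * \<phi> z \<partial>M)\<bar> \<le> \<epsilon>"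
  proof -
    have "\<delta> * (\<integral>z. \<bar>g z\<bar> \<partial>M) \<le> \<delta> * D" using D \<delta> by (intro mult_left_mono) auto
    also have "\<delta> * D = \<epsilon>" using D by (simp add: \<delta>_def)
    finally show ?thesis using err[OF g] by linarith
  qed
  ultimately show "\<exists>b \<beta>. b \<longlonglongrightarrow> \<beta> \<and> (\<forall>\<^sub>F k in sequentially. \<bar>(\<integral>z. f k z * \<psi> z \<partial>M) - b k\<bar> \<le> \<epsilon>) \<and>
      \<bar>(\<integral>z. g z * \<psi> z \<partial>M) - \<beta>\<bar> \<le> \<epsilon>"
    by (intro exI conjI always_eventually) auto
qed

text \<open>
  The binary number that records in which of the first \<open>l\<close> sets of a sequence a point lies. The points with a given
  code form a cell of a partition, and the partition of level \<open>l + 1\<close> splits the cell \<open>i\<close> into \<open>2 i\<close> and \<open>2 i + 1\<close>.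
\<close>

primrec code :: "(nat \<Rightarrow> 'a set) \<Rightarrow> nat \<Rightarrow> 'a \<Rightarrow> nat" where
  "code B 0 x = 0"
| "code B (Suc l) x = 2 * code B l x + of_bool (x \<in> B l)"

lemma code_less: "code B l x < 2 ^ l"
  by (induction l) auto

lemma code_Suc_div: "code B (Suc l) x div 2 = code B l x"
  by simp

lemma code_eq_mono: "l \<le> l' \<Longrightarrow> code B l' x = code B l' y \<Longrightarrow> code B l x = code B l y"
proof (induction l' rule: dec_induct)
  case (step p)
  then have "code B p x = code B p y" by (metis code_Suc_div)
  with step show ?case by blast
qed

lemma code_eq_imp: "code B l x = code B l y \<Longrightarrow> i < l \<Longrightarrow> x \<in> B i \<longleftrightarrow> y \<in> B i"
proof -
  assume "code B l x = code B l y" "i < l"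
  then have "code B (Suc i) x = code B (Suc i) y" by (intro code_eq_mono[of "Suc i" l]) auto
  moreover from this have "code B i x = code B i y" by (rule code_eq_mono[rotated]) simp
  ultimately show ?thesis by (auto simp: of_bool_def split: if_splits)
qed

lemma code_measurable [measurable]:
  assumes "\<And>i. B i \<in> sets borel"
  shows "code B l \<in> measurable borel (count_space UNIV)"
proof (induction l)
  case 0
  have "code B 0 = (\<lambda>x. 0)" by auto
  then show ?case by simp
next
  case (Suc l)
  note [measurable] = Suc assms
  have "code B (Suc l) = (\<lambda>x. if x \<in> B l then 2 * code B l x + 1 else 2 * code B l x)" by auto
  then show ?case by simp
qed

text \<open>
  Finitely many basic sets of diameter less than \<open>\<epsilon>\<close> cover a compact set.
\<close>

lemma code_separates:
  fixes B :: "nat \<Rightarrow> 'a::metric_space set"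
  assumes B: "topological_basis (range B)" and C: "compact C" and e: "\<epsilon> > 0"
  shows "\<exists>l. \<forall>x\<in>C. \<forall>y. code B l x = code B l y \<longrightarrow> dist x y < \<epsilon>"
proof -
  define I where "I = {i. \<forall>x\<in>B i. \<forall>y\<in>B i. dist x y < \<epsilon>}"
  have "C \<subseteq> (\<Union>i\<in>I. B i)"
  proof
    fix x assume "x \<in> C"
    have "x \<in> ball x (\<epsilon> / 2)" using e by simp
    then obtain b where b: "b \<in> range B" "x \<in> b" "b \<subseteq> ball x (\<epsilon> / 2)"
      using topological_basisE[OF B open_ball] by metis
    then obtain i where i: "b = B i" by blast
    have "dist y z < \<epsilon>" if "y \<in> B i" "z \<in> B i" for y z
    proof (rule dist_triangle_half_r)
      show "dist x y < \<epsilon> / 2" "dist x z < \<epsilon> / 2" using b(3) that unfolding i by auto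
    qed
    then show "x \<in> (\<Union>i\<in>I. B i)" using b i by (auto simp: I_def)
  qed
  moreover have "open (B i)" for i using topological_basis_open[OF B] by simp
  ultimately obtain J where J: "J \<subseteq> I" "finite J" "C \<subseteq> (\<Union>i\<in>J. B i)"
    using compactE_image[OF C, of I B] by metis
  obtain l where l: "\<forall>i\<in>J. i < l" using finite_nat_iff_bounded[of J] J(2) by auto
  have "dist x y < \<epsilon>" if x: "x \<in> C" and xy: "code B l x = code B l y" for x y
  proof -
    obtain i where i: "i \<in> J" "x \<in> B i" using J(3) x by blast
    then have "y \<in> B i" using code_eq_imp[OF xy] l by auto
    then show ?thesis using i J by (auto simp: I_def)
  qed
  then show ?thesis by blast
qed

lemma sum_nat_split2: "(\<Sum>j<2 * i. f j) = (\<Sum>j<i. f (2 * j) + f (2 * j + 1))"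
  for f :: "nat \<Rightarrow> real"
  by (induction i) simp_all

text \<open>
  Consistent masses of the cells of all levels are realised by a random variable on the unit interval: on level
  \<open>l\<close> the interval is cut into consecutive pieces of lengths \<open>m l i\<close>, and \<open>X\<close> is the limit of the step functions with
  value \<open>rep l i\<close> on the \<open>i\<close>-th piece. The pieces of level \<open>l + 1\<close> refine those of level \<open>l\<close>, so the steps converge
  by \<open>code_separates\<close>. This avoids constructing a measure from a functional: only integrals of continuous
  functions matter.
\<close>

lemma random_variable_with_cell_masses:
  fixes C :: "'a::complete_space set" and m :: "nat \<Rightarrow> nat \<Rightarrow> real"
  assumes B: "topological_basis (range B)" and C: "compact C" and x0: "x0 \<in> C"
    and m0: "\<And>l i. m l i \<ge> 0" and m1: "m 0 0 = 1"
    and split: "\<And>l i. i < 2 ^ l \<Longrightarrow> m l i = m (Suc l) (2 * i) + m (Suc l) (2 * i + 1)"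
    and rep: "\<And>l i. i < 2 ^ l \<Longrightarrow> m l i > 0 \<Longrightarrow> rep l i \<in> C \<and> code B l (rep l i) = i"
  obtains X where "X \<in> borel_measurable (borel :: real measure)" "\<And>\<omega>. X \<omega> \<in> C"
    "\<And>(f :: 'a \<Rightarrow> real) l \<epsilon>. continuous_on C f \<Longrightarrow>
       (\<And>x y. x \<in> C \<Longrightarrow> y \<in> C \<Longrightarrow> code B l x = code B l y \<Longrightarrow> \<bar>f x - f y\<bar> \<le> \<epsilon>) \<Longrightarrow>
       \<bar>(LINT \<omega>:{0..<1}|lborel. f (X \<omega>)) - (\<Sum>i<2 ^ l. f (rep l i) * m l i)\<bar> \<le> \<epsilon>"
proof -
  define F where "F l i = (\<Sum>j<i. m l j)" for l i
  have F0: "F l 0 = 0" for l by (simp add: F_def)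
  have FS: "F l (Suc i) = F l i + m l i" for l i by (simp add: F_def)
  have Fmono: "i \<le> j \<Longrightarrow> F l i \<le> F l j" for i j l
    unfolding F_def by (intro sum_mono2) (auto simp: m0)
  have F2: "F (Suc l) (2 * i) = F l i" if "i \<le> 2 ^ l" for l i
    unfolding F_def sum_nat_split2 using that by (intro sum.cong refl split[symmetric]) auto
  have Ftop: "F l (2 ^ l) = 1" for l
  proof (induction l)
    case 0 then show ?case by (simp add: F_def m1)
  next
    case (Suc l) then show ?case using F2[of "2 ^ l" l] by simp
  qed
  define J where "J l \<omega> = (LEAST i. \<omega> < F l (Suc i))" for l \<omega>
  have J: "J l \<omega> < 2 ^ l" "F l (J l \<omega>) \<le> \<omega>" "\<omega> < F l (Suc (J l \<omega>))" if "\<omega> \<in> {0..<1}" for l \<omega>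
  proof -
    have ex: "\<omega> < F l (Suc (2 ^ l - 1))" using that Ftop[of l] by simp
    show "\<omega> < F l (Suc (J l \<omega>))" unfolding J_def using ex by (rule LeastI)
    have "J l \<omega> \<le> 2 ^ l - 1" unfolding J_def using ex by (rule Least_le)
    moreover have "(2::nat) ^ l > 0" by simp
    ultimately show "J l \<omega> < 2 ^ l" by linarith
    show "F l (J l \<omega>) \<le> \<omega>"
    proof (cases "J l \<omega>")
      case 0 then show ?thesis using that by (simp add: F0)
    next
      case (Suc q)
      then have "\<not> \<omega> < F l (Suc q)" using not_less_Least[of q "\<lambda>i. \<omega> < F l (Suc i)"] by (simp add: J_def)
      then show ?thesis using Suc by simp
    qed
  qed
  have Juniq: "J l \<omega> = i" if "\<omega> \<in> {0..<1}" "F l i \<le> \<omega>" "\<omega> < F l (Suc i)" for l \<omega> i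
  proof (rule ccontr)
    assume "J l \<omega> \<noteq> i"
    then consider "Suc (J l \<omega>) \<le> i" | "Suc i \<le> J l \<omega>" by linarith
    then show False
    proof cases
      case 1 then show False using J(3)[OF that(1), of l] Fmono[OF 1, of l] that by linarith
    next
      case 2 then show False using J(2)[OF that(1), of l] Fmono[OF 2, of l] that by linarith
    qed
  qed
  have Jdiv: "J (Suc l) \<omega> div 2 = J l \<omega>" if "\<omega> \<in> {0..<1}" for l \<omega>
  proof -
    define q where "q = J (Suc l) \<omega>"
    have q: "q < 2 * 2 ^ l" using J(1)[OF that, of "Suc l"] by (simp add: q_def)
    have "F l (q div 2) = F (Suc l) (2 * (q div 2))" using q by (intro F2[symmetric]) simp
    also have "\<dots> \<le> F (Suc l) q" by (intro Fmono) simp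
    also have "\<dots> \<le> \<omega>" unfolding q_def by (rule J(2)[OF that])
    finally have 1: "F l (q div 2) \<le> \<omega>" .
    have "\<omega> < F (Suc l) (Suc q)" unfolding q_def by (rule J(3)[OF that])
    also have "\<dots> \<le> F (Suc l) (2 * Suc (q div 2))" by (intro Fmono) presburger
    also have "\<dots> = F l (Suc (q div 2))" using q by (intro F2) simp
    finally show ?thesis using Juniq[OF that 1] by (simp add: q_def)
  qed
  define Y where "Y l \<omega> = (if \<omega> \<in> {0..<1} then rep l (J l \<omega>) else x0)" for l \<omega>
  have Yin: "Y l \<omega> \<in> C" "\<omega> \<in> {0..<1} \<Longrightarrow> code B l (Y l \<omega>) = J l \<omega>" for l \<omega>
  proof -
    have "rep l (J l \<omega>) \<in> C \<and> code B l (rep l (J l \<omega>)) = J l \<omega>" if "\<omega> \<in> {0..<1}"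
      using J[OF that, of l] FS[of l "J l \<omega>"] by (intro rep) auto
    then show "Y l \<omega> \<in> C" "\<omega> \<in> {0..<1} \<Longrightarrow> code B l (Y l \<omega>) = J l \<omega>" using x0 by (auto simp: Y_def)
  qed
  have Ycode: "code B l (Y l' \<omega>) = code B l (Y l \<omega>)" if "l \<le> l'" for l l' \<omega>
  proof (cases "\<omega> \<in> {0..<1}")
    case True
    from \<open>l \<le> l'\<close> have "code B l (Y l' \<omega>) = J l \<omega>"
    proof (induction l rule: inc_induct)
      case base then show ?case using Yin(2)[OF True] .
    next
      case (step l) then show ?case using code_Suc_div Jdiv[OF True] by metis
    qed
    then show ?thesis using Yin(2)[OF True] by simp
  qed (simp add: Y_def del: atLeastLessThan_iff)
  have "\<exists>x\<in>C. (\<lambda>l. Y l \<omega>) \<longlonglongrightarrow> x" for \<omega>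
  proof -
    have "Cauchy (\<lambda>l. Y l \<omega>)"
    proof (rule metric_CauchyI)
      fix e :: real assume "e > 0"
      then obtain l where l: "\<forall>x\<in>C. \<forall>y. code B l x = code B l y \<longrightarrow> dist x y < e"
        using code_separates[OF B C] by blast
      have "dist (Y p \<omega>) (Y q \<omega>) < e" if "p \<ge> l" "q \<ge> l" for p q
        using l Yin(1) Ycode[OF that(1)] Ycode[OF that(2)] by metis
      then show "\<exists>M. \<forall>m\<ge>M. \<forall>n\<ge>M. dist (Y m \<omega>) (Y n \<omega>) < e" by blast
    qed
    then obtain x where x: "(\<lambda>l. Y l \<omega>) \<longlonglongrightarrow> x" using Cauchy_convergent convergent_def by metis
    then have "x \<in> C"
      using compact_imp_closed[OF C] Yin(1) closed_sequentially by metis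
    with x show ?thesis by blast
  qed
  then obtain X where X: "\<And>\<omega>. X \<omega> \<in> C" "\<And>\<omega>. (\<lambda>l. Y l \<omega>) \<longlonglongrightarrow> X \<omega>" by metis
  have Jm[measurable]: "J l \<in> measurable borel (count_space UNIV)" for l
    unfolding J_def by measurable
  have repm: "(\<lambda>\<omega>. rep l (J l \<omega>)) \<in> borel_measurable borel" for l
    by (rule measurable_compose[OF Jm]) simp
  have Ym[measurable]: "Y l \<in> borel_measurable borel" for l
    unfolding Y_def by (intro measurable_If repm) auto
  have Xm[measurable]: "X \<in> borel_measurable borel"
    by (rule borel_measurable_LIMSEQ_metric[of Y]) (use Ym X in auto)
  have "\<bar>(LINT \<omega>:{0..<1}|lborel. f (X \<omega>)) - (\<Sum>i<2 ^ l. f (rep l i) * m l i)\<bar> \<le> \<epsilon>"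
    if f: "continuous_on C f"
      and osc: "\<And>x y. x \<in> C \<Longrightarrow> y \<in> C \<Longrightarrow> code B l x = code B l y \<Longrightarrow> \<bar>f x - f y\<bar> \<le> \<epsilon>"
    for f :: "'a \<Rightarrow> real" and l \<epsilon>
  proof -
    define f' where "f' x = (if x \<in> C then f x else 0)" for x
    have f'm[measurable]: "f' \<in> borel_measurable borel"
      unfolding f'_def using compact_imp_closed[OF C] f
      by (intro borel_measurable_continuous_on_if) auto
    have XY: "\<bar>f (X \<omega>) - f (Y l \<omega>)\<bar> \<le> \<epsilon>" for \<omega>
    proof (rule LIMSEQ_le_const2)
      show "(\<lambda>q. \<bar>f (Y q \<omega>) - f (Y l \<omega>)\<bar>) \<longlonglongrightarrow> \<bar>f (X \<omega>) - f (Y l \<omega>)\<bar>"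
        by (intro tendsto_intros continuous_on_tendsto_compose[OF f X(2) X(1)] always_eventually allI Yin)
      show "\<exists>N. \<forall>q\<ge>N. \<bar>f (Y q \<omega>) - f (Y l \<omega>)\<bar> \<le> \<epsilon>"
        using osc Yin(1) Ycode by blast
    qed
    obtain M where M: "\<And>x. x \<in> C \<Longrightarrow> \<bar>f x\<bar> \<le> M"
      using compact_imp_bounded[OF compact_continuous_image[OF f C]] by (auto simp: bounded_iff)
    have intg: "set_integrable lborel {0..<1} (\<lambda>\<omega>. f (Z \<omega>))"
      if [measurable]: "Z \<in> borel_measurable borel" and Z: "\<And>\<omega>. Z \<omega> \<in> C" for Z :: "real \<Rightarrow> 'a"
    proof -
      have "(\<lambda>\<omega>. f (Z \<omega>)) = (\<lambda>\<omega>. f' (Z \<omega>))" using Z by (auto simp: f'_def)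
      then have [measurable]: "(\<lambda>\<omega>. f (Z \<omega>)) \<in> borel_measurable borel" by simp
      show ?thesis unfolding set_integrable_def
        by (rule integrableI_bounded_set_indicator[where B = M]) (use Z M in auto)
    qed
    have "(LINT \<omega>:{0..<1}|lborel. f (Y l \<omega>)) = (\<integral>\<omega>. (\<Sum>i<2 ^ l. f (rep l i) * indicator {F l i..<F l (Suc i)} \<omega>) \<partial>lborel)"
      unfolding set_lebesgue_integral_def
    proof (rule Bochner_Integration.integral_cong[OF refl])
      fix \<omega> :: real
      show "indicat_real {0..<1} \<omega> *\<^sub>R f (Y l \<omega>) = (\<Sum>i<2 ^ l. f (rep l i) * indicator {F l i..<F l (Suc i)} \<omega>)"
      proof (cases "\<omega> \<in> {0..<1}")
        case True
        have "indicator {F l i..<F l (Suc i)} \<omega> = (if i = J l \<omega> then 1 else 0 :: real)" for i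
        proof (cases "i = J l \<omega>")
          case eq: True
          then have "\<omega> \<in> {F l i..<F l (Suc i)}"
            unfolding atLeastLessThan_iff using J(2,3)[OF True, of l] by blast
          then show ?thesis using eq by (simp only: indicator_simps simp_thms if_True)
        next
          case ne: False
          then have "\<omega> \<notin> {F l i..<F l (Suc i)}"
            unfolding atLeastLessThan_iff using Juniq[OF True, of l i] by blast
          then show ?thesis using ne by (simp only: indicator_simps simp_thms if_False)
        qed
        then have "(\<Sum>i<2 ^ l. f (rep l i) * indicator {F l i..<F l (Suc i)} \<omega>)
            = (\<Sum>i<2 ^ l. if i = J l \<omega> then f (rep l i) else 0)"
          by (intro sum.cong) simp_all
        also have "\<dots> = f (Y l \<omega>)" using True J(1)[OF True, of l] by (simp add: Y_def)
        finally show ?thesis using True by simp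
      next
        case False
        have "\<omega> \<notin> {F l i..<F l (Suc i)}" if "i < 2 ^ l" for i
          using False Fmono[of 0 i l] Fmono[of "Suc i" "2 ^ l" l] F0 Ftop that by auto
        then have "(\<Sum>i<2 ^ l. f (rep l i) * indicat_real {F l i..<F l (Suc i)} \<omega>) = 0"
          by (intro sum.neutral ballI) (simp del: atLeastLessThan_iff)
        then show ?thesis using False by (simp del: atLeastLessThan_iff)
      qed
    qed
    also have "\<dots> = (\<Sum>i<2 ^ l. f (rep l i) * m l i)"
    proof (subst Bochner_Integration.integral_sum)
      show "(\<Sum>i<2 ^ l. \<integral>\<omega>. f (rep l i) * indicat_real {F l i..<F l (Suc i)} \<omega> \<partial>lborel)
          = (\<Sum>i<2 ^ l. f (rep l i) * m l i)"
        by (intro sum.cong) (simp_all add: FS m0)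
    qed (simp add: FS m0)
    finally have Yint: "(LINT \<omega>:{0..<1}|lborel. f (Y l \<omega>)) = (\<Sum>i<2 ^ l. f (rep l i) * m l i)" .
    have iX: "set_integrable lborel {0..<1} (\<lambda>\<omega>. f (X \<omega>))" using intg X(1) Xm by blast
    have iY: "set_integrable lborel {0..<1} (\<lambda>\<omega>. f (Y l \<omega>))" using intg Yin(1) Ym by blast
    have c: "set_integrable lborel {0..<1::real} (\<lambda>\<omega>. \<epsilon>)"
      unfolding set_integrable_def by (rule integrableI_bounded_set_indicator[where B = "\<bar>\<epsilon>\<bar>"]) auto
    have "\<bar>(LINT \<omega>:{0..<1}|lborel. f (X \<omega>)) - (LINT \<omega>:{0..<1}|lborel. f (Y l \<omega>))\<bar>
        = \<bar>LINT \<omega>:{0..<1}|lborel. f (X \<omega>) - f (Y l \<omega>)\<bar>"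
      using iX iY by (simp add: set_integral_diff)
    also have "\<dots> \<le> (LINT \<omega>:{0..<1}|lborel. \<bar>f (X \<omega>) - f (Y l \<omega>)\<bar>)"
      using set_integral_norm_bound[OF set_integral_diff(1)[OF iX iY]] by simp
    also have "\<dots> \<le> (LINT \<omega>:{0..<1::real}|lborel. \<epsilon>)"
      using set_integral_diff(1)[OF iX iY] XY c by (intro set_integral_mono set_integrable_abs) auto
    also have "\<dots> = \<epsilon>" by (simp add: set_lebesgue_integral_def)
    finally show ?thesis unfolding Yint .
  qed
  then show ?thesis using that[OF Xm X(1)] by blast
qed

lemma integral_density_indicator:
  fixes f :: "'a::topological_space \<Rightarrow> real"
  assumes [measurable]: "Q \<in> sets borel" "f \<in> borel_measurable borel" and M: "sets M = sets borel"
  shows "integral\<^sup>L (density M (indicator Q)) f = set_lebesgue_integral M Q f"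
proof -
  note measurable_cong_sets[OF M refl, measurable_cong]
  have "density M (indicator Q) = density M (\<lambda>z. ennreal (indicator Q z))"
    by (rule arg_cong[where f = "density M"]) (auto simp: indicator_def)
  moreover have "integral\<^sup>L (density M (\<lambda>z. ennreal (indicator Q z))) f = (\<integral>z. indicator Q z *\<^sub>R f z \<partial>M)"
    using M by (intro integral_density) auto
  ultimately show ?thesis by (simp add: set_lebesgue_integral_def)
qed

text \<open>
  The fundamental theorem on Young measures for sequences with values in a compact set. The measure at \<open>z\<close> is the
  law of \<open>X z\<close> under the uniform distribution on \<open>{0..<1}\<close>. A diagonal subsequence makes the indicator functions
  of all countably many cells \<open>{x. code B l x = i}\<close> converge weakly along \<open>u\<close>; the limit densities are for almost
  every \<open>z\<close> consistent masses of these cells, and a continuous function is uniformly close to a combination of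
  indicators of cells.
\<close>

theorem young_measure_exists:
  fixes u :: "nat \<Rightarrow> 'z::euclidean_space \<Rightarrow> 'a::euclidean_space"
  assumes Q: "Q \<in> sets borel" "emeasure lborel Q < \<infinity>"
    and C: "compact C" and um: "\<And>k. u k \<in> borel_measurable borel" and uC: "\<And>k z. u k z \<in> C"
  obtains r X where "strict_mono r"
    "\<And>z. X z \<in> borel_measurable (borel :: real measure)" "\<And>z \<omega>. X z \<omega> \<in> C"
    "\<And>f :: 'a \<Rightarrow> real. continuous_on C f \<Longrightarrow> (\<lambda>z. LINT \<omega>:{0..<1}|lborel. f (X z \<omega>)) \<in> borel_measurable borel"
    "\<And>(f :: 'a \<Rightarrow> real) \<psi> c. continuous_on C f \<Longrightarrow> \<psi> \<in> borel_measurable borel \<Longrightarrow> (\<And>z. \<bar>\<psi> z\<bar> \<le> c) \<Longrightarrow>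
       (\<lambda>k. LINT z:Q|lborel. f (u (r k) z) * \<psi> z)
         \<longlonglongrightarrow> (LINT z:Q|lborel. (LINT \<omega>:{0..<1}|lborel. f (X z \<omega>)) * \<psi> z)"
proof -
  define M :: "'z measure" where "M = density lborel (indicator Q)"
  have sM [measurable_cong]: "sets M = sets borel" and spM: "space M = UNIV" by (simp_all add: M_def)
  note [measurable] = um Q(1)
  interpret finite_measure M
    by (rule finite_measureI) (use Q in \<open>simp add: spM M_def emeasure_density\<close>)
  define x0 where "x0 = u 0 0"
  have x0: "x0 \<in> C" using uC by (simp add: x0_def)
  obtain BB :: "'a set set" where BB: "countable BB" "topological_basis BB"
    using ex_countable_basis by blast
  have "BB \<noteq> {}" using topological_basisE[OF BB(2) open_UNIV, of undefined] by auto
  define B where "B = from_nat_into BB"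
  have rB: "range B = BB" using BB(1) \<open>BB \<noteq> {}\<close> by (simp add: B_def)
  have B: "topological_basis (range B)" by (simp add: rB BB)
  have [measurable]: "B i \<in> sets borel" for i
    using topological_basis_open[OF B] by auto
  note cm = code_measurable[of B, OF \<open>\<And>i. B i \<in> sets borel\<close>]
  note [measurable] = cm
  obtain G :: "'z set set" where G: "countable G" "Int_stable G" "borel = sigma UNIV G" "UNIV \<in> G"
    using countable_Int_stable_generator by blast
  define GG where "GG = from_nat_into G"
  have rG: "range GG = G"
    unfolding GG_def using G(1,4) by (intro range_from_nat_into) auto
  have sG: "sets M = sigma_sets (space M) G"
    unfolding sM spM by (subst G(3)) simp
  define ci where "ci l i x = (if code B l x = i then 1 else 0 :: real)" for l i x
  have ci01: "0 \<le> ci l i x" "ci l i x \<le> 1" for l i x by (auto simp: ci_def)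
  have cim[measurable]: "(\<lambda>z. ci l i (u k z)) \<in> borel_measurable borel" for l i k
    unfolding ci_def by measurable
  define a where "a j k = (case prod_decode j of (p, q) \<Rightarrow> case prod_decode q of (l, i) \<Rightarrow>
      (\<integral>z. indicator (GG p) z * ci l i (u k z) \<partial>M))" for j k
  have bound: "\<bar>\<integral>z. indicator A z * ci l i (u k z) \<partial>M\<bar> \<le> measure M (space M)" if "A \<in> sets borel" for A l i k
  proof -
    have i: "integrable M (\<lambda>z. indicator A z * ci l i (u k z))"
      by (rule integrable_const_bound[where B = 1]) (use that ci01 in \<open>auto simp: indicator_def\<close>)
    have "\<bar>\<integral>z. indicator A z * ci l i (u k z) \<partial>M\<bar> \<le> (\<integral>z. \<bar>indicator A z * ci l i (u k z)\<bar> \<partial>M)"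
      by (rule integral_abs_bound)
    also have "\<dots> \<le> (\<integral>z. 1 \<partial>M)"
      using i ci01 by (intro integral_mono) (auto simp: indicator_def)
    finally show ?thesis by simp
  qed
  have Gb: "A \<in> sets borel" if "A \<in> G" for A using that by (subst G(3)) auto
  have "\<bar>a j k\<bar> \<le> measure M (space M)" for j k
    unfolding a_def using bound[OF Gb[OF rangeI[of GG, unfolded rG]]] by (simp split: prod.split)
  from diagonal_subsequence_convergent[of a "\<lambda>_. measure M (space M)", OF this] obtain r
    where r: "strict_mono r" "\<And>j. convergent (\<lambda>k. a j (r k))" by blast
  have conv: "convergent (\<lambda>k. \<integral>z. indicator A z * ci l i (u (r k) z) \<partial>M)" if A: "A \<in> G" for A l i
  proof -
    obtain p where p: "A = GG p" using A rG by blast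
    show ?thesis using r(2)[of "prod_encode (p, prod_encode (l, i))"] by (simp add: a_def p)
  qed
  define P where "P l i g \<longleftrightarrow> g \<in> borel_measurable M \<and> integrable M g \<and> (\<forall>z. 0 \<le> g z) \<and>
    (\<forall>A\<in>sets M. (\<lambda>k. \<integral>z. indicator A z * ci l i (u (r k) z) \<partial>M) \<longlonglongrightarrow> (\<integral>z. indicator A z * g z \<partial>M))"
    for l i g
  have "\<exists>g. P l i g" for l i
    unfolding P_def
    by (rule weak_star_limit[OF G(2) _ sG _ _ _ _ conv, of l i]) (use G(4) spM ci01 in auto)
  then have P: "P l i (SOME g. P l i g)" for l i by (rule someI_ex)
  define mm where "mm l i = (SOME g. P l i g)" for l i
  have mm: "\<And>l i. mm l i \<in> borel_measurable M" "\<And>l i. integrable M (mm l i)"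
    "\<And>l i z. 0 \<le> mm l i z" and lim: "\<And>l i A. A \<in> sets M \<Longrightarrow>
      (\<lambda>k. \<integral>z. indicator A z * ci l i (u (r k) z) \<partial>M) \<longlonglongrightarrow> (\<integral>z. indicator A z * mm l i z \<partial>M)"
    using P unfolding mm_def P_def by blast+
  have [measurable]: "mm l i \<in> borel_measurable borel" for l i
    using mm(1)[of l i] measurable_cong_sets[OF sM refl] by simp
  have intA: "integrable M (\<lambda>z. indicator A z * ci l i (u k z))" if "A \<in> sets M" for A l i k
    by (rule integrable_const_bound[where B = 1]) (use that ci01 in \<open>auto simp: indicator_def sM\<close>)
  have intm: "integrable M (\<lambda>z. indicator A z * mm l i z)" if "A \<in> sets M" for A l i
    using integrable_mult_indicator[OF that mm(2)] by simp
  have E1: "AE z in M. mm 0 0 z = 1"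
  proof (rule AE_eq_if_set_integrals_eq)
    fix A assume A: "A \<in> sets M"
    have "ci 0 0 x = 1" for x by (simp add: ci_def)
    then show "(\<integral>z. indicator A z * mm 0 0 z \<partial>M) = (\<integral>z. indicator A z * 1 \<partial>M)"
      using lim[OF A, of 0 0] by (intro LIMSEQ_unique[OF lim[OF A, of 0 0]]) simp
  qed (use mm in auto)
  have E2: "AE z in M. mm l i z = mm (Suc l) (2 * i) z + mm (Suc l) (2 * i + 1) z" for l i
  proof (rule AE_eq_if_set_integrals_eq)
    fix A assume A: "A \<in> sets M"
    have c: "ci l i x = ci (Suc l) (2 * i) x + ci (Suc l) (2 * i + 1) x" for x
      by (auto simp: ci_def) presburger+
    have "(\<integral>z. indicator A z * ci l i (u (r k) z) \<partial>M) = (\<integral>z. indicator A z * ci (Suc l) (2 * i) (u (r k) z) \<partial>M)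
        + (\<integral>z. indicator A z * ci (Suc l) (2 * i + 1) (u (r k) z) \<partial>M)" for k
      by (subst Bochner_Integration.integral_add[OF intA[OF A] intA[OF A], symmetric])
        (simp add: c distrib_left)
    then have "(\<integral>z. indicator A z * mm l i z \<partial>M)
      = (\<integral>z. indicator A z * mm (Suc l) (2 * i) z \<partial>M) + (\<integral>z. indicator A z * mm (Suc l) (2 * i + 1) z \<partial>M)"
      by (intro LIMSEQ_unique[OF lim[OF A, of l i]]) (simp add: tendsto_add lim[OF A] del: code.simps)
    also have "\<dots> = (\<integral>z. indicator A z * (mm (Suc l) (2 * i) z + mm (Suc l) (2 * i + 1) z) \<partial>M)"
      by (subst Bochner_Integration.integral_add[OF intm[OF A] intm[OF A], symmetric]) (simp add: distrib_left)
    finally show "(\<integral>z. indicator A z * mm l i z \<partial>M)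
      = (\<integral>z. indicator A z * (mm (Suc l) (2 * i) z + mm (Suc l) (2 * i + 1) z) \<partial>M)" .
  qed (use mm in auto)
  define empty_cell where "empty_cell l i \<longleftrightarrow> (\<forall>x\<in>C. code B l x \<noteq> i)" for l i
  have E3: "AE z in M. empty_cell l i \<longrightarrow> mm l i z = 0" for l i
  proof (cases "empty_cell l i")
    case True
    have "AE z in M. mm l i z = 0"
    proof (rule AE_eq_if_set_integrals_eq)
      fix A assume A: "A \<in> sets M"
      have "ci l i (u (r k) z) = 0" for k z using True uC by (auto simp: ci_def empty_cell_def)
      then show "(\<integral>z. indicator A z * mm l i z \<partial>M) = (\<integral>z. indicator A z * 0 \<partial>M)"
        by (intro LIMSEQ_unique[OF lim[OF A, of l i]]) simp
    qed (use mm in auto)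
    then show ?thesis by eventually_elim simp
  qed simp
  define good where "good z \<longleftrightarrow> mm 0 0 z = 1 \<and>
    (\<forall>l i. mm l i z = mm (Suc l) (2 * i) z + mm (Suc l) (2 * i + 1) z) \<and>
    (\<forall>l i. empty_cell l i \<longrightarrow> mm l i z = 0)" for z
  have AEgood: "AE z in M. good z"
    unfolding good_def using E1 E2 E3 by (simp add: AE_all_countable)
  have [measurable]: "Measurable.pred borel good"
    unfolding good_def by measurable
  \<comment> \<open>On the exceptional null set the masses are those of the Dirac measure at \<open>x0\<close>.\<close>
  define m where "m z l i = (if good z then mm l i z else ci l i x0)" for z l i
  have mmeas[measurable]: "(\<lambda>z. m z l i) \<in> borel_measurable borel" for l i
    unfolding m_def by measurable
  define rep where "rep l i = (SOME x. x \<in> C \<and> code B l x = i)" for l i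
  have rep: "rep l i \<in> C \<and> code B l (rep l i) = i" if "x \<in> C" "code B l x = i" for l i x
    unfolding rep_def by (rule someI[of _ x]) (use that in simp)
  define PX where "PX z X \<longleftrightarrow> X \<in> borel_measurable (borel :: real measure) \<and> (\<forall>\<omega>. X \<omega> \<in> C) \<and>
    (\<forall>(f :: 'a \<Rightarrow> real) l \<epsilon>. continuous_on C f \<longrightarrow>
       (\<forall>x y. x \<in> C \<longrightarrow> y \<in> C \<longrightarrow> code B l x = code B l y \<longrightarrow> \<bar>f x - f y\<bar> \<le> \<epsilon>) \<longrightarrow>
       \<bar>(LINT \<omega>:{0..<1}|lborel. f (X \<omega>)) - (\<Sum>i<2 ^ l. f (rep l i) * m z l i)\<bar> \<le> \<epsilon>)" for z X
  have "\<exists>X. PX z X" for z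
    unfolding PX_def
  proof (rule random_variable_with_cell_masses[OF B C x0, of "m z" rep])
    show "0 \<le> m z l i" for l i using mm ci01 by (simp add: m_def)
    have g: "mm 0 0 z = 1" "mm l i z = mm (Suc l) (2 * i) z + mm (Suc l) (2 * i + 1) z"
      "empty_cell l i \<Longrightarrow> mm l i z = 0" if "good z" for l i
      using that unfolding good_def by blast+
    show "m z 0 0 = 1" using g(1) by (simp add: m_def ci_def)
    show "m z l i = m z (Suc l) (2 * i) + m z (Suc l) (2 * i + 1)" for l i
    proof (cases "good z")
      case True then show ?thesis using g(2)[OF True, of l i] by (simp only: m_def if_True)
    next
      case False then show ?thesis by (auto simp: m_def ci_def) presburger+
    qed
    show "rep l i \<in> C \<and> code B l (rep l i) = i" if "0 < m z l i" for l i
    proof (cases "good z")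
      case True
      then have "\<not> empty_cell l i" using that g(3)[OF True, of l i] by (auto simp: m_def)
      then show ?thesis using rep by (auto simp: empty_cell_def)
    next
      case False
      then have "code B l x0 = i" using that by (auto simp: m_def ci_def split: if_splits)
      then show ?thesis using rep x0 by blast
    qed
  qed blast
  then have PX: "PX z (SOME X. PX z X)" for z by (rule someI_ex)
  define X where "X z = (SOME X. PX z X)" for z
  have X: "\<And>z. X z \<in> borel_measurable (borel :: real measure)" "\<And>z \<omega>. X z \<omega> \<in> C"
    and Xf: "\<And>z (f :: 'a \<Rightarrow> real) l \<epsilon>. continuous_on C f \<Longrightarrow>
       (\<And>x y. x \<in> C \<Longrightarrow> y \<in> C \<Longrightarrow> code B l x = code B l y \<Longrightarrow> \<bar>f x - f y\<bar> \<le> \<epsilon>) \<Longrightarrow>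
       \<bar>(LINT \<omega>:{0..<1}|lborel. f (X z \<omega>)) - (\<Sum>i<2 ^ l. f (rep l i) * m z l i)\<bar> \<le> \<epsilon>"
    using PX unfolding X_def PX_def by blast+
  define S where "S f l z = (\<Sum>i<2 ^ l. f (rep l i) * m z l i)" for f :: "'a \<Rightarrow> real" and l z
  have Sm[measurable]: "S f l \<in> borel_measurable borel" for f l unfolding S_def by measurable
  have osc: "\<exists>l. \<forall>x y. x \<in> C \<longrightarrow> y \<in> C \<longrightarrow> code B l x = code B l y \<longrightarrow> \<bar>f x - f y\<bar> \<le> \<epsilon>"
    if f: "continuous_on C f" and "\<epsilon> > 0" for f :: "'a \<Rightarrow> real" and \<epsilon>
  proof -
    obtain d where d: "d > 0" "\<And>x y. x \<in> C \<Longrightarrow> y \<in> C \<Longrightarrow> dist y x < d \<Longrightarrow> dist (f y) (f x) < \<epsilon>"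
      using compact_uniformly_continuous[OF f C] \<open>\<epsilon> > 0\<close> unfolding uniformly_continuous_on_def by metis
    obtain l where "\<forall>x\<in>C. \<forall>y. code B l x = code B l y \<longrightarrow> dist x y < d"
      using code_separates[OF B C d(1)] by blast
    then show ?thesis using d(2) by (intro exI[of _ l]) (auto simp: dist_real_def less_imp_le)
  qed
  have Am: "(\<lambda>z. LINT \<omega>:{0..<1}|lborel. f (X z \<omega>)) \<in> borel_measurable borel"
    if f: "continuous_on C f" for f :: "'a \<Rightarrow> real"
  proof -
    have "\<exists>l. \<forall>x y. x \<in> C \<longrightarrow> y \<in> C \<longrightarrow> code B l x = code B l y \<longrightarrow> \<bar>f x - f y\<bar> \<le> 1 / real (Suc N)" for N
      using osc[OF f] by simp
    then obtain l where l: "\<And>N x y. x \<in> C \<Longrightarrow> y \<in> C \<Longrightarrow> code B (l N) x = code B (l N) y \<Longrightarrow> \<bar>f x - f y\<bar> \<le> 1 / real (Suc N)"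
      by metis
    show ?thesis
    proof (rule borel_measurable_LIMSEQ_real[of _ "\<lambda>N. S f (l N)"])
      fix z
      have "\<bar>S f (l N) z - (LINT \<omega>:{0..<1}|lborel. f (X z \<omega>))\<bar> \<le> 1 / real (Suc N)" for N
        using Xf[where z = z and l = "l N", OF f l] by (simp add: S_def abs_minus_commute)
      then show "(\<lambda>N. S f (l N) z) \<longlonglongrightarrow> (LINT \<omega>:{0..<1}|lborel. f (X z \<omega>))"
        unfolding real_norm_def[symmetric] inverse_eq_divide[symmetric]
        by (rule LIM_zero_cancel[OF Lim_null_comparison[OF always_eventually[OF allI] LIMSEQ_inverse_real_of_nat]])
    qed simp
  qed
  have main: "(\<lambda>k. LINT z:Q|lborel. f (u (r k) z) * \<psi> z)
         \<longlonglongrightarrow> (LINT z:Q|lborel. (LINT \<omega>:{0..<1}|lborel. f (X z \<omega>)) * \<psi> z)"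
    if f: "continuous_on C f" and \<psi>[measurable]: "\<psi> \<in> borel_measurable borel" and c: "\<And>z. \<bar>\<psi> z\<bar> \<le> c"
    for f :: "'a \<Rightarrow> real" and \<psi> c
  proof -
    define Af where "Af z = (LINT \<omega>:{0..<1}|lborel. f (X z \<omega>))" for z
    have [measurable]: "Af \<in> borel_measurable borel" unfolding Af_def using Am[OF f] .
    define f' where "f' x = (if x \<in> C then f x else 0)" for x
    have f'm[measurable]: "f' \<in> borel_measurable borel"
      unfolding f'_def using compact_imp_closed[OF C] f
      by (intro borel_measurable_continuous_on_if) auto
    have "(\<lambda>z. f (u k z)) = (\<lambda>z. f' (u k z))" for k using uC by (auto simp: f'_def)
    then have fum[measurable]: "(\<lambda>z. f (u k z)) \<in> borel_measurable borel" for k by simp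
    have c0: "c \<ge> 0" using c[of undefined] by linarith
    have intg: "integrable M (\<lambda>z. h z * \<psi> z)" if "integrable M h" for h
    proof (rule Bochner_Integration.integrable_bound)
      show "integrable M (\<lambda>z. c * \<bar>h z\<bar>)" using that by simp
      show "AE z in M. norm (h z * \<psi> z) \<le> norm (c * \<bar>h z\<bar>)"
        using c c0 by (intro AE_I2) (simp add: abs_mult mult.commute[of c] mult_left_mono)
      show "(\<lambda>z. h z * \<psi> z) \<in> borel_measurable M"
        using borel_measurable_integrable[OF that] \<psi> by measurable
    qed
    obtain K where K: "\<And>x. x \<in> C \<Longrightarrow> \<bar>f x\<bar> \<le> K"
      using compact_imp_bounded[OF compact_continuous_image[OF f C]] by (auto simp: bounded_iff)
    have iu: "integrable M (\<lambda>z. f (u k z))" for k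
      by (rule integrable_const_bound[where B = K]) (use K uC in auto)
    have ici: "integrable M (\<lambda>z. ci l i (u k z))" for l i k
      by (rule integrable_const_bound[where B = 1]) (use ci01 in auto)
    have "(\<lambda>k. \<integral>z. f (u (r k) z) * \<psi> z \<partial>M) \<longlonglongrightarrow> (\<integral>z. Af z * \<psi> z \<partial>M)"
    proof (rule tendsto_by_uniform_approximation)
      fix \<epsilon> :: real assume \<epsilon>: "\<epsilon> > 0"
      define D where "D = c * measure M (space M) + 1"
      have D: "D > 0" "c * measure M (space M) \<le> D" using c0 by (auto simp: D_def add_nonneg_pos)
      obtain l where l: "\<And>x y. x \<in> C \<Longrightarrow> y \<in> C \<Longrightarrow> code B l x = code B l y \<Longrightarrow> \<bar>f x - f y\<bar> \<le> \<epsilon> / D"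
        using osc[OF f, of "\<epsilon> / D"] \<epsilon> D by auto
      have small: "\<bar>(\<integral>z. h z * \<psi> z \<partial>M) - (\<integral>z. h' z * \<psi> z \<partial>M)\<bar> \<le> \<epsilon>"
        if h: "integrable M h" "integrable M h'" and d: "\<And>z. \<bar>h z - h' z\<bar> \<le> \<epsilon> / D" for h h'
      proof -
        have i: "integrable M (\<lambda>z. (h z - h' z) * \<psi> z)" using intg h by simp
        have "(\<integral>z. h z * \<psi> z \<partial>M) - (\<integral>z. h' z * \<psi> z \<partial>M) = (\<integral>z. (h z - h' z) * \<psi> z \<partial>M)"
          using intg h by (simp add: left_diff_distrib)
        also have "\<bar>\<dots>\<bar> \<le> (\<integral>z. \<bar>(h z - h' z) * \<psi> z\<bar> \<partial>M)" by (rule integral_abs_bound)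
        also have "\<dots> \<le> (\<integral>z. \<epsilon> / D * c \<partial>M)"
        proof (rule integral_mono[OF integrable_abs[OF i]])
          show "\<bar>(h z - h' z) * \<psi> z\<bar> \<le> \<epsilon> / D * c" for z
            unfolding abs_mult using d c \<epsilon> D by (intro mult_mono) auto
        qed simp
        also have "\<dots> = \<epsilon> / D * (c * measure M (space M))" by simp
        also have "\<dots> \<le> \<epsilon> / D * D" using D \<epsilon> by (intro mult_left_mono) auto
        finally show ?thesis using D by simp
      qed
      have code_lt: "code B l x \<in> {..<2 ^ l}" for x using code_less by auto
      have Sci: "(\<Sum>i<2 ^ l. f (rep l i) * ci l i x) = f (rep l (code B l x))" for x
      proof -
        have "(\<Sum>i<2 ^ l. f (rep l i) * ci l i x) = (\<Sum>i<2 ^ l. if i = code B l x then f (rep l i) else 0)"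
          by (intro sum.cong) (auto simp: ci_def)
        then show ?thesis using code_lt[of x] by simp
      qed
      define b where "b k = (\<integral>z. (\<Sum>i<2 ^ l. f (rep l i) * ci l i (u (r k) z)) * \<psi> z \<partial>M)" for k
      have bsum: "b k = (\<Sum>i<2 ^ l. f (rep l i) * (\<integral>z. ci l i (u (r k) z) * \<psi> z \<partial>M))" for k
        unfolding b_def sum_distrib_right
        by (subst Bochner_Integration.integral_sum) (use intg[OF ici] in \<open>simp_all add: mult.assoc\<close>)
      define \<beta> where "\<beta> = (\<Sum>i<2 ^ l. f (rep l i) * (\<integral>z. mm l i z * \<psi> z \<partial>M))"
      have "b \<longlonglongrightarrow> \<beta>"
        unfolding bsum[abs_def] \<beta>_def
      proof (intro tendsto_sum tendsto_mult_left)
        fix i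
        show "(\<lambda>k. \<integral>z. ci l i (u (r k) z) * \<psi> z \<partial>M) \<longlonglongrightarrow> (\<integral>z. mm l i z * \<psi> z \<partial>M)"
          by (rule weak_star_bounded_test_function[OF _ _ _ mm(2) lim _ c]) (use ci01 in auto)
      qed
      moreover have "\<bar>(\<integral>z. f (u (r k) z) * \<psi> z \<partial>M) - b k\<bar> \<le> \<epsilon>" for k
        unfolding b_def
      proof (rule small)
        show "integrable M (\<lambda>z. \<Sum>i<2 ^ l. f (rep l i) * ci l i (u (r k) z))"
          using ici by simp
        show "\<bar>f (u (r k) z) - (\<Sum>i<2 ^ l. f (rep l i) * ci l i (u (r k) z))\<bar> \<le> \<epsilon> / D" for z
          unfolding Sci using l uC rep[OF uC refl] by metis
      qed (rule iu)
      moreover have "\<bar>(\<integral>z. Af z * \<psi> z \<partial>M) - \<beta>\<bar> \<le> \<epsilon>"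
      proof -
        have "\<beta> = (\<integral>z. (\<Sum>i<2 ^ l. f (rep l i) * mm l i z) * \<psi> z \<partial>M)"
          unfolding \<beta>_def sum_distrib_right
          by (subst Bochner_Integration.integral_sum) (use intg[OF mm(2)] in \<open>simp_all add: mult.assoc\<close>)
        also have "\<dots> = (\<integral>z. S f l z * \<psi> z \<partial>M)"
        proof (rule integral_cong_AE)
          show "AE z in M. (\<Sum>i<2 ^ l. f (rep l i) * mm l i z) * \<psi> z = S f l z * \<psi> z"
            using AEgood by eventually_elim (simp add: S_def m_def)
        qed measurable
        finally have \<beta>: "\<beta> = (\<integral>z. S f l z * \<psi> z \<partial>M)" .
        have close: "\<bar>Af z - S f l z\<bar> \<le> \<epsilon> / D" for z
          unfolding Af_def S_def using Xf[OF f l] by blast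
        have iS: "integrable M (S f l)"
        proof -
          have "integrable M (\<lambda>z. \<Sum>i<2 ^ l. f (rep l i) * mm l i z)" using mm(2) by simp
          then show ?thesis
          proof (rule integrable_cong_AE_imp)
            show "AE z in M. (\<Sum>i<2 ^ l. f (rep l i) * mm l i z) = S f l z"
              using AEgood by eventually_elim (simp add: S_def m_def)
          qed measurable
        qed
        have "integrable M (\<lambda>z. \<bar>S f l z\<bar> + \<epsilon> / D)" using iS by simp
        then have "integrable M Af"
        proof (rule Bochner_Integration.integrable_bound)
          have "norm (Af z) \<le> norm (\<bar>S f l z\<bar> + \<epsilon> / D)" for z
            using close[of z] unfolding real_norm_def by linarith
          then show "AE z in M. norm (Af z) \<le> norm (\<bar>S f l z\<bar> + \<epsilon> / D)" by simp
        qed measurable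
        then show ?thesis unfolding \<beta> using iS close by (rule small)
      qed
      ultimately show "\<exists>b \<beta>. b \<longlonglongrightarrow> \<beta> \<and> (\<forall>\<^sub>F k in sequentially. \<bar>(\<integral>z. f (u (r k) z) * \<psi> z \<partial>M) - b k\<bar> \<le> \<epsilon>) \<and>
          \<bar>(\<integral>z. Af z * \<psi> z \<partial>M) - \<beta>\<bar> \<le> \<epsilon>"
        by (intro exI[of _ b] exI[of _ \<beta>]) auto
    qed
    then show ?thesis
      unfolding M_def by (simp add: integral_density_indicator Af_def[symmetric])
  qed
  show ?thesis by (rule that[OF r(1) X Am main])
qed

section \<open>Passage to the limit\<close>

text \<open>
  Numerical solutions on finer and finer meshes with values in a compact set \<open>C\<close> of admissible states, together with
  the Young measure that they generate: the measure at \<open>z\<close> is the law of \<open>X z\<close> under the uniform distribution on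
  \<open>{0..<1}\<close>. Only the uniform convergence \<open>init\<close> to the initial data is retained from the way in which these
  are discretised.
\<close>

locale lf_sequence =
  fixes \<gamma> T :: real and sch :: lf_scheme and n :: "nat \<Rightarrow> nat"
    and U :: "nat \<Rightarrow> real \<Rightarrow> int ^ 'n::finite \<Rightarrow> 'n state" and C :: "'n state set"
    and U0 :: "real ^ 'n \<Rightarrow> 'n state" and X :: "real \<times> (real ^ 'n) \<Rightarrow> real \<Rightarrow> 'n state"
  assumes gamma: "\<gamma> > 1" and T_pos: "T > 0" and compact_C: "compact C" and C_adm: "C \<subseteq> admissible \<gamma>"
    and n_lim: "filterlim n at_top sequentially"
    and run: "\<And>k. lf_run \<gamma> T sch (n k) (U k)"
    and inC: "\<And>k t K. 0 \<le> t \<Longrightarrow> t < T \<Longrightarrow> U k t K \<in> C"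
    and U0_meas: "U0 \<in> borel_measurable borel" and U0_C: "\<And>x. U0 x \<in> C"
    and init: "\<And>\<epsilon>. \<epsilon> > 0 \<Longrightarrow> \<forall>\<^sub>F k in sequentially. \<forall>K\<in>torus_cells (n k). \<forall>x\<in>cell (n k) K. norm (U k 0 K - U0 x) < \<epsilon>"
    and X_meas: "\<And>z. X z \<in> borel_measurable borel" and X_C: "\<And>z \<omega>. X z \<omega> \<in> C"
    and avg_meas: "\<And>f :: 'n state \<Rightarrow> real. continuous_on C f \<Longrightarrow>
       (\<lambda>z. LINT \<omega>:{0..<1}|lborel. f (X z \<omega>)) \<in> borel_measurable borel"
    and weak: "\<And>(f :: 'n state \<Rightarrow> real) \<psi> c. continuous_on C f \<Longrightarrow> \<psi> \<in> borel_measurable borel \<Longrightarrow> (\<And>z. \<bar>\<psi> z\<bar> \<le> c) \<Longrightarrow>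
       (\<lambda>k. LINT z:space_time T|lborel. f (grid_to_fun (n k) (U k) z) * \<psi> z)
         \<longlonglongrightarrow> (LINT z:space_time T|lborel. (LINT \<omega>:{0..<1}|lborel. f (X z \<omega>)) * \<psi> z)"
begin

definition avg :: "('n state \<Rightarrow> real) \<Rightarrow> real \<times> (real ^ 'n) \<Rightarrow> real" where
  "avg f z = (LINT \<omega>:{0..<1}|lborel. f (X z \<omega>))"

lemma C_nonempty: "C \<noteq> {}"
  using U0_C by auto

lemma continuous_on_C_bounded:
  assumes "continuous_on C (f :: 'n state \<Rightarrow> real)"
  shows "\<exists>B\<ge>0. \<forall>V\<in>C. \<bar>f V\<bar> \<le> B"
proof -
  obtain B where B: "\<And>V. V \<in> C \<Longrightarrow> \<bar>f V\<bar> \<le> B"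
    using compact_imp_bounded[OF compact_continuous_image[OF assms compact_C]] by (auto simp: bounded_iff)
  then have "\<bar>f V\<bar> \<le> \<bar>B\<bar>" if "V \<in> C" for V using that by fastforce
  then show ?thesis by (intro exI[of _ "\<bar>B\<bar>"]) auto
qed

lemma X_integrable:
  assumes "continuous_on C (f :: 'n state \<Rightarrow> real)"
  shows "set_integrable lborel {0..<1} (\<lambda>\<omega>. f (X z \<omega>))"
proof -
  obtain B where "B \<ge> 0" and B: "\<And>V. V \<in> C \<Longrightarrow> \<bar>f V\<bar> \<le> B" using continuous_on_C_bounded[OF assms] by blast
  have [measurable]: "(\<lambda>\<omega>. f (X z \<omega>)) \<in> borel_measurable borel"
    by (rule continuous_comp_measurable[OF compact_imp_closed[OF compact_C] assms X_meas X_C])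
  show ?thesis unfolding set_integrable_def
    by (rule integrableI_bounded_set_indicator[where B = B]) (use B X_C in auto)
qed

lemma unit_const: "set_integrable lborel {0..<1::real} (\<lambda>\<omega>. c :: real)" "(LINT \<omega>:{0..<1::real}|lborel. c) = (c :: real)"
proof -
  show "set_integrable lborel {0..<1::real} (\<lambda>\<omega>. c :: real)"
    unfolding set_integrable_def by (rule integrableI_bounded_set_indicator[where B = "\<bar>c\<bar>"]) auto
  show "(LINT \<omega>:{0..<1::real}|lborel. c) = (c :: real)" by (simp add: set_lebesgue_integral_def)
qed

lemma avg_le:
  assumes f: "continuous_on C f" and B: "\<And>V. V \<in> C \<Longrightarrow> f V \<le> B"
  shows "avg f z \<le> B"
proof -
  have "avg f z \<le> (LINT \<omega>:{0..<1::real}|lborel. B)"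
    unfolding avg_def by (rule set_integral_mono[OF X_integrable[OF f] unit_const(1)]) (use B X_C in auto)
  then show ?thesis by (simp only: unit_const)
qed

lemma avg_linear:
  assumes f: "continuous_on C f" and g: "continuous_on C g"
  shows "avg (\<lambda>V. f V + g V) z = avg f z + avg g z" "avg (\<lambda>V. f V - g V) z = avg f z - avg g z"
    "avg (\<lambda>V. - f V) z = - avg f z"
proof -
  show "avg (\<lambda>V. f V + g V) z = avg f z + avg g z" "avg (\<lambda>V. f V - g V) z = avg f z - avg g z"
    unfolding avg_def using X_integrable[OF f, of z] X_integrable[OF g, of z]
    by (simp_all add: set_integral_add set_integral_diff)
  show "avg (\<lambda>V. - f V) z = - avg f z" by (simp add: avg_def set_lebesgue_integral_def)
qed

lemma avg_bounded:
  assumes f: "continuous_on C f" and B: "\<And>V. V \<in> C \<Longrightarrow> \<bar>f V\<bar> \<le> B"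
  shows "\<bar>avg f z\<bar> \<le> B"
proof -
  have "avg f z \<le> B" by (rule avg_le[OF f]) (use B in force)
  moreover have "avg (\<lambda>V. - f V) z \<le> B"
    by (rule avg_le[OF continuous_on_minus[OF f]]) (use B in force)
  ultimately show ?thesis using avg_linear(3)[OF f f] by (simp add: abs_le_iff)
qed

lemma avg_measurable: "continuous_on C f \<Longrightarrow> avg f \<in> borel_measurable borel"
  unfolding avg_def by (rule avg_meas)

lemma initial_limit:
  fixes G :: "'n state \<Rightarrow> real" and \<psi> :: "real ^ 'n \<Rightarrow> real"
  assumes G: "continuous_on C G" and \<psi>: "continuous_on node_box \<psi>"
  shows "(\<lambda>k. (\<Sum>K\<in>torus_cells (n k). G (U k 0 K) * \<psi> (node (n k) K)) / real (n k) ^ CARD('n))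
    \<longlonglongrightarrow> (LINT x:torus|lborel. G (U0 x) * \<psi> x)"
proof -
  have closed_C: "closed C" by (rule compact_imp_closed[OF compact_C])
  have npos: "n k > 0" for k using lf_run.n_pos[OF run] .
  have cB: "compact (node_box :: (real ^ 'n) set)" by (simp add: node_box_def)
  obtain M where Mnn: "M \<ge> 0" and M: "\<And>V. V \<in> C \<Longrightarrow> \<bar>G V\<bar> \<le> M" using continuous_on_C_bounded[OF G] by blast
  obtain B' where B': "\<And>x. x \<in> node_box \<Longrightarrow> \<bar>\<psi> x\<bar> \<le> B'"
    using compact_imp_bounded[OF compact_continuous_image[OF \<psi> cB]] by (auto simp: bounded_iff)
  define B where "B = \<bar>B'\<bar>"
  have B: "\<bar>\<psi> x\<bar> \<le> B" if "x \<in> node_box" for x using B'[OF that] by (simp add: B_def)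
  have B0: "B \<ge> 0" by (simp add: B_def)
  define I where "I k = (\<Sum>K\<in>torus_cells (n k). G (U k 0 K) * \<psi> (node (n k) K)) / real (n k) ^ CARD('n)" for k
  have "I \<longlonglongrightarrow> (LINT x:torus|lborel. G (U0 x) * \<psi> x)"
  proof (rule LIMSEQ_I)
    fix e :: real assume e: "e > 0"
    define a where "a = e / (4 * (B + 1))"
    define b where "b = e / (4 * (M + 1))"
    have ab: "a > 0" "b > 0" using e B0 Mnn by (auto simp: a_def b_def)
    have quarter: "e / (4 * (p + 1)) * (p + 1) = e / 4" if "p \<ge> 0" for p :: real
      using that by (simp add: divide_simps)
    have aB: "a * B \<le> e / 4" and Mb: "M * b \<le> e / 4"
    proof -
      have "a * B \<le> a * (B + 1)" using ab by (intro mult_left_mono) auto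
      also have "\<dots> = e / 4" unfolding a_def by (rule quarter[OF B0])
      finally show "a * B \<le> e / 4" .
      have "M * b \<le> (M + 1) * b" using ab by (intro mult_right_mono) auto
      also have "\<dots> = e / 4" unfolding b_def mult.commute[of "M + 1"] by (rule quarter[OF Mnn])
      finally show "M * b \<le> e / 4" .
    qed
    obtain d where d: "d > 0" "\<And>V W. V \<in> C \<Longrightarrow> W \<in> C \<Longrightarrow> dist W V < d \<Longrightarrow> dist (G W) (G V) < a"
      using compact_uniformly_continuous[OF G compact_C] ab unfolding uniformly_continuous_on_def by metis
    obtain d' where d': "d' > 0" "\<And>x y. x \<in> node_box \<Longrightarrow> y \<in> node_box \<Longrightarrow> dist y x < d' \<Longrightarrow> dist (\<psi> y) (\<psi> x) < b"
      using compact_uniformly_continuous[OF \<psi> cB] ab unfolding uniformly_continuous_on_def by metis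
    obtain n1 where n1: "CARD('n) / d' < real n1" using reals_Archimedean2 by blast
    have i\<phi>: "set_integrable lborel torus (\<lambda>x. G (U0 x) * \<psi> x)"
    proof (rule set_integrable_torus_bounded)
      have "(\<lambda>x. if x \<in> node_box then \<psi> x else 0) \<in> borel_measurable borel"
        using compact_imp_closed[OF cB] by (intro borel_measurable_continuous_on_if \<psi>) auto
      moreover have "(\<lambda>x. G (U0 x)) \<in> borel_measurable borel"
        by (rule continuous_comp_measurable[OF closed_C G U0_meas U0_C])
      ultimately have "(\<lambda>x. indicator torus x * (G (U0 x) * (if x \<in> node_box then \<psi> x else 0))) \<in> borel_measurable borel"
        by (intro borel_measurable_times borel_measurable_indicator torus_borel)
      moreover have "(\<lambda>x. indicator torus x * (G (U0 x) * (if x \<in> node_box then \<psi> x else 0)))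
          = (\<lambda>x. indicator torus x * (G (U0 x) * \<psi> x))"
        by (intro ext) (use torus_subset_node_box in \<open>auto simp: indicator_def\<close>)
      ultimately show "(\<lambda>x. indicator torus x * (G (U0 x) * \<psi> x)) \<in> borel_measurable borel" by simp
      show "\<bar>G (U0 x) * \<psi> x\<bar> \<le> M * B" if "x \<in> torus" for x
        using M[OF U0_C] B that torus_subset_node_box Mnn B0
        unfolding abs_mult by (intro mult_mono) auto
    qed
    have "\<forall>\<^sub>F k in sequentially. n1 \<le> n k" using n_lim unfolding filterlim_at_top by blast
    with init[OF d(1)] have "\<forall>\<^sub>F k in sequentially. norm (I k - (LINT x:torus|lborel. G (U0 x) * \<psi> x)) < e"
    proof eventually_elim
      case (elim k)
      have small: "CARD('n) / real (n k) < d'"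
      proof -
        have "CARD('n) / d' < real (n k)" using n1 elim by linarith
        then show ?thesis using d'(1) npos[of k] by (simp add: field_simps)
      qed
      have "\<bar>I k - (LINT x:torus|lborel. G (U0 x) * \<psi> x)\<bar> \<le> e / 2"
        unfolding I_def
      proof (rule cell_sum_approximates_integral[OF npos i\<phi>])
        fix K :: "int ^ 'n" and x assume K: "K \<in> torus_cells (n k)" and x: "x \<in> cell (n k) K"
        have xB: "x \<in> node_box" "node (n k) K \<in> node_box"
          using cell_subset_torus[OF npos K] x node_in_torus(2)[OF npos K] torus_subset_node_box by auto
        have UC: "U k 0 K \<in> C" using inC T_pos by simp
        have g: "\<bar>G (U k 0 K) - G (U0 x)\<bar> \<le> a"
          using d(2)[OF U0_C UC, of x] elim(1) K x by (auto simp: dist_norm less_imp_le)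
        have "dist (node (n k) K) x < d'" using dist_in_cell[OF npos x] small by (simp add: dist_norm norm_minus_commute)
        then have f: "\<bar>\<psi> (node (n k) K) - \<psi> x\<bar> \<le> b"
          using d'(2)[OF xB] by (simp add: dist_norm less_imp_le)
        have diff: "G (U k 0 K) * \<psi> (node (n k) K) - G (U0 x) * \<psi> x
            = (G (U k 0 K) - G (U0 x)) * \<psi> (node (n k) K) + G (U0 x) * (\<psi> (node (n k) K) - \<psi> x)"
          by (simp add: algebra_simps)
        have "\<bar>G (U k 0 K) * \<psi> (node (n k) K) - G (U0 x) * \<psi> x\<bar> \<le> \<bar>G (U k 0 K) - G (U0 x)\<bar> * \<bar>\<psi> (node (n k) K)\<bar> + \<bar>G (U0 x)\<bar> * \<bar>\<psi> (node (n k) K) - \<psi> x\<bar>"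
          unfolding diff by (rule order_trans[OF abs_triangle_ineq]) (simp add: abs_mult)
        also have "\<dots> \<le> a * B + M * b"
          using g f M[OF U0_C] B[OF xB(2)] ab Mnn B0 by (intro add_mono mult_mono) auto
        finally show "\<bar>G (U k 0 K) * \<psi> (node (n k) K) - G (U0 x) * \<psi> x\<bar> \<le> e / 2" using aB Mb by linarith
      qed
      then show ?case using e by simp
    qed
    then show "\<exists>no. \<forall>k\<ge>no. norm (I k - (LINT x:torus|lborel. G (U0 x) * \<psi> x)) < e"
      by (simp add: eventually_sequentially)
  qed
  then show ?thesis by (simp add: I_def[abs_def])
qed

text \<open>
  The error terms in \<open>weak_form\<close> tend to zero: the consistency error because the derivatives of \<open>\<phi>\<close> are
  equicontinuous, the numerical diffusion by \<open>variation_vanishes\<close>.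
\<close>

lemma weak_form_limit:
  fixes G :: "'n state \<Rightarrow> real" and F :: "'n \<Rightarrow> 'n state \<Rightarrow> real"
  assumes G: "continuous_on C G" and F: "\<And>s. continuous_on C (F s)"
    and td: "test_data T \<phi> \<tau> B dt dx"
    and balance: "\<And>k t K. 0 < t \<Longrightarrow> t < T \<Longrightarrow> \<exists>g. ((\<lambda>t. G (U k t K)) has_real_derivative g) (at t) \<and>
        0 \<le> (g - scheme sch \<gamma> (n k) G F (U k t) K) * \<phi> (t, node (n k) K)"
  shows "(LINT z:space_time T|lborel. avg G z * dt z + (\<Sum>s\<in>UNIV. avg (F s) z * dx s z))
    \<le> - (LINT x:torus|lborel. G (U0 x) * \<phi> (0, x))"
proof -
  note tds = test_dataD[OF td]
  have closed_C: "closed C" by (rule compact_imp_closed[OF compact_C])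
  have \<tau>: "0 < \<tau>" "\<tau> < T" and B0: "0 \<le> B" by (rule tds)+
  obtain M0 where M0: "M0 \<ge> 0" "\<And>V. V \<in> C \<Longrightarrow> \<bar>G V\<bar> \<le> M0" using continuous_on_C_bounded[OF G] by blast
  have "\<forall>s. \<exists>M. M \<ge> 0 \<and> (\<forall>V\<in>C. \<bar>F s V\<bar> \<le> M)"
    using continuous_on_C_bounded[OF F] by (intro allI)
  from choice[OF this] obtain M1 where M1: "\<And>s. M1 s \<ge> 0" "\<And>s V. V \<in> C \<Longrightarrow> \<bar>F s V\<bar> \<le> M1 s" by blast
  define M where "M = M0 + (\<Sum>s\<in>UNIV. M1 s)"
  have M: "\<bar>G V\<bar> \<le> M" "\<bar>F s V\<bar> \<le> M" "M \<ge> 0" if "V \<in> C" for V s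
  proof -
    have "M1 s \<le> (\<Sum>s\<in>UNIV. M1 s)" by (rule member_le_sum) (use M1 in auto)
    moreover have "0 \<le> (\<Sum>s\<in>UNIV. M1 s)" by (intro sum_nonneg M1)
    ultimately show "\<bar>G V\<bar> \<le> M" "\<bar>F s V\<bar> \<le> M" "M \<ge> 0"
      using M0(2)[OF that] M1(2)[OF that, of s] M0(1) by (simp_all add: M_def)
  qed
  have Mnn: "M \<ge> 0" using M(3) U0_C by blast
  have adm: "dens V > 0" "pressure \<gamma> V > 0" if "V \<in> C" for V using that C_adm by (auto simp: admissible_def)
  have ws0: "0 \<le> wave_speed \<gamma> V" if "V \<in> C" for V
    using adm[OF that] gamma by (simp add: wave_speed_def)
  have "continuous_on C (wave_speed \<gamma>)"
    unfolding wave_speed_def[abs_def]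
    by (intro continuous_intros continuous_on_subset[OF continuous_on_pressure]) (use adm in \<open>auto dest: adm(1)\<close>)
  then obtain \<Lambda> where \<Lambda>: "\<Lambda> \<ge> 0" "\<And>V. V \<in> C \<Longrightarrow> \<bar>wave_speed \<gamma> V\<bar> \<le> \<Lambda>" using continuous_on_C_bounded by blast
  define L where "L k = (LINT z:space_time T|lborel. G (grid_to_fun (n k) (U k) z) * dt z + (\<Sum>s\<in>UNIV. F s (grid_to_fun (n k) (U k) z) * dx s z))" for k
  define I where "I k = (\<Sum>K\<in>torus_cells (n k). G (U k 0 K) * \<phi> (0, node (n k) K)) / real (n k) ^ CARD('n)" for k
  have npos: "n k > 0" for k using lf_run.n_pos[OF run] .
  have est: "\<forall>\<^sub>F k in sequentially. L k \<le> - I k + e" if e: "e > 0" for e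
  proof -
    define \<epsilon> where "\<epsilon> = e / (2 * (T * (M * (1 + CARD('n))) + 1))"
    define \<epsilon>' where "\<epsilon>' = e / (2 * (\<Lambda> * B + 1))"
    have p1: "T * (M * (1 + CARD('n))) \<ge> 0" using T_pos Mnn by simp
    have p2: "\<Lambda> * B \<ge> 0" using \<Lambda> B0 by simp
    have \<epsilon>: "\<epsilon> > 0" using e p1 by (simp add: \<epsilon>_def)
    have \<epsilon>': "\<epsilon>' > 0" using e p2 by (simp add: \<epsilon>'_def)
    have half: "e / (2 * (p + 1)) * (p + 1) = e / 2" if "p \<ge> 0" for p :: real
      using that by (simp add: divide_simps)
    have e1: "T * (M * \<epsilon> * (1 + CARD('n))) \<le> e / 2"
    proof -
      have "T * (M * \<epsilon> * (1 + CARD('n))) = \<epsilon> * (T * (M * (1 + CARD('n))))" by simp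
      also have "\<dots> \<le> \<epsilon> * (T * (M * (1 + CARD('n))) + 1)" using \<epsilon> by (intro mult_left_mono) auto
      also have "\<dots> = e / 2" unfolding \<epsilon>_def by (rule half[OF p1])
      finally show ?thesis .
    qed
    have e2: "\<Lambda> * B * \<epsilon>' \<le> e / 2"
    proof -
      have "\<Lambda> * B * \<epsilon>' \<le> (\<Lambda> * B + 1) * \<epsilon>'" using \<epsilon>' by (intro mult_right_mono) auto
      also have "\<dots> = e / 2" unfolding \<epsilon>'_def mult.commute[of "\<Lambda> * B + 1"] by (rule half[OF p2])
      finally show ?thesis .
    qed
    obtain \<delta> where \<delta>: "\<delta> > 0" "\<And>t x y s h. 0 \<le> t \<Longrightarrow> t < T \<Longrightarrow> x \<in> torus \<Longrightarrow> y \<in> torus \<Longrightarrow> norm (y - x) < \<delta> \<Longrightarrow>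
        0 < h \<Longrightarrow> h < \<delta> \<Longrightarrow> \<bar>dt (t, x) - dt (t, y)\<bar> \<le> \<epsilon> \<and>
        \<bar>(\<phi> (t, x + h *\<^sub>R axis s 1) - \<phi> (t, x - h *\<^sub>R axis s 1)) / (2 * h) - dx s (t, y)\<bar> \<le> \<epsilon>"
      using tds(18)[OF \<epsilon>] by blast
    obtain n0 where n0: "\<And>sch n U \<tau>. n \<ge> n0 \<Longrightarrow> lf_run \<gamma> T sch n U \<Longrightarrow> (\<And>t K. 0 \<le> t \<Longrightarrow> t < T \<Longrightarrow> U t K \<in> C) \<Longrightarrow> 0 \<le> \<tau> \<Longrightarrow> \<tau> < T \<Longrightarrow>
      (LINT t:{0..\<tau>}|lborel. variation n U G t) \<le> \<epsilon>'"
      using variation_vanishes[OF gamma compact_C C_adm C_nonempty G \<epsilon>' T_pos] by blast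
    obtain n1 where n1: "CARD('n) / \<delta> < real n1" using reals_Archimedean2 by blast
    have "\<forall>\<^sub>F k in sequentially. max n0 n1 \<le> n k" using n_lim unfolding filterlim_at_top by blast
    then show ?thesis
    proof eventually_elim
      case (elim k)
      interpret lf_run \<gamma> T sch "n k" "U k" by (rule run)
      have small: "CARD('n) / real (n k) < \<delta>"
      proof -
        have "CARD('n) / \<delta> < real (n k)" using n1 elim by linarith
        then show ?thesis using \<delta>(1) n_pos by (simp add: field_simps)
      qed
      have "1 / real (n k) \<le> CARD('n) / real (n k)" by (intro divide_right_mono) (auto simp: Suc_leI)
      then have h: "0 < 1 / real (n k)" "1 / real (n k) < \<delta>" using small n_pos by auto
      have dd: "\<bar>dt (t, node (n k) K) - dt (t, x)\<bar> \<le> \<epsilon> \<and>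
         \<bar>(\<phi> (t, node (n k) (K + axis s 1)) - \<phi> (t, node (n k) (K - axis s 1))) * (real (n k) / 2) - dx s (t, x)\<bar> \<le> \<epsilon>"
        if t: "0 \<le> t" "t < T" and K: "K \<in> torus_cells (n k)" and x: "x \<in> cell (n k) K" for t K x s
      proof -
        have xt: "x \<in> torus" using cell_subset_torus[OF n_pos K] x by blast
        have "norm (x - node (n k) K) < \<delta>" using dist_in_cell[OF n_pos x] small by linarith
        from \<delta>(2)[OF t node_in_torus(2)[OF n_pos K] xt this h, of s] show ?thesis
          by (simp add: node_shift)
      qed
      have "L k \<le> - I k + T * (M * \<epsilon> * (1 + CARD('n))) + \<Lambda> * B * (LINT t:{0..\<tau>}|lborel. variation (n k) (U k) G t)"
        unfolding L_def I_def
      proof (rule weak_form[OF closed_C inC G F M(1,2) _ _ td])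
        show "wave_speed \<gamma> V \<le> \<Lambda>" if "V \<in> C" for V using \<Lambda>(2)[OF that] by simp
      qed (use ws0 \<epsilon> dd balance in \<open>auto simp: less_imp_le\<close>)
      moreover have "\<Lambda> * B * (LINT t:{0..\<tau>}|lborel. variation (n k) (U k) G t) \<le> \<Lambda> * B * \<epsilon>'"
        using n0[OF _ run inC, of k \<tau>] elim \<tau> p2 by (intro mult_left_mono) auto
      ultimately show "L k \<le> - I k + e" using e1 e2 by linarith
    qed
  qed
  define cut where "cut f z = (if z \<in> space_time T then f z else 0)" for f :: "real \<times> (real ^ 'n) \<Rightarrow> real" and z
  have st: "space_time T \<subseteq> {0..<T} \<times> (UNIV :: (real ^ 'n) set)" by (auto simp: space_time_def)
  have cutm: "cut f \<in> borel_measurable borel" if "continuous_on ({0..<T} \<times> UNIV) f" for f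
    unfolding cut_def by (rule borel_measurable_continuous_on_if[OF space_time_borel continuous_on_subset[OF that st]]) auto
  have cutB: "\<bar>cut dt z\<bar> \<le> B" "\<bar>cut (dx s) z\<bar> \<le> B" for z s
    using tds(15)[of "fst z" "snd z"] tds(16)[of "fst z" "snd z" s] B0 torus_subset_node_box
    by (auto simp: cut_def space_time_def)
  have split: "(LINT z:space_time T|lborel. g z * dt z + (\<Sum>s\<in>UNIV. h s z * dx s z))
      = (LINT z:space_time T|lborel. g z * cut dt z) + (\<Sum>s\<in>UNIV. LINT z:space_time T|lborel. h s z * cut (dx s) z)"
    if g: "(\<lambda>z. indicator (space_time T) z * g z) \<in> borel_measurable borel" "\<And>z. z \<in> space_time T \<Longrightarrow> \<bar>g z\<bar> \<le> M"
      and h: "\<And>s. (\<lambda>z. indicator (space_time T) z * h s z) \<in> borel_measurable borel" "\<And>s z. z \<in> space_time T \<Longrightarrow> \<bar>h s z\<bar> \<le> M"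
    for g h
  proof -
    have i: "set_integrable lborel (space_time T) (\<lambda>z. a z * cut b z)"
      if "(\<lambda>z. indicator (space_time T) z * a z) \<in> borel_measurable borel" "\<And>z. z \<in> space_time T \<Longrightarrow> \<bar>a z\<bar> \<le> M"
        "cut b \<in> borel_measurable borel" "\<And>z. \<bar>cut b z\<bar> \<le> B" for a b
    proof -
      have "set_integrable lborel (space_time T) (\<lambda>z. (indicator (space_time T) z * a z) * cut b z)"
        by (rule integral_space_time(1)[where B = "M * B"])
          (use that Mnn B0 in \<open>auto simp: abs_mult intro!: mult_mono borel_measurable_times\<close>)
      moreover have "(\<lambda>z. indicator (space_time T) z *\<^sub>R ((indicator (space_time T) z * a z) * cut b z))
          = (\<lambda>z. indicator (space_time T) z *\<^sub>R (a z * cut b z))" by (auto simp: indicator_def)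
      ultimately show ?thesis by (simp add: set_integrable_def)
    qed
    have ig: "set_integrable lborel (space_time T) (\<lambda>z. g z * cut dt z)"
      by (rule i[OF g cutm[OF tds(12)] cutB(1)])
    have ih: "set_integrable lborel (space_time T) (\<lambda>z. h s z * cut (dx s) z)" for s
      by (rule i[OF h cutm[OF tds(13)] cutB(2)])
    have "(LINT z:space_time T|lborel. g z * dt z + (\<Sum>s\<in>UNIV. h s z * dx s z))
      = (LINT z:space_time T|lborel. g z * cut dt z + (\<Sum>s\<in>UNIV. h s z * cut (dx s) z))"
      by (rule set_lebesgue_integral_cong) (simp_all add: cut_def)
    also have "\<dots> = (LINT z:space_time T|lborel. g z * cut dt z) + (LINT z:space_time T|lborel. \<Sum>s\<in>UNIV. h s z * cut (dx s) z)"
    proof (rule set_integral_add(2)[OF ig])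
      show "set_integrable lborel (space_time T) (\<lambda>z. \<Sum>s\<in>UNIV. h s z * cut (dx s) z)"
        unfolding set_integrable_def scaleR_sum_right using ih
        by (intro Bochner_Integration.integrable_sum) (simp add: set_integrable_def)
    qed
    also have "(LINT z:space_time T|lborel. \<Sum>s\<in>UNIV. h s z * cut (dx s) z) = (\<Sum>s\<in>UNIV. LINT z:space_time T|lborel. h s z * cut (dx s) z)"
      unfolding set_lebesgue_integral_def scaleR_sum_right
      by (rule Bochner_Integration.integral_sum) (use ih in \<open>simp add: set_integrable_def\<close>)
    finally show ?thesis .
  qed
  have gridm: "(\<lambda>z. indicator (space_time T) z * f (grid_to_fun (n k) (U k) z)) \<in> borel_measurable borel"
    if f: "continuous_on C f" for f :: "'n state \<Rightarrow> real" and k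
  proof -
    define u where "u z = (if z \<in> space_time T then grid_to_fun (n k) (U k) z else U k 0 0)" for z
    have "u \<in> borel_measurable borel"
      unfolding u_def[abs_def] by (rule lf_run.grid_measurable[OF run])
    moreover have "u z \<in> C" for z
      using inC T_pos by (auto simp: u_def grid_to_fun_def space_time_def)
    ultimately have "(\<lambda>z. f (u z)) \<in> borel_measurable borel"
      using continuous_comp_measurable[OF closed_C f, of u borel] by blast
    then have "(\<lambda>z. indicator (space_time T) z * f (u z)) \<in> borel_measurable borel"
      by (intro borel_measurable_times borel_measurable_indicator space_time_borel)
    moreover have "(\<lambda>z. indicator (space_time T) z * f (u z)) = (\<lambda>z. indicator (space_time T) z * f (grid_to_fun (n k) (U k) z))"
      by (auto simp: u_def indicator_def)
    ultimately show ?thesis by simp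
  qed
  have gridC: "grid_to_fun (n k) (U k) z \<in> C" if "z \<in> space_time T" for k z
    using that inC by (auto simp: grid_to_fun_def space_time_def)
  have L_lim: "L \<longlonglongrightarrow> (LINT z:space_time T|lborel. avg G z * dt z + (\<Sum>s\<in>UNIV. avg (F s) z * dx s z))"
  proof -
    have "L = (\<lambda>k. (LINT z:space_time T|lborel. G (grid_to_fun (n k) (U k) z) * cut dt z)
        + (\<Sum>s\<in>UNIV. LINT z:space_time T|lborel. F s (grid_to_fun (n k) (U k) z) * cut (dx s) z))"
      unfolding L_def by (intro ext split gridm G F M gridC)
    moreover have "(LINT z:space_time T|lborel. avg G z * dt z + (\<Sum>s\<in>UNIV. avg (F s) z * dx s z))
       = (LINT z:space_time T|lborel. avg G z * cut dt z) + (\<Sum>s\<in>UNIV. LINT z:space_time T|lborel. avg (F s) z * cut (dx s) z)"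
      by (intro split avg_bounded G F M borel_measurable_times avg_measurable borel_measurable_indicator) auto
    ultimately show ?thesis
      using weak[OF G cutm[OF tds(12)] cutB(1)] weak[OF F cutm[OF tds(13)] cutB(2)]
      unfolding avg_def[symmetric] by (auto intro!: tendsto_add tendsto_sum)
  qed
  have I_lim: "I \<longlonglongrightarrow> (LINT x:torus|lborel. G (U0 x) * \<phi> (0, x))"
    unfolding I_def
  proof (rule initial_limit[OF G])
    show "continuous_on node_box (\<lambda>x. \<phi> (0, x))"
      by (rule continuous_on_compose2[OF tds(11)]) (use T_pos in \<open>auto intro!: continuous_intros\<close>)
  qed
  show ?thesis
  proof (rule field_le_epsilon)
    fix e :: real assume "e > 0"
    have "(\<lambda>k. - I k + e) \<longlonglongrightarrow> - (LINT x:torus|lborel. G (U0 x) * \<phi> (0, x)) + e"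
      by (intro tendsto_intros I_lim)
    from tendsto_le[OF _ this L_lim est[OF \<open>e > 0\<close>]]
    show "(LINT z:space_time T|lborel. avg G z * dt z + (\<Sum>s\<in>UNIV. avg (F s) z * dx s z))
      \<le> - (LINT x:torus|lborel. G (U0 x) * \<phi> (0, x)) + e" by simp
  qed
qed

end

section \<open>Smoothing of concave functions\<close>

lemma concave_increment_antimono:
  fixes chi :: "real \<Rightarrow> real"
  assumes "concave_on UNIV chi" "t \<le> s" "h > 0"
  shows "chi (s + h) - chi s \<le> chi (t + h) - chi t"
proof -
  define l where "l = h / (s - t + h)"
  have d: "s - t + h > 0" using assms by linarith
  have l: "0 \<le> l" "l \<le> 1" using assms d by (auto simp: l_def)
  have c: "u * chi a + (1 - u) * chi b \<le> chi (u * a + (1 - u) * b)" if "0 \<le> u" "u \<le> 1" for u a b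
  proof -
    have "convex_on UNIV (\<lambda>x. - chi x)" using assms(1) by (simp add: concave_on_def)
    from convex_onD[OF this, of "1 - u" a b] that show ?thesis by (simp add: algebra_simps)
  qed
  have "l * (s - t + h) = h" using d by (simp add: l_def)
  then have e: "l * t + (1 - l) * (s + h) = s" "(1 - l) * t + l * (s + h) = t + h" by (simp_all add: algebra_simps)
  have "l * chi t + (1 - l) * chi (s + h) \<le> chi s" using c[OF l, of t "s + h"] by (simp add: e)
  moreover have "(1 - l) * chi t + l * chi (s + h) \<le> chi (t + h)"
    using c[of "1 - l" t "s + h"] l by (simp add: e)
  ultimately show ?thesis by (simp add: algebra_simps)
qed

lemma antimono_derivative_tangent:
  fixes f f' :: "real \<Rightarrow> real"
  assumes d: "\<And>x. (f has_real_derivative f' x) (at x)" and anti: "\<And>x y. x \<le> y \<Longrightarrow> f' y \<le> f' x"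
  shows "f y \<le> f x + f' x * (y - x)"
proof (cases x y rule: linorder_cases)
  case less
  obtain z where z: "z > x" "z < y" "f y - f x = (y - x) * f' z" using MVT2[OF less d] by blast
  have "(y - x) * f' z \<le> (y - x) * f' x" using anti[of x z] z less by (intro mult_left_mono) auto
  then show ?thesis using z by (simp add: algebra_simps)
next
  case greater
  obtain z where z: "z > y" "z < x" "f x - f y = (x - y) * f' z" using MVT2[OF greater d] by blast
  have "(x - y) * f' x \<le> (x - y) * f' z" using anti[of z x] z greater by (intro mult_left_mono) auto
  then show ?thesis using z by (simp add: algebra_simps)
qed simp

lemma entropy_cutoff_continuous: "entropy_cutoff chi \<Longrightarrow> continuous_on UNIV chi"
proof -
  assume "entropy_cutoff chi"
  then have "convex_on UNIV (\<lambda>x. - chi x)" by (simp add: entropy_cutoff_def concave_on_def)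
  then have "continuous_on UNIV (\<lambda>x. - chi x)" by (intro convex_on_continuous) auto
  from continuous_on_minus[OF this] show ?thesis by simp
qed

text \<open>
  A concave function need not be differentiable along the trajectory of a cell. Its mean over \<open>[x, x + h]\<close> is, it is
  again increasing and concave, and by concavity the error is largest at the left end of a half-line.
\<close>

lemma smooth_entropy_cutoff:
  assumes chi: "entropy_cutoff chi" and h: "h > 0"
  shows "\<exists>f f'. (\<forall>x. (f has_real_derivative f' x) (at x)) \<and> (\<forall>x. f' x \<ge> 0) \<and> (\<forall>x y. f y \<le> f x + f' x * (y - x)) \<and>
    (\<forall>a x. a \<le> x \<longrightarrow> \<bar>f x - chi x\<bar> \<le> chi (a + h) - chi a)"
proof -
  have cont: "continuous_on UNIV chi" by (rule entropy_cutoff_continuous[OF chi])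
  have mono: "mono chi" and conc: "concave_on UNIV chi" using chi by (auto simp: entropy_cutoff_def)
  define F where "F s = (LBINT y=ereal 0..ereal s. chi y)" for s :: real
  have dF: "(F has_real_derivative chi x) (at x)" for x
  proof -
    have "(F has_vector_derivative chi x) (at x within {- \<bar>x\<bar> - 1..\<bar>x\<bar> + 1})"
      unfolding F_def
    proof (rule interval_integral_FTC2)
      show "- \<bar>x\<bar> - 1 \<le> 0" "0 \<le> \<bar>x\<bar> + 1" by linarith+
      show "continuous_on {- \<bar>x\<bar> - 1..\<bar>x\<bar> + 1} chi" by (rule continuous_on_subset[OF cont]) simp
      show "- \<bar>x\<bar> - 1 \<le> x" "x \<le> \<bar>x\<bar> + 1" by linarith+
    qed
    moreover have "- \<bar>x\<bar> - 1 < x" "x < \<bar>x\<bar> + 1" by linarith+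
    ultimately show ?thesis
      unfolding has_real_derivative_iff_has_vector_derivative by (metis at_within_Icc_at)
  qed
  define f where "f s = (F (s + h) - F s) / h" for s
  define f' where "f' s = (chi (s + h) - chi s) / h" for s
  have df: "(f has_real_derivative f' x) (at x)" for x
  proof -
    have "((\<lambda>s. F (s + h)) has_real_derivative chi (x + h)) (at x)"
      using DERIV_shift[of F "chi (x + h)" x h] dF[of "x + h"] by simp
    then show ?thesis unfolding f_def f'_def by (intro DERIV_cdivide DERIV_diff dF)
  qed
  have f'0: "f' x \<ge> 0" for x using monoD[OF mono, of x "x + h"] h by (simp add: f'_def)
  have anti: "f' y \<le> f' x" if "x \<le> y" for x y
    unfolding f'_def using concave_increment_antimono[OF conc that h] h by (intro divide_right_mono) auto
  have "\<bar>f x - chi x\<bar> \<le> chi (a + h) - chi a" if "a \<le> x" for a x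
  proof -
    obtain z where z: "x < z" "z < x + h" "F (x + h) - F x = (x + h - x) * chi z"
      using MVT2[of x "x + h" F chi] dF h by auto
    then have "f x = chi z" using h by (simp add: f_def)
    then have "chi x \<le> f x" "f x \<le> chi (x + h)" using monoD[OF mono] z by auto
    then show ?thesis using concave_increment_antimono[OF conc that h] by simp
  qed
  then show ?thesis using df f'0 antimono_derivative_tangent[OF df anti] by blast
qed

context lf_sequence
begin

section \<open>The limit equations\<close>

lemma set_integral_uminus: "(LINT x:A|M. - f x) = - (LINT x:A|M. (f x :: real))"
  by (simp add: set_lebesgue_integral_def)

lemma positive_on_C: "V \<in> C \<Longrightarrow> dens V > 0" "V \<in> C \<Longrightarrow> pressure \<gamma> V > 0"
  using C_adm by (auto simp: admissible_def)

lemma continuous_on_C_pressure: "continuous_on C (pressure \<gamma>)"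
  by (rule continuous_on_subset[OF continuous_on_pressure]) (use positive_on_C in auto)

lemma continuous_on_C_entropy: "continuous_on C (entropy \<gamma>)"
  by (rule continuous_on_subset[OF continuous_on_entropy]) (use positive_on_C in auto)

lemma continuous_on_C_flux: "continuous_on C (flux \<gamma> s)"
  unfolding flux_def[abs_def]
  by (intro continuous_intros continuous_on_C_pressure) (auto dest: positive_on_C(1))

text \<open>
  An equation, not just an inequality, since \<open>l\<close> may be replaced by \<open>- l\<close>.
\<close>

lemma conservation_law_limit:
  fixes l :: "'n state \<Rightarrow> real"
  assumes l: "bounded_linear l" and td: "test_data T \<phi> \<tau> B dt dx"
  shows "(LINT z:space_time T|lborel. avg l z * dt z + (\<Sum>s\<in>UNIV. avg (\<lambda>V. l (flux \<gamma> s V)) z * dx s z))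
    = - (LINT x:torus|lborel. l (U0 x) * \<phi> (0, x))"
proof -
  have le: "(LINT z:space_time T|lborel. avg l z * dt z + (\<Sum>s\<in>UNIV. avg (\<lambda>V. l (flux \<gamma> s V)) z * dx s z))
    \<le> - (LINT x:torus|lborel. l (U0 x) * \<phi> (0, x))" if l: "bounded_linear l" for l :: "'n state \<Rightarrow> real"
  proof (rule weak_form_limit[OF _ _ td])
    interpret l: bounded_linear l by (rule l)
    show "continuous_on C l" by (intro l.continuous_on continuous_on_id)
    show "continuous_on C (\<lambda>V. l (flux \<gamma> s V))" for s by (intro l.continuous_on continuous_on_C_flux)
    show "\<exists>g. ((\<lambda>t. l (U k t K)) has_real_derivative g) (at t) \<and>
        0 \<le> (g - scheme sch \<gamma> (n k) l (\<lambda>s V. l (flux \<gamma> s V)) (U k t) K) * \<phi> (t, node (n k) K)"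
      if "0 < t" "t < T" for k t K
      using l.has_vector_derivative[OF lf_run.ode[OF run that, of k K]]
      unfolding scheme_linear[OF l.linear_axioms] has_real_derivative_iff_has_vector_derivative
      by (intro exI conjI) auto
  qed
  have cl: "continuous_on C l" "continuous_on C (\<lambda>V. l (flux \<gamma> s V))" for s
    using bounded_linear.continuous_on[OF l] continuous_on_id continuous_on_C_flux by blast+
  have "(LINT z:space_time T|lborel. - (avg l z * dt z + (\<Sum>s\<in>UNIV. avg (\<lambda>V. l (flux \<gamma> s V)) z * dx s z)))
    \<le> - (LINT x:torus|lborel. - (l (U0 x) * \<phi> (0, x)))"
    using le[OF bounded_linear_minus[OF l]]
    by (simp add: avg_linear(3)[OF cl(1) cl(1)] avg_linear(3)[OF cl(2) cl(2)] sum_negf)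
  then have "- (LINT z:space_time T|lborel. avg l z * dt z + (\<Sum>s\<in>UNIV. avg (\<lambda>V. l (flux \<gamma> s V)) z * dx s z))
    \<le> (LINT x:torus|lborel. l (U0 x) * \<phi> (0, x))"
    unfolding set_integral_uminus by simp
  with le[OF l] show ?thesis by linarith
qed

text \<open>
  First for the smoothed functions of \<open>smooth_entropy_cutoff\<close>, which converge to \<open>chi\<close> uniformly on the bounded
  range of the entropy on \<open>C\<close>; then by dominated convergence.
\<close>

lemma entropy_limit:
  assumes chi: "entropy_cutoff chi" and td: "test_data T \<phi> \<tau> B dt dx"
    and \<phi>: "\<And>z. z \<in> {0..<T} \<times> UNIV \<Longrightarrow> \<phi> z \<ge> 0"
  shows "(LINT z:space_time T|lborel. avg (\<lambda>V. dens V * chi (entropy \<gamma> V)) z * dt z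
      + (\<Sum>s\<in>UNIV. avg (\<lambda>V. mom V $ s * chi (entropy \<gamma> V)) z * dx s z))
    \<le> - (LINT x:torus|lborel. dens (U0 x) * chi (entropy \<gamma> (U0 x)) * \<phi> (0, x))"
proof -
  have cchi: "continuous_on UNIV chi" by (rule entropy_cutoff_continuous[OF chi])
  obtain S where S: "S \<ge> 0" "\<And>V. V \<in> C \<Longrightarrow> \<bar>entropy \<gamma> V\<bar> \<le> S" using continuous_on_C_bounded[OF continuous_on_C_entropy] by blast
  define h where "h j = 1 / real (Suc j)" for j
  have h: "h j > 0" for j by (simp add: h_def)
  have "\<forall>j. \<exists>f. \<exists>f'. (\<forall>x. (f has_real_derivative f' x) (at x)) \<and> (\<forall>x. f' x \<ge> 0) \<and> (\<forall>x y. f y \<le> f x + f' x * (y - x)) \<and>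
    (\<forall>a x. a \<le> x \<longrightarrow> \<bar>f x - chi x\<bar> \<le> chi (a + h j) - chi a)"
    using smooth_entropy_cutoff[OF chi h] by blast
  from choice[OF this] obtain f where "\<forall>j. \<exists>f'. (\<forall>x. (f j has_real_derivative f' x) (at x)) \<and> (\<forall>x. f' x \<ge> 0) \<and> (\<forall>x y. f j y \<le> f j x + f' x * (y - x)) \<and>
    (\<forall>a x. a \<le> x \<longrightarrow> \<bar>f j x - chi x\<bar> \<le> chi (a + h j) - chi a)" ..
  from choice[OF this] obtain f' where f: "\<And>j x. (f j has_real_derivative f' j x) (at x)" "\<And>j x. f' j x \<ge> 0"
    "\<And>j x y. f j y \<le> f j x + f' j x * (y - x)" "\<And>j a x. a \<le> x \<Longrightarrow> \<bar>f j x - chi x\<bar> \<le> chi (a + h j) - chi a" by blast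
  define \<eta> where "\<eta> j = chi (- S + h j) - chi (- S)" for j
  have \<eta>: "\<eta> \<longlonglongrightarrow> 0"
  proof -
    have "h \<longlonglongrightarrow> 0" unfolding h_def using LIMSEQ_inverse_real_of_nat by (simp add: inverse_eq_divide)
    then have "(\<lambda>j. - S + h j) \<longlonglongrightarrow> - S" using tendsto_add[OF tendsto_const[of "- S"]] by fastforce
    moreover have "isCont chi (- S)" using cchi by (simp add: continuous_on_eq_continuous_at)
    ultimately have "(\<lambda>j. chi (- S + h j)) \<longlonglongrightarrow> chi (- S)" by (rule isCont_tendsto_compose[rotated])
    then show ?thesis unfolding \<eta>_def by (intro LIM_zero)
  qed
  have close: "\<bar>f j (entropy \<gamma> V) - chi (entropy \<gamma> V)\<bar> \<le> \<eta> j" if "V \<in> C" for j V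
    unfolding \<eta>_def by (rule f(4)) (use S(2)[OF that] in auto)
  have cf: "continuous_on UNIV (f j)" for j using f(1) DERIV_isCont by (intro continuous_at_imp_continuous_on) blast
  have cfe: "continuous_on C (\<lambda>V. f j (entropy \<gamma> V))" for j
    by (rule continuous_on_compose2[OF cf continuous_on_C_entropy]) auto
  have cce: "continuous_on C (\<lambda>V. chi (entropy \<gamma> V))"
    by (rule continuous_on_compose2[OF cchi continuous_on_C_entropy]) auto
  define G where "G g V = dens V * g (entropy \<gamma> V)" for g and V :: "'n state"
  define F where "F g s V = mom V $ s * g (entropy \<gamma> V)" for g s and V :: "'n state"
  have cG: "continuous_on C (G g)" and cF: "continuous_on C (F g s)" if "continuous_on C (\<lambda>V. g (entropy \<gamma> V))" for g s
    unfolding G_def F_def by (intro continuous_intros that)+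
  have ineq: "(LINT z:space_time T|lborel. avg (G (f j)) z * dt z + (\<Sum>s\<in>UNIV. avg (F (f j) s) z * dx s z))
    \<le> - (LINT x:torus|lborel. G (f j) (U0 x) * \<phi> (0, x))" for j
  proof (rule weak_form_limit[OF cG[OF cfe] cF[OF cfe] td])
    fix k t K assume t: "0 < t" "t < T"
    interpret lf_run \<gamma> T sch "n k" "U k" by (rule run)
    have p: "\<And>K. pressure \<gamma> (U k t K) > 0" using positive_on_C inC t by simp
    obtain g where g: "((\<lambda>t. dens (U k t K) * f j (entropy \<gamma> (U k t K))) has_real_derivative g) (at t)"
      "scheme sch \<gamma> (n k) (\<lambda>V. dens V * f j (entropy \<gamma> V)) (\<lambda>s V. mom V $ s * f j (entropy \<gamma> V)) (U k t) K
       + f' j (entropy \<gamma> (U k t K)) * entropy_dissipation t K \<le> g"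
      using entropy_balance[OF t p f(1) f(2) f(3)] by blast
    have "0 \<le> f' j (entropy \<gamma> (U k t K)) * entropy_dissipation t K"
      using f(2) entropy_dissipation_nonneg[OF _ t(2) p] t by (intro mult_nonneg_nonneg) auto
    then show "\<exists>g. ((\<lambda>t. G (f j) (U k t K)) has_real_derivative g) (at t) \<and>
        0 \<le> (g - scheme sch \<gamma> (n k) (G (f j)) (F (f j)) (U k t) K) * \<phi> (t, node (n k) K)"
      unfolding G_def F_def using g \<phi>[of "(t, node (n k) K)"] t
      by (intro exI[of _ g] conjI mult_nonneg_nonneg) auto
  qed
  obtain R where R: "R \<ge> 0" "\<And>V. V \<in> C \<Longrightarrow> norm V \<le> R"
  proof -
    obtain R where "\<And>V. V \<in> C \<Longrightarrow> norm V \<le> R" using compact_imp_bounded[OF compact_C] by (auto simp: bounded_iff)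
    then show ?thesis using that[of "max 0 R"] by (meson le_max_iff_disj max.cobounded1)
  qed
  have dm: "\<bar>dens V\<bar> \<le> R" "\<bar>mom V $ s\<bar> \<le> R" if "V \<in> C" for V s
  proof -
    obtain a b c where V: "V = (a, b, c)" by (cases V) auto
    have "norm a \<le> norm (a, b, c)" by (rule norm_fst_le)
    moreover have "norm b \<le> norm (a, b, c)" by (rule order_trans[OF norm_fst_le norm_snd_le])
    ultimately have n: "norm (dens V) \<le> norm V" "norm (mom V) \<le> norm V" by (simp_all only: V fst_conv snd_conv)
    then show "\<bar>dens V\<bar> \<le> R" "\<bar>mom V $ s\<bar> \<le> R"
      using R(2)[OF that] component_le_norm_cart[of "mom V" s] by simp_all
  qed
  have Gd: "\<bar>G (f j) V - G chi V\<bar> \<le> R * \<eta> j" and Fd: "\<bar>F (f j) s V - F chi s V\<bar> \<le> R * \<eta> j" if "V \<in> C" for j V s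
    unfolding G_def F_def right_diff_distrib[symmetric] abs_mult
    using dm[OF that] close[OF that] R by (auto intro!: mult_mono)
  have avg_lim: "(\<lambda>j. avg (g j) z) \<longlonglongrightarrow> avg g0 z"
    if "\<And>j. continuous_on C (g j)" "continuous_on C g0" "\<And>j V. V \<in> C \<Longrightarrow> \<bar>g j V - g0 V\<bar> \<le> R * \<eta> j" for g g0 z
  proof (rule LIM_zero_cancel, rule Lim_null_comparison[OF always_eventually[OF allI]])
    show "norm (avg (g j) z - avg g0 z) \<le> R * \<eta> j" for j
      using avg_bounded[OF continuous_on_diff[OF that(1)[of j] that(2)] that(3)]
      by (simp add: avg_linear(2)[OF that(1,2)])
    show "(\<lambda>j. R * \<eta> j) \<longlonglongrightarrow> 0" using tendsto_mult_left[OF \<eta>, of R] by simp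
  qed
  obtain E where E: "\<And>j. \<bar>\<eta> j\<bar> \<le> E" using convergent_imp_Bseq[OF convergentI[OF \<eta>]] by (auto simp: Bseq_def)
  obtain Mc where Mc: "Mc \<ge> 0" "\<And>V. V \<in> C \<Longrightarrow> \<bar>chi (entropy \<gamma> V)\<bar> \<le> Mc" using continuous_on_C_bounded[OF cce] by blast
  define M where "M = R * (Mc + E)"
  have fM: "\<bar>f j (entropy \<gamma> V)\<bar> \<le> Mc + E" if "V \<in> C" for j V
    using close[OF that, of j] Mc(2)[OF that] E[of j] by linarith
  have GM: "\<bar>G (f j) V\<bar> \<le> M" "\<bar>F (f j) s V\<bar> \<le> M" if "V \<in> C" for j V s
    unfolding G_def F_def abs_mult M_def using dm[OF that] fM[OF that, of j] R by (auto intro!: mult_mono)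
  have M0: "M \<ge> 0" using GM(1)[OF U0_C] abs_ge_zero order_trans by blast
  note tds = test_dataD[OF td]
  have B0: "B \<ge> 0" by (rule tds)
  define cut where "cut f z = (if z \<in> space_time T then f z else 0)" for f :: "real \<times> (real ^ 'n) \<Rightarrow> real" and z
  have st: "space_time T \<subseteq> {0..<T} \<times> (UNIV :: (real ^ 'n) set)" by (auto simp: space_time_def)
  have cutm: "cut f \<in> borel_measurable borel" if "continuous_on ({0..<T} \<times> UNIV) f" for f
    unfolding cut_def by (rule borel_measurable_continuous_on_if[OF space_time_borel continuous_on_subset[OF that st]]) auto
  have cutB: "\<bar>cut dt z\<bar> \<le> B" "\<bar>cut (dx s) z\<bar> \<le> B" for z s
    using tds(15)[of "fst z" "snd z"] tds(16)[of "fst z" "snd z" s] B0 torus_subset_node_box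
    by (auto simp: cut_def space_time_def)
  define e where "e g z = avg (G g) z * cut dt z + (\<Sum>s\<in>UNIV. avg (F g s) z * cut (dx s) z)" for g z
  have em: "e g \<in> borel_measurable borel" if "continuous_on C (\<lambda>V. g (entropy \<gamma> V))" for g
    unfolding e_def
    by (intro borel_measurable_add borel_measurable_sum borel_measurable_times cutm tds(12,13) avg_measurable cG cF that)
  have e_eq: "(LINT z:space_time T|lborel. avg (G g) z * dt z + (\<Sum>s\<in>UNIV. avg (F g s) z * dx s z)) = (LINT z:space_time T|lborel. e g z)" for g
    by (rule set_lebesgue_integral_cong) (simp_all add: e_def cut_def)
  have eB: "\<bar>e (f j) z\<bar> \<le> M * B + CARD('n) * (M * B)" for j z
  proof -
    have "\<bar>e (f j) z\<bar> \<le> \<bar>avg (G (f j)) z * cut dt z\<bar> + (\<Sum>s\<in>(UNIV :: 'n set). \<bar>avg (F (f j) s) z * cut (dx s) z\<bar>)"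
      unfolding e_def by (rule order_trans[OF abs_triangle_ineq add_left_mono[OF sum_abs]])
    also have "\<dots> \<le> M * B + (\<Sum>s\<in>(UNIV :: 'n set). M * B)"
      unfolding abs_mult using M0 B0
      by (intro add_mono sum_mono mult_mono cutB avg_bounded cG cF cfe GM) auto
    finally show ?thesis by simp
  qed
  have "(\<lambda>j. LINT z:space_time T|lborel. e (f j) z) \<longlonglongrightarrow> (LINT z:space_time T|lborel. e chi z)"
    unfolding set_lebesgue_integral_def
  proof (rule integral_dominated_convergence)
    show "integrable lborel (\<lambda>z. indicator (space_time T :: (real \<times> (real ^ 'n)) set) z * (M * B + CARD('n) * (M * B)))"
      by (intro integrable_mult_left integrable_real_indicator) (use emeasure_space_time_finite[of T, where 'n = 'n] space_time_borel in auto)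
    show "AE z in lborel. (\<lambda>j. indicator (space_time T) z *\<^sub>R e (f j) z) \<longlonglongrightarrow> indicator (space_time T) z *\<^sub>R e chi z"
      unfolding e_def by (intro AE_I2 tendsto_intros avg_lim cG cF cfe cce Gd Fd)
    show "AE z in lborel. norm (indicator (space_time T) z *\<^sub>R e (f j) z) \<le> indicator (space_time T) z * (M * B + CARD('n) * (M * B))" for j
      using eB by (intro AE_I2) (simp add: indicator_def)
  qed (use em[OF cfe] em[OF cce] in measurable)
  moreover have "(\<lambda>j. - (LINT x:torus|lborel. G (f j) (U0 x) * \<phi> (0, x))) \<longlonglongrightarrow> - (LINT x:torus|lborel. G chi (U0 x) * \<phi> (0, x))"
    unfolding set_lebesgue_integral_def
  proof (rule tendsto_minus, rule integral_dominated_convergence)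
    have \<phi>m: "(\<lambda>x. indicator torus x * \<phi> (0, x)) \<in> borel_measurable borel"
    proof -
      have "continuous_on node_box (\<lambda>x. \<phi> (0, x))"
        by (rule continuous_on_compose2[OF tds(11)]) (use T_pos in \<open>auto intro!: continuous_intros\<close>)
      then have "(\<lambda>x. if x \<in> node_box then \<phi> (0, x) else 0) \<in> borel_measurable borel"
        by (intro borel_measurable_continuous_on_if) (auto simp: node_box_def)
      then have "(\<lambda>x. indicator torus x * (if x \<in> node_box then \<phi> (0, x) else 0)) \<in> borel_measurable borel"
        by (intro borel_measurable_times borel_measurable_indicator torus_borel)
      moreover have "(\<lambda>x. indicator torus x * (if x \<in> node_box then \<phi> (0, x) else 0)) = (\<lambda>x. indicator torus x * \<phi> (0, x))"
        by (intro ext) (use torus_subset_node_box in \<open>auto simp: indicator_def\<close>)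
      ultimately show ?thesis by simp
    qed
    have m: "(\<lambda>x. indicator torus x *\<^sub>R (G g (U0 x) * \<phi> (0, x))) \<in> borel_measurable borel"
      if "continuous_on C (\<lambda>V. g (entropy \<gamma> V))" for g
    proof -
      have "(\<lambda>x. G g (U0 x)) \<in> borel_measurable borel"
        by (rule continuous_comp_measurable[OF compact_imp_closed[OF compact_C] cG[OF that] U0_meas U0_C])
      from borel_measurable_times[OF this \<phi>m] show ?thesis by (simp add: mult_ac)
    qed
    show "(\<lambda>x. indicator torus x *\<^sub>R (G chi (U0 x) * \<phi> (0, x))) \<in> borel_measurable lborel" using m[OF cce] by simp
    show "(\<lambda>x. indicator torus x *\<^sub>R (G (f j) (U0 x) * \<phi> (0, x))) \<in> borel_measurable lborel" for j using m[OF cfe] by simp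
    show "integrable lborel (\<lambda>x. indicator (torus :: (real ^ 'n) set) x * (M * B))" by (simp add: emeasure_torus)
    have "(\<lambda>j. f j (entropy \<gamma> V)) \<longlonglongrightarrow> chi (entropy \<gamma> V)" if "V \<in> C" for V
    proof (rule LIM_zero_cancel, rule Lim_null_comparison[OF always_eventually[OF allI]])
      show "norm (f j (entropy \<gamma> V) - chi (entropy \<gamma> V)) \<le> \<eta> j" for j using close[OF that] by simp
    qed (rule \<eta>)
    then show "AE x in lborel. (\<lambda>j. indicator torus x *\<^sub>R (G (f j) (U0 x) * \<phi> (0, x))) \<longlonglongrightarrow> indicator torus x *\<^sub>R (G chi (U0 x) * \<phi> (0, x))"
      unfolding G_def using U0_C by (intro AE_I2 tendsto_intros) blast
    show "AE x in lborel. norm (indicator torus x *\<^sub>R (G (f j) (U0 x) * \<phi> (0, x))) \<le> indicator torus x * (M * B)" for j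
    proof (rule AE_I2)
      fix x
      have "\<bar>G (f j) (U0 x) * \<phi> (0, x)\<bar> \<le> M * B" if "x \<in> torus"
        using GM(1)[OF U0_C] tds(14)[of 0 x] that torus_subset_node_box T_pos M0
        unfolding abs_mult by (intro mult_mono) auto
      then show "norm (indicator torus x *\<^sub>R (G (f j) (U0 x) * \<phi> (0, x))) \<le> indicator torus x * (M * B)"
        by (simp add: indicator_def)
    qed
  qed
  ultimately have "(LINT z:space_time T|lborel. e chi z) \<le> - (LINT x:torus|lborel. G chi (U0 x) * \<phi> (0, x))"
    by (rule LIMSEQ_le) (use ineq e_eq in auto)
  then show ?thesis unfolding e_eq[symmetric] unfolding G_def F_def .
qed

text \<open>
  The energy of a numerical solution is constant in time. Testing with indicator functions of sets of times shows that
  the energy of the limit is constant for almost every time.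
\<close>

lemma energy_conserved:
  "AE t in lborel. t \<in> {0<..<T} \<longrightarrow> (LINT x:torus|lborel. avg energy (t, x)) = (LINT x:torus|lborel. energy (U0 x))"
proof -
  define e0 where "e0 = (LINT x:torus|lborel. energy (U0 x))"
  have cE: "continuous_on C (\<lambda>V. energy V)" by (intro continuous_intros)
  obtain M where M: "M \<ge> 0" "\<And>V. V \<in> C \<Longrightarrow> \<bar>energy V\<bar> \<le> M" using continuous_on_C_bounded[OF cE] by blast
  have npos: "n k > 0" for k using lf_run.n_pos[OF run] .
  define ek where "ek k = (\<Sum>K\<in>torus_cells (n k). energy (U k 0 K)) / real (n k) ^ CARD('n)" for k
  have ek: "ek \<longlonglongrightarrow> e0"
    using initial_limit[OF cE continuous_on_const[of _ "1 :: real"]] by (simp add: ek_def[abs_def] e0_def)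
  have const: "(\<Sum>K\<in>torus_cells (n k). energy (U k t K)) / real (n k) ^ CARD('n) = ek k" if t: "0 < t" "t < T" for k t
  proof -
    interpret lf_run \<gamma> T sch "n k" "U k" by (rule run)
    define P where "P t = (\<Sum>K\<in>torus_cells (n k). energy (U k t K))" for t
    have "P t = P 0"
    proof (rule DERIV_isconst2[of 0 t])
      show "continuous_on {0..t} P" unfolding P_def
        by (intro continuous_intros continuous_on_subset[OF cont]) (use t in auto)
      fix r assume r: "0 < r" "r < t"
      have bl: "bounded_linear (\<lambda>V :: 'n state. energy V)" by (intro bounded_linear_intros)
      have "((\<lambda>t. energy (U k t K)) has_real_derivative scheme sch \<gamma> (n k) (\<lambda>V. energy V) (\<lambda>s V. energy (flux \<gamma> s V)) (U k r) K) (at r)" for K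
        using bounded_linear.has_vector_derivative[OF bl ode[of r K]] r t
        unfolding scheme_linear[OF bounded_linear.linear[OF bl]] has_real_derivative_iff_has_vector_derivative by simp
      then have "(P has_real_derivative (\<Sum>K\<in>torus_cells (n k). scheme sch \<gamma> (n k) (\<lambda>V. energy V) (\<lambda>s V. energy (flux \<gamma> s V)) (U k r) K)) (at r)"
        unfolding P_def[abs_def] by (intro DERIV_sum)
      then show "DERIV P r :> 0" using sum_scheme_zero[OF periodic n_pos, of r] r t by simp
    qed (use t in auto)
    then show ?thesis by (simp add: P_def ek_def)
  qed
  have mA: "avg energy \<in> borel_measurable borel" by (rule avg_measurable[OF cE])
  have bA: "\<bar>avg energy z\<bar> \<le> M" for z by (rule avg_bounded[OF cE M(2)])
  define e where "e t = (LINT x:torus|lborel. avg energy (t, x))" for t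
  have ie: "set_integrable lborel {0<..<T} e" unfolding e_def by (rule integral_space_time(3)[OF mA bA])
  have i1: "integrable lborel (\<lambda>t. indicator {0<..<T} t * e t)" using ie by (simp add: set_integrable_def)
  have i0: "integrable lborel (\<lambda>t. indicator {0<..<T} t * e0)" using T_pos by simp
  have "AE t in lborel. indicator {0<..<T} t * e t = indicator {0<..<T} t * e0"
  proof (rule AE_eq_if_set_integrals_eq[OF i1 i0])
    fix A :: "real set" assume "A \<in> sets lborel"
    then have A[measurable]: "A \<in> sets borel" by simp
    define \<psi> where "\<psi> z = indicat_real A (fst z)" for z :: "real \<times> (real ^ 'n)"
    have f: "(fst :: real \<times> (real ^ 'n) \<Rightarrow> real) \<in> borel_measurable borel"
      by (intro borel_measurable_continuous_onI continuous_intros)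
    have \<psi>: "\<psi> \<in> borel_measurable borel" unfolding \<psi>_def
      by (rule measurable_compose[OF f]) measurable
    have \<psi>1: "\<bar>\<psi> z\<bar> \<le> 1" for z by (simp add: \<psi>_def indicator_def)
    define c where "c = (\<integral>t. indicator A t * indicat_real {0<..<T} t \<partial>lborel)"
    have lhs: "(LINT z:space_time T|lborel. energy (grid_to_fun (n k) (U k) z) * \<psi> z) = ek k * c" for k
    proof -
      define u where "u z = (if z \<in> space_time T then grid_to_fun (n k) (U k) z else U k 0 0)" for z
      have um: "u \<in> borel_measurable borel" unfolding u_def[abs_def] by (rule lf_run.grid_measurable[OF run])
      have uC: "u z \<in> C" for z using inC T_pos by (auto simp: u_def grid_to_fun_def space_time_def)
      have em: "(\<lambda>z. energy (u z) * \<psi> z) \<in> borel_measurable borel"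
        using continuous_comp_measurable[OF compact_imp_closed[OF compact_C] cE um uC] \<psi> by (intro borel_measurable_times)
      have eM: "\<bar>energy (u z) * \<psi> z\<bar> \<le> M * 1" for z
        unfolding abs_mult using M uC \<psi>1 by (intro mult_mono) auto
      have "(LINT z:space_time T|lborel. energy (grid_to_fun (n k) (U k) z) * \<psi> z) = (LINT z:space_time T|lborel. energy (u z) * \<psi> z)"
        by (rule set_lebesgue_integral_cong) (simp_all add: u_def)
      also have "\<dots> = (LINT t:{0<..<T}|lborel. LINT x:torus|lborel. energy (u (t, x)) * \<psi> (t, x))"
        by (rule integral_space_time(2)[OF em eM])
      also have "\<dots> = (LINT t:{0<..<T}|lborel. ek k * indicator A t)"
      proof (rule set_lebesgue_integral_cong)
        show "\<forall>t. t \<in> {0<..<T} \<longrightarrow> (LINT x:torus|lborel. energy (u (t, x)) * \<psi> (t, x)) = ek k * indicator A t"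
        proof (intro allI impI)
          fix t assume t: "t \<in> {0<..<T}"
          have "(LINT x:torus|lborel. energy (u (t, x)) * \<psi> (t, x)) = (LINT x:torus|lborel. (energy (U k t (cell_index (n k) x))) * indicator A t)"
            by (rule set_lebesgue_integral_cong) (use t in \<open>auto simp: u_def \<psi>_def space_time_def grid_to_fun_def\<close>)
          also have "\<dots> = (LINT x:torus|lborel. energy (U k t (cell_index (n k) x))) * indicator A t" by simp
          also have "\<dots> = ek k * indicator A t"
            using integral_torus_grid(2)[OF npos[of k], of "\<lambda>K. energy (U k t K)"] const[of t k] t by simp
          finally show "(LINT x:torus|lborel. energy (u (t, x)) * \<psi> (t, x)) = ek k * indicator A t" .
        qed
      qed simp
      also have "\<dots> = ek k * c" by (simp add: c_def set_lebesgue_integral_def mult_ac)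
      finally show ?thesis .
    qed
    have rhs: "(LINT z:space_time T|lborel. avg energy z * \<psi> z) = (\<integral>t. indicator A t * (indicator {0<..<T} t * e t) \<partial>lborel)"
    proof -
      have "(LINT z:space_time T|lborel. avg energy z * \<psi> z) = (LINT t:{0<..<T}|lborel. LINT x:torus|lborel. avg energy (t, x) * \<psi> (t, x))"
      proof (rule integral_space_time(2))
        show "(\<lambda>z. avg energy z * \<psi> z) \<in> borel_measurable borel" by (intro borel_measurable_times mA \<psi>)
        show "\<bar>avg energy z * \<psi> z\<bar> \<le> M * 1" for z unfolding abs_mult using bA \<psi>1 M by (intro mult_mono) auto
      qed
      also have "\<dots> = (LINT t:{0<..<T}|lborel. e t * indicator A t)"
        by (simp add: \<psi>_def e_def)
      finally show ?thesis by (simp add: set_lebesgue_integral_def mult_ac)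
    qed
    have "(\<lambda>k. ek k * c) \<longlonglongrightarrow> (LINT z:space_time T|lborel. avg energy z * \<psi> z)"
      using weak[OF cE \<psi> \<psi>1] unfolding lhs avg_def .
    moreover have "(\<lambda>k. ek k * c) \<longlonglongrightarrow> e0 * c" by (intro tendsto_mult_right ek)
    ultimately have "(LINT z:space_time T|lborel. avg energy z * \<psi> z) = e0 * c" by (rule LIMSEQ_unique)
    then show "(\<integral>t. indicator A t * (indicator {0<..<T} t * e t) \<partial>lborel) = (\<integral>t. indicator A t * (indicator {0<..<T} t * e0) \<partial>lborel)"
      unfolding rhs by (simp add: c_def mult_ac)
  qed
  then show ?thesis unfolding e0_def e_def by eventually_elim (auto simp: indicator_def split: if_splits)
qed

end

section \<open>The limit as a Young measure\<close>

lemma phase_space_borel: "(phase_space :: ('n::finite state) set) \<in> sets borel"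
proof -
  have "closed (phase_space :: ('n state) set)"
    unfolding phase_space_def by (intro closed_Collect_conj closed_Collect_le continuous_intros)
  then show ?thesis by simp
qed

lemma space_phase_borel: "space (phase_borel :: ('n::finite state) measure) = phase_space"
  by (simp add: phase_borel_def space_restrict_space)

lemma continuous_phase_measurable:
  "continuous_on UNIV f \<Longrightarrow> f \<in> borel_measurable (phase_borel :: ('n::finite state) measure)"
  unfolding phase_borel_def by (intro measurable_restrict_space1 borel_measurable_continuous_onI)

lemma component_measurable:
  "(\<lambda>V :: 'n::finite state. dens V) \<in> borel_measurable phase_borel"
  "(\<lambda>V :: 'n::finite state. mom V) \<in> borel_measurable phase_borel"
  "(\<lambda>V :: 'n::finite state. mom V $ i) \<in> borel_measurable phase_borel"
  "(\<lambda>V :: 'n::finite state. energy V) \<in> borel_measurable phase_borel"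
  by (intro continuous_phase_measurable continuous_intros)+

lemma pressure_measurable: "pressure \<gamma> \<in> borel_measurable (phase_borel :: ('n::finite state) measure)"
proof -
  note [measurable] = component_measurable
  show ?thesis unfolding pressure_def[abs_def] by measurable
qed

lemma convection_measurable: "convection \<in> borel_measurable (phase_borel :: ('n::finite state) measure)"
proof (subst borel_measurable_euclidean_space, rule ballI)
  fix b :: "real ^ 'n ^ 'n" assume "b \<in> Basis"
  then obtain i j where b: "b = axis i (axis j 1)" by (auto simp: Basis_vec_def)
  note [measurable] = component_measurable
  have "(\<lambda>V :: 'n state. mom V $ i * mom V $ j / dens V) \<in> borel_measurable phase_borel" by measurable
  then show "(\<lambda>V :: 'n state. convection V \<bullet> b) \<in> borel_measurable phase_borel"
    by (simp add: b inner_axis convection_def)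
qed

lemma S_chi_eq: "S_chi \<gamma> chi V = chi (entropy \<gamma> V)"
  by (simp add: S_chi_def entropy_def)

lemma S_chi_measurable:
  assumes "entropy_cutoff chi"
  shows "S_chi \<gamma> chi \<in> borel_measurable (phase_borel :: ('n::finite state) measure)"
proof -
  note [measurable] = component_measurable pressure_measurable
  have "(\<lambda>V :: 'n state. 1 / (\<gamma> - 1) * ln (pressure \<gamma> V / dens V powr \<gamma>)) \<in> borel_measurable phase_borel" by measurable
  moreover have "chi \<in> borel_measurable borel"
    using assms by (intro borel_measurable_mono) (simp add: entropy_cutoff_def)
  ultimately show ?thesis unfolding S_chi_def[abs_def] by (rule measurable_compose)
qed

lemma test_integrable:
  fixes a b :: "real \<times> (real ^ 'n::finite) \<Rightarrow> real"
  assumes a: "a \<in> borel_measurable borel" "\<And>z. \<bar>a z\<bar> \<le> M"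
    and b: "continuous_on ({0..<T} \<times> UNIV) b" "\<And>z. z \<in> space_time T \<Longrightarrow> \<bar>b z\<bar> \<le> B"
  shows "set_integrable lborel (space_time T) (\<lambda>z. a z * b z)"
proof -
  define c where "c z = (if z \<in> space_time T then b z else 0)" for z
  have "c \<in> borel_measurable borel" unfolding c_def
    by (rule borel_measurable_continuous_on_if[OF space_time_borel continuous_on_subset[OF b(1)]]) (auto simp: space_time_def)
  moreover have "\<bar>a z * c z\<bar> \<le> M * B" if "z \<in> space_time T" for z
    using mult_mono[OF a(2)[of z] b(2)[OF that]] a(2)[of z] that by (simp add: c_def abs_mult)
  ultimately have "set_integrable lborel (space_time T) (\<lambda>z. a z * c z)"
    by (intro integral_space_time(1) borel_measurable_times a)
  moreover have "(\<lambda>z. indicator (space_time T) z *\<^sub>R (a z * c z)) = (\<lambda>z. indicator (space_time T) z *\<^sub>R (a z * b z))"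
    by (auto simp: c_def indicator_def)
  ultimately show ?thesis by (simp add: set_integrable_def)
qed

context lf_sequence
begin

lemma C_proper: "C \<subseteq> phase_space" "C \<subseteq> proper_states \<gamma>"
proof -
  have "energy V \<ge> 0" if "V \<in> C" for V
    using energy_ge_pressure(2)[OF gamma positive_on_C(1)[OF that] positive_on_C(2)[OF that]] .
  then show "C \<subseteq> phase_space" "C \<subseteq> proper_states \<gamma>"
    using positive_on_C by (auto simp: phase_space_def proper_states_def less_imp_le dest: positive_on_C(1))
qed

lemma C_sets: "C \<in> sets phase_borel"
proof -
  have "C \<in> sets borel" using compact_imp_closed[OF compact_C] by simp
  then show ?thesis using C_proper(1)
    by (auto simp: phase_borel_def sets_restrict_space_iff[OF] phase_space_borel)
qed

lemma bounded_on_C: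
  fixes f :: "'n state \<Rightarrow> 'b::real_normed_vector"
  assumes "continuous_on C f"
  shows "\<exists>B\<ge>0. \<forall>V\<in>C. norm (f V) \<le> B"
  using continuous_on_C_bounded[OF continuous_on_norm[OF assms]] by simp

lemma carried_integrable:
  fixes f :: "'n state \<Rightarrow> 'b::{banach, second_countable_topology}"
  assumes \<nu>: "\<nu> \<in> phase_probs" and C: "AE V in \<nu>. V \<in> C"
    and f: "f \<in> borel_measurable phase_borel" "continuous_on C f"
  shows "integrable \<nu> f"
proof -
  interpret prob_space \<nu> using \<nu> by (simp add: phase_probs_def)
  obtain B where "B \<ge> 0" and B: "\<And>V. V \<in> C \<Longrightarrow> norm (f V) \<le> B" using bounded_on_C[OF f(2)] by blast
  have s: "sets \<nu> = sets phase_borel" using \<nu> by (simp add: phase_probs_def)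
  have "f \<in> borel_measurable \<nu>" using f(1) measurable_cong_sets[OF s refl] by blast
  then show ?thesis using C B by (intro integrable_const_bound[where B = B]) (auto elim: eventually_mono)
qed

definition young :: "real \<times> (real ^ 'n) \<Rightarrow> 'n state measure" where
  "young z = distr (restrict_space lborel {0..<1}) phase_borel (X z)"

lemma X_phase: "X z \<in> measurable (restrict_space lborel {0..<1}) phase_borel"
  unfolding phase_borel_def
proof (rule measurable_restrict_space2)
  show "X z \<in> space (restrict_space lborel {0..<1}) \<rightarrow> phase_space" using X_C C_proper(1) by blast
  show "X z \<in> borel_measurable (restrict_space lborel {0..<1})"
    by (rule measurable_restrict_space1) (use X_meas[of z] in simp)
qed

lemma young_probs: "young z \<in> phase_probs"
proof -
  have "prob_space (restrict_space lborel {0..<1::real})" by (rule prob_space_restrict_space) auto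
  from prob_space.prob_space_distr[OF this X_phase] show ?thesis
    by (simp add: phase_probs_def young_def)
qed

lemma young_carried: "AE V in young z. V \<in> C"
  unfolding young_def using C_sets sets.sets_into_space[OF C_sets] X_C
  by (subst AE_distr_iff[OF X_phase]) (auto simp: Int_absorb2 Collect_conj_eq)

lemma young_integral:
  assumes f: "f \<in> borel_measurable phase_borel"
  shows "(\<integral>V. f V \<partial>young z) = avg f z"
  unfolding young_def avg_def set_lebesgue_integral_def
  by (subst integral_distr[OF X_phase f], subst integral_restrict_space) auto

lemma young_inner:
  fixes f :: "'n state \<Rightarrow> 'b::euclidean_space"
  assumes f: "f \<in> borel_measurable phase_borel" "continuous_on C f"
  shows "(\<integral>V. f V \<partial>young z) \<bullet> b = avg (\<lambda>V. f V \<bullet> b) z"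
proof -
  have "(\<integral>V. f V \<partial>young z) \<bullet> b = (\<integral>V. f V \<bullet> b \<partial>young z)"
    using carried_integrable[OF young_probs young_carried f] by simp
  also have "\<dots> = avg (\<lambda>V. f V \<bullet> b) z" by (rule young_integral) (use f in measurable)
  finally show ?thesis .
qed

lemma young_pairing_integrable:
  fixes f :: "'n state \<Rightarrow> 'b::euclidean_space"
  assumes f: "f \<in> borel_measurable phase_borel" "continuous_on C f"
  shows "pairing_integrable (space_time T) young f"
  unfolding pairing_integrable_def
proof (rule conjI, rule AE_I2, rule impI, rule carried_integrable[OF young_probs young_carried f])
  obtain B where "B \<ge> 0" and B: "\<And>V. V \<in> C \<Longrightarrow> norm (f V) \<le> B" using bounded_on_C[OF f(2)] by blast
  have ci: "continuous_on C (\<lambda>V. f V \<bullet> b)" for b by (intro continuous_intros f)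
  have "\<bar>(\<integral>V. f V \<partial>young z) \<bullet> b\<bar> \<le> B" if "b \<in> Basis" for b z
    unfolding young_inner[OF f]
  proof (rule avg_bounded[OF ci])
    show "\<bar>f V \<bullet> b\<bar> \<le> B" if "V \<in> C" for V
      using Basis_le_norm[OF \<open>b \<in> Basis\<close>, of "f V"] B[OF that] by linarith
  qed
  then have "norm (\<integral>V. f V \<partial>young z) \<le> (\<Sum>b\<in>(Basis :: 'b set). B)" for z
    by (intro order_trans[OF norm_le_l1 sum_mono])
  moreover have "(\<lambda>z. \<integral>V. f V \<partial>young z) \<in> borel_measurable borel"
    by (subst borel_measurable_euclidean_space) (simp add: young_inner[OF f] avg_measurable[OF ci])
  ultimately show "set_integrable lborel (space_time T) (\<lambda>z. \<integral>V. f V \<partial>young z)"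
    unfolding set_integrable_def using emeasure_space_time_finite[of T, where 'n = 'n] space_time_borel
    by (intro integrableI_bounded_set_indicator[where B = "\<Sum>b\<in>(Basis :: 'b set). B"]) auto
qed

definition initial :: "real ^ 'n \<Rightarrow> 'n state measure" where
  "initial x = return phase_borel (U0 x)"

lemma U0_phase: "U0 x \<in> space phase_borel"
  using U0_C C_proper(1) by (auto simp: space_phase_borel)

lemma initial_probs: "initial x \<in> phase_probs"
  using prob_space_return[OF U0_phase] by (simp add: phase_probs_def initial_def)

lemma initial_carried: "AE V in initial x. V \<in> C"
  unfolding initial_def by (subst AE_return[OF U0_phase]) (use C_sets U0_C in \<open>simp_all add: pred_sets2\<close>)

lemma initial_integral:
  fixes f :: "'n state \<Rightarrow> 'b::{banach, second_countable_topology}"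
  shows "f \<in> borel_measurable phase_borel \<Longrightarrow> (\<integral>V. f V \<partial>initial x) = f (U0 x)"
  unfolding initial_def by (rule integral_return[OF U0_phase])

lemma initial_pairing_integrable:
  fixes f :: "'n state \<Rightarrow> 'b::euclidean_space"
  assumes f: "f \<in> borel_measurable phase_borel" "continuous_on C f"
  shows "pairing_integrable torus initial f"
  unfolding pairing_integrable_def
proof (rule conjI, rule AE_I2, rule impI, rule carried_integrable[OF initial_probs initial_carried f])
  obtain B where "B \<ge> 0" and B: "\<And>V. V \<in> C \<Longrightarrow> norm (f V) \<le> B" using bounded_on_C[OF f(2)] by blast
  have "(\<lambda>x. f (U0 x)) \<in> borel_measurable borel"
  proof (subst borel_measurable_euclidean_space, rule ballI)
    fix b :: 'b
    show "(\<lambda>x. f (U0 x) \<bullet> b) \<in> borel_measurable borel"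
      by (rule continuous_comp_measurable[OF compact_imp_closed[OF compact_C] _ U0_meas U0_C]) (intro continuous_intros f)
  qed
  then show "set_integrable lborel torus (\<lambda>x. \<integral>V. f V \<partial>initial x)"
    unfolding set_integrable_def initial_integral[OF f(1)] using B[OF U0_C] emeasure_torus[where 'n = 'n]
    by (intro integrableI_bounded_set_indicator[where B = B]) auto
qed

lemma continuous_on_C_S_chi:
  assumes "entropy_cutoff chi"
  shows "continuous_on C (S_chi \<gamma> chi)"
  unfolding S_chi_eq[abs_def]
  by (rule continuous_on_compose2[OF entropy_cutoff_continuous[OF assms] continuous_on_C_entropy]) auto

lemma continuous_on_C_convection: "continuous_on C convection"
  unfolding convection_def[abs_def] by (intro continuous_intros) (auto dest: positive_on_C(1))

text \<open>
  Measures carried by \<open>C\<close> see only bounded values of all expressions of the system, and no vacuum.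
\<close>

lemma expressions_integrable_if:
  assumes AE: "\<And>z. z \<in> Q \<Longrightarrow> AE V in W z. V \<in> C"
    and p1: "\<And>f :: 'n state \<Rightarrow> real. f \<in> borel_measurable phase_borel \<Longrightarrow> continuous_on C f \<Longrightarrow> pairing_integrable Q W f"
    and p2: "\<And>f :: 'n state \<Rightarrow> real ^ 'n. f \<in> borel_measurable phase_borel \<Longrightarrow> continuous_on C f \<Longrightarrow> pairing_integrable Q W f"
    and p3: "\<And>f :: 'n state \<Rightarrow> real ^ 'n ^ 'n. f \<in> borel_measurable phase_borel \<Longrightarrow> continuous_on C f \<Longrightarrow> pairing_integrable Q W f"
  shows "expressions_integrable \<gamma> Q W"
  unfolding expressions_integrable_def
proof (intro conjI allI impI)
  show "AE z in lborel. z \<in> Q \<longrightarrow> (AE V in W z. V \<in> proper_states \<gamma>)"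
  proof (rule AE_I2, rule impI)
    fix z assume "z \<in> Q"
    from AE[OF this] show "AE V in W z. V \<in> proper_states \<gamma>" by eventually_elim (use C_proper(2) in blast)
  qed
  show "pairing_integrable Q W dens" "pairing_integrable Q W energy"
    by (intro p1 component_measurable continuous_intros)+
  show "pairing_integrable Q W mom" by (intro p2 component_measurable continuous_intros)
  show "pairing_integrable Q W convection" by (intro p3 convection_measurable continuous_on_C_convection)
  show "pairing_integrable Q W (pressure \<gamma>)" by (intro p1 pressure_measurable continuous_on_C_pressure)
  fix chi assume chi: "entropy_cutoff chi"
  note [measurable] = component_measurable S_chi_measurable[OF chi]
  show "pairing_integrable Q W (\<lambda>V. dens V * S_chi \<gamma> chi V)"
    by (intro p1 borel_measurable_times component_measurable S_chi_measurable chi continuous_intros continuous_on_C_S_chi)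
  show "pairing_integrable Q W (\<lambda>V. S_chi \<gamma> chi V *\<^sub>R mom V)"
    by (intro p2 borel_measurable_scaleR component_measurable S_chi_measurable chi continuous_intros continuous_on_C_S_chi)
qed

lemma grid_set_integrable:
  fixes f :: "'n state \<Rightarrow> real"
  assumes f: "continuous_on C f"
  shows "set_integrable lborel (space_time T) (\<lambda>z. f (grid_to_fun (n k) (U k) z))"
proof -
  define u where "u z = (if z \<in> space_time T then grid_to_fun (n k) (U k) z else U k 0 0)" for z
  obtain B where "B \<ge> 0" and B: "\<And>V. V \<in> C \<Longrightarrow> \<bar>f V\<bar> \<le> B" using continuous_on_C_bounded[OF f] by blast
  have um: "u \<in> borel_measurable borel"
    unfolding u_def[abs_def] by (rule lf_run.grid_measurable[OF run])
  have uC: "u z \<in> C" for z using inC T_pos by (auto simp: u_def grid_to_fun_def space_time_def)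
  have "set_integrable lborel (space_time T) (\<lambda>z. f (u z))"
    by (rule integral_space_time(1)[OF continuous_comp_measurable[OF compact_imp_closed[OF compact_C] f um uC] B[OF uC]])
  moreover have "(\<lambda>z. indicator (space_time T) z *\<^sub>R f (u z)) = (\<lambda>z. indicator (space_time T) z *\<^sub>R f (grid_to_fun (n k) (U k) z))"
    by (auto simp: u_def indicator_def)
  ultimately show ?thesis by (simp add: set_integrable_def)
qed

lemma Cc_phase_regular:
  assumes "g \<in> Cc_phase"
  shows "g \<in> borel_measurable phase_borel" "continuous_on C g"
  using assms continuous_on_subset[OF _ C_proper(1)]
  by (auto simp: Cc_phase_def phase_borel_def intro!: borel_measurable_continuous_on_restrict)

lemma young_parametrized: "parametrized_measure T young"
  unfolding parametrized_measure_def
proof (intro conjI ballI young_probs)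
  fix g :: "'n state \<Rightarrow> real" assume g: "g \<in> Cc_phase"
  show "(\<lambda>z. \<integral>V. g V \<partial>young z) \<in> borel_measurable (restrict_space lborel (space_time T))"
    unfolding young_integral[OF Cc_phase_regular(1)[OF g]]
    by (rule measurable_restrict_space1) (use avg_measurable[OF Cc_phase_regular(2)[OF g]] in simp)
qed

text \<open>
  A test function that is bounded almost everywhere on the space-time cylinder only is replaced by its truncation.
\<close>

lemma young_generated: "generates_young_measure T (\<lambda>k. grid_to_fun (n k) (U k)) young"
  unfolding generates_young_measure_def
proof (intro conjI ballI young_parametrized)
  fix g :: "'n state \<Rightarrow> real" assume g: "g \<in> Cc_phase"
  note gr = Cc_phase_regular[OF g]
  obtain B where "B \<ge> 0" and B: "\<And>V. V \<in> C \<Longrightarrow> \<bar>g V\<bar> \<le> B" using continuous_on_C_bounded[OF gr(2)] by blast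
  have ia: "set_integrable lborel (space_time T) (avg g)"
    by (rule integral_space_time(1)[OF avg_measurable[OF gr(2)]]) (rule avg_bounded[OF gr(2) B])
  show "weak_L1_limit (space_time T) (\<lambda>k z. g (grid_to_fun (n k) (U k) z)) (\<lambda>z. \<integral>V. g V \<partial>young z)"
    unfolding weak_L1_limit_def young_integral[OF gr(1)]
  proof (intro conjI allI ballI impI grid_set_integrable gr ia)
    fix \<psi> :: "real \<times> (real ^ 'n) \<Rightarrow> real" and c
    assume \<psi>: "\<psi> \<in> borel_measurable lborel" and c: "AE z in lborel. z \<in> space_time T \<longrightarrow> \<bar>\<psi> z\<bar> \<le> c"
    define \<psi>' where "\<psi>' z = max (- \<bar>c\<bar>) (min \<bar>c\<bar> (\<psi> z))" for z
    have m: "\<psi>' \<in> borel_measurable borel" using \<psi> unfolding \<psi>'_def by simp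
    have eq: "(LINT z:space_time T|lborel. f z * \<psi> z) = (LINT z:space_time T|lborel. f z * \<psi>' z)"
      if f: "set_integrable lborel (space_time T) f" for f
    proof -
      have [measurable]: "(\<lambda>z. indicator (space_time T) z * f z) \<in> borel_measurable borel"
        using borel_measurable_integrable[OF f[unfolded set_integrable_def]] by simp
      note [measurable] = m
      have [measurable]: "\<psi> \<in> borel_measurable borel" using \<psi> by simp
      have "(\<integral>z. (indicator (space_time T) z * f z) * \<psi> z \<partial>lborel) = (\<integral>z. (indicator (space_time T) z * f z) * \<psi>' z \<partial>lborel)"
      proof (rule integral_cong_AE)
        show "AE z in lborel. (indicator (space_time T) z * f z) * \<psi> z = (indicator (space_time T) z * f z) * \<psi>' z"
          using c by eventually_elim (auto simp: \<psi>'_def indicator_def)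
      qed measurable
      then show ?thesis by (simp add: set_lebesgue_integral_def mult_ac)
    qed
    have "\<bar>\<psi>' z\<bar> \<le> \<bar>c\<bar>" for z by (auto simp: \<psi>'_def)
    from weak[OF gr(2) m this]
    show "(\<lambda>k. LINT z:space_time T|lborel. g (grid_to_fun (n k) (U k) z) * \<psi> z) \<longlonglongrightarrow> (LINT z:space_time T|lborel. avg g z * \<psi> z)"
      unfolding eq[OF ia] eq[OF grid_set_integrable[OF gr(2)]] unfolding avg_def .
  qed
qed

lemma young_vec_nth:
  fixes f :: "'n state \<Rightarrow> real ^ 'n"
  assumes f: "f \<in> borel_measurable phase_borel" "continuous_on C f"
  shows "(\<integral>V. f V \<partial>young z) $ s = avg (\<lambda>V. f V $ s) z"
  using young_inner[OF f, of z "axis s 1"] by (simp add: inner_axis)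

lemma young_mat_nth:
  fixes f :: "'n state \<Rightarrow> real ^ 'n ^ 'n"
  assumes f: "f \<in> borel_measurable phase_borel" "continuous_on C f"
  shows "(\<integral>V. f V \<partial>young z) $ i $ j = avg (\<lambda>V. f V $ i $ j) z"
  using young_inner[OF f, of z "axis i (axis j 1)"] by (simp add: inner_axis)

lemma limit_continuity_eq: "continuity_eq T initial young"
  unfolding continuity_eq_def
proof (intro allI impI)
  fix \<phi> :: "real \<times> (real ^ 'n) \<Rightarrow> real" assume "test_function T \<phi>"
  then obtain \<tau> B dt dx where td: "test_data T \<phi> \<tau> B dt dx" using test_function_test_data[OF T_pos] by blast
  note tds = test_dataD[OF td]
  have "(LINT z:space_time T|lborel. (\<integral>V. dens V \<partial>young z) * time_deriv \<phi> z + (\<integral>V. mom V \<partial>young z) \<bullet> space_grad \<phi> z)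
    = (LINT z:space_time T|lborel. avg (\<lambda>V. dens V) z * dt z + (\<Sum>s\<in>UNIV. avg (\<lambda>V. dens (flux \<gamma> s V)) z * dx s z))"
  proof (rule set_lebesgue_integral_cong, simp, intro allI impI)
    fix z :: "real \<times> (real ^ 'n)" assume "z \<in> space_time T"
    then obtain t x where z: "z = (t, x)" "0 < t" "t < T" by (auto simp: space_time_def)
    show "(\<integral>V. dens V \<partial>young z) * time_deriv \<phi> z + (\<integral>V. mom V \<partial>young z) \<bullet> space_grad \<phi> z
      = avg (\<lambda>V. dens V) z * dt z + (\<Sum>s\<in>UNIV. avg (\<lambda>V. dens (flux \<gamma> s V)) z * dx s z)"
      using z tds(9)[of t x] tds(10)[of t x]
      by (simp add: young_integral[OF component_measurable(1)] inner_vec_def flux_def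
        young_vec_nth[OF component_measurable(2) continuous_on_fst[OF continuous_on_snd[OF continuous_on_id]]])
  qed
  also have "\<dots> = - (LINT x:torus|lborel. dens (U0 x) * \<phi> (0, x))"
    by (rule conservation_law_limit[OF bounded_linear_fst td])
  finally show "(LINT z:space_time T|lborel. (\<integral>V. dens V \<partial>young z) * time_deriv \<phi> z + (\<integral>V. mom V \<partial>young z) \<bullet> space_grad \<phi> z)
    = - (LINT x:torus|lborel. (\<integral>V. dens V \<partial>initial x) * \<phi> (0, x))"
    by (simp add: initial_integral component_measurable)
qed

lemma limit_entropy_ineq: "entropy_ineq \<gamma> T initial young"
  unfolding entropy_ineq_def
proof (intro allI impI, elim conjE)
  fix chi and \<phi> :: "real \<times> (real ^ 'n) \<Rightarrow> real"
  assume chi: "entropy_cutoff chi" and "test_function T \<phi>" and \<phi>: "\<forall>z\<in>{0..<T} \<times> UNIV. \<phi> z \<ge> 0"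
  then obtain \<tau> B dt dx where td: "test_data T \<phi> \<tau> B dt dx" using test_function_test_data[OF T_pos] by blast
  note tds = test_dataD[OF td]
  have m: "(\<lambda>V :: 'n state. dens V * S_chi \<gamma> chi V) \<in> borel_measurable phase_borel"
    "(\<lambda>V :: 'n state. S_chi \<gamma> chi V *\<^sub>R mom V) \<in> borel_measurable phase_borel"
    by (intro borel_measurable_times borel_measurable_scaleR component_measurable S_chi_measurable chi)+
  have c: "continuous_on C (\<lambda>V :: 'n state. S_chi \<gamma> chi V *\<^sub>R mom V)"
    by (intro continuous_intros continuous_on_C_S_chi chi)
  have "(LINT z:space_time T|lborel. (\<integral>V. dens V * S_chi \<gamma> chi V \<partial>young z) * time_deriv \<phi> z
        + (\<integral>V. S_chi \<gamma> chi V *\<^sub>R mom V \<partial>young z) \<bullet> space_grad \<phi> z)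
    = (LINT z:space_time T|lborel. avg (\<lambda>V. dens V * chi (entropy \<gamma> V)) z * dt z
        + (\<Sum>s\<in>UNIV. avg (\<lambda>V. mom V $ s * chi (entropy \<gamma> V)) z * dx s z))"
  proof (rule set_lebesgue_integral_cong, simp, intro allI impI)
    fix z :: "real \<times> (real ^ 'n)" assume "z \<in> space_time T"
    then obtain t x where z: "z = (t, x)" "0 < t" "t < T" by (auto simp: space_time_def)
    show "(\<integral>V. dens V * S_chi \<gamma> chi V \<partial>young z) * time_deriv \<phi> z
        + (\<integral>V. S_chi \<gamma> chi V *\<^sub>R mom V \<partial>young z) \<bullet> space_grad \<phi> z
      = avg (\<lambda>V. dens V * chi (entropy \<gamma> V)) z * dt z + (\<Sum>s\<in>UNIV. avg (\<lambda>V. mom V $ s * chi (entropy \<gamma> V)) z * dx s z)"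
      using z tds(9)[of t x] tds(10)[of t x]
      by (simp add: young_integral[OF m(1)[unfolded S_chi_eq]] inner_vec_def
        young_vec_nth[OF m(2)[unfolded S_chi_eq] c[unfolded S_chi_eq]] S_chi_eq mult.commute)
  qed
  also have "\<dots> \<le> - (LINT x:torus|lborel. dens (U0 x) * chi (entropy \<gamma> (U0 x)) * \<phi> (0, x))"
    by (rule entropy_limit[OF chi td]) (use \<phi> in blast)
  finally show "(LINT z:space_time T|lborel. (\<integral>V. dens V * S_chi \<gamma> chi V \<partial>young z) * time_deriv \<phi> z
        + (\<integral>V. S_chi \<gamma> chi V *\<^sub>R mom V \<partial>young z) \<bullet> space_grad \<phi> z)
    \<le> - (LINT x:torus|lborel. (\<integral>V. dens V * S_chi \<gamma> chi V \<partial>initial x) * \<phi> (0, x))"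
    by (simp add: initial_integral[OF m(1)[unfolded S_chi_eq]] S_chi_eq)
qed

lemma limit_energy_ineq: "energy_ineq T initial young"
  unfolding energy_ineq_def young_integral[OF component_measurable(4)] initial_integral[OF component_measurable(4)]
  using energy_conserved by eventually_elim simp

text \<open>
  By \<open>energy_conserved\<close> the right-hand side is zero, as is the total variation.
\<close>

lemma limit_defect_bound: "defect_bound 1 T initial young (\<lambda>A. 0)"
  unfolding defect_bound_def
proof (intro allI impI, elim conjE)
  fix \<tau> :: real assume \<tau>: "0 \<le> \<tau>" "\<tau> < T"
  have cE: "continuous_on C (\<lambda>V. energy V)" by (intro continuous_intros)
  obtain M where M: "M \<ge> 0" "\<And>V. V \<in> C \<Longrightarrow> \<bar>energy V\<bar> \<le> M" using continuous_on_C_bounded[OF cE] by blast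
  define f where "f z = energy (U0 (snd z)) - avg energy z" for z :: "real \<times> (real ^ 'n)"
  have mA: "avg energy \<in> borel_measurable borel" by (rule avg_measurable[OF cE])
  have bA: "\<bar>avg energy z\<bar> \<le> M" for z by (rule avg_bounded[OF cE M(2)])
  have mU: "(\<lambda>x. energy (U0 x)) \<in> borel_measurable borel"
    by (rule continuous_comp_measurable[OF compact_imp_closed[OF compact_C] cE U0_meas U0_C])
  have s: "(snd :: real \<times> (real ^ 'n) \<Rightarrow> real ^ 'n) \<in> borel_measurable borel"
    by (intro borel_measurable_continuous_onI continuous_intros)
  have fm: "f \<in> borel_measurable borel"
    unfolding f_def by (intro borel_measurable_diff mA measurable_compose[OF s mU])
  have fB: "\<bar>f z\<bar> \<le> 2 * M" for z using bA[of z] M(2)[OF U0_C[of "snd z"]] by (simp add: f_def abs_le_iff)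
  have inner: "(LINT x:torus|lborel. f (t, x)) = (LINT x:torus|lborel. energy (U0 x)) - (LINT x:torus|lborel. avg energy (t, x))" for t
  proof -
    have p: "(\<lambda>x. (t, x)) \<in> borel_measurable borel"
      by (intro borel_measurable_continuous_onI continuous_intros)
    have "set_integrable lborel torus (\<lambda>x. energy (U0 x))"
      by (rule set_integrable_torus_bounded[where B = M])
        (use mU M(2)[OF U0_C] in \<open>auto intro!: borel_measurable_times borel_measurable_indicator torus_borel\<close>)
    moreover have "set_integrable lborel torus (\<lambda>x. avg energy (t, x))"
      by (rule set_integrable_torus_bounded[where B = M])
        (use measurable_compose[OF p mA] bA in \<open>auto intro!: borel_measurable_times borel_measurable_indicator torus_borel\<close>)
    ultimately show ?thesis by (simp add: f_def set_integral_diff)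
  qed
  have "(LINT z:space_time \<tau>|lborel. f z) = (LINT t:{0<..<\<tau>}|lborel. LINT x:torus|lborel. f (t, x))"
    by (rule integral_space_time(2)[OF fm fB])
  also have "\<dots> = 0"
    unfolding set_lebesgue_integral_def[of _ "{0<..<\<tau>}"]
  proof (rule integral_eq_zero_AE)
    show "AE t in lborel. indicat_real {0<..<\<tau>} t *\<^sub>R (LINT x:torus|lborel. f (t, x)) = 0"
      using energy_conserved by eventually_elim (use \<tau> in \<open>auto simp: inner indicator_def\<close>)
  qed
  finally have "(LINT z:space_time \<tau>|lborel. f z) = 0" .
  moreover have "total_variation (\<lambda>A. 0 :: real ^ 'n ^ 'n) ({0..\<tau>} \<times> (torus :: (real ^ 'n) set)) \<le> 0"
    unfolding total_variation_def by (rule SUP_least) simp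
  ultimately show "total_variation (\<lambda>A. 0 :: real ^ 'n ^ 'n) ({0..\<tau>} \<times> (torus :: (real ^ 'n) set))
      \<le> ereal (1 * (LINT z:space_time \<tau>|lborel. (\<integral>V. energy V \<partial>initial (snd z)) - (\<integral>V. energy V \<partial>young z)))"
    unfolding young_integral[OF component_measurable(4)] initial_integral[OF component_measurable(4)] by (simp add: f_def flip: zero_ereal_def)
qed

lemma test_function_component:
  assumes "test_function T (\<phi> :: real \<times> (real ^ 'n) \<Rightarrow> real ^ 'n)"
  shows "test_function T (\<lambda>z. \<phi> z $ i)"
    and "0 < t \<Longrightarrow> t < T \<Longrightarrow> time_deriv \<phi> (t, x) $ i = time_deriv (\<lambda>z. \<phi> z $ i) (t, x)"
    and "0 < t \<Longrightarrow> t < T \<Longrightarrow> space_jacobian \<phi> (t, x) $ i $ j = space_grad (\<lambda>z. \<phi> z $ i) (t, x) $ j"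
proof -
  have bl: "bounded_linear (\<lambda>v :: real ^ 'n. v $ i)" by (rule bounded_linear_vec_nth)
  obtain D \<tau> where D: "continuous_on ({0..<T} \<times> UNIV) D"
      "\<And>z. z \<in> {0..<T} \<times> UNIV \<Longrightarrow> (\<phi> has_derivative blinfun_apply (D z)) (at z within {0..<T} \<times> UNIV)"
    and \<tau>: "\<tau> < T" "\<And>t x. t \<ge> \<tau> \<Longrightarrow> \<phi> (t, x) = 0" and per: "\<forall>t. periodic (\<lambda>x. \<phi> (t, x))"
    using assms unfolding test_function_def by blast
  show "test_function T (\<lambda>z. \<phi> z $ i)"
    unfolding test_function_def
  proof (intro conjI allI exI[of _ \<tau>] impI exI[of _ "\<lambda>z. Blinfun (\<lambda>v. v $ i) o\<^sub>L D z"] ballI)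
    show "periodic (\<lambda>x. \<phi> (t, x) $ i)" for t using per by (simp add: periodic_def)
    show "continuous_on ({0..<T} \<times> UNIV) (\<lambda>z. Blinfun (\<lambda>v. v $ i) o\<^sub>L D z)"
      by (rule bounded_bilinear.continuous_on[OF bounded_bilinear_blinfun_compose continuous_on_const D(1)])
    show "((\<lambda>z. \<phi> z $ i) has_derivative blinfun_apply (Blinfun (\<lambda>v. v $ i) o\<^sub>L D z)) (at z within {0..<T} \<times> UNIV)"
      if "z \<in> {0..<T} \<times> UNIV" for z
    proof -
      have "blinfun_apply (Blinfun (\<lambda>v. v $ i) o\<^sub>L D z) = (\<lambda>v. D z v $ i)"
        by (rule ext) (simp add: bounded_linear_Blinfun_apply[OF bl])
      with bounded_linear.has_derivative[OF bl D(2)[OF that]] show ?thesis by simp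
    qed
  qed (use \<tau> in auto)
  assume t: "0 < t" "t < T"
  have "(\<phi> has_derivative D (t, x)) (at (t, x) within {0<..<T} \<times> UNIV)"
    by (rule has_derivative_subset[OF D(2)]) (use t in auto)
  then have d: "(\<phi> has_derivative D (t, x)) (at (t, x))"
    using t by (subst (asm) at_within_open) (auto intro: open_Times)
  have "((\<lambda>s. (s, x)) has_derivative (\<lambda>r. (r, 0))) (at t)" by (intro derivative_eq_intros) auto
  from has_derivative_compose[OF this d] have "((\<lambda>s. \<phi> (s, x)) has_derivative (\<lambda>r. D (t, x) (r, 0))) (at t)"
    by (simp add: comp_def)
  moreover have "(\<lambda>r. D (t, x) (r, 0)) = (\<lambda>r. r *\<^sub>R D (t, x) (1, 0))"
  proof
    fix r :: real
    have "D (t, x) (r, 0) = D (t, x) (r *\<^sub>R (1, 0))" by simp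
    also have "\<dots> = r *\<^sub>R D (t, x) (1, 0)" by (simp only: blinfun.scaleR_right)
    finally show "D (t, x) (r, 0) = r *\<^sub>R D (t, x) (1, 0)" .
  qed
  ultimately have v: "((\<lambda>s. \<phi> (s, x)) has_vector_derivative D (t, x) (1, 0)) (at t)"
    unfolding has_vector_derivative_def by (simp only:)
  show "time_deriv \<phi> (t, x) $ i = time_deriv (\<lambda>z. \<phi> z $ i) (t, x)"
    using vector_derivative_at[OF v] vector_derivative_at[OF bounded_linear.has_vector_derivative[OF bl v]]
    by (simp add: time_deriv_def)
  have "((\<lambda>x. (t, x)) has_derivative (\<lambda>v. (0, v))) (at x)" by (intro derivative_eq_intros) auto
  from has_derivative_compose[OF this d] have g: "((\<lambda>x. \<phi> (t, x)) has_derivative (\<lambda>v. D (t, x) (0, v))) (at x)"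
    by (simp add: comp_def)
  show "space_jacobian \<phi> (t, x) $ i $ j = space_grad (\<lambda>z. \<phi> z $ i) (t, x) $ j"
    using frechet_derivative_at[OF g, symmetric] frechet_derivative_at[OF bounded_linear.has_derivative[OF bl g], symmetric]
    by (simp add: space_jacobian_def space_grad_def jacobian_def matrix_def)
qed

text \<open>
  The sum of the conservation laws for the components of the momentum. Both parts of the Jordan decomposition of the
  zero measure give the same integral, so the defect contributes nothing.
\<close>

lemma limit_momentum_eq: "momentum_eq \<gamma> T initial young (\<lambda>A. 0)"
  unfolding momentum_eq_def
proof (intro allI impI)
  fix \<phi> :: "real \<times> (real ^ 'n) \<Rightarrow> real ^ 'n" assume \<phi>: "test_function T \<phi>"
  have "\<forall>i. \<exists>q. test_data T (\<lambda>z. \<phi> z $ i) (fst q) (fst (snd q)) (fst (snd (snd q))) (snd (snd (snd q)))"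
  proof
    fix i
    obtain \<tau> B dt dx where "test_data T (\<lambda>z. \<phi> z $ i) \<tau> B dt dx"
      using test_function_test_data[OF T_pos test_function_component(1)[OF \<phi>]] by blast
    then show "\<exists>q. test_data T (\<lambda>z. \<phi> z $ i) (fst q) (fst (snd q)) (fst (snd (snd q))) (snd (snd (snd q)))"
      by (intro exI[of _ "(\<tau>, B, dt, dx)"]) simp
  qed
  from choice[OF this] obtain q where q: "\<And>i. test_data T (\<lambda>z. \<phi> z $ i) (fst (q i)) (fst (snd (q i))) (fst (snd (snd (q i)))) (snd (snd (snd (q i))))"
    by blast
  define B where "B i = fst (snd (q i))" for i
  define dt where "dt i = fst (snd (snd (q i)))" for i
  define dx where "dx i = snd (snd (snd (q i)))" for i
  have td: "test_data T (\<lambda>z. \<phi> z $ i) (fst (q i)) (B i) (dt i) (dx i)" for i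
    using q by (simp add: B_def dt_def dx_def)
  note tds = test_dataD[OF td]
  have cm: "continuous_on C (\<lambda>V. mom V)" by (intro continuous_intros)
  have cmi: "continuous_on C (\<lambda>V. mom V $ i)" for i by (intro continuous_intros)
  have cmf: "continuous_on C (\<lambda>V. mom (flux \<gamma> s V) $ i)" for s i by (intro continuous_intros continuous_on_C_flux)
  have cci: "continuous_on C (\<lambda>V. convection V $ i $ s)" for i s by (intro continuous_intros continuous_on_C_convection)
  have dB: "\<bar>dt i z\<bar> \<le> B i" "\<bar>dx i s z\<bar> \<le> B i" if "z \<in> space_time T" for i s z
    using that tds(15)[of "fst z" "snd z" i] tds(16)[of "fst z" "snd z" i s] torus_subset_node_box
    by (auto simp: space_time_def)
  define e where "e i z = avg (\<lambda>V. mom V $ i) z * dt i z + (\<Sum>s\<in>UNIV. avg (\<lambda>V. mom (flux \<gamma> s V) $ i) z * dx i s z)" for i z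
  have prod_int: "set_integrable lborel (space_time T) (\<lambda>z. avg f z * b z)"
    if f: "continuous_on C f" and b: "continuous_on ({0..<T} \<times> UNIV) b" "\<And>z. z \<in> space_time T \<Longrightarrow> \<bar>b z\<bar> \<le> c" for f b c
  proof -
    obtain M where "M \<ge> 0" and M: "\<And>V. V \<in> C \<Longrightarrow> \<bar>f V\<bar> \<le> M" using continuous_on_C_bounded[OF f] by blast
    from test_integrable[OF avg_measurable[OF f] avg_bounded[OF f M] b] show ?thesis .
  qed
  have ei: "set_integrable lborel (space_time T) (e i)" for i
  proof -
    have "set_integrable lborel (space_time T) (\<lambda>z. \<Sum>s\<in>UNIV. avg (\<lambda>V. mom (flux \<gamma> s V) $ i) z * dx i s z)"
      unfolding set_integrable_def scaleR_sum_right
      using prod_int[OF cmf tds(13) dB(2)] by (intro Bochner_Integration.integrable_sum) (simp add: set_integrable_def)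
    from set_integral_add(1)[OF prod_int[OF cmi tds(12) dB(1)] this] show ?thesis unfolding e_def .
  qed
  have e_int: "(LINT z:space_time T|lborel. e i z) = - (LINT x:torus|lborel. mom (U0 x) $ i * \<phi> (0, x) $ i)" for i
    unfolding e_def by (rule conservation_law_limit[OF _ td])
      (rule bounded_linear_compose[OF bounded_linear_vec_nth bounded_linear_compose[OF bounded_linear_fst bounded_linear_snd]])
  have "(LINT z:space_time T|lborel. (\<integral>V. mom V \<partial>young z) \<bullet> time_deriv \<phi> z
        + (\<integral>V. convection V \<partial>young z) \<bullet> space_jacobian \<phi> z
        + (\<integral>V. pressure \<gamma> V \<partial>young z) * trace (space_jacobian \<phi> z))
    = (LINT z:space_time T|lborel. \<Sum>i\<in>UNIV. e i z)"
  proof (rule set_lebesgue_integral_cong, simp, intro allI impI)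
    fix z :: "real \<times> (real ^ 'n)" assume "z \<in> space_time T"
    then obtain t x where z: "z = (t, x)" "0 < t" "t < T" by (auto simp: space_time_def)
    have dt: "time_deriv \<phi> z $ i = dt i z" for i
      using tds(9)[of t i x] z test_function_component(2)[OF \<phi>, of t x i] by simp
    have dx: "space_jacobian \<phi> z $ i $ j = dx i j z" for i j
      using tds(10)[of t i x j] z test_function_component(3)[OF \<phi>, of t x i j] by simp
    have fl: "avg (\<lambda>V. mom (flux \<gamma> s V) $ i) z = avg (\<lambda>V. convection V $ i $ s) z + (if s = i then avg (pressure \<gamma>) z else 0)" for s i
    proof -
      have "mom (flux \<gamma> s V) $ i = convection V $ i $ s + (if s = i then pressure \<gamma> V else 0)" for V :: "'n state"
        by (simp add: flux_def convection_def axis_def)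
      moreover have "continuous_on C (\<lambda>V. if s = i then pressure \<gamma> V else 0)"
        by (cases "s = i") (simp_all add: continuous_on_C_pressure)
      moreover have "avg (\<lambda>V. 0) z = 0" by (simp add: avg_def)
      ultimately show ?thesis by (simp add: avg_linear(1)[OF cci])
    qed
    have "(\<Sum>i\<in>UNIV. e i z) = (\<Sum>i\<in>UNIV. avg (\<lambda>V. mom V $ i) z * dt i z)
       + (\<Sum>i\<in>UNIV. \<Sum>s\<in>UNIV. avg (\<lambda>V. convection V $ i $ s) z * dx i s z) + avg (pressure \<gamma>) z * (\<Sum>i\<in>UNIV. dx i i z)"
      by (simp add: e_def fl distrib_right sum.distrib if_distrib[of "\<lambda>a. a * _"] sum_distrib_left cong: if_cong)
    then show "(\<integral>V. mom V \<partial>young z) \<bullet> time_deriv \<phi> z + (\<integral>V. convection V \<partial>young z) \<bullet> space_jacobian \<phi> z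
        + (\<integral>V. pressure \<gamma> V \<partial>young z) * trace (space_jacobian \<phi> z) = (\<Sum>i\<in>UNIV. e i z)"
      by (simp add: inner_vec_def young_vec_nth[OF component_measurable(2) cm] trace_def dt dx
        young_mat_nth[OF convection_measurable continuous_on_C_convection] young_integral[OF pressure_measurable])
  qed
  also have "\<dots> = (\<Sum>i\<in>UNIV. LINT z:space_time T|lborel. e i z)"
    unfolding set_lebesgue_integral_def scaleR_sum_right
    by (rule Bochner_Integration.integral_sum) (use ei in \<open>simp add: set_integrable_def\<close>)
  also have "\<dots> = - (\<Sum>i\<in>UNIV. LINT x:torus|lborel. mom (U0 x) $ i * \<phi> (0, x) $ i)"
    by (simp add: e_int sum_negf)
  also have "(\<Sum>i\<in>UNIV. LINT x:torus|lborel. mom (U0 x) $ i * \<phi> (0, x) $ i) = (LINT x:torus|lborel. \<Sum>i\<in>UNIV. mom (U0 x) $ i * \<phi> (0, x) $ i)"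
  proof -
    have "set_integrable lborel torus (\<lambda>x. mom (U0 x) $ i * \<phi> (0, x) $ i)" for i
    proof -
      obtain M where M: "M \<ge> 0" "\<And>V. V \<in> C \<Longrightarrow> \<bar>mom V $ i\<bar> \<le> M" using continuous_on_C_bounded[OF cmi] by blast
      show ?thesis
    proof (rule set_integrable_torus_bounded)
      have m: "(\<lambda>x. mom (U0 x) $ i) \<in> borel_measurable borel"
        by (rule continuous_comp_measurable[OF compact_imp_closed[OF compact_C] cmi U0_meas U0_C])
      have "continuous_on torus (\<lambda>x. \<phi> (0, x) $ i)"
        by (rule continuous_on_compose2[OF tds(11)[of i]]) (use T_pos in \<open>auto intro!: continuous_intros\<close>)
      then have "(\<lambda>x. if x \<in> torus then \<phi> (0, x) $ i else 0) \<in> borel_measurable borel"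
        by (intro borel_measurable_continuous_on_if torus_borel) auto
      from borel_measurable_times[OF m this]
      show "(\<lambda>x. indicator torus x * (mom (U0 x) $ i * \<phi> (0, x) $ i)) \<in> borel_measurable borel"
        by (rule measurable_cong[THEN iffD1, rotated]) (auto simp: indicator_def)
      show "\<bar>mom (U0 x) $ i * \<phi> (0, x) $ i\<bar> \<le> M * B i" if "x \<in> torus" for x
        using M(2)[OF U0_C] tds(14)[of 0 x i] that T_pos torus_subset_node_box M(1) unfolding abs_mult
        by (intro mult_mono) auto
    qed
    qed
    then show ?thesis
      unfolding set_lebesgue_integral_def scaleR_sum_right set_integrable_def
      by (intro Bochner_Integration.integral_sum[symmetric])
  qed
  finally show "(LINT z:space_time T|lborel. (\<integral>V. mom V \<partial>young z) \<bullet> time_deriv \<phi> z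
        + (\<integral>V. convection V \<partial>young z) \<bullet> space_jacobian \<phi> z
        + (\<integral>V. pressure \<gamma> V \<partial>young z) * trace (space_jacobian \<phi> z))
    = - (LINT x:torus|lborel. (\<integral>V. mom V \<partial>initial x) \<bullet> \<phi> (0, x))
      + matrix_integral ({0..T} \<times> torus) (\<lambda>A. 0) (space_jacobian \<phi>)"
    by (simp add: initial_integral[OF component_measurable(2)] inner_vec_def matrix_integral_def signed_integral_def)
qed

lemma limit_dmv_solution: "dmv_solution 1 \<gamma> T initial young"
  unfolding dmv_solution_def
proof (intro conjI ballI exI[of _ "\<lambda>A. 0"])
  show "expressions_integrable \<gamma> (space_time T) young"
    by (rule expressions_integrable_if) (intro young_carried young_pairing_integrable; assumption)+
  show "expressions_integrable \<gamma> torus initial"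
    by (rule expressions_integrable_if) (intro initial_carried initial_pairing_integrable; assumption)+
  show "vector_measure_on ({0..T} \<times> torus) (\<lambda>A. 0 :: real ^ 'n ^ 'n)"
    by (simp add: vector_measure_on_def)
qed (intro young_parametrized initial_probs limit_continuity_eq limit_energy_ineq limit_entropy_ineq
  limit_momentum_eq limit_defect_bound)+

end

section \<open>Convergence of the schemes\<close>

lemma projection_approximates:
  fixes f :: "real ^ 'n::finite \<Rightarrow> 'b::euclidean_space"
  assumes n: "n > 0" and f: "continuous_on UNIV f" and x: "x \<in> cell n K"
    and close: "\<And>y. norm (y - x) < \<delta> \<Longrightarrow> norm (f y - f x) \<le> \<epsilon>" and small: "2 * CARD('n) / real n < \<delta>"
  shows "norm (projection n f K - f x) \<le> \<epsilon>"
proof (rule projection_close[OF n f close])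
  fix y assume y: "y \<in> cell n K"
  have "norm (y - x) \<le> norm (y - node n K) + norm (x - node n K)"
    using norm_triangle_ineq4[of "y - node n K" "x - node n K"] by simp
  also have "\<dots> \<le> CARD('n) / real n + CARD('n) / real n" by (intro add_mono dist_in_cell n x y)
  also have "\<dots> < \<delta>" using small by simp
  finally show "norm (y - x) < \<delta>" .
qed

theorem theorem7p1:
  fixes \<gamma> :: real
  assumes "\<gamma> > 1" and "CARD('n::finite) \<in> {1, 2, 3}"
  shows "\<exists>c>0. \<forall>(T::real) (\<rho>0 :: real ^ 'n \<Rightarrow> real) (m0 :: real ^ 'n \<Rightarrow> real ^ 'n) (E0 :: real ^ 'n \<Rightarrow> real)
           (sch :: lf_scheme) (n :: nat \<Rightarrow> nat) (U :: nat \<Rightarrow> real \<Rightarrow> int ^ 'n \<Rightarrow> 'n state)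
           (\<rho>_low :: real) (E_up :: real).
      T > 0 \<and>
      C1_torus \<rho>0 \<and> (\<forall>x. \<rho>0 x > 0) \<and> C1_torus m0 \<and> C1_torus E0 \<and>
      (\<forall>x. pressure \<gamma> (\<rho>0 x, m0 x, E0 x) > 0) \<and>
      filterlim n at_top sequentially \<and>
      (\<forall>k. lf_solution sch \<gamma> T (n k) \<rho>0 m0 E0 (U k)) \<and>
      \<rho>_low > 0 \<and> E_up > 0 \<and>
      (\<forall>k. \<forall>t\<in>{0..T}. \<forall>K. \<rho>_low \<le> dens (U k t K) \<and> energy (U k t K) \<le> E_up)
      \<longrightarrow>
      (\<exists>(r :: nat \<Rightarrow> nat) (V :: real \<times> (real ^ 'n) \<Rightarrow> 'n state measure).
         strict_mono r \<and>
         generates_young_measure T (\<lambda>k. grid_to_fun (n (r k)) (U (r k))) V \<and>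
         dmv_solution c \<gamma> T (\<lambda>x. return phase_borel (\<rho>0 x, m0 x, E0 x)) V)"
proof (rule exI[of _ "1 :: real"], rule conjI, simp, intro allI impI, elim conjE)
  fix T :: real and \<rho>0 :: "real ^ 'n \<Rightarrow> real" and m0 :: "real ^ 'n \<Rightarrow> real ^ 'n" and E0 :: "real ^ 'n \<Rightarrow> real"
    and sch :: lf_scheme and n :: "nat \<Rightarrow> nat" and U :: "nat \<Rightarrow> real \<Rightarrow> int ^ 'n \<Rightarrow> 'n state" and \<rho>_low E_up :: real
  assume T: "T > 0" and data: "C1_torus \<rho>0" "\<forall>x. \<rho>0 x > 0" "C1_torus m0" "C1_torus E0"
      "\<forall>x. pressure \<gamma> (\<rho>0 x, m0 x, E0 x) > 0"
    and n: "filterlim n at_top sequentially" and sol: "\<forall>k. lf_solution sch \<gamma> T (n k) \<rho>0 m0 E0 (U k)"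
    and \<rho>_low: "\<rho>_low > 0"
    and bounds: "\<forall>k. \<forall>t\<in>{0..T}. \<forall>K. \<rho>_low \<le> dens (U k t K) \<and> energy (U k t K) \<le> E_up"
  define U0 where "U0 x = (\<rho>0 x, m0 x, E0 x)" for x
  note c = C1_torus_continuous[OF data(1)] C1_torus_continuous[OF data(3)] C1_torus_continuous[OF data(4)]
  have cU0: "continuous_on UNIV U0" unfolding U0_def by (intro continuous_intros c)
  have "\<exists>\<rho>u pl M. pl > 0 \<and> (\<forall>k t K. 0 \<le> t \<longrightarrow> t < T \<longrightarrow> U k t K \<in> state_bounds \<gamma> \<rho>_low \<rho>u pl M E_up)"
  proof (rule uniform_state_bounds[OF assms(1) T c data(2)[rule_format] data(5)[rule_format] \<rho>_low, of E_up])
    fix \<rho>u pl M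
    assume pl: "pl > 0" and b: "\<And>sch n U t K. lf_solution sch \<gamma> T n \<rho>0 m0 E0 U \<Longrightarrow>
      (\<And>t K. 0 \<le> t \<Longrightarrow> t < T \<Longrightarrow> \<rho>_low \<le> dens (U t K) \<and> energy (U t K) \<le> E_up) \<Longrightarrow>
      0 \<le> t \<Longrightarrow> t < T \<Longrightarrow> U t K \<in> state_bounds \<gamma> \<rho>_low \<rho>u pl M E_up"
    have "U k t K \<in> state_bounds \<gamma> \<rho>_low \<rho>u pl M E_up" if "0 \<le> t" "t < T" for k t K
      by (rule b[OF sol[rule_format]]) (use bounds that in auto)
    with pl show ?thesis by blast
  qed
  then obtain \<rho>u pl M where pl: "pl > 0" and b: "\<forall>k t K. 0 \<le> t \<longrightarrow> t < T \<longrightarrow> U k t K \<in> state_bounds \<gamma> \<rho>_low \<rho>u pl M E_up"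
    by blast
  define C where "C = (state_bounds \<gamma> \<rho>_low \<rho>u pl M E_up :: 'n state set)"
  have C: "compact C" unfolding C_def by (rule compact_state_bounds[OF \<rho>_low])
  have C_adm: "C \<subseteq> admissible \<gamma>" using \<rho>_low pl by (auto simp: C_def state_bounds_def admissible_def)
  have inC: "U k t K \<in> C" if "0 \<le> t" "t < T" for k t K
    unfolding C_def using b that by blast
  have run: "lf_run \<gamma> T sch (n k) (U k)" for k using lf_solution_lf_run[OF assms(1) T] sol by blast
  have npos: "n k > 0" for k using lf_run.n_pos[OF run] .
  have start: "U k 0 K = projection (n k) U0 K" for k and K :: "int ^ 'n"
  proof -
    have m: "bounded_linear (\<lambda>V :: 'n state. mom V)" "bounded_linear (\<lambda>V :: 'n state. energy V)"
      by (intro bounded_linear_intros)+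
    have "projection (n k) U0 K = (projection (n k) \<rho>0 K, projection (n k) m0 K, projection (n k) E0 K)"
      using projection_linear[OF cU0 bounded_linear_fst, of "n k" K] projection_linear[OF cU0 m(1), of "n k" K]
        projection_linear[OF cU0 m(2), of "n k" K] by (intro prod_eqI) (simp_all add: U0_def)
    then show ?thesis using sol by (simp add: lf_solution_def)
  qed
  have fine: "\<forall>\<^sub>F k in sequentially. 2 * CARD('n) / real (n k) < \<delta>" if \<delta>: "\<delta> > 0" for \<delta>
  proof -
    obtain n1 where n1: "2 * CARD('n) / \<delta> < real n1" using reals_Archimedean2 by blast
    have "\<forall>\<^sub>F k in sequentially. n1 \<le> n k" using n unfolding filterlim_at_top by blast
    then show ?thesis
    proof eventually_elim
      case (elim k)
      have "2 * CARD('n) / \<delta> < real (n k)" using n1 elim by linarith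
      then show ?case using \<delta> npos[of k] by (simp add: field_simps)
    qed
  qed
  \<comment> \<open>The data are limits of cell averages, which are numerical states at time 0.\<close>
  have U0_C: "U0 x \<in> C" for x
  proof -
    have "\<exists>V\<in>C. dist V (U0 x) < e" if e: "e > 0" for e
    proof -
      obtain \<delta> where \<delta>: "\<delta> > 0" "\<And>y. norm (y - x) < \<delta> \<Longrightarrow> norm (U0 y - U0 x) \<le> e / 2"
        using cU0 e unfolding continuous_on_iff dist_norm by (meson UNIV_I half_gt_zero less_imp_le)
      obtain k where k: "2 * CARD('n) / real (n k) < \<delta>" using eventually_happens[OF fine[OF \<delta>(1)]] by auto
      have "x \<in> cell (n k) (cell_index (n k) x)" using cell_index_eq_iff[OF npos] by blast
      from projection_approximates[OF npos cU0 this \<delta>(2) k] have "dist (U k 0 (cell_index (n k) x)) (U0 x) \<le> e / 2"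
        by (simp add: dist_norm start)
      then show ?thesis using inC[of 0] T e by (intro bexI[of _ "U k 0 (cell_index (n k) x)"]) auto
    qed
    then show ?thesis using compact_imp_closed[OF C] closed_approachable[of C "U0 x"] by blast
  qed
  have init: "\<forall>\<^sub>F k in sequentially. \<forall>K\<in>torus_cells (n k). \<forall>x\<in>cell (n k) K. norm (U k 0 K - U0 x) < \<epsilon>" if \<epsilon>: "\<epsilon> > 0" for \<epsilon>
  proof -
    have cB: "compact (node_box :: (real ^ 'n) set)" by (simp add: node_box_def)
    have "uniformly_continuous_on node_box U0"
      by (rule compact_uniformly_continuous[OF continuous_on_subset[OF cU0] cB]) auto
    then obtain \<delta> where \<delta>: "\<delta> > 0" "\<And>x y. x \<in> node_box \<Longrightarrow> y \<in> node_box \<Longrightarrow> norm (y - x) < \<delta> \<Longrightarrow> norm (U0 y - U0 x) < \<epsilon> / 2"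
      unfolding uniformly_continuous_on_def dist_norm using \<epsilon> by (meson half_gt_zero)
    have "min \<delta> 1 > 0" using \<delta> by simp
    from fine[OF this] show ?thesis
    proof eventually_elim
      case (elim k)
      show ?case
      proof (intro ballI)
        fix K :: "int ^ 'n" and x assume K: "K \<in> torus_cells (n k)" and x: "x \<in> cell (n k) K"
        have xt: "x \<in> torus" using cell_subset_torus[OF npos K] x by blast
        have "norm (projection (n k) U0 K - U0 x) \<le> \<epsilon> / 2"
        proof (rule projection_approximates[OF npos cU0 x _ elim])
          fix y assume y: "norm (y - x) < min \<delta> 1"
          have "y \<in> node_box" unfolding node_box_iff
          proof
            fix i
            have "\<bar>(y - x) $ i\<bar> < 1" using component_le_norm_cart[of "y - x" i] y by linarith
            moreover have "0 \<le> x $ i \<and> x $ i < 1" using xt by (simp add: torus_def)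
            ultimately show "- 1 \<le> y $ i \<and> y $ i \<le> 2" by (simp add: abs_less_iff)
          qed
          then show "norm (U0 y - U0 x) \<le> \<epsilon> / 2"
            using \<delta>(2)[of x y] y xt torus_subset_node_box by auto
        qed
        then show "norm (U k 0 K - U0 x) < \<epsilon>" using \<epsilon> by (simp add: start)
      qed
    qed
  qed
  \<comment> \<open>Outside the cylinder any fixed state will do.\<close>
  define u where "u k z = (if z \<in> space_time T then grid_to_fun (n k) (U k) z else U k 0 0)" for k z
  have um: "u k \<in> borel_measurable borel" for k
    unfolding u_def[abs_def] by (rule lf_run.grid_measurable[OF run])
  have uC: "u k z \<in> C" for k z using inC T by (auto simp: u_def grid_to_fun_def space_time_def)
  show "\<exists>(r :: nat \<Rightarrow> nat) V. strict_mono r \<and> generates_young_measure T (\<lambda>k. grid_to_fun (n (r k)) (U (r k))) V \<and>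
      dmv_solution 1 \<gamma> T (\<lambda>x. return phase_borel (\<rho>0 x, m0 x, E0 x)) V"
  proof (rule young_measure_exists[OF space_time_borel emeasure_space_time_finite C um uC])
  fix r :: "nat \<Rightarrow> nat" and X :: "real \<times> (real ^ 'n) \<Rightarrow> real \<Rightarrow> 'n state"
  assume r: "strict_mono r" and X: "\<And>z. X z \<in> borel_measurable (borel :: real measure)" "\<And>z \<omega>. X z \<omega> \<in> C"
    "\<And>f :: 'n state \<Rightarrow> real. continuous_on C f \<Longrightarrow> (\<lambda>z. LINT \<omega>:{0..<1}|lborel. f (X z \<omega>)) \<in> borel_measurable borel"
    and w: "\<And>(f :: 'n state \<Rightarrow> real) \<psi> c. continuous_on C f \<Longrightarrow> \<psi> \<in> borel_measurable borel \<Longrightarrow> (\<And>z. \<bar>\<psi> z\<bar> \<le> c) \<Longrightarrow>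
       (\<lambda>k. LINT z:space_time T|lborel. f (u (r k) z) * \<psi> z)
         \<longlonglongrightarrow> (LINT z:space_time T|lborel. (LINT \<omega>:{0..<1}|lborel. f (X z \<omega>)) * \<psi> z)"
  have sub: "filterlim r sequentially sequentially" by (rule filterlim_subseq[OF r])
  interpret lf_sequence \<gamma> T sch "\<lambda>k. n (r k)" "\<lambda>k. U (r k)" C U0 X
  proof (rule lf_sequence.intro)
    show "\<gamma> > 1" "T > 0" "compact C" "C \<subseteq> admissible \<gamma>" by fact+
    show "filterlim (\<lambda>k. n (r k)) at_top sequentially" by (rule filterlim_compose[OF n sub])
    show "lf_run \<gamma> T sch (n (r k)) (U (r k))" for k by (rule run)
    show "U (r k) t K \<in> C" if "0 \<le> t" "t < T" for k t K by (rule inC[OF that])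
    show "U0 \<in> borel_measurable borel" by (rule borel_measurable_continuous_onI[OF cU0])
    show "U0 x \<in> C" for x by (rule U0_C)
    show "\<forall>\<^sub>F k in sequentially. \<forall>K\<in>torus_cells (n (r k)). \<forall>x\<in>cell (n (r k)) K. norm (U (r k) 0 K - U0 x) < \<epsilon>"
      if "\<epsilon> > 0" for \<epsilon>
      using filterlim_iff[THEN iffD1, OF sub] init[OF that] by blast
    show "X z \<in> borel_measurable borel" for z by (rule X)
    show "X z \<omega> \<in> C" for z \<omega> by (rule X)
    show "(\<lambda>z. LINT \<omega>:{0..<1}|lborel. f (X z \<omega>)) \<in> borel_measurable borel" if "continuous_on C f" for f :: "'n state \<Rightarrow> real"
      by (rule X(3)[OF that])
    show "(\<lambda>k. LINT z:space_time T|lborel. f (grid_to_fun (n (r k)) (U (r k)) z) * \<psi> z)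
         \<longlonglongrightarrow> (LINT z:space_time T|lborel. (LINT \<omega>:{0..<1}|lborel. f (X z \<omega>)) * \<psi> z)"
      if f: "continuous_on C f" and \<psi>: "\<psi> \<in> borel_measurable borel" "\<And>z. \<bar>\<psi> z\<bar> \<le> c" for f :: "'n state \<Rightarrow> real" and \<psi> c
    proof -
      have "(LINT z:space_time T|lborel. f (u (r k) z) * \<psi> z) = (LINT z:space_time T|lborel. f (grid_to_fun (n (r k)) (U (r k)) z) * \<psi> z)" for k
        by (rule set_lebesgue_integral_cong) (simp_all add: u_def)
      with w[OF f \<psi>] show ?thesis by simp
    qed
  qed
  have "initial = (\<lambda>x. return phase_borel (\<rho>0 x, m0 x, E0 x))"
    by (simp add: fun_eq_iff initial_def U0_def)
  then show ?thesis
    using r young_generated limit_dmv_solution by (intro exI[of _ r] exI[of _ young]) simp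
  qed
qed

end
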